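(* Let $D\subset\overline{\mathbb{C}}$ be a domain possessing a Green function $g(z,\zeta)$, let $K\subset D\setminus\{\infty\}$ be compact, let $R>0$, and let $f:K\to\mathbb{R}\cup\{+\infty\}$ be lower semicontinuous with $\mathrm{cap}(\{z\in K: f(z)<+\infty\})>0$. Let $\lambda$ be a probability measure on $K$ with finite Green energy. Then there exists a unique measure $\mu_\lambda^*$ satisfying $0\le\mu_\lambda^*\le R\lambda$ and $$J_f(\mu_\lambda^* )=v_{f,\lambda}=\inf\{J_f(\mu):0\le\mu\le R\lambda\}.$$ Let $\rho_\lambda:=R\lambda-\mu_\lambda^*$ and $S_\lambda:=\mathrm{supp}(\mu_\lambda^* )$. If $\|\mu_\lambda^*\|>0$, then $v_{f,\lambda}<0$ and $$\sup_{z\in S_\lambda}\,(U_G^{\mu_\lambda^*}(z)+f(z))\le\mathrm{ess\,inf}_{\rho_\lambda}\,(U_G^{\mu_\lambda^*}(z)+f(z)).$$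
   Context: $g(z,\zeta)$ is the Green function of $D$ with logarithmic pole ($g(z,z)=+\infty$); $\mathrm{cap}$ is logarithmic capacity. The Green energy of $\mu$ is $\iint g(z,\zeta)\,d\mu(z)\,d\mu(\zeta)$; $U_G^\mu(z)=\int g(z,\zeta)\,d\mu(\zeta)$; $J_f(\mu)=\iint g\,d\mu\,d\mu+2\int f\,d\mu$. Measures are Borel measures on $K$; $\|\mu\|=\mu(K)$; $\sigma\le\tau$ means that $\tau-\sigma$ is a positive measure. For a function $h:K\to\mathbb{R}\cup\{+\infty\}$ and a positive measure $\sigma$ on $K$, $\mathrm{ess\,inf}_\sigma h=\sup\{r\in\mathbb{R}: h(x)\ge r\text{ holds }\sigma\text{-a.e. on }K\}$ ($-\infty$ if this set is empty). *)

theory Defs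
  imports "HOL-Probability.Probability"
begin

text \<open>The extended plane is the one-point compactification of the complex plane:
  \<open>Some z\<close> is the finite point \<open>z\<close>, and \<open>None\<close> is the point at infinity.\<close>

abbreviation riemann_sphere :: "complex option topology" where
  "riemann_sphere \<equiv> Alexandroff_compactification euclidean"

definition sphere_domain :: "complex option set \<Rightarrow> bool" where
  "sphere_domain D \<longleftrightarrow> D \<noteq> {} \<and> openin riemann_sphere D \<and> connectedin riemann_sphere D"

text \<open>Real harmonic functions: twice continuously differentiable (the functions \<open>ux\<close>, \<open>uxy\<close>, \ldots
  are the partial derivatives) with vanishing Laplacian.\<close>

definition harmonic_on :: "(complex \<Rightarrow> real) \<Rightarrow> complex set \<Rightarrow> bool" where
  "harmonic_on u S \<longleftrightarrow> open S \<and>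
     (\<exists>ux uy uxx uxy uyx uyy.
        continuous_on S uxx \<and> continuous_on S uxy \<and> continuous_on S uyx \<and> continuous_on S uyy \<and>
        (\<forall>z\<in>S. (u has_derivative (\<lambda>h. ux z * Re h + uy z * Im h)) (at z) \<and>
               (ux has_derivative (\<lambda>h. uxx z * Re h + uxy z * Im h)) (at z) \<and>
               (uy has_derivative (\<lambda>h. uyx z * Re h + uyy z * Im h)) (at z) \<and>
               uxx z + uyy z = 0))"

text \<open>The chart of the sphere around infinity, \<open>w \<mapsto> 1/w\<close>.\<close>

definition inv_chart :: "complex \<Rightarrow> complex option" where
  "inv_chart w = (if w = 0 then None else Some (inverse w))"

definition sphere_harmonic_on :: "(complex option \<Rightarrow> real) \<Rightarrow> complex option set \<Rightarrow> bool" where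
  "sphere_harmonic_on u U \<longleftrightarrow> openin riemann_sphere U \<and>
     harmonic_on (u \<circ> Some) (Some -` U) \<and> harmonic_on (u \<circ> inv_chart) (inv_chart -` U)"

definition log_pole :: "(complex option \<Rightarrow> real) \<Rightarrow> complex option \<Rightarrow> bool" where
  "log_pole p \<zeta> \<longleftrightarrow> (case \<zeta> of
      Some a \<Rightarrow> Bfun (\<lambda>z. p (Some z) + ln (cmod (z - a))) (at a)
    | None \<Rightarrow> Bfun (\<lambda>z. p (Some z) - ln (cmod z)) at_infinity)"

definition green_competitor :: "complex option set \<Rightarrow> complex option \<Rightarrow> (complex option \<Rightarrow> real) \<Rightarrow> bool" where
  "green_competitor D \<zeta> p \<longleftrightarrow>
     sphere_harmonic_on p (D - {\<zeta>}) \<and> (\<forall>z\<in>D - {\<zeta>}. 0 \<le> p z) \<and> log_pole p \<zeta>"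

text \<open>The Green function of \<open>D\<close> with pole \<open>\<zeta>\<close> is the least nonnegative harmonic function on
  \<open>D - {\<zeta>}\<close> with a logarithmic pole at \<open>\<zeta>\<close>; \<open>D\<close> possesses a Green function if and only if
  there is some \<open>g\<close> with \<open>is_green_function D g\<close>. Only the values of \<open>g\<close> on \<open>D \<times> D\<close> matter.\<close>

definition is_green_function ::
  "complex option set \<Rightarrow> (complex option \<Rightarrow> complex option \<Rightarrow> ereal) \<Rightarrow> bool" where
  "is_green_function D g \<longleftrightarrow>
     (\<forall>\<zeta>\<in>D. g \<zeta> \<zeta> = \<infinity> \<and>
        (\<exists>p. green_competitor D \<zeta> p \<and> (\<forall>z\<in>D - {\<zeta>}. g z \<zeta> = ereal (p z)) \<and>
             (\<forall>q. green_competitor D \<zeta> q \<longrightarrow> (\<forall>z\<in>D - {\<zeta>}. p z \<le> q z))))"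

text \<open>Integral of an extended real valued function as the integral of its positive part minus that
  of its negative part. In every use below the integrand is bounded below and the measure is finite,
  so that the negative part has a finite integral.\<close>

definition ereal_integral :: "'a measure \<Rightarrow> ('a \<Rightarrow> ereal) \<Rightarrow> ereal" where
  "ereal_integral M h =
     enn2ereal (\<integral>\<^sup>+x. e2ennreal (h x) \<partial>M) - enn2ereal (\<integral>\<^sup>+x. e2ennreal (- h x) \<partial>M)"

definition borel_measure_on :: "complex set \<Rightarrow> complex measure \<Rightarrow> bool" where
  "borel_measure_on K \<mu> \<longleftrightarrow> sets \<mu> = sets (restrict_space borel K)"

definition log_kernel :: "complex \<Rightarrow> complex \<Rightarrow> ereal" where
  "log_kernel z w = (if z = w then \<infinity> else ereal (- ln (cmod (z - w))))"

definition log_energy :: "complex measure \<Rightarrow> ereal" where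
  "log_energy \<mu> = ereal_integral \<mu> (\<lambda>z. ereal_integral \<mu> (\<lambda>w. log_kernel z w))"

text \<open>This is the inner capacity. It takes values in the extended nonnegative reals, so that the
  empty set has capacity \<open>0\<close>.\<close>

definition log_capacity :: "complex set \<Rightarrow> ennreal" where
  "log_capacity E =
     Sup {if log_energy \<mu> = \<infinity> then 0 else ennreal (exp (- real_of_ereal (log_energy \<mu>))) | \<mu> C.
            compact C \<and> C \<subseteq> E \<and> borel_measure_on C \<mu> \<and> prob_space \<mu>}"

definition green_potential ::
  "(complex option \<Rightarrow> complex option \<Rightarrow> ereal) \<Rightarrow> complex measure \<Rightarrow> complex \<Rightarrow> ereal" where
  "green_potential g \<mu> z = ereal_integral \<mu> (\<lambda>\<zeta>. g (Some z) (Some \<zeta>))"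

definition green_energy ::
  "(complex option \<Rightarrow> complex option \<Rightarrow> ereal) \<Rightarrow> complex measure \<Rightarrow> ereal" where
  "green_energy g \<mu> = ereal_integral \<mu> (green_potential g \<mu>)"

definition weighted_energy ::
  "(complex option \<Rightarrow> complex option \<Rightarrow> ereal) \<Rightarrow> (complex \<Rightarrow> ereal) \<Rightarrow> complex measure \<Rightarrow> ereal" where
  "weighted_energy g f \<mu> = green_energy g \<mu> + 2 * ereal_integral \<mu> f"

text \<open>The equality of the sigma-algebras is needed: the library order on measures is
  lexicographic, and a measure on the same space with fewer measurable sets is always smaller.\<close>

definition constrained_measures :: "complex set \<Rightarrow> real \<Rightarrow> complex measure \<Rightarrow> complex measure set" where
  "constrained_measures K R lam =
     {\<mu>. borel_measure_on K \<mu> \<and> \<mu> \<le> scale_measure (ennreal R) lam}"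

definition constrained_value ::
  "(complex option \<Rightarrow> complex option \<Rightarrow> ereal) \<Rightarrow> (complex \<Rightarrow> ereal) \<Rightarrow>
     complex set \<Rightarrow> real \<Rightarrow> complex measure \<Rightarrow> ereal" where
  "constrained_value g f K R lam = (INF \<mu>\<in>constrained_measures K R lam. weighted_energy g f \<mu>)"

definition lower_semicontinuous_on :: "complex set \<Rightarrow> (complex \<Rightarrow> ereal) \<Rightarrow> bool" where
  "lower_semicontinuous_on K f \<longleftrightarrow> (\<forall>c. openin (top_of_set K) {x\<in>K. c < f x})"

definition ess_inf :: "'a measure \<Rightarrow> ('a \<Rightarrow> ereal) \<Rightarrow> ereal" where
  "ess_inf \<sigma> h = Sup (ereal ` {r. AE x in \<sigma>. ereal r \<le> h x})"

definition measure_support :: "complex measure \<Rightarrow> complex set" where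
  "measure_support \<mu> = {z\<in>space \<mu>. \<forall>U. open U \<and> z \<in> U \<longrightarrow> 0 < emeasure \<mu> (U \<inter> space \<mu>)}"

end

theory Submission
  imports Defs "HOL-Complex_Analysis.Complex_Analysis"
begin

text \<open>The Green function is exhausted from below by kernels obtained by successively sweeping (Poisson
  modification in both variables) over discs in \<open>D\<close> and adding the Green function of the disc. Each of
  them is a finite sum of squares, so the Green energy is positive semidefinite; the contribution of a
  single disc \<open>B\<close> to the energy of a difference of two measures controls their masses on discs concentric
  with \<open>B\<close>, so the energy is strictly convex.

  The measures dominated by \<open>R * \<lambda>\<close> are the densities \<open>u\<close> with \<open>0 \<le> u \<le> R\<close>. Convexity and Fatou's lemma give a
  minimiser in \<open>L\<^sup>2\<close>, and strict convexity its uniqueness. Comparison with the zero measure gives the sign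
  of the minimum. If the final inequality failed at a point \<open>z\<close> of the support, lower semicontinuity
  of the potential and of \<open>f\<close> would allow to move mass from a neighbourhood of \<open>z\<close> to a set where the
  weighted potential is smaller and the constraint is not active, thereby decreasing the energy.\<close>

section \<open>Harmonic functions as real parts of holomorphic functions\<close>

text \<open>The hypothesis describes \<open>g\<close> only by minimality among positive harmonic
  functions with a logarithmic pole; symmetry, positivity of the energy and semicontinuity must be
  extracted from that. The bridge is an identity: the logarithmic kernel is the swept kernel plus a
  remainder, obtained by sweeping the logarithmic kernel itself. Sweeping lowers superharmonic
  functions, so the swept kernels increase; the minimum principle keeps them below \<open>g\<close>;
  and the factors of Hadamard's formula survive sweeping in both variables, so positivity is never
  lost. Kernels take values in [0, \<infinity>], so positivity reads 2 E(u,v) \<le> E(u,u) + E(v,v),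
  and a term is cancelled only where it is known to be finite. Passing to densities replaces weak
  compactness: as \<lambda> has finite energy, the kernel is integrable for the product measure, so
  the energy of densities bounded by R is continuous under almost everywhere convergence, and only
  the term with f needs Fatou. Since f may be infinite but is bounded below on K, it is shifted by a
  constant \<open>c\<close> to become nonnegative.\<close>

lemma mixed_difference_mvt:
  fixes u ux uxy :: "real \<Rightarrow> real \<Rightarrow> real"
  assumes h: "h > 0"
    and ux: "\<And>x y. \<bar>x - a\<bar> \<le> h \<Longrightarrow> \<bar>y - b\<bar> \<le> h \<Longrightarrow> ((\<lambda>t. u t y) has_field_derivative ux x y) (at x)"
    and uxy: "\<And>x y. \<bar>x - a\<bar> \<le> h \<Longrightarrow> \<bar>y - b\<bar> \<le> h \<Longrightarrow> ((\<lambda>t. ux x t) has_field_derivative uxy x y) (at y)"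
  shows "\<exists>x y. \<bar>x - a\<bar> \<le> h \<and> \<bar>y - b\<bar> \<le> h \<and>
           u (a + h) (b + h) - u (a + h) b - u a (b + h) + u a b = h\<^sup>2 * uxy x y"
proof -
  let ?\<phi> = "\<lambda>t. u t (b + h) - u t b"
  have "\<exists>x. a < x \<and> x < a + h \<and> ?\<phi> (a + h) - ?\<phi> a = (a + h - a) * (ux x (b + h) - ux x b)"
    by (rule MVT2) (use h in \<open>auto intro!: derivative_eq_intros ux\<close>)
  then obtain x where x: "a < x" "x < a + h" "?\<phi> (a + h) - ?\<phi> a = h * (ux x (b + h) - ux x b)"
    by auto
  have "\<exists>y. b < y \<and> y < b + h \<and> ux x (b + h) - ux x b = (b + h - b) * uxy x y"
    by (rule MVT2) (use h x in \<open>auto intro!: uxy\<close>)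
  then obtain y where "b < y" "y < b + h" "ux x (b + h) - ux x b = h * uxy x y"
    by auto
  with x show ?thesis
    by (intro exI[of _ x] exI[of _ y]) (auto simp: power2_eq_square algebra_simps)
qed

text \<open>The second difference of \<open>u\<close> over a square is symmetric in the two
  variables, so \<open>mixed_difference_mvt\<close> in both orders yields equal values of
  \<open>uxy\<close> and \<open>uyx\<close> at points near \<open>z\<close>; then the square
  shrinks. \<open>harmonic_on\<close> does not ask for equal mixed partials, but the Cauchy-Riemann
  equations below need them.\<close>

lemma mixed_partials_eq:
  fixes u ux uy uxx uxy uyx uyy :: "complex \<Rightarrow> real"
  assumes S: "open S" "z \<in> S" and cont: "continuous_on S uxy" "continuous_on S uyx"
    and u: "\<And>z. z \<in> S \<Longrightarrow> (u has_derivative (\<lambda>h. ux z * Re h + uy z * Im h)) (at z)"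
    and ux: "\<And>z. z \<in> S \<Longrightarrow> (ux has_derivative (\<lambda>h. uxx z * Re h + uxy z * Im h)) (at z)"
    and uy: "\<And>z. z \<in> S \<Longrightarrow> (uy has_derivative (\<lambda>h. uyx z * Re h + uyy z * Im h)) (at z)"
  shows "uxy z = uyx z"
proof -
  have X: "((\<lambda>t. f (Complex t y)) has_field_derivative fx) (at x)"
    if "(f has_derivative (\<lambda>h. fx * Re h + fy * Im h)) (at (Complex x y))" for f :: "complex \<Rightarrow> real" and fx fy x y
  proof -
    have "((\<lambda>t. Complex t y) has_derivative (\<lambda>t. Complex t 0)) (at x)"
      by (rule has_derivative_eq_rhs[where f="\<lambda>t. of_real t + \<i> * of_real y"]
            has_derivative_transform[where s=UNIV, OF _ _ has_derivative_eq_rhs[where f="\<lambda>t. of_real t + \<i> * of_real y"]])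
         (auto intro!: derivative_eq_intros simp: complex_eq_iff)
    from has_derivative_compose[OF this that] show ?thesis
      by (simp add: has_field_derivative_def)
  qed
  have Y: "((\<lambda>t. f (Complex x t)) has_field_derivative fy) (at y)"
    if "(f has_derivative (\<lambda>h. fx * Re h + fy * Im h)) (at (Complex x y))" for f :: "complex \<Rightarrow> real" and fx fy x y
  proof -
    have "((\<lambda>t. Complex x t) has_derivative (\<lambda>t. Complex 0 t)) (at y)"
      by (rule has_derivative_transform[where s=UNIV, OF _ _ has_derivative_eq_rhs[where f="\<lambda>t. of_real x + \<i> * of_real t"]])
         (auto intro!: derivative_eq_intros simp: complex_eq_iff)
    from has_derivative_compose[OF this that] show ?thesis
      by (simp add: has_field_derivative_def)
  qed
  define a b where "a = Re z" and "b = Im z"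
  have z: "z = Complex a b"
    by (simp add: a_def b_def)
  obtain e where e: "e > 0" "ball z e \<subseteq> S"
    using S openE by blast
  have inS: "Complex x y \<in> S \<and> dist (Complex x y) z < 4 * h"
    if "\<bar>x - a\<bar> \<le> h" "\<bar>y - b\<bar> \<le> h" "0 < h" "h < e / 4" for x y h
  proof -
    have "dist (Complex x y) z \<le> \<bar>x - a\<bar> + \<bar>y - b\<bar>"
      unfolding dist_norm using cmod_le[of "Complex x y - z"] by (simp add: z)
    with that e show ?thesis
      by (auto simp: subset_iff dist_commute)
  qed
  have "\<exists>v w. dist v z < 4 * h \<and> dist w z < 4 * h \<and> uxy v = uyx w" if h: "0 < h" "h < e / 4" for h
  proof -
    let ?u = "\<lambda>x y. u (Complex x y)"
    obtain x y where 1: "\<bar>x - a\<bar> \<le> h" "\<bar>y - b\<bar> \<le> h"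
        "?u (a + h) (b + h) - ?u (a + h) b - ?u a (b + h) + ?u a b = h\<^sup>2 * uxy (Complex x y)"
      using mixed_difference_mvt[of h a b ?u "\<lambda>x y. ux (Complex x y)" "\<lambda>x y. uxy (Complex x y)"]
      using h inS X[OF u] Y[OF ux] by blast
    obtain x' y' where 2: "\<bar>x' - a\<bar> \<le> h" "\<bar>y' - b\<bar> \<le> h"
        "?u (a + h) (b + h) - ?u a (b + h) - ?u (a + h) b + ?u a b = h\<^sup>2 * uyx (Complex x' y')"
      using mixed_difference_mvt[of h b a "\<lambda>y x. ?u x y" "\<lambda>y x. uy (Complex x y)" "\<lambda>y x. uyx (Complex x y)"]
      using h inS Y[OF u] X[OF uy] by blast
    have "h\<^sup>2 * uxy (Complex x y) = h\<^sup>2 * uyx (Complex x' y')"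
      using 1(3) 2(3) by linarith
    then have "uxy (Complex x y) = uyx (Complex x' y')"
      using h by simp
    then show ?thesis
      using 1 2 h inS by blast
  qed
  note close = this
  \<comment> \<open>The half-width \<open>e / 5 / Suc n\<close> is below the \<open>e / 4\<close>
    required by \<open>close\<close> already for \<open>n = 0\<close>.\<close>
  have "\<forall>n. \<exists>v w. dist v z < 4 * (e / 5 / Suc n) \<and> dist w z < 4 * (e / 5 / Suc n) \<and> uxy v = uyx w"
  proof
    fix n :: nat
    have "0 < e / 5 / Suc n" "e / 5 / Suc n < e / 4"
      using e(1) by (auto simp: field_simps intro: less_le_trans[of _ "e * 5"] mult_pos_pos add_pos_nonneg)
    then show "\<exists>v w. dist v z < 4 * (e / 5 / Suc n) \<and> dist w z < 4 * (e / 5 / Suc n) \<and> uxy v = uyx w"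
      by (rule close)
  qed
  then obtain v w where vw: "\<And>n. dist (v n) z < 4 * (e / 5 / Suc n)" "\<And>n. dist (w n) z < 4 * (e / 5 / Suc n)"
      "\<And>n. uxy (v n) = uyx (w n)"
    by metis
  have lim0: "(\<lambda>n. 4 * (e / 5 / Suc n)) \<longlonglongrightarrow> 0"
    using tendsto_mult_right_zero[OF LIMSEQ_inverse_real_of_nat, of "4 * (e/5)"]
    by (simp add: field_simps)
  have v: "v \<longlonglongrightarrow> z"
    by (rule metric_tendsto_imp_tendsto[OF lim0]) (use vw(1) e in \<open>auto intro!: always_eventually less_imp_le simp: field_simps\<close>)
  have w: "w \<longlonglongrightarrow> z"
    by (rule metric_tendsto_imp_tendsto[OF lim0]) (use vw(2) e in \<open>auto intro!: always_eventually less_imp_le simp: field_simps\<close>)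
  have "(\<lambda>n. uxy (v n)) \<longlonglongrightarrow> uxy z" "(\<lambda>n. uyx (w n)) \<longlonglongrightarrow> uyx z"
    using cont S v w by (auto simp: continuous_on_eq_continuous_at intro: isCont_tendsto_compose)
  then show ?thesis
    unfolding vw(3) by (rule LIMSEQ_unique)
qed

lemma holomorphic_onI_DERIV:
  assumes "\<And>x. x \<in> S \<Longrightarrow> (f has_field_derivative f' x) (at x)"
  shows "f holomorphic_on S"
  using assms unfolding holomorphic_on_def field_differentiable_def by (meson has_field_derivative_at_within)

text \<open>The working form of harmonicity: it turns Poisson and mean value formulas into Cauchy's
  formula and is stable under holomorphic changes of variable. The radius is recorded because
  circles have to stay inside the disc of the holomorphic function.\<close>

definition re_holomorphic_near :: "(complex \<Rightarrow> real) \<Rightarrow> complex \<Rightarrow> real \<Rightarrow> bool" where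
  "re_holomorphic_near u z r \<longleftrightarrow> (\<exists>F. F holomorphic_on ball z r \<and> (\<forall>w\<in>ball z r. u w = Re (F w)))"

lemma has_derivative_Re_comp:
  assumes "(F has_field_derivative F') (at z)"
  shows "((\<lambda>w. Re (F w)) has_derivative (\<lambda>h. Re F' * Re h + (- Im F') * Im h)) (at z)"
    and "((\<lambda>w. Im (F w)) has_derivative (\<lambda>h. Im F' * Re h + Re F' * Im h)) (at z)"
proof -
  have F: "(F has_derivative (\<lambda>h. F' * h)) (at z)"
    using assms by (simp add: has_field_derivative_def)
  show "((\<lambda>w. Re (F w)) has_derivative (\<lambda>h. Re F' * Re h + (- Im F') * Im h)) (at z)"
    by (rule has_derivative_eq_rhs[OF bounded_linear.has_derivative[OF bounded_linear_Re F]]) (simp add: fun_eq_iff)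
  show "((\<lambda>w. Im (F w)) has_derivative (\<lambda>h. Im F' * Re h + Re F' * Im h)) (at z)"
    by (rule has_derivative_eq_rhs[OF bounded_linear.has_derivative[OF bounded_linear_Im F]]) (simp add: fun_eq_iff)
qed

lemma linear_form_eqD:
  fixes a b c d :: real
  assumes "(\<lambda>h. a * Re h + b * Im h) = (\<lambda>h. c * Re h + d * Im h)"
  shows "a = c" "b = d"
  using fun_cong[OF assms, of 1] fun_cong[OF assms, of \<i>] by simp_all

text \<open>\<open>ux - \<i> * uy\<close> satisfies the Cauchy-Riemann equations by the vanishing
  Laplacian and the equality of mixed partials. A disc is convex, so there is a primitive, and its
  real part has the same gradient as \<open>u\<close>.\<close>

lemma harmonic_on_imp_re_holomorphic:
  assumes "harmonic_on u S" "ball c r \<subseteq> S"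
  shows "re_holomorphic_near u c r"
proof (cases "r > 0")
  case True
  obtain ux uy uxx uxy uyx uyy where S: "open S"
    and H: "continuous_on S uxx \<and> continuous_on S uxy \<and> continuous_on S uyx \<and> continuous_on S uyy \<and>
        (\<forall>z\<in>S. (u has_derivative (\<lambda>h. ux z * Re h + uy z * Im h)) (at z) \<and>
               (ux has_derivative (\<lambda>h. uxx z * Re h + uxy z * Im h)) (at z) \<and>
               (uy has_derivative (\<lambda>h. uyx z * Re h + uyy z * Im h)) (at z) \<and>
               uxx z + uyy z = 0)"
    using assms(1) unfolding harmonic_on_def by (elim conjE exE) (rule that, assumption, intro conjI)
  have cont: "continuous_on S uxy" "continuous_on S uyx"
    using H by blast+
  have u: "(u has_derivative (\<lambda>h. ux z * Re h + uy z * Im h)) (at z)"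
    and ux: "(ux has_derivative (\<lambda>h. uxx z * Re h + uxy z * Im h)) (at z)"
    and uy: "(uy has_derivative (\<lambda>h. uyx z * Re h + uyy z * Im h)) (at z)"
    and lap: "uxx z + uyy z = 0" if "z \<in> S" for z
    using H that by blast+
  have mix: "uxy z = uyx z" if "z \<in> S" for z
    using mixed_partials_eq[OF S that cont u ux uy] .
  define f where "f z = Complex (ux z) (- uy z)" for z
  have f_eq: "f = (\<lambda>z. of_real (ux z) - \<i> * of_real (uy z))"
    by (auto simp: f_def fun_eq_iff complex_eq_iff)
  have f: "(f has_field_derivative Complex (uxx z) (- uyx z)) (at z)" if "z \<in> S" for z
  proof -
    have "(f has_derivative (\<lambda>h. of_real (uxx z * Re h + uxy z * Im h) - \<i> * of_real (uyx z * Re h + uyy z * Im h))) (at z)"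
      unfolding f_eq by (intro derivative_intros bounded_linear.has_derivative[OF bounded_linear_of_real] ux uy that
          bounded_linear.has_derivative[OF bounded_linear_mult_right])
    moreover have lap': "uyy z = - uxx z"
      using lap[OF that] by simp
    ultimately show ?thesis
      unfolding has_field_derivative_def
      by - (rule has_derivative_eq_rhs, assumption, use mix[OF that] lap' in \<open>auto simp: fun_eq_iff complex_eq_iff algebra_simps\<close>)
  qed
  then have "f holomorphic_on ball c r"
    using assms(2) by (intro holomorphic_onI_DERIV[OF f]) auto
  then obtain F where F: "\<And>x. x \<in> ball c r \<Longrightarrow> (F has_field_derivative f x) (at x within ball c r)"
    using holomorphic_convex_primitive'[of "ball c r" f] by auto
  have F': "(F has_field_derivative f x) (at x)" if "x \<in> ball c r" for x
    using F[OF that] unfolding at_within_open[OF that open_ball] .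
  have "\<exists>k. \<forall>x\<in>ball c r. u x - Re (F x) = k"
  proof (rule has_derivative_zero_constant)
    fix x assume x: "x \<in> ball c r"
    have "((\<lambda>x. u x - Re (F x)) has_derivative
        (\<lambda>h. (ux x * Re h + uy x * Im h) - (Re (f x) * Re h + (- Im (f x)) * Im h))) (at x)"
      using x assms(2) by (intro has_derivative_diff u has_derivative_Re_comp F') auto
    then have "((\<lambda>x. u x - Re (F x)) has_derivative (\<lambda>h. 0)) (at x)"
      by (rule has_derivative_eq_rhs) (auto simp: f_def)
    then show "((\<lambda>x. u x - Re (F x)) has_derivative (\<lambda>h. 0)) (at x within ball c r)"
      by (rule has_derivative_at_withinI)
  qed auto
  then obtain k where k: "\<And>x. x \<in> ball c r \<Longrightarrow> u x = Re (F x + of_real k)"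
    by (auto simp: algebra_simps)
  have "(\<lambda>x. F x + of_real k) holomorphic_on ball c r"
    by (intro holomorphic_intros holomorphic_onI_DERIV[OF F'])
  with k show ?thesis
    unfolding re_holomorphic_near_def by blast
next
  case False
  then have empty: "ball c r = {}"
    by simp
  show ?thesis
    unfolding re_holomorphic_near_def empty by (auto simp: holomorphic_on_def)
qed

text \<open>The local functions \<open>F z\<close> need not agree on overlaps, but their derivatives
  are determined by the gradient of \<open>u\<close>. Hence \<open>d1\<close> is one holomorphic
  function on \<open>S\<close>, and the second partials are read off its derivative.\<close>

lemma harmonic_onI:
  assumes S: "open S" and loc: "\<And>z. z \<in> S \<Longrightarrow> \<exists>r>0. re_holomorphic_near u z r"
  shows "harmonic_on u S"
proof -
  have "\<forall>z. \<exists>r F. z \<in> S \<longrightarrow> r > 0 \<and> ball z r \<subseteq> S \<and> F holomorphic_on ball z r \<and> (\<forall>w\<in>ball z r. u w = Re (F w))"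
  proof (intro allI)
    fix z
    show "\<exists>r F. z \<in> S \<longrightarrow> r > 0 \<and> ball z r \<subseteq> S \<and> F holomorphic_on ball z r \<and> (\<forall>w\<in>ball z r. u w = Re (F w))"
    proof (cases "z \<in> S")
      case True
      obtain e where e: "e > 0" "ball z e \<subseteq> S"
        using S True openE by blast
      obtain r F where r: "r > 0" "F holomorphic_on ball z r" "\<forall>w\<in>ball z r. u w = Re (F w)"
        using loc[OF True] by (auto simp: re_holomorphic_near_def)
      show ?thesis
        by (rule exI[of _ "min e r"], rule exI[of _ F])
          (use e r in \<open>auto intro: holomorphic_on_subset simp: subset_iff\<close>)
    qed auto
  qed
  then obtain R F where R: "\<And>z. z \<in> S \<Longrightarrow> R z > 0" "\<And>z. z \<in> S \<Longrightarrow> ball z (R z) \<subseteq> S"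
    and F: "\<And>z. z \<in> S \<Longrightarrow> F z holomorphic_on ball z (R z)"
    and uF: "\<And>z w. z \<in> S \<Longrightarrow> w \<in> ball z (R z) \<Longrightarrow> u w = Re (F z w)"
    by metis
  define d1 where "d1 z = deriv (F z) z" for z
  define d2 where "d2 z = deriv (deriv (F z)) z" for z
  have DF: "(F z has_field_derivative deriv (F z) w) (at w)" if "z \<in> S" "w \<in> ball z (R z)" for z w
    using F[OF that(1)] that by (meson holomorphic_derivI open_ball)
  have DF2: "(deriv (F z) has_field_derivative deriv (deriv (F z)) w) (at w)" if "z \<in> S" "w \<in> ball z (R z)" for z w
    using holomorphic_deriv[OF F[OF that(1)]] that by (meson holomorphic_derivI open_ball)
  have u: "(u has_derivative (\<lambda>h. Re (deriv (F z) w) * Re h + (- Im (deriv (F z) w)) * Im h)) (at w)"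
    if "z \<in> S" "w \<in> ball z (R z)" for z w
    by (rule has_derivative_transform_within_open[OF has_derivative_Re_comp(1)[OF DF[OF that]], of "ball z (R z)"])
      (use that uF in auto)
  have d1: "d1 w = deriv (F z) w" if "z \<in> S" "w \<in> ball z (R z)" for z w
  proof -
    have w: "w \<in> S"
      using that R(2) by blast
    then have w': "w \<in> ball w (R w)"
      using R(1) by simp
    show ?thesis
      using linear_form_eqD[OF has_derivative_unique[OF u[OF w w'] u[OF that]]]
      by (auto simp: d1_def complex_eq_iff)
  qed
  have D1: "(d1 has_field_derivative d2 z) (at z)" if "z \<in> S" for z
    unfolding d2_def
    by (rule has_field_derivative_transform_within_open[OF DF2[OF that], where S="ball z (R z)"])
      (use that R d1 in auto)
  have "d1 holomorphic_on S"
    using D1 by (rule holomorphic_onI_DERIV)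
  then have "(deriv d1) holomorphic_on S"
    using S by (rule holomorphic_deriv)
  then have "continuous_on S (deriv d1)"
    by (rule holomorphic_on_imp_continuous_on)
  then have cont: "continuous_on S d2"
    by (rule continuous_on_eq) (use D1 DERIV_imp_deriv in blast)
  show ?thesis
    unfolding harmonic_on_def
  proof (intro conjI S exI ballI)
    show "continuous_on S (\<lambda>z. Re (d2 z))" "continuous_on S (\<lambda>z. - Im (d2 z))"
         "continuous_on S (\<lambda>z. - Im (d2 z))" "continuous_on S (\<lambda>z. - Re (d2 z))"
      by (intro continuous_intros cont)+
    fix z assume z: "z \<in> S"
    show "(u has_derivative (\<lambda>h. Re (d1 z) * Re h + (- Im (d1 z)) * Im h)) (at z)"
      using u[OF z, of z] z R by (simp add: d1_def)
    show "((\<lambda>z. Re (d1 z)) has_derivative (\<lambda>h. Re (d2 z) * Re h + (- Im (d2 z)) * Im h)) (at z)"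
      by (rule has_derivative_Re_comp D1 z)+
    have "((\<lambda>z. - Im (d1 z)) has_derivative (\<lambda>h. - (Im (d2 z) * Re h + Re (d2 z) * Im h))) (at z)"
      by (intro has_derivative_minus has_derivative_Re_comp D1 z)
    then show "((\<lambda>z. - Im (d1 z)) has_derivative (\<lambda>h. - Im (d2 z) * Re h + - Re (d2 z) * Im h)) (at z)"
      by (rule has_derivative_eq_rhs) auto
  qed auto
qed

section \<open>The Poisson integral\<close>

text \<open>Normalised arc length on the unit circle, parametrised like
  \<open>circlepath 0 1\<close>, so that Cauchy's contour integral becomes an integral against
  it.\<close>

definition circle_measure :: "complex measure" where
  "circle_measure = distr (density lborel (indicator {0..1})) borel (\<lambda>t. exp (2 * of_real pi * \<i> * of_real t))"

lemma sets_circle_measure [measurable_cong, simp]: "sets circle_measure = sets borel"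
  and space_circle_measure [simp]: "space circle_measure = UNIV"
  by (simp_all add: circle_measure_def)

interpretation circle_measure: prob_space circle_measure
proof
  show "emeasure circle_measure (space circle_measure) = 1"
    by (simp add: circle_measure_def emeasure_distr emeasure_density)
qed

lemma measure_circle_measure_UNIV [simp]: "measure circle_measure UNIV = 1" "emeasure circle_measure UNIV = 1"
  using circle_measure.prob_space circle_measure.emeasure_space_1 by simp_all

lemma AE_circle_measure: "AE \<xi> in circle_measure. norm \<xi> = 1"
  unfolding circle_measure_def
  by (subst AE_distr_iff) (auto simp: norm_exp_eq_Re)

lemma circle_measure_integrableI:
  fixes f :: "complex \<Rightarrow> 'a::{banach, second_countable_topology}"
  assumes [measurable]: "f \<in> borel_measurable borel" and "\<And>\<xi>. norm \<xi> = 1 \<Longrightarrow> norm (f \<xi>) \<le> C"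
  shows "integrable circle_measure f"
  by (rule circle_measure.integrable_const_bound[where B=C])
    (use AE_circle_measure assms(2) in \<open>auto elim: eventually_mono\<close>)

lemma integral_circle_measure:
  fixes f :: "complex \<Rightarrow> complex"
  assumes [measurable]: "f \<in> borel_measurable borel" and "\<And>\<xi>. norm \<xi> = 1 \<Longrightarrow> norm (f \<xi>) \<le> C"
  shows "integral\<^sup>L circle_measure f = integral {0..1} (\<lambda>t. f (exp (2 * of_real pi * \<i> * of_real t)))"
proof -
  let ?e = "\<lambda>t::real. exp (2 * of_real pi * \<i> * of_real t)"
  have bd: "norm (f (?e t)) \<le> C" for t
    by (rule assms(2)) (simp add: norm_exp_eq_Re)
  have "integral\<^sup>L circle_measure f = integral\<^sup>L (density lborel (indicator {0..1})) (\<lambda>t. f (?e t))"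
    unfolding circle_measure_def by (rule integral_distr) auto
  also have "\<dots> = (LINT t|lborel. indicator {0..1} t *\<^sub>R f (?e t))"
  proof -
    have "density lborel (indicator {0..1}) = density lborel (\<lambda>t. ennreal (indicator {0..1} (t::real)))"
      by (simp add: ennreal_indicator)
    then show ?thesis
      by (simp only:) (rule integral_density, auto)
  qed
  also have "\<dots> = set_lebesgue_integral lborel {0..1} (\<lambda>t. f (?e t))"
    by (simp add: set_lebesgue_integral_def)
  also have "\<dots> = integral {0..1} (\<lambda>t. f (?e t))"
  proof (rule set_borel_integral_eq_integral)
    show "set_integrable lborel {0..1} (\<lambda>t. f (?e t))"
      unfolding set_integrable_def
      by (rule integrableI_bounded_set_indicator[where B=C]) (use bd in auto)
  qed
  finally show ?thesis .
qed

text \<open>The usual Poisson kernel only for \<open>norm \<xi> = 1\<close>, see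
  \<open>poisson_eq\<close>. Written as a real part, it exhibits Poisson integrals as real parts of
  holomorphic functions of \<open>z\<close>.\<close>

definition poisson :: "complex \<Rightarrow> complex \<Rightarrow> real" where
  "poisson z \<xi> = Re ((\<xi> + z) / (\<xi> - z))"

lemma poisson_eq:
  assumes "norm \<xi> = 1"
  shows "poisson z \<xi> = (1 - (norm z)\<^sup>2) / (norm (\<xi> - z))\<^sup>2"
proof -
  have "(\<xi> + z) / (\<xi> - z) = (\<xi> + z) * cnj (\<xi> - z) / (norm (\<xi> - z))\<^sup>2"
    by (subst complex_div_cnj) simp
  moreover have "Re ((\<xi> + z) * cnj (\<xi> - z)) = (norm \<xi>)\<^sup>2 - (norm z)\<^sup>2"
    unfolding cmod_power2 by (simp add: algebra_simps power2_eq_square)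
  ultimately show ?thesis
    using assms by (simp add: poisson_def)
qed

lemma poisson_nonneg:
  assumes "norm \<xi> = 1" "norm z < 1"
  shows "0 \<le> poisson z \<xi>"
  using assms by (auto simp: poisson_eq power_le_one)

lemma poisson_le:
  assumes "norm \<xi> = 1" "norm z < 1"
  shows "poisson z \<xi> \<le> 1 / (1 - norm z)\<^sup>2"
proof -
  have "1 - norm z \<le> norm (\<xi> - z)"
    using norm_triangle_ineq2[of \<xi> z] assms by simp
  then have "(1 - norm z)\<^sup>2 \<le> (norm (\<xi> - z))\<^sup>2"
    using assms by (intro power_mono) auto
  moreover have "0 < (1 - norm z)\<^sup>2"
    using assms by simp
  ultimately show ?thesis
    unfolding poisson_eq[OF assms(1)] by (intro frac_le) (auto simp: power_le_one)
qed

lemma measurable_poisson [measurable (raw)]: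
  assumes [measurable]: "f \<in> borel_measurable M" "h \<in> borel_measurable M"
  shows "(\<lambda>x. poisson (f x) (h x)) \<in> borel_measurable M"
  unfolding poisson_def by measurable

text \<open>Cauchy's formula at \<open>z\<close> for \<open>F(\<xi>) (1 - |z|\<^sup>2) / (1 - cnj z * \<xi>)\<close>, whose quotient by \<open>\<xi> - z\<close> is
  \<open>F(\<xi>) / \<xi>\<close> times the Poisson kernel on the unit circle.\<close>

lemma poisson_formula:
  assumes F: "F holomorphic_on S" and S: "open S" "cball 0 1 \<subseteq> S" and z: "norm z < 1"
    and [measurable]: "u \<in> borel_measurable borel" and u: "\<And>\<xi>. norm \<xi> = 1 \<Longrightarrow> u \<xi> = Re (F \<xi>)"
  shows "(LINT \<xi>|circle_measure. poisson z \<xi> * u \<xi>) = Re (F z)"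
proof -
  define G where "G \<xi> = F \<xi> * (1 - (norm z)\<^sup>2) / (1 - cnj z * \<xi>)" for \<xi>
  have nz: "1 - cnj z * \<xi> \<noteq> 0" if "norm \<xi> \<le> 1" for \<xi>
  proof
    assume "1 - cnj z * \<xi> = 0"
    then have "norm z * norm \<xi> = 1"
      by (metis complex_mod_cnj norm_mult norm_one right_minus_eq)
    moreover have "norm z * norm \<xi> < 1"
      using z that by (meson mult_left_le norm_ge_zero order_le_less_trans)
    ultimately show False by simp
  qed
  have F': "F holomorphic_on cball 0 1" "continuous_on (cball 0 1) F"
    using F S by (auto intro: holomorphic_on_subset holomorphic_on_imp_continuous_on)
  have G: "G holomorphic_on ball 0 1" "continuous_on (cball 0 1) G"
    unfolding G_def using nz
    by (auto intro!: holomorphic_intros continuous_intros F' holomorphic_on_subset[OF F'(1)])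
  have "((\<lambda>u. G u / (u - z)) has_contour_integral (2 * of_real pi * \<i>) * G z) (circlepath 0 1)"
    by (rule Cauchy_integral_circlepath[OF G(2,1)]) (use z in simp)
  from contour_integral_unique[OF this] have ci: "integral {0..1} (\<lambda>t. G (circlepath 0 1 t) / (circlepath 0 1 t - z) * vector_derivative (circlepath 0 1) (at t))
      = 2 * of_real pi * \<i> * G z"
    unfolding contour_integral_integral .
  have "G z = F z"
  proof -
    have "cnj z * z = of_real ((norm z)\<^sup>2)"
      using complex_norm_square[of z] by (simp add: mult.commute)
    moreover have "1 - cnj z * z \<noteq> 0"
      using nz[of z] z by simp
    ultimately show ?thesis
      by (simp add: G_def)
  qed
  obtain C where C: "\<And>\<xi>. norm \<xi> \<le> 1 \<Longrightarrow> norm (F \<xi>) \<le> C"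
    using compact_imp_bounded[OF compact_continuous_image[OF F'(2)]]
    unfolding bounded_iff by (metis compact_cball image_eqI mem_cball_0)
  \<comment> \<open>Set to 0 off the circle: \<open>F\<close> is controlled only on
    \<open>S\<close>, while a Borel function on the plane is needed.\<close>
  define f where "f \<xi> = (if norm \<xi> = 1 then of_real (poisson z \<xi>) * F \<xi> else 0)" for \<xi>
  have meas: "f \<in> borel_measurable borel"
  proof -
    have "continuous_on (sphere 0 1) (\<lambda>\<xi>. of_real (poisson z \<xi>) * F \<xi>)"
      unfolding poisson_def using z by (auto intro!: continuous_intros continuous_on_subset[OF F'(2)])
    then have "(\<lambda>\<xi>. indicator (sphere 0 1) \<xi> *\<^sub>R (of_real (poisson z \<xi>) * F \<xi>)) \<in> borel_measurable borel"
      by (intro borel_measurable_continuous_on_indicator) auto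
    moreover have "(\<lambda>\<xi>. indicator (sphere 0 1) \<xi> *\<^sub>R (of_real (poisson z \<xi>) * F \<xi>)) = f"
      by (auto simp: f_def fun_eq_iff indicator_def)
    ultimately show ?thesis by simp
  qed
  have bound: "norm (f \<xi>) \<le> 1 / (1 - norm z)\<^sup>2 * C" if "norm \<xi> = 1" for \<xi>
  proof -
    have "norm (f \<xi>) = poisson z \<xi> * norm (F \<xi>)"
      using poisson_nonneg[OF that z] that by (simp add: f_def norm_mult)
    also have "\<dots> \<le> 1 / (1 - norm z)\<^sup>2 * C"
      using that poisson_le[OF that z] poisson_nonneg[OF that z] C[of \<xi>] by (intro mult_mono) auto
    finally show ?thesis .
  qed
  have "(LINT \<xi>|circle_measure. f \<xi>) = integral {0..1} (\<lambda>t. f (exp (2 * of_real pi * \<i> * of_real t)))"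
    by (rule integral_circle_measure[OF meas bound])
  also have "\<dots> = integral {0..1} (\<lambda>t. (1 / (2 * of_real pi * \<i>)) *
      (G (circlepath 0 1 t) / (circlepath 0 1 t - z) * vector_derivative (circlepath 0 1) (at t)))"
  proof (rule integral_cong)
    fix t :: real
    define \<xi> where "\<xi> = exp (2 * of_real pi * \<i> * of_real t)"
    have n: "norm \<xi> = 1"
      by (simp add: \<xi>_def norm_exp_eq_Re)
    then have x0: "\<xi> \<noteq> 0" "\<xi> - z \<noteq> 0" "\<xi> * cnj \<xi> = 1"
      using z complex_norm_square[of \<xi>] by auto
    \<comment> \<open>On the circle \<open>cnj \<xi>\<close> is the inverse of \<open>\<xi>\<close>;
      this is what makes the squared norm of \<open>\<xi> - z\<close> appear.\<close>
    have e: "1 - cnj z * \<xi> = \<xi> * cnj (\<xi> - z)"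
      using x0 by (simp add: algebra_simps)
    have p: "complex_of_real (poisson z \<xi>) = (1 - (norm z)\<^sup>2) / ((\<xi> - z) * cnj (\<xi> - z))"
      unfolding poisson_eq[OF n] complex_norm_square[of "\<xi> - z", symmetric] by simp
    have "f \<xi> = G \<xi> / (\<xi> - z) * \<xi>"
      unfolding f_def G_def e p using n x0 by (simp add: divide_simps del: complex_cnj_diff)
    then show "f (exp (2 * of_real pi * \<i> * of_real t)) = (1 / (2 * of_real pi * \<i>)) *
      (G (circlepath 0 1 t) / (circlepath 0 1 t - z) * vector_derivative (circlepath 0 1) (at t))"
    proof -
      have "circlepath 0 1 t = \<xi>" "vector_derivative (circlepath 0 1) (at t) = 2 * of_real pi * \<i> * \<xi>"
        by (simp_all only: vector_derivative_circlepath \<xi>_def) (simp_all add: circlepath)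
      with \<open>f \<xi> = G \<xi> / (\<xi> - z) * \<xi>\<close> show ?thesis
        unfolding \<xi>_def[symmetric] by (simp add: field_simps)
    qed
  qed
  also have "\<dots> = F z"
    by (simp only: integral_mult_right ci \<open>G z = F z\<close>) simp
  finally have "(LINT \<xi>|circle_measure. f \<xi>) = F z" .
  moreover have "(LINT \<xi>|circle_measure. Re (f \<xi>)) = Re (LINT \<xi>|circle_measure. f \<xi>)"
    by (intro integral_Re circle_measure_integrableI[OF meas bound])
  moreover have "(LINT \<xi>|circle_measure. poisson z \<xi> * u \<xi>) = (LINT \<xi>|circle_measure. Re (f \<xi>))"
  proof (rule integral_cong_AE)
    show "AE \<xi> in circle_measure. poisson z \<xi> * u \<xi> = Re (f \<xi>)"
      using AE_circle_measure by eventually_elim (simp add: f_def u)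
  qed (use meas in measurable)
  ultimately show ?thesis by simp
qed

lemma integral_poisson:
  assumes "norm z < 1"
  shows "(LINT \<xi>|circle_measure. poisson z \<xi>) = 1"
  using poisson_formula[of "\<lambda>_. 1" UNIV z "\<lambda>_. 1"] assms by simp

lemma poisson_0: "norm \<xi> = 1 \<Longrightarrow> poisson 0 \<xi> = 1"
  by (auto simp: poisson_def)

lemma poisson_integrand_bound:
  assumes "norm \<xi> = 1" "norm z < 1" "\<bar>v\<bar> \<le> C"
  shows "norm (poisson z \<xi> * v) \<le> 1 / (1 - norm z)\<^sup>2 * C"
  using poisson_nonneg[OF assms(1,2)] poisson_le[OF assms(1,2)] assms(3)
  unfolding norm_mult by (intro mult_mono) auto

lemma integrable_poisson:
  assumes [measurable]: "u \<in> borel_measurable borel" and "\<And>\<xi>. norm \<xi> = 1 \<Longrightarrow> \<bar>u \<xi>\<bar> \<le> C" and "norm z < 1"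
  shows "integrable circle_measure (\<lambda>\<xi>. poisson z \<xi> * u \<xi>)"
proof (rule circle_measure_integrableI)
  show "norm (poisson z \<xi> * u \<xi>) \<le> 1 / (1 - norm z)\<^sup>2 * C" if "norm \<xi> = 1" for \<xi>
    using that assms(2)[OF that] assms(3) by (intro poisson_integrand_bound)
qed measurable

text \<open>On the circle \<open>(\<xi> + z) / (\<xi> - z) = 2 / (1 - z / \<xi>) - 1\<close> is a
  geometric series in \<open>z\<close>. Multiplied by \<open>u \<xi>\<close>, its coefficients are
  the \<open>b n\<close>, bounded by \<open>C * 3\<close>, so term-by-term integration gives a power
  series in \<open>z\<close>.\<close>

lemma poisson_integral_re_holomorphic:
  assumes [measurable]: "u \<in> borel_measurable borel" and C: "\<And>\<xi>. norm \<xi> = 1 \<Longrightarrow> \<bar>u \<xi>\<bar> \<le> C"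
  shows "re_holomorphic_near (\<lambda>z. LINT \<xi>|circle_measure. poisson z \<xi> * u \<xi>) 0 1"
proof -
  define b where "b n \<xi> = of_real (u \<xi>) * (2 * inverse \<xi> ^ n - (if n = 0 then 1 else 0))" for n and \<xi> :: complex
  have meas [measurable]: "b n \<in> borel_measurable borel" for n
    unfolding b_def by measurable
  have bound: "norm (b n \<xi>) \<le> C * 3" if "norm \<xi> = 1" for n \<xi>
    unfolding b_def norm_mult
    by (rule mult_mono) (use that C[OF that] norm_triangle_ineq4[of "2 * inverse \<xi> ^ n" "if n = 0 then 1 else 0"] in
        \<open>auto simp: norm_mult norm_power norm_inverse split: if_splits\<close>)
  have C0: "0 \<le> C"
    using C[of 1] by simp
  define F where "F z = (LINT \<xi>|circle_measure. of_real (u \<xi>) * ((\<xi> + z) / (\<xi> - z)))" for z :: complex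
  have sums: "(\<lambda>n. b n \<xi> * z ^ n) sums (of_real (u \<xi>) * ((\<xi> + z) / (\<xi> - z)))"
    if z: "norm z < 1" and \<xi>: "norm \<xi> = 1" for z \<xi>
  proof -
    have n0: "\<xi> \<noteq> 0" "\<xi> \<noteq> z"
      using z \<xi> by auto
    have "norm (z / \<xi>) < 1"
      using z \<xi> by (simp add: norm_divide)
    then have "(\<lambda>n. 2 * (z / \<xi>) ^ n - (if n = 0 then 1 else 0)) sums (2 * (1 / (1 - z / \<xi>)) - 1)"
      by (intro sums_diff sums_mult geometric_sums sums_If_finite_set[of "{0}" "\<lambda>_. 1", simplified])
    then have "(\<lambda>n. of_real (u \<xi>) * (2 * (z / \<xi>) ^ n - (if n = 0 then 1 else 0))) sums
        (of_real (u \<xi>) * (2 * (1 / (1 - z / \<xi>)) - 1))"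
      by (rule sums_mult)
    moreover have "2 * (1 / (1 - z / \<xi>)) - 1 = (\<xi> + z) / (\<xi> - z)"
      using n0 by (simp add: field_simps)
    moreover have "of_real (u \<xi>) * (2 * (z / \<xi>) ^ n - (if n = 0 then 1 else 0)) = b n \<xi> * z ^ n" for n
      by (simp add: b_def power_divide divide_inverse power_inverse algebra_simps)
    ultimately show ?thesis
      by (simp only:)
  qed
  have int: "integrable circle_measure (\<lambda>\<xi>. b n \<xi> * z ^ n)" for n z
    by (rule circle_measure_integrableI[where C="C * 3 * norm z ^ n"])
      (use bound C0 in \<open>auto simp: norm_mult norm_power intro!: mult_right_mono\<close>)
  have "(\<lambda>n. (LINT \<xi>|circle_measure. b n \<xi>) * (z - 0) ^ n) sums F z" if "z \<in> ball 0 1" for z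
  proof -
    have z: "norm z < 1"
      using that by simp
    have le: "norm (b n \<xi> * z ^ n) \<le> C * 3 * norm z ^ n" if "norm \<xi> = 1" for n \<xi>
      using bound[OF that] by (auto simp: norm_mult norm_power intro!: mult_right_mono)
    have summ: "summable (\<lambda>n. C * 3 * norm z ^ n)"
      using z by (intro summable_mult summable_geometric) simp
    have "(\<lambda>n. LINT \<xi>|circle_measure. b n \<xi> * z ^ n) sums (LINT \<xi>|circle_measure. (\<Sum>n. b n \<xi> * z ^ n))"
    proof (rule sums_integral[OF int])
      show "AE \<xi> in circle_measure. summable (\<lambda>n. norm (b n \<xi> * z ^ n))"
        using AE_circle_measure
      proof eventually_elim
        case (elim \<xi>)
        show ?case
          by (rule summable_comparison_test'[OF summ, where N=0]) (use le[OF elim] in simp)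
      qed
      show "summable (\<lambda>n. LINT \<xi>|circle_measure. norm (b n \<xi> * z ^ n))"
      proof (rule summable_comparison_test'[OF summ, where N=0])
        fix n
        have "(LINT \<xi>|circle_measure. norm (b n \<xi> * z ^ n)) \<le> (LINT \<xi>|circle_measure. C * 3 * norm z ^ n)"
          by (intro integral_mono_AE integrable_norm int) (use AE_circle_measure le in \<open>auto elim: eventually_mono\<close>)
        then show "norm (LINT \<xi>|circle_measure. norm (b n \<xi> * z ^ n)) \<le> C * 3 * norm z ^ n"
          by (simp add: circle_measure.prob_space)
      qed
    qed
    moreover have "(LINT \<xi>|circle_measure. (\<Sum>n. b n \<xi> * z ^ n)) = F z"
      unfolding F_def
    proof (rule integral_cong_AE)
      show "AE \<xi> in circle_measure. (\<Sum>n. b n \<xi> * z ^ n) = of_real (u \<xi>) * ((\<xi> + z) / (\<xi> - z))"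
        using AE_circle_measure by eventually_elim (use sums[OF z] sums_unique in metis)
    qed measurable
    ultimately show ?thesis
      by simp
  qed
  then have "F holomorphic_on ball 0 1"
    by (rule power_series_holomorphic)
  moreover have "(LINT \<xi>|circle_measure. poisson z \<xi> * u \<xi>) = Re (F z)" if "z \<in> ball 0 1" for z
  proof -
    have z: "norm z < 1"
      using that by simp
    have "integrable circle_measure (\<lambda>\<xi>. of_real (u \<xi>) * ((\<xi> + z) / (\<xi> - z)))"
    proof (rule circle_measure_integrableI)
      fix \<xi> :: complex assume n: "norm \<xi> = 1"
      have "norm ((\<xi> + z) / (\<xi> - z)) \<le> 2 / (1 - norm z)"
        unfolding norm_divide
        using norm_triangle_ineq2[of \<xi> z] norm_triangle_ineq[of \<xi> z] n z by (intro frac_le) auto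
      then show "norm (of_real (u \<xi>) * ((\<xi> + z) / (\<xi> - z))) \<le> C * (2 / (1 - norm z))"
        unfolding norm_mult using C[OF n] by (intro mult_mono) auto
    qed measurable
    then have "Re (F z) = (LINT \<xi>|circle_measure. Re (of_real (u \<xi>) * ((\<xi> + z) / (\<xi> - z))))"
      unfolding F_def by simp
    moreover have "Re (of_real a * w) = Re w * a" for a w
      by simp
    ultimately show ?thesis
      by (simp only: poisson_def)
  qed
  ultimately show ?thesis
    unfolding re_holomorphic_near_def by blast
qed

lemma continuous_imp_bounded_on_sphere:
  fixes u :: "complex \<Rightarrow> real"
  assumes "continuous_on UNIV u"
  obtains C where "\<And>\<xi>. norm \<xi> = 1 \<Longrightarrow> \<bar>u \<xi>\<bar> \<le> C"
proof -
  have "bounded (u ` sphere 0 1)"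
    by (intro compact_imp_bounded compact_continuous_image continuous_on_subset[OF assms]) auto
  then show thesis
    unfolding bounded_iff by (metis image_eqI mem_sphere_0 real_norm_def that)
qed

text \<open>Split the circle at distance \<open>d\<close> from \<open>z0\<close>: on the near arc
  \<open>u\<close> is within \<open>e / 2\<close> of \<open>u z0\<close>, and on the far arc the
  kernel is at most a multiple of \<open>1 - (norm z)\<^sup>2\<close>, which tends to 0.\<close>

lemma poisson_integral_tendsto_boundary:
  assumes u: "continuous_on UNIV u" and z0: "norm z0 = 1" and e: "e > 0"
  obtains d where "d > 0" "\<And>z. norm z < 1 \<Longrightarrow> dist z z0 < d \<Longrightarrow>
      \<bar>(LINT \<xi>|circle_measure. poisson z \<xi> * u \<xi>) - u z0\<bar> < e"
proof -
  have meas [measurable]: "u \<in> borel_measurable borel"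
    by (rule borel_measurable_continuous_onI[OF u])
  obtain C where C: "\<And>\<xi>. norm \<xi> = 1 \<Longrightarrow> \<bar>u \<xi>\<bar> \<le> C"
    using continuous_imp_bounded_on_sphere[OF u] by blast
  have C0: "0 \<le> C"
    using C[of 1] by simp
  obtain d where d: "d > 0" "\<And>\<xi>. dist \<xi> z0 < d \<Longrightarrow> \<bar>u \<xi> - u z0\<bar> < e / 2"
    using u e unfolding continuous_on_iff by (metis UNIV_I half_gt_zero_iff real_norm_def dist_norm)
  \<comment> \<open>On the far arc the denominator of the kernel is at least
    \<open>(d / 2)\<^sup>2\<close> and \<open>\<bar>u \<xi> - u z0\<bar> \<le> 2 * C\<close>;
    \<open>K\<close> is their quotient.\<close>
  define K where "K = 8 * C / d\<^sup>2"
  have K: "0 \<le> K"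
    using C0 by (simp add: K_def)
  \<comment> \<open>\<open>d / 2\<close> keeps \<open>z\<close> at least \<open>d / 2\<close> away
    from the far arc; the second bound makes \<open>K * (2 * d') < e / 2\<close>.\<close>
  define d' where "d' = min (d / 2) (e / (4 * (K + 1)))"
  have d': "0 < d'"
    using d e K by (simp add: d'_def)
  show thesis
  proof (rule that[OF d'])
    fix z assume z: "norm z < 1" "dist z z0 < d'"
    have zz: "1 - (norm z)\<^sup>2 \<le> 2 * dist z z0"
    proof -
      have *: "1 - norm z \<le> dist z z0"
        using norm_triangle_ineq2[of z0 z] z0 by (simp add: dist_norm norm_minus_commute)
      have "1 - (norm z)\<^sup>2 = (1 - norm z) * (1 + norm z)"
        by (simp add: power2_eq_square algebra_simps)
      also have "\<dots> \<le> (1 - norm z) * 2"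
        using z by (intro mult_left_mono) auto
      also have "\<dots> \<le> dist z z0 * 2"
        using * by simp
      finally show ?thesis by simp
    qed
    have pt: "\<bar>poisson z \<xi> * (u \<xi> - u z0)\<bar> \<le> poisson z \<xi> * (e / 2) + K * (1 - (norm z)\<^sup>2)" if n: "norm \<xi> = 1" for \<xi>
    proof (cases "dist \<xi> z0 < d")
      case True
      have "\<bar>poisson z \<xi> * (u \<xi> - u z0)\<bar> \<le> poisson z \<xi> * (e / 2)"
        unfolding abs_mult using poisson_nonneg[OF n z(1)] d(2)[OF True] by (intro mult_mono) auto
      moreover have "0 \<le> K * (1 - (norm z)\<^sup>2)"
        using K z by (simp add: power_le_one)
      ultimately show ?thesis by linarith
    next
      case False
      have "dist \<xi> z0 \<le> norm (\<xi> - z) + dist z z0"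
        using norm_triangle_ineq[of "\<xi> - z" "z - z0"] by (simp add: dist_norm)
      then have "d / 2 \<le> norm (\<xi> - z)"
        using False z d by (simp add: d'_def)
      then have "(d / 2)\<^sup>2 \<le> (norm (\<xi> - z))\<^sup>2"
        using d by (intro power_mono) auto
      then have "poisson z \<xi> \<le> (1 - (norm z)\<^sup>2) / (d / 2)\<^sup>2"
        unfolding poisson_eq[OF n] using d z by (intro divide_left_mono mult_pos_pos) (auto simp: power_le_one)
      moreover have "\<bar>u \<xi> - u z0\<bar> \<le> 2 * C"
        using C[OF n] C[OF z0] by linarith
      ultimately have "\<bar>poisson z \<xi> * (u \<xi> - u z0)\<bar> \<le> (1 - (norm z)\<^sup>2) / (d / 2)\<^sup>2 * (2 * C)"
        unfolding abs_mult using poisson_nonneg[OF n z(1)] by (intro mult_mono) auto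
      also have "\<dots> = K * (1 - (norm z)\<^sup>2)"
        by (simp add: K_def power2_eq_square)
      finally show ?thesis
        using poisson_nonneg[OF n z(1)] e by (simp add: add_increasing)
    qed
    have int1: "integrable circle_measure (\<lambda>\<xi>. poisson z \<xi> * (u \<xi> - u z0))"
      by (rule integrable_poisson[where C="2 * C"]) (use C C[OF z0] z in \<open>force+\<close>)
    have int2: "integrable circle_measure (\<lambda>\<xi>. poisson z \<xi>)"
      using integrable_poisson[of "\<lambda>_. 1" 1 z] z by simp
    have "(LINT \<xi>|circle_measure. poisson z \<xi> * (u \<xi> - u z0)) = (LINT \<xi>|circle_measure. poisson z \<xi> * u \<xi> - poisson z \<xi> * u z0)"
      by (simp add: right_diff_distrib)
    also have "\<dots> = (LINT \<xi>|circle_measure. poisson z \<xi> * u \<xi>) - u z0"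
      using integrable_poisson[OF meas C z(1)] int2 integral_poisson[OF z(1)] by simp
    finally have eq: "(LINT \<xi>|circle_measure. poisson z \<xi> * u \<xi>) - u z0 = (LINT \<xi>|circle_measure. poisson z \<xi> * (u \<xi> - u z0))"
      by simp
    have "\<bar>LINT \<xi>|circle_measure. poisson z \<xi> * (u \<xi> - u z0)\<bar> \<le> (LINT \<xi>|circle_measure. \<bar>poisson z \<xi> * (u \<xi> - u z0)\<bar>)"
      by (rule integral_abs_bound)
    also have "\<dots> \<le> (LINT \<xi>|circle_measure. poisson z \<xi> * (e / 2) + K * (1 - (norm z)\<^sup>2))"
      by (rule integral_mono_AE) (use int1 int2 AE_circle_measure pt in \<open>auto elim: eventually_mono\<close>)
    also have "\<dots> = e / 2 + K * (1 - (norm z)\<^sup>2)"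
      using int2 integral_poisson[OF z(1)] by (simp add: circle_measure.prob_space)
    also have "K * (1 - (norm z)\<^sup>2) \<le> K * (2 * (e / (4 * (K + 1))))"
      using zz z K by (intro mult_left_mono) (auto simp: d'_def)
    also have "\<dots> < e / 2"
      using K e by (simp add: field_simps)
    finally show "\<bar>(LINT \<xi>|circle_measure. poisson z \<xi> * u \<xi>) - u z0\<bar> < e"
      unfolding eq by simp
  qed
qed

section \<open>Closure properties of real parts of holomorphic functions\<close>

lemma re_holomorphic_near_subset:
  assumes "re_holomorphic_near u z r" "ball w s \<subseteq> ball z r"
  shows "re_holomorphic_near u w s"
  using assms unfolding re_holomorphic_near_def by (meson holomorphic_on_subset subsetD)

lemma re_holomorphic_near_cong:
  assumes "\<And>w. w \<in> ball z r \<Longrightarrow> u w = v w"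
  shows "re_holomorphic_near u z r \<longleftrightarrow> re_holomorphic_near v z r"
  using assms unfolding re_holomorphic_near_def by auto

lemma re_holomorphic_near_imp_continuous:
  assumes "re_holomorphic_near u z r"
  shows "continuous_on (ball z r) u"
proof -
  obtain F where F: "F holomorphic_on ball z r" "\<And>w. w \<in> ball z r \<Longrightarrow> u w = Re (F w)"
    using assms by (auto simp: re_holomorphic_near_def)
  have "continuous_on (ball z r) (\<lambda>w. Re (F w))"
    by (intro continuous_intros holomorphic_on_imp_continuous_on F)
  then show ?thesis
    by (rule continuous_on_eq) (simp add: F)
qed

lemma re_holomorphic_near_isCont:
  assumes "re_holomorphic_near u z r" "r > 0"
  shows "isCont u z"
  using re_holomorphic_near_imp_continuous[OF assms(1)] continuous_on_eq_continuous_at[OF open_ball, of z r u] assms(2)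
  by auto

lemma re_holomorphic_near_const [intro]: "re_holomorphic_near (\<lambda>_. c) z r"
  unfolding re_holomorphic_near_def by (rule exI[of _ "\<lambda>_. of_real c"]) auto

lemma re_holomorphic_near_add:
  assumes "re_holomorphic_near u z r" "re_holomorphic_near v z r"
  shows "re_holomorphic_near (\<lambda>w. u w + v w) z r"
proof -
  obtain F G where "F holomorphic_on ball z r" "\<forall>w\<in>ball z r. u w = Re (F w)"
    "G holomorphic_on ball z r" "\<forall>w\<in>ball z r. v w = Re (G w)"
    using assms by (auto simp: re_holomorphic_near_def)
  then show ?thesis
    unfolding re_holomorphic_near_def
    by (intro exI[of _ "\<lambda>w. F w + G w"]) (auto intro: holomorphic_intros)
qed

lemma re_holomorphic_near_cmult:
  assumes "re_holomorphic_near u z r"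
  shows "re_holomorphic_near (\<lambda>w. c * u w) z r"
proof -
  obtain F where "F holomorphic_on ball z r" "\<forall>w\<in>ball z r. u w = Re (F w)"
    using assms by (auto simp: re_holomorphic_near_def)
  then show ?thesis
    unfolding re_holomorphic_near_def
    by (intro exI[of _ "\<lambda>w. of_real c * F w"]) (auto intro: holomorphic_intros)
qed

lemma re_holomorphic_near_diff:
  assumes "re_holomorphic_near u z r" "re_holomorphic_near v z r"
  shows "re_holomorphic_near (\<lambda>w. u w - v w) z r"
  using re_holomorphic_near_add[OF assms(1) re_holomorphic_near_cmult[OF assms(2), of "-1"]] by simp

lemma re_holomorphic_near_compose:
  assumes "re_holomorphic_near u (g z) s" "g holomorphic_on ball z r" "g ` ball z r \<subseteq> ball (g z) s"
  shows "re_holomorphic_near (\<lambda>w. u (g w)) z r"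
proof -
  obtain F where "F holomorphic_on ball (g z) s" "\<forall>w\<in>ball (g z) s. u w = Re (F w)"
    using assms by (auto simp: re_holomorphic_near_def)
  then show ?thesis
    unfolding re_holomorphic_near_def using assms(2,3)
    by (intro exI[of _ "F \<circ> g"] conjI holomorphic_on_compose_gen[OF assms(2)]) auto
qed

text \<open>On the disc the quotient \<open>(w - \<zeta>) / (z - \<zeta>)\<close> is at distance
  less than 1 from 1, so the principal branch of the logarithm serves on the whole disc.\<close>

lemma re_holomorphic_near_ln_norm:
  "re_holomorphic_near (\<lambda>w. ln (norm (w - \<zeta>))) z (norm (z - \<zeta>))"
proof (cases "z = \<zeta>")
  case False
  have pos: "0 < Re ((w - \<zeta>) / (z - \<zeta>))" if "w \<in> ball z (norm (z - \<zeta>))" for w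
  proof -
    have "(w - \<zeta>) / (z - \<zeta>) = 1 + (w - z) / (z - \<zeta>)"
      using False by (simp add: field_simps)
    moreover have "norm ((w - z) / (z - \<zeta>)) < 1"
      using that False by (simp add: norm_divide dist_norm norm_minus_commute)
    ultimately show ?thesis
      using abs_Re_le_cmod[of "(w - z) / (z - \<zeta>)"] by (simp only: plus_complex.sel one_complex.sel)
  qed
  show ?thesis
    unfolding re_holomorphic_near_def
  proof (intro exI conjI ballI)
    show "(\<lambda>w. Ln ((w - \<zeta>) / (z - \<zeta>)) + of_real (ln (norm (z - \<zeta>)))) holomorphic_on ball z (norm (z - \<zeta>))"
      using pos False by (auto intro!: holomorphic_intros dest!: complex_nonpos_Reals_iff[THEN iffD1]) fastforce
    fix w assume w: "w \<in> ball z (norm (z - \<zeta>))"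
    then have "w \<noteq> \<zeta>"
      by (auto simp: dist_norm)
    then show "ln (norm (w - \<zeta>)) = Re (Ln ((w - \<zeta>) / (z - \<zeta>)) + of_real (ln (norm (z - \<zeta>))))"
      using False by (simp add: Re_Ln norm_divide ln_div)
  qed
qed (simp add: re_holomorphic_near_def, auto simp: holomorphic_on_def)

section \<open>Poisson modification, mean values and the minimum principle\<close>

definition poisson_modification :: "complex \<Rightarrow> real \<Rightarrow> (complex \<Rightarrow> real) \<Rightarrow> complex \<Rightarrow> real" where
  "poisson_modification c r u z =
     (if dist c z < r then LINT \<xi>|circle_measure. poisson ((z - c) / of_real r) \<xi> * u (c + of_real r * \<xi>) else u z)"

lemma norm_scaled_less_1_iff: "0 < r \<Longrightarrow> norm ((z - c) / complex_of_real r) < 1 \<longleftrightarrow> dist c z < r"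
  by (simp add: norm_divide dist_norm norm_minus_commute)

lemma continuous_poisson_modification_unit:
  assumes u: "continuous_on UNIV u"
  shows "continuous_on UNIV (\<lambda>z. if norm z < 1 then LINT \<xi>|circle_measure. poisson z \<xi> * u \<xi> else u z)"
    (is "continuous_on UNIV ?V")
proof -
  obtain C where C: "\<And>\<xi>. norm \<xi> = 1 \<Longrightarrow> \<bar>u \<xi>\<bar> \<le> C"
    using continuous_imp_bounded_on_sphere[OF u] by blast
  have "isCont ?V z" for z
  proof -
    consider "norm z < 1" | "norm z > 1" | "norm z = 1"
      by linarith
    then show ?thesis
    proof cases
      case 1
      have "continuous_on (ball 0 1) (\<lambda>z. LINT \<xi>|circle_measure. poisson z \<xi> * u \<xi>)"
        by (intro re_holomorphic_near_imp_continuous poisson_integral_re_holomorphic[OF _ C]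
            borel_measurable_continuous_onI u)
      then have "continuous_on (ball 0 1) ?V"
        by (rule continuous_on_eq) auto
      then show ?thesis
        using 1 by (simp add: continuous_on_eq_continuous_at)
    next
      case 2
      have "continuous_on (- cball 0 1) ?V"
        by (rule continuous_on_eq[OF continuous_on_subset[OF u]]) auto
      then show ?thesis
        using 2 by (simp add: continuous_on_eq_continuous_at open_Compl)
    next
      case 3
      show ?thesis
        unfolding continuous_at_eps_delta
      proof (intro allI impI)
        fix e :: real assume e: "0 < e"
        obtain d1 where d1: "d1 > 0" "\<And>w. norm w < 1 \<Longrightarrow> dist w z < d1 \<Longrightarrow>
            \<bar>(LINT \<xi>|circle_measure. poisson w \<xi> * u \<xi>) - u z\<bar> < e"
          using poisson_integral_tendsto_boundary[OF u 3 e] by blast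
        obtain d2 where d2: "d2 > 0" "\<And>w. dist w z < d2 \<Longrightarrow> dist (u w) (u z) < e"
          using u e unfolding continuous_on_iff by blast
        show "\<exists>d>0. \<forall>x'. dist x' z < d \<longrightarrow> dist (?V x') (?V z) < e"
          by (rule exI[of _ "min d1 d2"]) (use d1 d2 3 in \<open>auto simp: dist_real_def\<close>)
      qed
    qed
  qed
  then show ?thesis
    by (simp add: continuous_at_imp_continuous_on)
qed

lemma continuous_poisson_modification:
  assumes u: "continuous_on UNIV u" and r: "r > 0"
  shows "continuous_on UNIV (poisson_modification c r u)"
proof -
  let ?u = "\<lambda>\<xi>. u (c + of_real r * \<xi>)"
  let ?V = "\<lambda>z. if norm z < 1 then LINT \<xi>|circle_measure. poisson z \<xi> * ?u \<xi> else ?u z"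
  have "continuous_on UNIV ?u"
    by (rule continuous_on_compose2[OF u]) (auto intro!: continuous_intros)
  then have "continuous_on UNIV ?V"
    by (rule continuous_poisson_modification_unit)
  then have "continuous_on UNIV (\<lambda>z. ?V ((z - c) / of_real r))"
    by (rule continuous_on_compose2) (use r in \<open>auto intro!: continuous_intros\<close>)
  moreover have "(\<lambda>z. ?V ((z - c) / of_real r)) = poisson_modification c r u"
    using r by (auto simp: poisson_modification_def fun_eq_iff norm_scaled_less_1_iff)
  ultimately show ?thesis by (simp only:)
qed

lemma poisson_modification_re_holomorphic:
  assumes [measurable]: "u \<in> borel_measurable borel" and C: "\<And>w. dist c w = r \<Longrightarrow> \<bar>u w\<bar> \<le> C" and r: "r > 0"
  shows "re_holomorphic_near (poisson_modification c r u) c r"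
proof -
  let ?u = "\<lambda>\<xi>. u (c + of_real r * \<xi>)"
  have *: "re_holomorphic_near (\<lambda>z. LINT \<xi>|circle_measure. poisson z \<xi> * ?u \<xi>) ((c - c) / of_real r) 1"
    using poisson_integral_re_holomorphic[of ?u C] C r by (simp add: dist_norm norm_mult)
  have "re_holomorphic_near (\<lambda>z. LINT \<xi>|circle_measure. poisson ((z - c) / of_real r) \<xi> * ?u \<xi>) c r"
    by (rule re_holomorphic_near_compose[where g="\<lambda>z. (z - c) / of_real r", OF *])
      (use r in \<open>auto intro!: holomorphic_intros simp: dist_norm norm_divide norm_minus_commute\<close>)
  then show ?thesis
    by (subst re_holomorphic_near_cong[where v="\<lambda>z. LINT \<xi>|circle_measure. poisson ((z - c) / of_real r) \<xi> * ?u \<xi>"])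
      (auto simp: poisson_modification_def)
qed

text \<open>After rescaling, \<open>F\<close> is holomorphic on a disc of radius
  \<open>R / r > 1\<close>, so \<open>poisson_formula\<close> reproduces it. The mean value property
  is the case of the centre, where the kernel is 1.\<close>

lemma poisson_modification_eq_self:
  assumes u: "re_holomorphic_near u c R" "u \<in> borel_measurable borel" and r: "0 < r" "r < R"
  shows "poisson_modification c r u z = u z"
proof (cases "dist c z < r")
  case True
  let ?u = "\<lambda>\<xi>. u (c + of_real r * \<xi>)"
  obtain F where F: "F holomorphic_on ball c R" "\<And>w. w \<in> ball c R \<Longrightarrow> u w = Re (F w)"
    using u by (auto simp: re_holomorphic_near_def)
  have sub: "c + of_real r * \<xi> \<in> ball c R" if "norm \<xi> < R / r" for \<xi>
    using that r by (simp add: dist_norm norm_mult field_simps)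
  have "(LINT \<xi>|circle_measure. poisson ((z - c) / of_real r) \<xi> * ?u \<xi>) = Re (F (c + of_real r * ((z - c) / of_real r)))"
  proof (rule poisson_formula)
    show "(\<lambda>\<xi>. F (c + of_real r * \<xi>)) holomorphic_on ball 0 (R / r)"
      by (intro holomorphic_on_compose_gen[OF _ F(1), unfolded o_def] holomorphic_intros) (use sub in auto)
    show "cball 0 1 \<subseteq> ball (0::complex) (R / r)"
      using r by (simp add: cball_subset_ball_iff)
    show "norm ((z - c) / complex_of_real r) < 1"
      using True r by (simp add: norm_scaled_less_1_iff)
    show "?u \<in> borel_measurable borel"
      using u(2) by measurable
    show "?u \<xi> = Re (F (c + complex_of_real r * \<xi>))" if "norm \<xi> = 1" for \<xi>
      using sub[of \<xi>] that r F by simp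
  qed auto
  also have "\<dots> = u z"
    using F(2)[of z] True r by simp
  finally show ?thesis
    using True by (simp add: poisson_modification_def)
qed (simp add: poisson_modification_def)

lemma circle_mean_re_holomorphic:
  assumes "re_holomorphic_near u c R" "u \<in> borel_measurable borel" "0 < r" "r < R"
  shows "(LINT \<xi>|circle_measure. u (c + of_real r * \<xi>)) = u c"
proof -
  note [measurable] = assms(2)
  have "(LINT \<xi>|circle_measure. u (c + of_real r * \<xi>)) = poisson_modification c r u c"
    using assms(3) unfolding poisson_modification_def
    by (auto intro!: integral_cong_AE eventually_mono[OF AE_circle_measure] simp: poisson_0)
  with poisson_modification_eq_self[OF assms] show ?thesis by simp
qed

lemma integrable_circle_continuous:
  fixes u :: "complex \<Rightarrow> real"
  assumes "continuous_on (sphere z r) u" "0 < r" "u \<in> borel_measurable borel"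
  shows "integrable circle_measure (\<lambda>\<xi>. u (z + of_real r * \<xi>))"
proof -
  note [measurable] = assms(3)
  have "bounded (u ` sphere z r)"
    by (intro compact_imp_bounded compact_continuous_image assms) auto
  then obtain C where C: "\<And>w. w \<in> sphere z r \<Longrightarrow> \<bar>u w\<bar> \<le> C"
    unfolding bounded_iff by (metis image_eqI real_norm_def)
  show ?thesis
    by (rule circle_measure_integrableI[where C=C]) (use C assms in \<open>auto simp: dist_norm norm_mult\<close>)
qed

text \<open>The mean of \<open>Re \<xi>\<^sup>2\<close> over the circle vanishes, so \<open>Re \<xi>\<close> cannot vanish almost everywhere.\<close>

lemma circle_not_AE_left_half: "\<not> (AE \<xi> in circle_measure. Re \<xi> \<le> 0)"
proof
  assume le: "AE \<xi> in circle_measure. Re \<xi> \<le> 0"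
  have holo: "re_holomorphic_near (\<lambda>\<xi>. Re (F \<xi>)) 0 2" if "F holomorphic_on UNIV" for F
    unfolding re_holomorphic_near_def using holomorphic_on_subset[OF that] by blast
  have 1: "(LINT \<xi>|circle_measure. Re \<xi>) = 0"
    using circle_mean_re_holomorphic[OF holo[of "\<lambda>x. x"], of 1] by (simp add: holomorphic_intros)
  have 2: "(LINT \<xi>|circle_measure. Re (\<xi>\<^sup>2)) = 0"
    using circle_mean_re_holomorphic[OF holo[of "\<lambda>x. x\<^sup>2"], of 1] by (simp add: holomorphic_intros)
  have int: "integrable circle_measure (\<lambda>\<xi>. - Re \<xi>)"
    by (rule circle_measure_integrableI[where C=1]) (measurable, metis abs_Re_le_cmod norm_minus_cancel real_norm_def)
  have "AE \<xi> in circle_measure. - Re \<xi> = 0"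
    using integral_nonneg_eq_0_iff_AE[OF int] le 1 by (auto elim: eventually_mono)
  then have "AE \<xi> in circle_measure. Re (\<xi>\<^sup>2) = - 1"
    using AE_circle_measure
  proof eventually_elim
    case (elim \<xi>)
    then have "(Im \<xi>)\<^sup>2 = 1"
      using cmod_power2[of \<xi>] by simp
    with elim show ?case
      by (simp add: power2_eq_square)
  qed
  then have "(LINT \<xi>|circle_measure. Re (\<xi>\<^sup>2)) = (LINT \<xi>|circle_measure. - 1)"
    by (intro integral_cong_AE) auto
  with 2 show False
    by simp
qed

text \<open>A negative minimum \<open>m\<close> would be attained, and only in \<open>C\<close>. Let
  \<open>a\<close> be a minimum point with largest real part. The mean inequality on one circle
  around \<open>a\<close> forces \<open>w = m\<close> almost everywhere on it, so almost all of that
  circle lies in \<open>A\<close>, not to the right of \<open>a\<close>;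
  \<open>circle_not_AE_left_half\<close> excludes this. One radius per point is enough, and the
  condition outside \<open>C\<close> takes the place of boundary values.\<close>

lemma minimum_principle:
  fixes w :: "complex \<Rightarrow> real"
  assumes cont: "continuous_on S w" and meas: "w \<in> borel_measurable borel"
    and C: "compact C" "C \<subseteq> S" and out: "\<And>z. z \<in> S - C \<Longrightarrow> 0 \<le> w z"
    and sup: "\<And>z. z \<in> C \<Longrightarrow> w z < 0 \<Longrightarrow>
      \<exists>r>0. cball z r \<subseteq> S \<and> (LINT \<xi>|circle_measure. w (z + of_real r * \<xi>)) \<le> w z"
    and z: "z \<in> S"
  shows "0 \<le> w z"
proof (rule ccontr)
  assume neg: "\<not> 0 \<le> w z"
  with z out have zC: "z \<in> C"
    by blast
  have contC: "continuous_on C w"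
    using cont C(2) continuous_on_subset by blast
  obtain a0 where a0: "a0 \<in> C" "\<And>x. x \<in> C \<Longrightarrow> w a0 \<le> w x"
    using continuous_attains_inf[OF C(1) _ contC] zC by blast
  define m where "m = w a0"
  have m0: "m < 0"
    using a0(2)[OF zC] neg by (simp add: m_def)
  have ge: "m \<le> w x" if "x \<in> S" for x
    using a0(2)[of x] out[of x] that m0 by (cases "x \<in> C") (auto simp: m_def)
  define A where "A = {x \<in> C. w x = m}"
  have "compact A"
  proof -
    have "closedin (top_of_set C) (C \<inter> w -` {m})"
      by (intro continuous_closedin_preimage contC) auto
    moreover have "C \<inter> w -` {m} = A"
      by (auto simp: A_def)
    ultimately show ?thesis
      using C(1) closedin_compact by metis
  qed
  moreover have "A \<noteq> {}"
    using a0 by (auto simp: A_def m_def)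
  ultimately obtain a where a: "a \<in> A" "\<And>x. x \<in> A \<Longrightarrow> Re x \<le> Re a"
    using continuous_attains_sup[of A Re] continuous_on_Re[OF continuous_on_id] by blast
  have aC: "a \<in> C" "w a = m"
    using a(1) by (auto simp: A_def)
  obtain r where r: "r > 0" "cball a r \<subseteq> S" "(LINT \<xi>|circle_measure. w (a + of_real r * \<xi>)) \<le> m"
    using sup[of a] aC m0 by auto
  have circ: "a + of_real r * \<xi> \<in> S" if "norm \<xi> = 1" for \<xi>
    using r that by (auto simp: subset_iff dist_norm norm_mult)
  have int: "integrable circle_measure (\<lambda>\<xi>. w (a + of_real r * \<xi>))"
    using r by (intro integrable_circle_continuous continuous_on_subset[OF cont] meas) auto
  then have int': "integrable circle_measure (\<lambda>\<xi>. w (a + of_real r * \<xi>) - m)"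
    by simp
  have nonneg: "AE \<xi> in circle_measure. 0 \<le> w (a + of_real r * \<xi>) - m"
    using AE_circle_measure by eventually_elim (use ge circ in simp)
  have "(LINT \<xi>|circle_measure. w (a + of_real r * \<xi>) - m) \<le> 0"
    using r(3) int by simp
  moreover have "0 \<le> (LINT \<xi>|circle_measure. w (a + of_real r * \<xi>) - m)"
    by (rule integral_nonneg_AE[OF nonneg])
  ultimately have "AE \<xi> in circle_measure. w (a + of_real r * \<xi>) - m = 0"
    using integral_nonneg_eq_0_iff_AE[OF int' nonneg] by simp
  then have "AE \<xi> in circle_measure. Re \<xi> \<le> 0"
    using AE_circle_measure
  proof eventually_elim
    case (elim \<xi>)
    then have "a + of_real r * \<xi> \<in> A"
      using out[of "a + of_real r * \<xi>"] circ[of \<xi>] m0 by (force simp: A_def)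
    from a(2)[OF this] show ?case
      using r(1) by (simp add: mult_le_0_iff)
  qed
  with circle_not_AE_left_half show False ..
qed

section \<open>Superharmonic functions\<close>

text \<open>Continuous and real-valued by definition, so that circle integrals, Poisson modification
  and the minimum principle need no semicontinuous version; the logarithmic kernel enters through
  its truncations.\<close>

definition superharmonic :: "(complex \<Rightarrow> real) \<Rightarrow> bool" where
  "superharmonic u \<longleftrightarrow> continuous_on UNIV u \<and>
     (\<forall>z. \<exists>e>0. \<forall>r. 0 < r \<and> r < e \<longrightarrow> (LINT \<xi>|circle_measure. u (z + of_real r * \<xi>)) \<le> u z)"

lemma superharmonic_continuous: "superharmonic u \<Longrightarrow> continuous_on UNIV u"
  by (simp add: superharmonic_def)

lemma superharmonicE:
  assumes "superharmonic u"
  obtains e where "e > 0" "\<And>r. 0 < r \<Longrightarrow> r < e \<Longrightarrow> (LINT \<xi>|circle_measure. u (z + of_real r * \<xi>)) \<le> u z"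
  using assms unfolding superharmonic_def by blast

lemma continuous_bounded_on_circle:
  fixes u :: "complex \<Rightarrow> real"
  assumes "continuous_on UNIV u"
  obtains C where "\<And>w. dist c w = r \<Longrightarrow> \<bar>u w\<bar> \<le> C"
proof -
  have "bounded (u ` sphere c r)"
    by (intro compact_imp_bounded compact_continuous_image continuous_on_subset[OF assms]) auto
  then show thesis
    unfolding bounded_iff by (metis image_eqI mem_sphere real_norm_def that)
qed

lemma integrable_circle_continuous_UNIV:
  fixes u :: "complex \<Rightarrow> real"
  assumes "continuous_on UNIV u" "0 < r"
  shows "integrable circle_measure (\<lambda>\<xi>. u (z + of_real r * \<xi>))"
  by (intro integrable_circle_continuous continuous_on_subset[OF assms(1)] assms borel_measurable_continuous_onI) auto

lemma poisson_modification_re_holomorphic':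
  assumes "continuous_on UNIV u" "r > 0"
  shows "re_holomorphic_near (poisson_modification c r u) c r"
proof -
  obtain C where "\<And>w. dist c w = r \<Longrightarrow> \<bar>u w\<bar> \<le> C"
    using continuous_bounded_on_circle[OF assms(1)] by blast
  then show ?thesis
    by (intro poisson_modification_re_holomorphic borel_measurable_continuous_onI assms)
qed

lemma poisson_modification_mean:
  assumes u: "continuous_on UNIV u" and r: "r > 0" and s: "0 < s" "s < r - dist c z"
  shows "(LINT \<xi>|circle_measure. poisson_modification c r u (z + of_real s * \<xi>)) = poisson_modification c r u z"
proof (rule circle_mean_re_holomorphic[OF _ _ s])
  show "re_holomorphic_near (poisson_modification c r u) z (r - dist c z)"
    by (rule re_holomorphic_near_subset[OF poisson_modification_re_holomorphic'[OF u r]])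
      (simp add: ball_subset_ball_iff dist_commute)
  show "poisson_modification c r u \<in> borel_measurable borel"
    by (intro borel_measurable_continuous_onI continuous_poisson_modification u r)
qed

text \<open>Minimum principle on the disc for \<open>u - ?P + d\<close>, for every
  \<open>d > 0\<close>. The slack \<open>d\<close> makes this function positive on the bounding
  circle, so that its nonpositive set is compact inside the open disc.\<close>

lemma poisson_modification_le:
  assumes u: "superharmonic u" and r: "r > 0"
  shows "poisson_modification c r u z \<le> u z"
proof (cases "dist c z < r")
  case True
  let ?P = "poisson_modification c r u"
  have cu: "continuous_on UNIV u"
    using u by (rule superharmonic_continuous)
  have cP: "continuous_on UNIV ?P"
    by (rule continuous_poisson_modification[OF cu r])
  have "?P z \<le> u z + d" if d: "d > 0" for d
  proof -
    define w where "w x = u x - ?P x + d" for x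
    have cw: "continuous_on UNIV w"
      unfolding w_def by (intro continuous_intros cu cP)
    define C where "C = cball c r \<inter> {x. w x \<le> 0}"
    have C: "compact C"
      unfolding C_def by (intro compact_Int_closed compact_cball closed_Collect_le cw continuous_intros)
    have sub: "C \<subseteq> ball c r"
      using d by (auto simp: C_def w_def poisson_modification_def)
    have "0 \<le> w z"
    proof (rule minimum_principle[OF continuous_on_subset[OF cw] borel_measurable_continuous_onI[OF cw] C sub])
      show "0 \<le> w x" if "x \<in> ball c r - C" for x
        using that by (auto simp: C_def)
      show "\<exists>s>0. cball x s \<subseteq> ball c r \<and> (LINT \<xi>|circle_measure. w (x + of_real s * \<xi>)) \<le> w x" if "x \<in> C" for x
      proof -
        have x: "dist c x < r"
          using sub that by auto
        obtain e where e: "e > 0" "\<And>s. 0 < s \<Longrightarrow> s < e \<Longrightarrow> (LINT \<xi>|circle_measure. u (x + of_real s * \<xi>)) \<le> u x"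
          using superharmonicE[OF u, of x] by blast
        define s where "s = min e (r - dist c x) / 2"
        have s: "0 < s" "s < e" "s < r - dist c x"
          using e x by (auto simp: s_def)
        have "(LINT \<xi>|circle_measure. w (x + of_real s * \<xi>)) =
            (LINT \<xi>|circle_measure. u (x + of_real s * \<xi>)) - (LINT \<xi>|circle_measure. ?P (x + of_real s * \<xi>)) + d"
          unfolding w_def using integrable_circle_continuous_UNIV[OF cu s(1)] integrable_circle_continuous_UNIV[OF cP s(1)]
          by simp
        also have "\<dots> \<le> w x"
          unfolding w_def poisson_modification_mean[OF cu r s(1,3)] using e(2)[OF s(1,2)] by simp
        finally show ?thesis
          using s by (intro exI[of _ s]) (auto simp: cball_subset_ball_iff dist_commute)
      qed
    qed (use True in auto)
    then show ?thesis
      by (simp add: w_def)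
  qed
  then show ?thesis
    by (rule field_le_epsilon)
qed (simp add: poisson_modification_def)

text \<open>Inside the disc small circle means are exact. At any other point the modified function
  lies below \<open>u\<close> and equals it at the centre of the circle, so the inequality is
  inherited.\<close>

lemma poisson_modification_superharmonic:
  assumes u: "superharmonic u" and r: "r > 0"
  shows "superharmonic (poisson_modification c r u)"
  unfolding superharmonic_def
proof (intro conjI allI)
  let ?P = "poisson_modification c r u"
  have cu: "continuous_on UNIV u"
    using u by (rule superharmonic_continuous)
  show cP: "continuous_on UNIV ?P"
    by (rule continuous_poisson_modification[OF cu r])
  fix z
  show "\<exists>e>0. \<forall>s. 0 < s \<and> s < e \<longrightarrow> (LINT \<xi>|circle_measure. ?P (z + of_real s * \<xi>)) \<le> ?P z"
  proof (cases "dist c z < r")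
    case True
    then show ?thesis
      by (intro exI[of _ "r - dist c z"]) (auto simp: poisson_modification_mean[OF cu r])
  next
    case False
    obtain e where e: "e > 0" "\<And>s. 0 < s \<Longrightarrow> s < e \<Longrightarrow> (LINT \<xi>|circle_measure. u (z + of_real s * \<xi>)) \<le> u z"
      using superharmonicE[OF u, of z] by blast
    have "(LINT \<xi>|circle_measure. ?P (z + of_real s * \<xi>)) \<le> ?P z" if s: "0 < s" "s < e" for s
    proof -
      have "(LINT \<xi>|circle_measure. ?P (z + of_real s * \<xi>)) \<le> (LINT \<xi>|circle_measure. u (z + of_real s * \<xi>))"
        by (intro integral_mono integrable_circle_continuous_UNIV cu cP s poisson_modification_le u r)
      also have "\<dots> \<le> u z"
        by (rule e(2)[OF s])
      also have "u z = ?P z"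
        using False by (simp add: poisson_modification_def)
      finally show ?thesis .
    qed
    with e(1) show ?thesis
      by blast
  qed
qed

lemma poisson_modification_mono:
  assumes "continuous_on UNIV u" "continuous_on UNIV v" "r > 0" "\<And>z. u z \<le> v z"
  shows "poisson_modification c r u z \<le> poisson_modification c r v z"
proof (cases "dist c z < r")
  case True
  then have z: "norm ((z - c) / complex_of_real r) < 1"
    using assms(3) by (simp add: norm_scaled_less_1_iff)
  have int: "integrable circle_measure (\<lambda>\<xi>. poisson ((z - c) / of_real r) \<xi> * w (c + of_real r * \<xi>))"
    if w: "continuous_on UNIV w" for w :: "complex \<Rightarrow> real"
  proof -
    obtain C where C: "\<And>x. dist c x = r \<Longrightarrow> \<bar>w x\<bar> \<le> C"
      using continuous_bounded_on_circle[OF w] by blast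
    have "w \<in> borel_measurable borel"
      by (rule borel_measurable_continuous_onI[OF w])
    then show ?thesis
      by (intro integrable_poisson[where C=C] z C) (use assms(3) in \<open>auto simp: dist_norm norm_mult\<close>)
  qed
  have "(LINT \<xi>|circle_measure. poisson ((z - c) / of_real r) \<xi> * u (c + of_real r * \<xi>))
      \<le> (LINT \<xi>|circle_measure. poisson ((z - c) / of_real r) \<xi> * v (c + of_real r * \<xi>))"
    by (rule integral_mono_AE[OF int int])
      (use assms AE_circle_measure in \<open>auto elim!: eventually_mono intro!: mult_left_mono poisson_nonneg z\<close>)
  then show ?thesis
    using True by (simp add: poisson_modification_def)
qed (use assms(4) in \<open>simp add: poisson_modification_def\<close>)

text \<open>Where the truncation is active the function has its global maximum
  \<open>M - ln d\<close>; elsewhere it lies below the harmonic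
  \<open>M - ln (norm (w - \<zeta>))\<close> and agrees with it at the centre.\<close>

lemma superharmonic_truncated_log:
  assumes d: "d > 0"
  shows "superharmonic (\<lambda>z. M - ln (max (norm (z - \<zeta>)) d))"
  unfolding superharmonic_def
proof (intro conjI allI)
  let ?u = "\<lambda>z. M - ln (max (norm (z - \<zeta>)) d)"
  show cu: "continuous_on UNIV ?u"
    by (intro continuous_intros ballI) (use d in \<open>auto simp: max_def\<close>)
  fix z
  show "\<exists>e>0. \<forall>s. 0 < s \<and> s < e \<longrightarrow> (LINT \<xi>|circle_measure. ?u (z + of_real s * \<xi>)) \<le> ?u z"
  proof -
    have le: "(LINT \<xi>|circle_measure. ?u (z + of_real s * \<xi>)) \<le> M - ln d" if "s > 0" for s
    proof -
      have "(LINT \<xi>|circle_measure. ?u (z + of_real s * \<xi>)) \<le> (LINT \<xi>|circle_measure. M - ln d)"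
        by (rule integral_mono[OF integrable_circle_continuous_UNIV[OF cu that]]) (use d in \<open>auto intro!: ln_mono\<close>)
      then show ?thesis by simp
    qed
    show ?thesis
    proof (cases "norm (z - \<zeta>) \<le> d")
      case True
      then show ?thesis
        using le by (intro exI[of _ 1]) (auto simp: max_def)
    next
      case False
      define v where "v w = M - ln (norm (w - \<zeta>))" for w
      have hol: "re_holomorphic_near v z (norm (z - \<zeta>))"
        unfolding v_def by (intro re_holomorphic_near_diff re_holomorphic_near_ln_norm) auto
      have meas: "v \<in> borel_measurable borel"
        unfolding v_def by measurable
      have "(LINT \<xi>|circle_measure. ?u (z + of_real s * \<xi>)) \<le> ?u z" if s: "0 < s" "s < norm (z - \<zeta>)" for s
      proof -
        have nz: "z + of_real s * \<xi> \<noteq> \<zeta>" if "norm \<xi> = 1" for \<xi>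
        proof
          assume "z + of_real s * \<xi> = \<zeta>"
          then have "norm (z - \<zeta>) = norm (of_real s * \<xi>)"
            by (metis add_diff_cancel_left' norm_minus_commute)
          with that s show False
            by (simp add: norm_mult)
        qed
        have "continuous_on (sphere z s) v"
          unfolding v_def using s by (auto intro!: continuous_intros simp: dist_norm)
        then have "integrable circle_measure (\<lambda>\<xi>. v (z + of_real s * \<xi>))"
          by (intro integrable_circle_continuous meas s)
        then have "(LINT \<xi>|circle_measure. ?u (z + of_real s * \<xi>)) \<le> (LINT \<xi>|circle_measure. v (z + of_real s * \<xi>))"
          by (intro integral_mono_AE integrable_circle_continuous_UNIV[OF cu s(1)])
            (use AE_circle_measure in \<open>auto elim!: eventually_mono intro!: ln_mono nz simp: v_def\<close>)
        also have "\<dots> = v z"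
          by (rule circle_mean_re_holomorphic[OF hol meas s])
        also have "v z = ?u z"
          using False by (simp add: v_def max_def)
        finally show ?thesis .
      qed
      then show ?thesis
        using False d by (intro exI[of _ "norm (z - \<zeta>)"]) auto
    qed
  qed
qed

section \<open>Removable singularities of bounded harmonic functions\<close>

lemma removable_singularity_aux:
  fixes u :: "complex \<Rightarrow> real"
  assumes r: "r > 0" and cont: "continuous_on (cball 0 r - {0}) u" and B: "\<And>z. z \<in> ball 0 r - {0} \<Longrightarrow> \<bar>u z\<bar> \<le> B"
    and loc: "\<And>z. z \<in> ball 0 r - {0} \<Longrightarrow> \<exists>s>0. re_holomorphic_near u z s"
    and bdry: "\<And>z. norm z = r \<Longrightarrow> u z = 0" and z: "z \<in> ball 0 r - {0}"
  shows "0 \<le> u z"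
proof -
  have B0: "0 \<le> B"
    using B[OF z] by linarith
  \<comment> \<open>\<open>ln (r / norm z)\<close> is harmonic, vanishes on the outer circle and
    tends to infinity at 0, so any positive multiple outweighs the bounded \<open>u\<close> near the
    puncture; \<open>d\<close> makes the boundary values positive. Both parameters are sent to 0
    afterwards.\<close>
  have bound: "- (e * ln (r / norm z)) - d \<le> u z" if e: "e > 0" and d: "d > 0" for e d
  proof -
    define w where "w z = (if z \<in> cball 0 r - {0} then u z + e * ln (r / norm z) + d else 0)" for z
    \<comment> \<open>For \<open>norm z < r1\<close> the barrier \<open>e * ln (r / norm z)\<close>
      exceeds \<open>B\<close>, so the set where \<open>w\<close> is nonpositive stays away from
      0.\<close>
    define r1 where "r1 = r * exp (- (B / e))"
    have r1: "0 < r1" "r1 \<le> r"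
      using r B0 e by (auto simp: r1_def mult_le_cancel_left1)
    have cw: "continuous_on (cball 0 r - {0}) w"
    proof (rule continuous_on_eq)
      show "continuous_on (cball 0 r - {0}) (\<lambda>z. u z + e * ln (r / norm z) + d)"
        using r by (intro continuous_intros cont) auto
    qed (simp add: w_def)
    have meas: "(\<lambda>z. indicator (cball 0 r - {0}) z *\<^sub>R w z) \<in> borel_measurable borel"
      by (intro borel_measurable_continuous_on_indicator cw) auto
    have meas: "w \<in> borel_measurable borel"
    proof -
      have "(\<lambda>z. indicator (cball 0 r - {0}) z *\<^sub>R w z) = w"
        by (auto simp: w_def fun_eq_iff indicator_def)
      with meas show ?thesis by simp
    qed
    define C where "C = {z \<in> cball 0 r - ball 0 r1. w z \<le> 0}"
    have comp: "compact (cball (0::complex) r - ball 0 r1)"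
      by (intro compact_diff compact_cball open_ball)
    have cwr: "continuous_on (cball 0 r - ball 0 r1) w"
      by (rule continuous_on_subset[OF cw]) (use r1 in auto)
    have "closedin (top_of_set (cball 0 r - ball 0 r1)) ((cball 0 r - ball 0 r1) \<inter> w -` {..0})"
      by (intro continuous_closedin_preimage cwr) auto
    moreover have "(cball 0 r - ball 0 r1) \<inter> w -` {..0} = C"
      by (auto simp: C_def)
    ultimately have C: "compact C"
      using comp closedin_compact by metis
    have sub: "C \<subseteq> ball 0 r - {0}"
    proof
      fix x assume x: "x \<in> C"
      have "norm x \<noteq> r"
        using x d r bdry[of x] by (auto simp: C_def w_def split: if_splits)
      with x r1 show "x \<in> ball 0 r - {0}"
        by (auto simp: C_def)
    qed
    have "0 \<le> w z"
    proof (rule minimum_principle[OF continuous_on_subset[OF cw] meas C sub _ _ z])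
      fix x assume x: "x \<in> ball 0 r - {0} - C"
      show "0 \<le> w x"
      proof (cases "norm x < r1")
        case True
        have "B / e \<le> ln (r / norm x)"
        proof -
          have "exp (B / e) \<le> r / norm x"
            using True x r by (simp add: r1_def exp_minus field_simps)
          then show ?thesis
            using x r by (simp add: ln_ge_iff)
        qed
        then have "B \<le> e * ln (r / norm x)"
          using e by (simp add: field_simps)
        then show ?thesis
          using B[of x] x d by (auto simp: w_def)
      next
        case False
        with x show ?thesis
          by (auto simp: C_def)
      qed
    next
      fix x assume "x \<in> C"
      with sub have x: "x \<in> ball 0 r - {0}"
        by blast
      obtain s where s: "s > 0" "re_holomorphic_near u x s"
        using loc[OF x] by blast
      have "open (ball 0 r - {0::complex})"
        by auto
      then obtain t where t: "t > 0" "ball x t \<subseteq> ball 0 r - {0}"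
        using x openE by blast
      define q where "q = min s t"
      have q: "q > 0" "ball x q \<subseteq> ball 0 r - {0}" "ball x q \<subseteq> ball x s"
        using s(1) t(1) by (simp_all add: q_def order_trans[OF _ t(2)] ball_subset_ball_iff)
      have qn: "q \<le> norm x"
      proof (rule ccontr)
        assume "\<not> q \<le> norm x"
        then have "0 \<in> ball x q"
          by simp
        then have "0 \<in> ball 0 r - {0::complex}"
          by (rule subsetD[OF q(2)])
        then show False by blast
      qed
      have "re_holomorphic_near (\<lambda>z. u z + (e * ln r + d) + (- e) * ln (norm (z - 0))) x q"
        by (intro re_holomorphic_near_add re_holomorphic_near_cmult re_holomorphic_near_const
            re_holomorphic_near_subset[OF s(2) q(3)] re_holomorphic_near_subset[OF re_holomorphic_near_ln_norm[where z=x]])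
          (use qn in auto)
      also have "?this \<longleftrightarrow> re_holomorphic_near w x q"
      proof (rule re_holomorphic_near_cong)
        fix y assume "y \<in> ball x q"
        with q have "y \<in> ball 0 r - {0}"
          by blast
        then show "u y + (e * ln r + d) + - e * ln (norm (y - 0)) = w y"
          using r by (auto simp: w_def ln_div algebra_simps)
      qed
      finally have "(LINT \<xi>|circle_measure. w (x + of_real (q / 2) * \<xi>)) = w x"
        by (rule circle_mean_re_holomorphic[OF _ meas]) (use q in auto)
      moreover have "cball x (q / 2) \<subseteq> ball 0 r - {0}"
        using q by (intro order_trans[OF _ q(2)]) (auto simp: cball_subset_ball_iff)
      ultimately show "\<exists>s>0. cball x s \<subseteq> ball 0 r - {0} \<and> (LINT \<xi>|circle_measure. w (x + of_real s * \<xi>)) \<le> w x"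
        using q(1) by (intro exI[of _ "q / 2"]) auto
    qed auto
    then show ?thesis
      using z by (auto simp: w_def split: if_splits)
  qed
  have nn: "0 \<le> ln (r / norm z)"
    using z by (auto simp: field_simps)
  have "0 \<le> u z + k" if "k > 0" for k
  proof -
    define L where "L = ln (r / norm z)"
    have "k / (2 * (L + 1)) * L \<le> k / 2"
      using nn that by (simp add: L_def field_simps)
    then show ?thesis
      using bound[of "k / (2 * (L + 1))" "k / 2"] nn that by (simp add: L_def)
  qed
  then show ?thesis
    by (rule field_le_epsilon)
qed

text \<open>The extension \<open>v\<close> solves the Dirichlet problem on a smaller disc with the
  values of \<open>u\<close> on its circle; Tietze's theorem makes these values continuous on the
  plane. \<open>u - v\<close> and \<open>v - u\<close> are bounded, harmonic off 0 and vanish on the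
  circle, so both are nonnegative.\<close>

lemma removable_singularity:
  fixes u :: "complex \<Rightarrow> real"
  assumes R: "R > 0" and B: "\<And>z. z \<in> ball 0 R - {0} \<Longrightarrow> \<bar>u z\<bar> \<le> B"
    and loc: "\<And>z. z \<in> ball 0 R - {0} \<Longrightarrow> \<exists>s>0. re_holomorphic_near u z s"
  obtains v r where "r > 0" "re_holomorphic_near v 0 r" "\<And>z. z \<in> ball 0 r - {0} \<Longrightarrow> v z = u z"
proof -
  define r where "r = R / 2"
  have r: "0 < r" "r < R"
    using R by (auto simp: r_def)
  have cont: "continuous_on (ball 0 R - {0}) u"
  proof (rule continuous_at_imp_continuous_on, rule ballI)
    fix z :: complex assume "z \<in> ball 0 R - {0}"
    then show "isCont u z"
      using loc re_holomorphic_near_isCont by blast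
  qed
  have "continuous_on (sphere 0 r) u"
    by (rule continuous_on_subset[OF cont]) (use r in auto)
  then obtain h where h: "continuous_on UNIV h" "\<And>z. z \<in> sphere 0 r \<Longrightarrow> h z = u z"
    using Tietze_unbounded[of "sphere 0 r" u UNIV] by auto
  define v where "v = poisson_modification 0 r h"
  have v: "continuous_on UNIV v" "re_holomorphic_near v 0 r"
    unfolding v_def using continuous_poisson_modification[OF h(1) r(1)] poisson_modification_re_holomorphic'[OF h(1) r(1)] by auto
  have vu: "v z = u z" if "norm z = r" for z
    using that h(2)[of z] by (simp add: v_def poisson_modification_def)
  have "bounded (v ` cball 0 r)"
    by (intro compact_imp_bounded compact_continuous_image continuous_on_subset[OF v(1)]) auto
  then obtain C where C: "\<And>z. z \<in> cball 0 r \<Longrightarrow> \<bar>v z\<bar> \<le> C"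
    unfolding bounded_iff by (metis image_eqI real_norm_def)
  have cont': "continuous_on (cball 0 r - {0}) u" "continuous_on (cball 0 r - {0}) v"
    by (rule continuous_on_subset[OF cont] continuous_on_subset[OF v(1)]; use r in auto)+
  have bd: "\<bar>u z\<bar> \<le> B" "\<bar>v z\<bar> \<le> C" if "z \<in> ball 0 r - {0}" for z
    using B[of z] C[of z] r that by auto
  have hol: "\<exists>s>0. re_holomorphic_near u z s \<and> re_holomorphic_near v z s" if z: "z \<in> ball 0 r - {0}" for z
  proof -
    obtain s where s: "s > 0" "re_holomorphic_near u z s"
      using loc[of z] z r by auto
    have "re_holomorphic_near u z (min s (r - norm z))"
      by (rule re_holomorphic_near_subset[OF s(2)]) auto
    moreover have "re_holomorphic_near v z (min s (r - norm z))"
      by (rule re_holomorphic_near_subset[OF v(2)]) (auto simp: ball_subset_ball_iff)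
    ultimately show ?thesis
      using s z by (intro exI[of _ "min s (r - norm z)"]) auto
  qed
  have "v z = u z" if z: "z \<in> ball 0 r - {0}" for z
  proof -
    have hol': "\<exists>s>0. re_holomorphic_near (\<lambda>z. u z - v z) z s \<and> re_holomorphic_near (\<lambda>z. v z - u z) z s"
      if "z \<in> ball 0 r - {0}" for z
      using hol[OF that] re_holomorphic_near_diff by blast
    have bd': "\<bar>u z - v z\<bar> \<le> B + C" "\<bar>v z - u z\<bar> \<le> B + C" if "z \<in> ball 0 r - {0}" for z
      using bd[OF that] by linarith+
    have "0 \<le> u z - v z"
      by (rule removable_singularity_aux[where u="\<lambda>z. u z - v z" and B="B + C", OF r(1) _ bd'(1) _ _ z])
        (use hol' vu in \<open>blast intro: continuous_on_diff cont' | simp\<close>)+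
    moreover have "0 \<le> v z - u z"
      by (rule removable_singularity_aux[where u="\<lambda>z. v z - u z" and B="B + C", OF r(1) _ bd'(2) _ _ z])
        (use hol' vu in \<open>blast intro: continuous_on_diff cont' | simp\<close>)+
    ultimately show ?thesis by linarith
  qed
  with r(1) v(2) show thesis
    by (rule that)
qed

section \<open>The Green function of a disc\<close>

lemma ennreal_eq_topI:
  assumes "\<And>x::real. ennreal x \<le> y"
  shows "y = \<infinity>"
proof (cases y rule: ennreal_cases)
  case (real r)
  then have "ennreal (r + 1) \<le> ennreal r"
    using assms by metis
  with real show ?thesis
    by (simp add: ennreal_le_iff)
qed simp

text \<open>By Hadamard's variational formula the Green function of a disc is the inner product of these factors,
  which makes it visibly positive definite.\<close>

definition disc_factor :: "complex \<Rightarrow> real \<Rightarrow> complex \<Rightarrow> real \<times> complex \<Rightarrow> ennreal" where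
  "disc_factor c r z = (\<lambda>(\<tau>, \<xi>). if 0 < \<tau> \<and> dist c z < r * exp (- \<tau>)
     then ennreal (poisson ((z - c) / of_real (r * exp (- \<tau>))) \<xi>) else 0)"

definition disc_green :: "complex \<Rightarrow> real \<Rightarrow> complex \<Rightarrow> complex \<Rightarrow> ennreal" where
  "disc_green c r z w = (\<integral>\<^sup>+p. disc_factor c r z p * disc_factor c r w p \<partial>(lborel \<Otimes>\<^sub>M circle_measure))"

lemma measurable_disc_factor [measurable]:
  "(\<lambda>(z, p). disc_factor c r z p) \<in> borel_measurable (borel \<Otimes>\<^sub>M (lborel \<Otimes>\<^sub>M circle_measure))"
  unfolding disc_factor_def by measurable

lemma disc_green_commute: "disc_green c r z w = disc_green c r w z"
  by (simp add: disc_green_def mult.commute)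

lemma nn_integral_poisson_mult:
  assumes F: "F holomorphic_on S" and S: "open S" "cball 0 1 \<subseteq> S" and z: "norm z < 1"
    and [measurable]: "u \<in> borel_measurable borel" and u: "\<And>\<xi>. norm \<xi> = 1 \<Longrightarrow> u \<xi> = Re (F \<xi>)"
    and nonneg: "\<And>\<xi>. norm \<xi> = 1 \<Longrightarrow> 0 \<le> u \<xi>"
  shows "(\<integral>\<^sup>+\<xi>. ennreal (poisson z \<xi>) * ennreal (u \<xi>) \<partial>circle_measure) = ennreal (Re (F z))"
proof -
  have "continuous_on (sphere 0 1) (\<lambda>\<xi>. Re (F \<xi>))"
    using F S(2) by (intro continuous_intros holomorphic_on_imp_continuous_on holomorphic_on_subset[OF F]) auto
  then have "bounded ((\<lambda>\<xi>. Re (F \<xi>)) ` sphere 0 1)"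
    by (intro compact_imp_bounded compact_continuous_image) auto
  then obtain C where C: "\<And>\<xi>. norm \<xi> = 1 \<Longrightarrow> \<bar>Re (F \<xi>)\<bar> \<le> C"
    unfolding bounded_iff by (metis image_eqI mem_sphere_0 real_norm_def)
  have "(\<integral>\<^sup>+\<xi>. ennreal (poisson z \<xi>) * ennreal (u \<xi>) \<partial>circle_measure) = (\<integral>\<^sup>+\<xi>. ennreal (poisson z \<xi> * u \<xi>) \<partial>circle_measure)"
    by (rule nn_integral_cong_AE) (use AE_circle_measure poisson_nonneg[OF _ z] nonneg in \<open>auto elim!: eventually_mono simp: ennreal_mult\<close>)
  also have "\<dots> = ennreal (LINT \<xi>|circle_measure. poisson z \<xi> * u \<xi>)"
  proof (rule nn_integral_eq_integral)
    show "integrable circle_measure (\<lambda>\<xi>. poisson z \<xi> * u \<xi>)"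
      by (rule integrable_poisson[where C=C]) (use C u z in auto)
    show "AE \<xi> in circle_measure. 0 \<le> poisson z \<xi> * u \<xi>"
      using AE_circle_measure by eventually_elim (use poisson_nonneg[OF _ z] nonneg in simp)
  qed
  also have "\<dots> = ennreal (Re (F z))"
    by (subst poisson_formula[OF F S z _ u]) auto
  finally show ?thesis .
qed

text \<open>On the circle \<open>poisson b \<xi>\<close> is the real part of
  \<open>(1 + \<xi> * cnj b) / (1 - \<xi> * cnj b)\<close>, since \<open>cnj \<xi>\<close> inverts
  \<open>\<xi>\<close>. This function is holomorphic beyond the closed disc, so its Poisson integral
  at \<open>a\<close> is its value there.\<close>

lemma poisson_convolution:
  assumes a: "norm a < 1" and b: "norm b < 1"
  shows "(\<integral>\<^sup>+\<xi>. ennreal (poisson a \<xi>) * ennreal (poisson b \<xi>) \<partial>circle_measure)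
    = ennreal (Re ((1 + a * cnj b) / (1 - a * cnj b)))"
proof (rule nn_integral_poisson_mult[where F="\<lambda>\<xi>. (1 + \<xi> * cnj b) / (1 - \<xi> * cnj b)" and S="{\<xi>. 1 - \<xi> * cnj b \<noteq> 0}"])
  have "continuous_on UNIV (\<lambda>\<xi>. 1 - \<xi> * cnj b)"
    by (intro continuous_intros)
  then show "open {\<xi>. 1 - \<xi> * cnj b \<noteq> 0}"
    by (intro open_Collect_neq) auto
  show "cball 0 1 \<subseteq> {\<xi>. 1 - \<xi> * cnj b \<noteq> 0}"
  proof (clarsimp)
    fix \<xi> :: complex assume "norm \<xi> \<le> 1" "\<xi> * cnj b = 1"
    moreover have "norm (\<xi> * cnj b) \<le> 1 * norm b"
      unfolding norm_mult using \<open>norm \<xi> \<le> 1\<close> by (intro mult_mono) auto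
    ultimately show False
      using b by simp
  qed
  show "poisson b \<xi> = Re ((1 + \<xi> * cnj b) / (1 - \<xi> * cnj b))" if n: "norm \<xi> = 1" for \<xi>
  proof -
    have x: "cnj \<xi> * \<xi> = 1" "cnj \<xi> \<noteq> 0"
      using n complex_norm_square[of \<xi>] by (auto simp: mult.commute)
    have "(1 + \<xi> * cnj b) / (1 - \<xi> * cnj b) = (cnj \<xi> * (1 + \<xi> * cnj b)) / (cnj \<xi> * (1 - \<xi> * cnj b))"
      using x(2) by (rule mult_divide_mult_cancel_left[symmetric])
    also have "\<dots> = cnj ((\<xi> + b) / (\<xi> - b))"
      using x(1) by (simp add: algebra_simps mult.assoc[symmetric])
    finally show ?thesis
      by (simp only: poisson_def cnj.sel)
  qed
qed (use a b poisson_nonneg in \<open>auto intro!: holomorphic_intros\<close>)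

text \<open>The value of \<open>poisson_convolution\<close> for the circle of radius
  \<open>exp (- \<tau>)\<close>, with numerator and denominator scaled so that the latter is the
  square of the norm whose logarithm is the antiderivative up to sign.\<close>

definition green_kernel_density :: "complex \<Rightarrow> complex \<Rightarrow> real \<Rightarrow> real" where
  "green_kernel_density a b \<tau> = (exp (- 2 * \<tau>) - exp (2 * \<tau>) * (norm (a * cnj b))\<^sup>2) /
     (norm (of_real (exp (- \<tau>)) - of_real (exp \<tau>) * (a * cnj b)))\<^sup>2"

text \<open>\<open>\<tau>\<close> shrinks the disc to radius \<open>r * exp (- \<tau>)\<close>;
  rescaling it to the unit disc multiplies \<open>a\<close> by \<open>exp \<tau>\<close>, and the
  circle integral is then \<open>poisson_convolution\<close>.\<close>

lemma disc_green_eq_integral: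
  fixes c z w :: complex and r :: real
  assumes r: "r > 0"
  defines "a \<equiv> (\<lambda>z. (z - c) / complex_of_real r)"
  shows "disc_green c r z w = (\<integral>\<^sup>+\<tau>. (if 0 < \<tau> \<and> norm (a z) < exp (- \<tau>) \<and> norm (a w) < exp (- \<tau>)
     then ennreal (green_kernel_density (a z) (a w) \<tau>) else 0) \<partial>lborel)"
proof -
  have "disc_green c r z w = (\<integral>\<^sup>+\<tau>. \<integral>\<^sup>+\<xi>. disc_factor c r z (\<tau>, \<xi>) * disc_factor c r w (\<tau>, \<xi>) \<partial>circle_measure \<partial>lborel)"
    unfolding disc_green_def by (rule circle_measure.nn_integral_fst[symmetric]) measurable
  also have "\<dots> = (\<integral>\<^sup>+\<tau>. (if 0 < \<tau> \<and> norm (a z) < exp (- \<tau>) \<and> norm (a w) < exp (- \<tau>)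
     then ennreal (green_kernel_density (a z) (a w) \<tau>) else 0) \<partial>lborel)"
  proof (rule nn_integral_cong)
    fix \<tau> :: real
    have iff: "dist c z < r * exp (- \<tau>) \<longleftrightarrow> norm (a z) < exp (- \<tau>)" for z
      using r by (simp add: a_def norm_divide dist_norm norm_minus_commute field_simps)
    have sc: "(z - c) / of_real (r * exp (- \<tau>)) = of_real (exp \<tau>) * a z" for z
      using r by (simp add: a_def exp_minus field_simps)
    show "(\<integral>\<^sup>+\<xi>. disc_factor c r z (\<tau>, \<xi>) * disc_factor c r w (\<tau>, \<xi>) \<partial>circle_measure) =
      (if 0 < \<tau> \<and> norm (a z) < exp (- \<tau>) \<and> norm (a w) < exp (- \<tau>)
     then ennreal (green_kernel_density (a z) (a w) \<tau>) else 0)"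
    proof (cases "0 < \<tau> \<and> norm (a z) < exp (- \<tau>) \<and> norm (a w) < exp (- \<tau>)")
      case True
      define q where "q = a z * cnj (a w)"
      have n: "norm (of_real (exp \<tau>) * a z) < 1" "norm (of_real (exp \<tau>) * a w) < 1"
        using True by (simp_all add: norm_mult exp_minus field_simps)
      have "(\<integral>\<^sup>+\<xi>. disc_factor c r z (\<tau>, \<xi>) * disc_factor c r w (\<tau>, \<xi>) \<partial>circle_measure)
        = (\<integral>\<^sup>+\<xi>. ennreal (poisson (of_real (exp \<tau>) * a z) \<xi>) * ennreal (poisson (of_real (exp \<tau>) * a w) \<xi>) \<partial>circle_measure)"
        using True by (simp add: disc_factor_def iff sc del: of_real_mult of_real_exp)
      also have "\<dots> = ennreal (Re ((1 + of_real (exp (2 * \<tau>)) * q) / (1 - of_real (exp (2 * \<tau>)) * q)))"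
      proof -
        have "of_real (exp \<tau>) * a z * cnj (of_real (exp \<tau>) * a w) = of_real (exp (2 * \<tau>)) * q"
        proof -
          have "exp (2 * \<tau>) = exp \<tau> * exp \<tau>"
            by (simp add: exp_double power2_eq_square)
          then show ?thesis
            by (simp only: q_def complex_cnj_mult complex_cnj_complex_of_real of_real_mult ac_simps)
        qed
        then show ?thesis
          unfolding poisson_convolution[OF n] by (simp only:)
      qed
      also have "Re ((1 + of_real (exp (2 * \<tau>)) * q) / (1 - of_real (exp (2 * \<tau>)) * q)) = green_kernel_density (a z) (a w) \<tau>"
      proof -
        define E where "E = exp \<tau>"
        have E: "E > 0" "exp (- \<tau>) = 1 / E" "exp (2 * \<tau>) = E\<^sup>2" "exp (- 2 * \<tau>) = 1 / E\<^sup>2"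
          by (simp_all add: E_def exp_minus exp_double[symmetric] field_simps)
        have "Re ((1 + of_real (E\<^sup>2) * q) / (1 - of_real (E\<^sup>2) * q)) =
            Re ((1 + of_real (E\<^sup>2) * q) * cnj (1 - of_real (E\<^sup>2) * q)) / (norm (1 - of_real (E\<^sup>2) * q))\<^sup>2"
          by (subst complex_div_cnj) (simp flip: of_real_power)
        also have "Re ((1 + of_real (E\<^sup>2) * q) * cnj (1 - of_real (E\<^sup>2) * q)) = 1 - (E\<^sup>2)\<^sup>2 * (norm q)\<^sup>2"
          unfolding cmod_power2 by (simp add: algebra_simps power2_eq_square flip: of_real_power)
        also have "norm (1 - of_real (E\<^sup>2) * q) = E * norm (of_real (1 / E) - of_real E * q)"
        proof -
          have "1 - of_real (E\<^sup>2) * q = of_real E * (of_real (1 / E) - of_real E * q)"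
            using E(1) by (simp add: algebra_simps power2_eq_square)
          then show ?thesis
            using E(1) by (simp only: norm_mult norm_of_real abs_of_pos)
        qed
        also have "(1 - (E\<^sup>2)\<^sup>2 * (norm q)\<^sup>2) / (E * norm (of_real (1 / E) - of_real E * q))\<^sup>2 =
            (1 / E\<^sup>2 - E\<^sup>2 * (norm q)\<^sup>2) / (norm (of_real (1 / E) - of_real E * q))\<^sup>2"
          using E(1) by (simp add: power_mult_distrib divide_simps)
        finally show ?thesis
          unfolding green_kernel_density_def E(2-4) q_def[symmetric] E_def[symmetric]
          by (simp only: of_real_divide of_real_1)
      qed
      finally show ?thesis
        using True by simp
    qed (auto simp: disc_factor_def iff)
  qed
  finally show ?thesis .
qed

lemma green_kernel_density_nonneg:
  assumes "norm a < exp (- \<tau>)" "norm b < exp (- \<tau>)"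
  shows "0 \<le> green_kernel_density a b \<tau>"
proof -
  have "norm (a * cnj b) \<le> exp (- \<tau>) * exp (- \<tau>)"
    unfolding norm_mult using assms by (intro mult_mono) auto
  then have "(norm (a * cnj b))\<^sup>2 \<le> (exp (- \<tau>) * exp (- \<tau>))\<^sup>2"
    by (intro power_mono) auto
  then have "exp (2 * \<tau>) * (norm (a * cnj b))\<^sup>2 \<le> exp (2 * \<tau>) * (exp (- \<tau>) * exp (- \<tau>))\<^sup>2"
    by (intro mult_left_mono) auto
  also have "\<dots> = exp (- 2 * \<tau>)"
    by (simp add: power2_eq_square flip: exp_add)
  finally show ?thesis
    by (simp add: green_kernel_density_def)
qed

text \<open>Hadamard's variational formula for the Green function of the concentric discs.\<close>

lemma green_kernel_density_antiderivative:
  assumes "of_real (exp (- \<tau>)) - of_real (exp \<tau>) * (a * cnj b) \<noteq> 0"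
  shows "((\<lambda>\<tau>. - ln (norm (of_real (exp (- \<tau>)) - of_real (exp \<tau>) * (a * cnj b)))) has_real_derivative green_kernel_density a b \<tau>) (at \<tau>)"
proof -
  define p where "p = a * cnj b"
  define N where "N t = exp (- 2 * t) - 2 * Re p + exp (2 * t) * (norm p)\<^sup>2" for t
  have N: "(norm (of_real (exp (- t)) - of_real (exp t) * p))\<^sup>2 = N t" for t :: real
  proof -
    have "(norm (of_real (exp (- t)) - of_real (exp t) * p))\<^sup>2 = (exp (- t) - exp t * Re p)\<^sup>2 + (exp t * Im p)\<^sup>2"
      by (simp add: cmod_power2 del: of_real_exp)
    also have "\<dots> = exp (- t) * exp (- t) - 2 * (exp (- t) * exp t) * Re p + (exp t * exp t) * (norm p)\<^sup>2"
      unfolding cmod_power2 by (simp add: power2_eq_square algebra_simps)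
    also have "\<dots> = N t"
      by (simp add: N_def flip: exp_add)
    finally show ?thesis .
  qed
  have pos: "N \<tau> > 0"
    using assms by (simp add: N[symmetric] p_def)
  have "((\<lambda>t. - (ln (N t) / 2)) has_real_derivative (exp (- 2 * \<tau>) - exp (2 * \<tau>) * (norm p)\<^sup>2) / N \<tau>) (at \<tau>)"
    using pos unfolding N_def by (auto intro!: derivative_eq_intros simp: field_simps)
  moreover have "- ln (norm (of_real (exp (- t)) - of_real (exp t) * p)) = - (ln (N t) / 2)" for t :: real
    unfolding N[symmetric] by (cases "norm (of_real (exp (- t)) - of_real (exp t) * p) = 0") (simp_all add: ln_realpow)
  ultimately show ?thesis
    unfolding green_kernel_density_def p_def[symmetric] N by (simp only:)
qed

lemma disc_green_outside:
  assumes "r > 0" "dist c z \<ge> r \<or> dist c w \<ge> r"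
  shows "disc_green c r z w = 0"
proof -
  have "disc_factor c r x p = 0" if "dist c x \<ge> r" for x p
  proof -
    have "r * exp (- t) \<le> r" if "t > 0" for t
      using assms(1) that by simp
    with \<open>dist c x \<ge> r\<close> show ?thesis
      by (cases p) (force simp: disc_factor_def)
  qed
  then have "disc_factor c r z p * disc_factor c r w p = 0" for p
    using assms(2) by (metis mult_zero_left mult_zero_right)
  then show ?thesis
    by (simp only: disc_green_def nn_integral_const mult_zero_left)
qed

text \<open>The circle of radius \<open>exp (- \<tau>)\<close> contributes while both rescaled
  points lie inside it, that is for \<open>\<tau> < T\<close>. At \<open>T\<close> it passes through
  the outer point, say \<open>a\<close>, and with \<open>m = norm a\<close> one gets
  \<open>norm (m - a * cnj b / m) = norm (a - b)\<close>; at \<open>\<tau> = 0\<close> the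
  antiderivative gives \<open>norm (1 - a * cnj b)\<close>.\<close>

lemma disc_green_eq:
  fixes c z w :: complex and r :: real
  assumes r: "r > 0" and zw: "dist c z < r" "dist c w < r" "z \<noteq> w"
  defines "a \<equiv> (z - c) / complex_of_real r" and "b \<equiv> (w - c) / complex_of_real r"
  shows "disc_green c r z w = ennreal (ln (norm (1 - a * cnj b)) - ln (norm (a - b)))"
proof -
  have ab: "norm a < 1" "norm b < 1" "a \<noteq> b"
    using zw r by (auto simp: a_def b_def norm_scaled_less_1_iff)
  define m where "m = max (norm a) (norm b)"
  have m: "0 < m" "m < 1" "norm a \<le> m" "norm b \<le> m"
    using ab by (auto simp: m_def max_def)
  define T where "T = - ln m"
  have T: "T > 0" "exp (- T) = m" "exp T = 1 / m"
    using m by (simp_all add: T_def exp_minus inverse_eq_divide)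
  let ?H = "\<lambda>\<tau>. - ln (norm (of_real (exp (- \<tau>)) - of_real (exp \<tau>) * (a * cnj b)))"
  have le: "norm a \<le> exp (- t)" "norm b \<le> exp (- t)" if "t \<le> T" for t
  proof -
    have "m \<le> exp (- t)"
      using that unfolding T(2)[symmetric] by simp
    with m show "norm a \<le> exp (- t)" "norm b \<le> exp (- t)" by linarith+
  qed
  \<comment> \<open>A zero would force \<open>a * cnj b = exp (- t) * exp (- t)\<close> with both
    norms at most \<open>exp (- t)\<close>, hence equal norms and then \<open>a = b\<close>.\<close>
  have nz: "of_real (exp (- t)) - of_real (exp t) * (a * cnj b) \<noteq> 0" if "t \<le> T" for t :: real
  proof
    define E where "E = exp (- t)"
    have E: "E > 0" "exp t = 1 / E"
      by (simp_all add: E_def exp_minus inverse_eq_divide)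
    assume "of_real (exp (- t)) - of_real (exp t) * (a * cnj b) = 0"
    then have "complex_of_real E = complex_of_real (1 / E) * (a * cnj b)"
      unfolding E_def[symmetric] E(2)[symmetric] by (simp add: exp_of_real E_def)
    then have eq: "a * cnj b = of_real (E * E)"
      using E(1) by (simp add: field_simps)
    then have n: "norm a * norm b = E * E"
      by (metis E(1) abs_of_pos complex_mod_cnj mult_pos_pos norm_mult norm_of_real)
    have leE: "norm a \<le> E" "norm b \<le> E"
      using le[OF that] by (simp_all add: E_def)
    have "E * E \<le> E * norm b" "E * E \<le> norm a * E"
      using n leE E(1) mult_right_mono[OF leE(1) norm_ge_zero[of b]] mult_left_mono[OF leE(2) norm_ge_zero[of a]] by linarith+
    then have "norm b = E"
      using leE E(1) by auto
    then have "b * cnj b = of_real (E * E)" "cnj b \<noteq> 0"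
      using complex_norm_square[of b] E(1) by (auto simp: power2_eq_square)
    with eq have "a = b"
      by (metis mult_right_cancel)
    with ab show False by simp
  qed
  have meas: "green_kernel_density a b \<in> borel_measurable borel"
    unfolding green_kernel_density_def by measurable
  have dens0: "0 \<le> green_kernel_density a b t" if "t \<le> T" for t
  proof -
    have "norm (a * cnj b) \<le> exp (- t) * exp (- t)"
      unfolding norm_mult using le[OF that] by (intro mult_mono) auto
    then have "(norm (a * cnj b))\<^sup>2 \<le> (exp (- t) * exp (- t))\<^sup>2"
      by (intro power_mono) auto
    then have "exp (2 * t) * (norm (a * cnj b))\<^sup>2 \<le> exp (2 * t) * (exp (- t) * exp (- t))\<^sup>2"
      by (intro mult_left_mono) auto
    also have "\<dots> = exp (- 2 * t)"
      by (simp add: power2_eq_square flip: exp_add)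
    finally show ?thesis
      by (simp add: green_kernel_density_def)
  qed
  have "disc_green c r z w = (\<integral>\<^sup>+\<tau>. (if 0 < \<tau> \<and> norm a < exp (- \<tau>) \<and> norm b < exp (- \<tau>)
     then ennreal (green_kernel_density a b \<tau>) else 0) \<partial>lborel)"
    unfolding a_def b_def by (rule disc_green_eq_integral[OF r])
  also have "\<dots> = (\<integral>\<^sup>+\<tau>. ennreal (green_kernel_density a b \<tau>) * indicator {0..T} \<tau> \<partial>lborel)"
  proof (rule nn_integral_cong_AE)
    have "AE \<tau> in lborel. \<tau> \<noteq> 0 \<and> \<tau> \<noteq> T"
      using AE_lborel_singleton[of 0] AE_lborel_singleton[of T] by eventually_elim auto
    then show "AE \<tau> in lborel. (if 0 < \<tau> \<and> norm a < exp (- \<tau>) \<and> norm b < exp (- \<tau>)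
     then ennreal (green_kernel_density a b \<tau>) else 0) = ennreal (green_kernel_density a b \<tau>) * indicator {0..T} \<tau>"
    proof eventually_elim
      case (elim t)
      have "norm a < exp (- t) \<and> norm b < exp (- t) \<longleftrightarrow> m < exp (- t)"
        by (auto simp: m_def)
      also have "\<dots> \<longleftrightarrow> t < T"
        unfolding T(2)[symmetric] by auto
      finally show ?case
        using elim by (auto simp: indicator_def)
    qed
  qed
  also have "\<dots> = ?H T - ?H 0"
    by (rule nn_integral_FTC_Icc[OF meas])
      (use T nz dens0 in \<open>auto intro!: green_kernel_density_antiderivative simp del: mult_minus_left\<close>)
  also have "?H T = - ln (norm (a - b))"
  proof -
    have "norm (m - a * cnj b / m) = norm (a - b)"
    proof (cases "norm b \<le> norm a")
      case True
      then have ma: "m = norm a" by (simp add: m_def)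
      then have "a * cnj a = of_real m * of_real m" "a \<noteq> 0"
        using complex_norm_square[of a] m(1) by (auto simp: power2_eq_square)
      then have "of_real m - a * cnj b / of_real m = a * cnj (a - b) / of_real m"
        using m(1) by (simp add: field_simps)
      then show ?thesis
        using ma m(1) by (simp add: norm_mult norm_divide flip: complex_cnj_diff)
    next
      case False
      then have mb: "m = norm b" by (simp add: m_def)
      then have "b * cnj b = of_real m * of_real m"
        using complex_norm_square[of b] by (auto simp: power2_eq_square)
      then have "of_real m - a * cnj b / of_real m = cnj b * (b - a) / of_real m"
        using m(1) by (simp add: field_simps)
      then show ?thesis
        using mb m(1) by (simp add: norm_mult norm_divide norm_minus_commute)
    qed
    then show ?thesis
      using T by (simp del: of_real_exp)
  qed
  finally show ?thesis
    by simp
qed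

text \<open>The integral up to \<open>T\<close> is \<open>?H T - ?H 0\<close>, and
  \<open>?H T\<close> tends to infinity as the shrinking circle reaches the point, i.e. as
  \<open>exp (- T)\<close> decreases to \<open>norm a\<close>.\<close>

lemma disc_green_diagonal:
  assumes r: "r > 0" and z: "dist c z < r"
  shows "disc_green c r z z = \<infinity>"
proof -
  define a where "a = (z - c) / complex_of_real r"
  define m where "m = norm a"
  have m: "0 \<le> m" "m < 1"
    using z r by (auto simp: a_def m_def norm_scaled_less_1_iff)
  let ?H = "\<lambda>\<tau>. - ln (norm (of_real (exp (- \<tau>)) - of_real (exp \<tau>) * (a * cnj a)))"
  have aa: "a * cnj a = of_real (m\<^sup>2)"
    unfolding m_def by (rule complex_norm_square[symmetric])
  have diff: "norm (of_real (exp (- t)) - of_real (exp t) * (a * cnj a)) = \<bar>exp (- t) - exp t * m\<^sup>2\<bar>" for t :: real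
    unfolding aa by (metis norm_of_real of_real_diff of_real_mult)
  have pos: "0 < exp (- t) - exp t * m\<^sup>2" if "m < exp (- t)" for t
  proof -
    have "m * m < exp (- t) * exp (- t)"
      using that m by (intro mult_strict_mono') auto
    then have "exp t * (m * m) < exp t * (exp (- t) * exp (- t))"
      by (intro mult_strict_left_mono) auto
    also have "\<dots> = exp (- t)"
      by (simp flip: exp_add)
    finally show ?thesis
      by (simp add: power2_eq_square)
  qed
  have meas: "green_kernel_density a a \<in> borel_measurable borel"
    unfolding green_kernel_density_def by measurable
  have ge: "ennreal (?H T - ?H 0) \<le> disc_green c r z z" if T: "T > 0" "m < exp (- T)" for T
  proof -
    have lt: "norm a < exp (- t)" if "t \<le> T" for t
      using T that by (auto simp: m_def intro: less_le_trans)
    have "ennreal (?H T - ?H 0) = (\<integral>\<^sup>+\<tau>. ennreal (green_kernel_density a a \<tau>) * indicator {0..T} \<tau> \<partial>lborel)"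
    proof (rule nn_integral_FTC_Icc[OF meas, symmetric])
      fix t assume t: "t \<in> {0..T}" 
      show "(?H has_real_derivative green_kernel_density a a t) (at t)"
      proof (rule green_kernel_density_antiderivative)
        have "norm (of_real (exp (- t)) - of_real (exp t) * (a * cnj a)) \<noteq> 0"
          using pos[of t] lt[of t] t unfolding diff m_def by auto
        then show "of_real (exp (- t)) - of_real (exp t) * (a * cnj a) \<noteq> 0"
          by (metis norm_zero)
      qed
      show "0 \<le> green_kernel_density a a t"
        using t lt by (intro green_kernel_density_nonneg) auto
    qed (use T in auto)
    also have "\<dots> \<le> (\<integral>\<^sup>+\<tau>. (if 0 < \<tau> \<and> norm a < exp (- \<tau>) \<and> norm a < exp (- \<tau>)
     then ennreal (green_kernel_density a a \<tau>) else 0) \<partial>lborel)"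
      by (rule nn_integral_mono_AE) (use AE_lborel_singleton[of 0] lt in \<open>auto elim!: eventually_mono simp: indicator_def\<close>)
    also have "\<dots> = disc_green c r z z"
      unfolding a_def by (rule disc_green_eq_integral[OF r, symmetric])
    finally show ?thesis .
  qed
  have "ennreal x \<le> disc_green c r z z" for x
  proof -
    define K where "K = x + ?H 0"
    \<comment> \<open>The circle stops at radius \<open>s = m + d\<close>: half of
      \<open>1 - m\<close> keeps it below 1, and \<open>exp (- K) / 2\<close> makes
      \<open>(s - m) * ((s + m) / s) \<le> exp (- K)\<close>, as
      \<open>(s + m) / s \<le> 2\<close>.\<close>
    define d where "d = min ((1 - m) / 2) (exp (- K) / 2)"
    define s where "s = m + d"
    have "0 < d"
      using m by (simp add: d_def)
    moreover have "d \<le> (1 - m) / 2"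
      unfolding d_def by (rule min.cobounded1)
    moreover have "d \<le> exp (- K) / 2"
      unfolding d_def by (rule min.cobounded2)
    ultimately have s: "m < s" "s < 1" "s - m \<le> exp (- K) / 2" "0 < s"
      using m by (auto simp: s_def)
    define T where "T = - ln s"
    have T: "T > 0" "exp (- T) = s" "exp T = 1 / s"
      using s by (simp_all add: T_def exp_minus inverse_eq_divide)
    have "exp (- T) - exp T * m\<^sup>2 = (s - m) * ((s + m) / s)"
      using s by (simp add: T field_simps power2_eq_square)
    also have "\<dots> \<le> exp (- K) / 2 * 2"
      using s m by (intro mult_mono) (auto simp: field_simps)
    also have "\<dots> = exp (- K)"
      by simp
    finally have "ln (exp (- T) - exp T * m\<^sup>2) \<le> ln (exp (- K))"
      using pos[of T] s T by (intro ln_mono) auto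
    then have "K \<le> ?H T"
      using pos[of T] s T unfolding diff by simp
    then have "ennreal x \<le> ennreal (?H T - ?H 0)"
      by (intro ennreal_leI) (simp add: K_def)
    also have "\<dots> \<le> disc_green c r z z"
      using T s by (intro ge) auto
    finally show ?thesis .
  qed
  then show ?thesis
    by (rule ennreal_eq_topI)
qed

lemma ln_le_of_le_exp: "0 < x \<Longrightarrow> x \<le> exp M \<Longrightarrow> ln x \<le> (M::real)"
  by (metis exp_gt_zero ln_exp ln_le_cancel_iff)

section \<open>Sweeping\<close>

text \<open>\<open>poisson_modification\<close> for \<open>ennreal\<close>-valued functions: kernels
  infinite on the diagonal can be swept, and monotone limits and exchanges of integrals carry no
  integrability conditions.\<close>

definition sweep :: "complex \<Rightarrow> real \<Rightarrow> (complex \<Rightarrow> ennreal) \<Rightarrow> complex \<Rightarrow> ennreal" where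
  "sweep c r u z =
     (if dist c z < r then \<integral>\<^sup>+\<xi>. ennreal (poisson ((z - c) / of_real r) \<xi>) * u (c + of_real r * \<xi>) \<partial>circle_measure else u z)"

text \<open>Meaningful for \<open>norm (z - w) \<le> exp M\<close> only: elsewhere \<open>ennreal\<close> truncates the kernel to \<open>0\<close>.\<close>

definition shifted_log :: "real \<Rightarrow> complex \<Rightarrow> complex \<Rightarrow> ennreal" where
  "shifted_log M z w = (if z = w then \<infinity> else ennreal (M - ln (norm (z - w))))"

lemma shifted_log_commute: "shifted_log M z w = shifted_log M w z"
  by (auto simp: shifted_log_def norm_minus_commute)

lemma measurable_shifted_log [measurable]:
  "(\<lambda>(z, w). shifted_log M z w) \<in> borel_measurable (borel \<Otimes>\<^sub>M borel)"
  unfolding shifted_log_def by measurable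

lemma measurable_sweep [measurable (raw)]:
  assumes [measurable]: "(\<lambda>(z, x). k z x) \<in> borel_measurable (borel \<Otimes>\<^sub>M N)"
  shows "(\<lambda>(z, x). sweep c r (\<lambda>z'. k z' x) z) \<in> borel_measurable (borel \<Otimes>\<^sub>M N)"
  unfolding sweep_def by measurable

lemma measurable_sweep1 [measurable (raw)]:
  assumes [measurable]: "u \<in> borel_measurable borel"
  shows "sweep c r u \<in> borel_measurable borel"
  unfolding sweep_def[abs_def] by measurable

lemma sweep_mono:
  assumes "\<And>x. dist c x = r \<Longrightarrow> u x \<le> v x" "dist c z \<ge> r \<Longrightarrow> u z \<le> v z" "0 \<le> r"
  shows "sweep c r u z \<le> sweep c r v z"
proof (cases "dist c z < r")
  case True
  have "(\<integral>\<^sup>+\<xi>. ennreal (poisson ((z - c) / of_real r) \<xi>) * u (c + of_real r * \<xi>) \<partial>circle_measure)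
      \<le> (\<integral>\<^sup>+\<xi>. ennreal (poisson ((z - c) / of_real r) \<xi>) * v (c + of_real r * \<xi>) \<partial>circle_measure)"
    by (rule nn_integral_mono_AE)
      (use assms AE_circle_measure in \<open>auto elim!: eventually_mono intro!: mult_left_mono simp: dist_norm norm_mult\<close>)
  then show ?thesis
    using True by (simp add: sweep_def)
qed (use assms in \<open>simp add: sweep_def\<close>)

lemma sweep_cong:
  assumes "\<And>x. dist c x = r \<Longrightarrow> u x = v x" "dist c z \<ge> r \<Longrightarrow> u z = v z" "0 \<le> r"
  shows "sweep c r u z = sweep c r v z"
  by (intro antisym sweep_mono) (use assms in auto)

text \<open>Sweeping reads values only on the circle and outside it, where it changes
  nothing.\<close>

lemma sweep_idem: "0 \<le> r \<Longrightarrow> sweep c r (sweep c r u) z = sweep c r u z"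
  by (rule sweep_cong) (auto simp: sweep_def)

lemma sweep_add:
  assumes [measurable]: "u \<in> borel_measurable borel" "v \<in> borel_measurable borel"
  shows "sweep c r (\<lambda>x. u x + v x) z = sweep c r u z + sweep c r v z"
  unfolding sweep_def by (simp add: distrib_left nn_integral_add)

lemma sweep_SUP:
  fixes u :: "nat \<Rightarrow> complex \<Rightarrow> ennreal"
  assumes [measurable]: "\<And>n. u n \<in> borel_measurable borel" and "incseq u"
  shows "sweep c r (\<lambda>x. SUP n. u n x) z = (SUP n. sweep c r (u n) z)"
proof (cases "dist c z < r")
  case True
  have "(\<integral>\<^sup>+\<xi>. (SUP n. ennreal (poisson ((z - c) / of_real r) \<xi>) * u n (c + of_real r * \<xi>)) \<partial>circle_measure)
      = (SUP n. \<integral>\<^sup>+\<xi>. ennreal (poisson ((z - c) / of_real r) \<xi>) * u n (c + of_real r * \<xi>) \<partial>circle_measure)"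
    by (rule nn_integral_monotone_convergence_SUP)
      (use assms(2) in \<open>auto simp: incseq_def le_fun_def intro!: mult_left_mono\<close>)
  then show ?thesis
    using True by (simp add: sweep_def SUP_mult_left_ennreal)
qed (simp add: sweep_def)

lemma sweep_commute:
  assumes [measurable]: "(\<lambda>(x, y). k x y) \<in> borel_measurable (borel \<Otimes>\<^sub>M borel)"
  shows "sweep c r (\<lambda>x. sweep d s (\<lambda>y. k x y) w) z = sweep d s (\<lambda>y. sweep c r (\<lambda>x. k x y) z) w"
proof (cases "dist c z < r \<and> dist d w < s")
  case True
  interpret pair_sigma_finite circle_measure circle_measure ..
  let ?p = "\<lambda>\<xi>. ennreal (poisson ((z - c) / of_real r) \<xi>)"
  let ?q = "\<lambda>\<eta>. ennreal (poisson ((w - d) / of_real s) \<eta>)"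
  let ?k = "\<lambda>\<xi> \<eta>. k (c + of_real r * \<xi>) (d + of_real s * \<eta>)"
  have "(\<integral>\<^sup>+\<xi>. ?p \<xi> * (\<integral>\<^sup>+\<eta>. ?q \<eta> * ?k \<xi> \<eta> \<partial>circle_measure) \<partial>circle_measure) =
      (\<integral>\<^sup>+\<xi>. \<integral>\<^sup>+\<eta>. ?p \<xi> * (?q \<eta> * ?k \<xi> \<eta>) \<partial>circle_measure \<partial>circle_measure)"
    by (subst nn_integral_cmult) auto
  also have "\<dots> = (\<integral>\<^sup>+\<eta>. \<integral>\<^sup>+\<xi>. ?p \<xi> * (?q \<eta> * ?k \<xi> \<eta>) \<partial>circle_measure \<partial>circle_measure)"
    by (rule Fubini'[symmetric]) measurable
  also have "\<dots> = (\<integral>\<^sup>+\<eta>. ?q \<eta> * (\<integral>\<^sup>+\<xi>. ?p \<xi> * ?k \<xi> \<eta> \<partial>circle_measure) \<partial>circle_measure)"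
    by (subst nn_integral_cmult[symmetric]) (auto simp: ac_simps)
  finally show ?thesis
    using True by (simp add: sweep_def)
qed (auto simp: sweep_def)

section \<open>Poisson integrals of the logarithmic kernel\<close>

lemma norm_one_minus_mult_cnj:
  "(norm (1 - a * cnj b))\<^sup>2 - (norm (a - b))\<^sup>2 = (1 - (norm a)\<^sup>2) * (1 - (norm b)\<^sup>2)"
  unfolding cmod_power2 by (simp add: power2_eq_square algebra_simps)

lemma norm_diff_on_circle:
  assumes "norm \<xi> = 1"
  shows "norm (\<xi> - b) = norm (1 - \<xi> * cnj b)"
proof -
  have "(norm (1 - \<xi> * cnj b))\<^sup>2 = (norm (\<xi> - b))\<^sup>2"
    using norm_one_minus_mult_cnj[of \<xi> b] assms by simp
  then show ?thesis
    by (metis norm_ge_zero power2_eq_imp_eq)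
qed

text \<open>With the pole outside the closed disc, \<open>ln (norm (\<xi> - b))\<close> is harmonic
  up to the circle and is reproduced. The bound on \<open>M\<close> keeps the integrand nonnegative,
  so that \<open>ennreal\<close> does not truncate it.\<close>

lemma poisson_log_outside:
  assumes a: "norm a < 1" and b: "norm b > 1" and M: "\<And>\<xi>. norm \<xi> = 1 \<Longrightarrow> norm (\<xi> - b) \<le> exp M"
  shows "(\<integral>\<^sup>+\<xi>. ennreal (poisson a \<xi>) * ennreal (M - ln (norm (\<xi> - b))) \<partial>circle_measure) = ennreal (M - ln (norm (a - b)))"
proof -
  have b0: "b \<noteq> 0"
    using b by auto
  let ?F = "\<lambda>\<xi>. of_real (M - ln (norm b)) - Ln (1 - \<xi> / b)"
  have pos: "0 < Re (1 - \<xi> / b)" if "norm \<xi> < norm b" for \<xi>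
  proof -
    have "norm (\<xi> / b) < 1"
      using that b0 by (simp add: norm_divide)
    then show ?thesis
      using abs_Re_le_cmod[of "\<xi> / b"] by simp
  qed
  have Re: "M - ln (norm (\<xi> - b)) = Re (?F \<xi>)" if "norm \<xi> < norm b" for \<xi>
  proof -
    have nz: "1 - \<xi> / b \<noteq> 0"
      using pos[OF that] by auto
    have "norm (\<xi> - b) = norm b * norm (1 - \<xi> / b)"
      using b0 by (simp add: norm_mult[symmetric] right_diff_distrib norm_minus_commute)
    then show ?thesis
      using nz b0 by (simp add: Re_Ln ln_mult)
  qed
  have "(\<integral>\<^sup>+\<xi>. ennreal (poisson a \<xi>) * ennreal (M - ln (norm (\<xi> - b))) \<partial>circle_measure) = ennreal (Re (?F a))"
  proof (rule nn_integral_poisson_mult[where S="ball 0 (norm b)"])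
    show "?F holomorphic_on ball 0 (norm b)"
      using b0 pos by (intro holomorphic_intros) (auto simp: complex_nonpos_Reals_iff dest!: pos)
    fix \<xi> :: complex assume n: "norm \<xi> = 1"
    then show "M - ln (norm (\<xi> - b)) = Re (?F \<xi>)"
      using Re b by simp
    have "ln (norm (\<xi> - b)) \<le> M"
      using M[OF n] n b by (intro ln_le_of_le_exp) auto
    then show "0 \<le> M - ln (norm (\<xi> - b))"
      by simp
  qed (use a b in \<open>auto simp: cball_subset_ball_iff\<close>)
  also have "Re (?F a) = M - ln (norm (a - b))"
    using Re[of a] a b by simp
  finally show ?thesis .
qed

text \<open>With the pole inside, \<open>norm (\<xi> - b)\<close> equals
  \<open>norm (1 - \<xi> * cnj b)\<close> on the circle, and the logarithm of the latter is harmonic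
  on the closed disc: the pole has been reflected out of it.\<close>

lemma poisson_log_inside:
  assumes a: "norm a < 1" and b: "norm b < 1" and M: "\<And>\<xi>. norm \<xi> = 1 \<Longrightarrow> norm (\<xi> - b) \<le> exp M"
  shows "(\<integral>\<^sup>+\<xi>. ennreal (poisson a \<xi>) * ennreal (M - ln (norm (\<xi> - b))) \<partial>circle_measure) = ennreal (M - ln (norm (1 - a * cnj b)))"
proof -
  let ?F = "\<lambda>\<xi>. of_real M - Ln (1 - \<xi> * cnj b)"
  let ?S = "{\<xi>. 0 < Re (1 - \<xi> * cnj b)}"
  have pos: "0 < Re (1 - \<xi> * cnj b)" if "norm \<xi> \<le> 1" for \<xi>
  proof -
    have "norm (\<xi> * cnj b) \<le> 1 * norm b"
      unfolding norm_mult using that by (intro mult_mono) auto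
    then show ?thesis
      using abs_Re_le_cmod[of "\<xi> * cnj b"] b by simp
  qed
  have "(\<integral>\<^sup>+\<xi>. ennreal (poisson a \<xi>) * ennreal (M - ln (norm (\<xi> - b))) \<partial>circle_measure) = ennreal (Re (?F a))"
  proof (rule nn_integral_poisson_mult[where S="?S"])
    show "open ?S"
      by (intro open_Collect_less continuous_intros)
    show "?F holomorphic_on ?S"
      by (intro holomorphic_intros) (auto simp: complex_nonpos_Reals_iff)
    show "cball 0 1 \<subseteq> ?S"
      using pos by auto
    fix \<xi> :: complex assume n: "norm \<xi> = 1"
    have "1 - \<xi> * cnj b \<noteq> 0"
      using pos[of \<xi>] n by (metis less_irrefl order_refl zero_complex.sel(1))
    then show "M - ln (norm (\<xi> - b)) = Re (?F \<xi>)"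
      by (simp add: norm_diff_on_circle[OF n] Re_Ln)
    have "ln (norm (\<xi> - b)) \<le> M"
      using M[OF n] n b by (intro ln_le_of_le_exp) auto
    then show "0 \<le> M - ln (norm (\<xi> - b))"
      by simp
  qed (use a in auto)
  moreover have "1 - a * cnj b \<noteq> 0"
    using pos[of a] a by (metis less_eq_real_def less_irrefl zero_complex.sel(1))
  ultimately show ?thesis
    by (simp add: Re_Ln)
qed

text \<open>For \<open>b\<close> on the circle approach it radially from outside: the kernels increase.\<close>

lemma poisson_log_boundary:
  assumes a: "norm a < 1" and b: "norm b = 1" and M: "3 \<le> exp M"
  shows "(\<integral>\<^sup>+\<xi>. ennreal (poisson a \<xi>) * shifted_log M \<xi> b \<partial>circle_measure) = ennreal (M - ln (norm (a - b)))"
proof -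
  \<comment> \<open>Radii between 1 and 2, so that
    \<open>norm (\<xi> - B k) \<le> 3 \<le> exp M\<close> for all \<open>k\<close>.\<close>
  define s where "s k = 1 + 1 / real (Suc k)" for k
  define B where "B k = of_real (s k) * b" for k
  have s: "1 < s k" "s k \<le> 2" "s (Suc k) \<le> s k" for k
    by (auto simp: s_def field_simps)
  have s_lim: "s \<longlonglongrightarrow> 1"
    unfolding s_def[abs_def] using tendsto_add[OF tendsto_const[of 1] LIMSEQ_inverse_real_of_nat] by (simp add: inverse_eq_divide)
  then have B_lim: "B \<longlonglongrightarrow> b"
    unfolding B_def[abs_def] using tendsto_mult[OF tendsto_of_real[OF s_lim] tendsto_const[of b]] by simp
  have nB: "norm (B k) > 1" "norm (B k) \<le> 2" for k
    using s[of k] b by (auto simp: B_def norm_mult)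
  \<comment> \<open>After rotation by \<open>cnj b\<close> the pole moves along the real axis
    towards 1 from the right, while the rotated \<open>\<xi>\<close> has real part at most
    1.\<close>
  have dec: "norm (\<xi> - B (Suc k)) \<le> norm (\<xi> - B k)" if "norm \<xi> = 1" for \<xi> k
  proof -
    define q where "q = \<xi> * cnj b"
    have "Re q \<le> 1"
      using complex_Re_le_cmod[of q] that b by (simp add: q_def norm_mult)
    have bb: "b * cnj b = 1"
      using complex_norm_square[of b] b by simp
    have eq: "(norm (\<xi> - of_real t * b))\<^sup>2 = (t - Re q)\<^sup>2 + (Im q)\<^sup>2" for t
    proof -
      have "norm (\<xi> - of_real t * b) = norm ((\<xi> - of_real t * b) * cnj b)"
        using b by (simp add: norm_mult)
      also have "(\<xi> - of_real t * b) * cnj b = q - of_real t"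
        using bb by (simp add: q_def algebra_simps)
      finally show ?thesis
        by (simp add: cmod_power2 power2_commute)
    qed
    have "(s (Suc k) - Re q)\<^sup>2 \<le> (s k - Re q)\<^sup>2"
      using s[of "Suc k"] s[of k] \<open>Re q \<le> 1\<close> by (intro power_mono) auto
    then have "(norm (\<xi> - B (Suc k)))\<^sup>2 \<le> (norm (\<xi> - B k))\<^sup>2"
      by (simp add: B_def eq)
    then show ?thesis
      by (rule power2_le_imp_le) simp
  qed
  have nz: "\<xi> \<noteq> B k" if "norm \<xi> \<le> 1" for \<xi> k
    using that nB(1)[of k] by auto
  have inc: "ennreal (M - ln (norm (\<xi> - B k))) \<le> ennreal (M - ln (norm (\<xi> - B (Suc k))))" if "norm \<xi> = 1" for \<xi> k
    using dec[OF that] nz that by (intro ennreal_leI) (auto intro!: ln_mono)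
  have sup: "(SUP k. ennreal (M - ln (norm (\<xi> - B k)))) = shifted_log M \<xi> b" if n: "norm \<xi> = 1" for \<xi>
  proof (cases "\<xi> = b")
    case True
    have "ennreal x \<le> (SUP k. ennreal (M - ln (norm (\<xi> - B k))))" for x
    proof -
      obtain k where k: "exp (x - M) < real k"
        using reals_Archimedean2 by blast
      have "norm (\<xi> - B k) = 1 / real (Suc k)"
      proof -
        have "\<xi> - B k = - (of_real (1 / real (Suc k)) * b)"
          using True by (simp add: B_def s_def ring_distribs)
        then show ?thesis
          using b by (simp only: norm_minus_cancel norm_mult norm_of_real) simp
      qed
      moreover have "ln (1 / real (Suc k)) \<le> ln (exp (M - x))"
      proof (rule ln_mono)
        have "1 / real (Suc k) \<le> 1 / exp (x - M)"
          using k by (intro divide_left_mono) auto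
        then show "1 / real (Suc k) \<le> exp (M - x)"
          by (simp add: exp_diff)
      qed auto
      ultimately have "x \<le> M - ln (norm (\<xi> - B k))"
        by simp
      then show ?thesis
        by (intro SUP_upper2[of k] ennreal_leI) auto
    qed
    then have "(SUP k. ennreal (M - ln (norm (\<xi> - B k)))) = \<infinity>"
      by (rule ennreal_eq_topI)
    then show ?thesis
      using True by (simp add: shifted_log_def)
  next
    case False
    have "(\<lambda>k. ennreal (M - ln (norm (\<xi> - B k)))) \<longlonglongrightarrow> ennreal (M - ln (norm (\<xi> - b)))"
      using False by (intro tendsto_intros tendsto_ennrealI B_lim) auto
    moreover have "(\<lambda>k. ennreal (M - ln (norm (\<xi> - B k)))) \<longlonglongrightarrow> (SUP k. ennreal (M - ln (norm (\<xi> - B k))))"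
      by (intro LIMSEQ_SUP incseq_SucI inc n)
    ultimately show ?thesis
      using False LIMSEQ_unique by (auto simp: shifted_log_def)
  qed
  have val: "(\<integral>\<^sup>+\<xi>. ennreal (poisson a \<xi>) * ennreal (M - ln (norm (\<xi> - B k))) \<partial>circle_measure) = ennreal (M - ln (norm (a - B k)))" for k
  proof (rule poisson_log_outside[OF a nB(1)])
    fix \<xi> :: complex assume "norm \<xi> = 1"
    then show "norm (\<xi> - B k) \<le> exp M"
      using norm_triangle_ineq4[of \<xi> "B k"] nB(2)[of k] M by linarith
  qed
  have "(\<integral>\<^sup>+\<xi>. ennreal (poisson a \<xi>) * shifted_log M \<xi> b \<partial>circle_measure)
      = (\<integral>\<^sup>+\<xi>. (SUP k. ennreal (poisson a \<xi>) * ennreal (M - ln (norm (\<xi> - B k)))) \<partial>circle_measure)"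
    by (rule nn_integral_cong_AE) (use AE_circle_measure sup in \<open>auto elim!: eventually_mono simp: SUP_mult_left_ennreal[symmetric]\<close>)
  also have "\<dots> = (SUP k. \<integral>\<^sup>+\<xi>. ennreal (poisson a \<xi>) * ennreal (M - ln (norm (\<xi> - B k))) \<partial>circle_measure)"
    by (rule nn_integral_monotone_convergence_SUP_AE)
      (use AE_circle_measure inc in \<open>auto elim!: eventually_mono intro!: mult_left_mono\<close>)
  also have "\<dots> = (SUP k. ennreal (M - ln (norm (a - B k))))"
    by (simp only: val)
  also have "\<dots> = ennreal (M - ln (norm (a - b)))"
  proof (rule LIMSEQ_unique[OF LIMSEQ_SUP])
    have "incseq (\<lambda>k. \<integral>\<^sup>+\<xi>. ennreal (poisson a \<xi>) * ennreal (M - ln (norm (\<xi> - B k))) \<partial>circle_measure)"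
      by (intro incseq_SucI nn_integral_mono_AE)
        (use AE_circle_measure inc in \<open>auto elim!: eventually_mono intro!: mult_left_mono\<close>)
    then show "incseq (\<lambda>k. ennreal (M - ln (norm (a - B k))))"
      by (simp only: val)
    show "(\<lambda>k. ennreal (M - ln (norm (a - B k)))) \<longlonglongrightarrow> ennreal (M - ln (norm (a - b)))"
      using a b by (intro tendsto_intros tendsto_ennrealI B_lim) auto
  qed
  finally show ?thesis .
qed

text \<open>Riesz decomposition of the logarithmic kernel in a disc: Green function plus harmonic
  part with the same boundary values. The bounds on \<open>exp M\<close> keep the shifted kernel
  nonnegative; \<open>3 * r\<close> serves the poles on the circle, through
  \<open>poisson_log_boundary\<close>.\<close>

lemma disc_green_add_sweep:
  assumes r: "r > 0" and M: "3 * r \<le> exp M" "\<And>x. dist c x \<le> r \<Longrightarrow> norm (x - w) \<le> exp M"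
  shows "disc_green c r z w + sweep c r (\<lambda>x. shifted_log M x w) z = shifted_log M z w"
proof (cases "dist c z < r")
  case z: True
  define a where "a = (z - c) / complex_of_real r"
  define b where "b = (w - c) / complex_of_real r"
  \<comment> \<open>Rescaling to the unit disc changes the logarithm by \<open>ln r\<close>, which
    is absorbed into the shift.\<close>
  define M' where "M' = M - ln r"
  have a: "norm a < 1"
    using z r by (simp add: a_def norm_scaled_less_1_iff)
  have w_eq: "w = c + of_real r * b" and z_eq: "z = c + of_real r * a"
    using r by (simp_all add: a_def b_def)
  have expM': "exp M' = exp M / r"
    using r by (simp add: M'_def exp_diff)
  have scale: "shifted_log M (c + of_real r * \<xi>) w = shifted_log M' \<xi> b" for \<xi>
  proof -
    have d: "c + of_real r * \<xi> - w = of_real r * (\<xi> - b)"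
      by (simp add: w_eq algebra_simps)
    have "c + of_real r * \<xi> = w \<longleftrightarrow> \<xi> = b"
      using r by (simp add: w_eq)
    moreover have "ln (norm (c + of_real r * \<xi> - w)) = ln r + ln (norm (\<xi> - b))" if "\<xi> \<noteq> b"
      unfolding d norm_mult using r that by (simp add: ln_mult)
    ultimately show ?thesis
      by (auto simp: shifted_log_def M'_def diff_diff_eq)
  qed
  have bound: "norm (\<xi> - b) \<le> exp M'" if "norm \<xi> \<le> 1" for \<xi>
  proof -
    have "norm (c + of_real r * \<xi> - w) \<le> exp M"
      using that r by (intro M) (simp add: dist_norm norm_mult)
    moreover have "norm (c + of_real r * \<xi> - w) = r * norm (\<xi> - b)"
    proof -
      have "c + of_real r * \<xi> - w = of_real r * (\<xi> - b)"
        by (simp add: w_eq algebra_simps)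
      then show ?thesis
        using r by (simp only: norm_mult norm_of_real abs_of_pos)
    qed
    ultimately show ?thesis
      unfolding expM' using r by (simp add: field_simps)
  qed
  have three: "3 \<le> exp M'"
    unfolding expM' using M(1) r by (simp add: field_simps)
  have sw: "sweep c r (\<lambda>x. shifted_log M x w) z = (\<integral>\<^sup>+\<xi>. ennreal (poisson a \<xi>) * shifted_log M' \<xi> b \<partial>circle_measure)"
    using z by (simp add: sweep_def a_def scale)
  have rhs: "shifted_log M z w = shifted_log M' a b"
    unfolding z_eq by (rule scale)
  have drop: "(\<integral>\<^sup>+\<xi>. ennreal (poisson a \<xi>) * shifted_log M' \<xi> b \<partial>circle_measure)
      = (\<integral>\<^sup>+\<xi>. ennreal (poisson a \<xi>) * ennreal (M' - ln (norm (\<xi> - b))) \<partial>circle_measure)" if "norm b \<noteq> 1"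
    by (rule nn_integral_cong_AE, use AE_circle_measure in eventually_elim) (use that in \<open>auto simp: shifted_log_def\<close>)
  have iff: "norm b < 1 \<longleftrightarrow> dist c w < r"
    using r by (simp add: b_def norm_scaled_less_1_iff)
  consider "norm b > 1" | "norm b = 1" | "norm b < 1"
    by linarith
  then show ?thesis
  proof cases
    case 1
    then have "disc_green c r z w = 0" "a \<noteq> b"
      using disc_green_outside[OF r, of c z w] iff a by auto
    then show ?thesis
      using poisson_log_outside[OF a 1 bound] 1 by (simp add: sw rhs drop) (simp add: shifted_log_def)
  next
    case 2
    then have "disc_green c r z w = 0" "a \<noteq> b"
      using disc_green_outside[OF r, of c z w] iff a by auto
    then show ?thesis
      using poisson_log_boundary[OF a 2 three] by (simp add: sw rhs) (simp add: shifted_log_def)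
  next
    case 3
    then have w: "dist c w < r"
      using iff by simp
    show ?thesis
    proof (cases "z = w")
      case True
      then show ?thesis
        using disc_green_diagonal[OF r z] by (simp add: shifted_log_def)
    next
      case False
      then have ab: "a \<noteq> b"
        by (auto simp: w_eq z_eq)
      have nab: "norm (a * cnj b) < 1"
        unfolding norm_mult using a 3 by (simp add: mult_strict_mono' [of "norm a" 1 "norm b" 1, simplified])
      have nz: "1 - a * cnj b \<noteq> 0"
        using nab by auto
      have "0 \<le> (norm (1 - a * cnj b))\<^sup>2 - (norm (a - b))\<^sup>2"
        unfolding norm_one_minus_mult_cnj using a 3 by (intro mult_nonneg_nonneg) (auto simp: power_le_one)
      then have le: "norm (a - b) \<le> norm (1 - a * cnj b)"
        by (intro power2_le_imp_le[OF _ norm_ge_zero]) linarith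
      then have 1: "0 \<le> ln (norm (1 - a * cnj b)) - ln (norm (a - b))"
        using ab nz by (simp add: ln_mono)
      have "norm (1 - a * cnj b) \<le> exp M'"
        using norm_triangle_ineq4[of 1 "a * cnj b"] nab three by simp
      then have 2: "0 \<le> M' - ln (norm (1 - a * cnj b))"
        using nz ln_mono[of "norm (1 - a * cnj b)" "exp M'"] by simp
      have "disc_green c r z w = ennreal (ln (norm (1 - a * cnj b)) - ln (norm (a - b)))"
        unfolding a_def b_def by (rule disc_green_eq[OF r z w False])
      moreover have "sweep c r (\<lambda>x. shifted_log M x w) z = ennreal (M' - ln (norm (1 - a * cnj b)))"
        using poisson_log_inside[OF a 3 bound] 3 by (simp add: sw drop)
      ultimately show ?thesis
        using 1 2 ab by (simp add: rhs shifted_log_def[of M' a b] ennreal_plus[symmetric] del: ennreal_plus)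
    qed
  qed
next
  case False
  then have "disc_green c r z w = 0"
    using disc_green_outside[OF r] by simp
  with False show ?thesis
    by (simp add: sweep_def)
qed

text \<open>Off the diagonal both sides are what remains of the symmetric logarithmic kernel after
  removing the symmetric and finite \<open>disc_green\<close>.\<close>

lemma sweep_shifted_log_commute:
  assumes r: "r > 0" and M: "3 * r \<le> exp M" "\<And>x. dist c x \<le> r \<Longrightarrow> norm (x - w) \<le> exp M"
    "\<And>x. dist c x \<le> r \<Longrightarrow> norm (x - z) \<le> exp M"
  shows "sweep c r (\<lambda>y. shifted_log M z y) w = sweep c r (\<lambda>x. shifted_log M x w) z"
proof (cases "z = w")
  case True
  then show ?thesis
    using shifted_log_commute[of M w] by presburger
next
  case False
  have 1: "disc_green c r z w + sweep c r (\<lambda>x. shifted_log M x w) z = shifted_log M z w"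
    by (rule disc_green_add_sweep[OF r M(1,2)])
  have 2: "disc_green c r z w + sweep c r (\<lambda>y. shifted_log M z y) w = shifted_log M z w"
    using disc_green_add_sweep[where c=c and z=w and w=z, OF r M(1,3)]
    by (simp add: disc_green_commute[of c r w] shifted_log_commute[of M z])
  have "shifted_log M z w < \<infinity>"
    using False by (simp add: shifted_log_def)
  then have "disc_green c r z w < \<infinity>"
    unfolding 1[symmetric] by (rule le_less_trans[rotated]) simp
  moreover have "disc_green c r z w + sweep c r (\<lambda>y. shifted_log M z y) w = disc_green c r z w + sweep c r (\<lambda>x. shifted_log M x w) z"
    using 1 2 by simp
  ultimately show ?thesis
    unfolding ennreal_add_left_cancel by (metis less_irrefl)
qed

text \<open>The first disc of the list is swept last. On a large disc the complement of \<open>swept_kernel l\<close> with respect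
  to the logarithmic kernel is \<open>sweeps l\<close> of that kernel; \<open>modifications\<close> is the real-valued version.\<close>

fun swept_kernel :: "(complex \<times> real) list \<Rightarrow> complex \<Rightarrow> complex \<Rightarrow> ennreal" where
  "swept_kernel [] z w = 0"
| "swept_kernel ((c, r) # l) z w = disc_green c r z w + sweep c r (\<lambda>x. sweep c r (\<lambda>y. swept_kernel l x y) w) z"

fun sweeps :: "(complex \<times> real) list \<Rightarrow> (complex \<Rightarrow> ennreal) \<Rightarrow> complex \<Rightarrow> ennreal" where
  "sweeps [] u = u"
| "sweeps ((c, r) # l) u = sweep c r (sweeps l (sweep c r u))"

fun modifications :: "(complex \<times> real) list \<Rightarrow> (complex \<Rightarrow> real) \<Rightarrow> complex \<Rightarrow> real" where
  "modifications [] u = u"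
| "modifications ((c, r) # l) u = poisson_modification c r (modifications l (poisson_modification c r u))"

text \<open>With all points and discs in the ball of radius \<open>R\<close>, distances are below
  \<open>2 * R\<close>, so the shift \<open>ln (3 * R)\<close> keeps the logarithmic kernel
  nonnegative throughout.\<close>

definition discs_within :: "(complex \<times> real) list \<Rightarrow> real \<Rightarrow> bool" where
  "discs_within l R \<longleftrightarrow> (\<forall>(c, r)\<in>set l. 0 < r \<and> norm c + r < R)"

lemma discs_within_simps [simp]:
  "discs_within [] R" "discs_within ((c, r) # l) R \<longleftrightarrow> 0 < r \<and> norm c + r < R \<and> discs_within l R"
  by (auto simp: discs_within_def)

lemma discs_within_exists:
  assumes "\<And>c r. (c, r) \<in> set l \<Longrightarrow> 0 < r"
  shows "\<exists>R>B. discs_within l R"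
  using assms
proof (induction l)
  case Nil
  then show ?case
    by (auto intro: gt_ex)
next
  case (Cons p l)
  obtain c r where p: "p = (c, r)"
    by force
  obtain R where R: "R > B" "discs_within l R"
    using Cons by auto
  have "discs_within l (max R (norm c + r + 1))"
    using R(2) by (force simp: discs_within_def less_max_iff_disj)
  then show ?case
    using Cons.prems R(1) by (intro exI[of _ "max R (norm c + r + 1)"]) (auto simp: p)
qed

lemma sigma_finite_disc_measure: "sigma_finite_measure (lborel \<Otimes>\<^sub>M circle_measure :: (real \<times> complex) measure)"
  by (intro sigma_finite_pair_measure lborel.sigma_finite_measure_axioms circle_measure.sigma_finite_measure_axioms)

lemma measurable_disc_green [measurable]:
  "(\<lambda>(z, w). disc_green c r z w) \<in> borel_measurable (borel \<Otimes>\<^sub>M borel)"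
proof -
  interpret sigma_finite_measure "lborel \<Otimes>\<^sub>M circle_measure :: (real \<times> complex) measure"
    by (rule sigma_finite_disc_measure)
  show ?thesis
    unfolding disc_green_def by measurable
qed

lemma measurable_sweep_sweep:
  assumes [measurable]: "(\<lambda>(x, y). k x y) \<in> borel_measurable (borel \<Otimes>\<^sub>M borel)"
  shows "(\<lambda>(z, w). sweep c r (\<lambda>x. sweep d s (\<lambda>y. k x y) w) z) \<in> borel_measurable (borel \<Otimes>\<^sub>M borel)"
  unfolding sweep_def by measurable

lemma measurable_swept_kernel [measurable]:
  "(\<lambda>(z, w). swept_kernel l z w) \<in> borel_measurable (borel \<Otimes>\<^sub>M borel)"
proof (induction l)
  case (Cons p l)
  obtain c r where p: "p = (c, r)"
    by force
  note [measurable] = measurable_sweep_sweep[OF Cons]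
  show ?case
    unfolding p swept_kernel.simps by measurable
qed simp

lemma measurable_sweeps [measurable (raw)]:
  assumes "(\<lambda>(x, y). k x y) \<in> borel_measurable (borel \<Otimes>\<^sub>M N)"
  shows "(\<lambda>(z, y). sweeps l (\<lambda>x. k x y) z) \<in> borel_measurable (borel \<Otimes>\<^sub>M N)"
  using assms
proof (induction l arbitrary: k)
  case (Cons p l)
  obtain c r where p: "p = (c, r)"
    by force
  show ?case
    unfolding p sweeps.simps
    by (intro measurable_sweep Cons.IH[of "\<lambda>x y. sweep c r (\<lambda>x. k x y) x"] Cons.prems)
qed simp

lemma measurable_sweeps1 [measurable (raw)]:
  "u \<in> borel_measurable borel \<Longrightarrow> sweeps l u \<in> borel_measurable borel"
  by (induction l arbitrary: u) (auto intro!: measurable_sweep1)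

lemma sweeps_cong:
  assumes "discs_within l R" "\<And>x. norm x < R \<Longrightarrow> u x = v x" "norm z < R"
  shows "sweeps l u z = sweeps l v z"
  using assms
proof (induction l arbitrary: u v z)
  case (Cons p l)
  obtain c r where p: "p = (c, r)"
    by force
  have circ: "norm x < R" if "dist c x = r" for x
    using norm_triangle_ineq4[of "c" "c - x"] Cons.prems(1) that by (simp add: p dist_norm)
  have "sweep c r u x = sweep c r v x" if "norm x < R" for x
    by (rule sweep_cong) (use Cons.prems that circ in \<open>auto simp: p\<close>)
  then have "sweeps l (sweep c r u) x = sweeps l (sweep c r v) x" if "norm x < R" for x
    using Cons.prems that by (intro Cons.IH) (auto simp: p)
  then show ?case
    unfolding p sweeps.simps by (intro sweep_cong) (use Cons.prems circ in \<open>auto simp: p\<close>)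
qed simp

lemma incseq_sweep:
  fixes u :: "nat \<Rightarrow> complex \<Rightarrow> ennreal"
  assumes "0 \<le> r" "incseq u"
  shows "incseq (\<lambda>n. sweep c r (u n))"
proof (rule incseq_SucI, rule le_funI)
  fix n x
  show "sweep c r (u n) x \<le> sweep c r (u (Suc n)) x"
    using incseq_SucD[OF assms(2)] by (intro sweep_mono assms(1)) (auto simp: le_fun_def)
qed

lemma sweeps_mono_incseq:
  fixes u :: "nat \<Rightarrow> complex \<Rightarrow> ennreal"
  assumes l: "\<And>c r. (c, r) \<in> set l \<Longrightarrow> 0 < r" and u: "incseq u"
  shows "incseq (\<lambda>n. sweeps l (u n))"
  using assms
proof (induction l arbitrary: u)
  case (Cons p l)
  obtain c r where p: "p = (c, r)"
    by force
  have r: "0 \<le> r"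
    using Cons.prems(1)[of c r] by (simp add: p)
  show ?case
    unfolding p sweeps.simps using Cons.prems by (intro incseq_sweep[OF r] Cons.IH) auto
qed simp

lemma sweeps_SUP:
  fixes u :: "nat \<Rightarrow> complex \<Rightarrow> ennreal"
  assumes l: "\<And>c r. (c, r) \<in> set l \<Longrightarrow> 0 < r" and m: "\<And>n. u n \<in> borel_measurable borel" and u: "incseq u"
  shows "sweeps l (\<lambda>x. SUP n. u n x) z = (SUP n. sweeps l (u n) z)"
  using assms
proof (induction l arbitrary: u z)
  case (Cons p l)
  obtain c r where p: "p = (c, r)"
    by force
  have r: "0 \<le> r"
    using Cons.prems(1)[of c r] by (simp add: p)
  have inc: "incseq (\<lambda>n. sweep c r (u n))"
    by (rule incseq_sweep[OF r Cons.prems(3)])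
  have "sweeps l (sweep c r (\<lambda>x. SUP n. u n x)) = sweeps l (\<lambda>x. SUP n. sweep c r (u n) x)"
    by (intro arg_cong[where f="sweeps l"] ext sweep_SUP Cons.prems)
  also have "\<dots> = (\<lambda>x. SUP n. sweeps l (sweep c r (u n)) x)"
    using Cons.prems inc by (intro ext Cons.IH measurable_sweep1) auto
  finally show ?case
    unfolding p sweeps.simps
    using Cons.prems sweeps_mono_incseq[OF _ inc, of l]
    by (simp only:) (intro sweep_SUP measurable_sweeps1 measurable_sweep1; auto)
qed simp

lemma sweep_sweeps_commute:
  assumes "(\<lambda>(x, y). k x y) \<in> borel_measurable (borel \<Otimes>\<^sub>M borel)"
  shows "sweep c r (\<lambda>y. sweeps l (\<lambda>x. k x y) z) w = sweeps l (\<lambda>x. sweep c r (\<lambda>y. k x y) w) z"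
  using assms
proof (induction l arbitrary: k z)
  case (Cons p l)
  obtain d s where p: "p = (d, s)"
    by force
  define k1 where "k1 x y = sweep d s (\<lambda>x. k x y) x" for x y
  have k1: "(\<lambda>(x, y). k1 x y) \<in> borel_measurable (borel \<Otimes>\<^sub>M borel)"
    unfolding k1_def by (rule measurable_sweep[OF Cons.prems])
  have "sweep c r (\<lambda>y. sweeps (p # l) (\<lambda>x. k x y) z) w = sweep c r (\<lambda>y. sweep d s (\<lambda>x. sweeps l (\<lambda>x. k1 x y) x) z) w"
    unfolding p sweeps.simps k1_def ..
  also have "\<dots> = sweep d s (\<lambda>x. sweep c r (\<lambda>y. sweeps l (\<lambda>x. k1 x y) x) w) z"
    by (rule sweep_commute[symmetric]) (rule measurable_sweeps[OF k1])
  also have "\<dots> = sweep d s (\<lambda>x. sweeps l (\<lambda>x. sweep c r (\<lambda>y. k1 x y) w) x) z"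
    by (simp only: Cons.IH[OF k1])
  also have "(\<lambda>x. sweep c r (\<lambda>y. k1 x y) w) = sweep d s (\<lambda>x. sweep c r (\<lambda>y. k x y) w)"
    unfolding k1_def by (intro ext sweep_commute[symmetric] Cons.prems)
  finally show ?case
    by (simp add: p)
qed simp

lemma swept_kernel_commute: "swept_kernel l z w = swept_kernel l w z"
proof (induction l arbitrary: z w)
  case (Cons p l)
  obtain c r where p: "p = (c, r)"
    by force
  have "sweep c r (\<lambda>x. sweep c r (\<lambda>y. swept_kernel l x y) w) z = sweep c r (\<lambda>y. sweep c r (\<lambda>x. swept_kernel l x y) z) w"
    by (rule sweep_commute) measurable
  also have "\<dots> = sweep c r (\<lambda>y. sweep c r (\<lambda>x. swept_kernel l y x) z) w"
    by (simp only: Cons[of _ _])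
  finally show ?case
    by (simp add: p disc_green_commute[of c r z])
qed simp

text \<open>Sweep the identity for \<open>l\<close> over the new disc in both variables. By symmetry
  of the swept logarithmic kernel, the sweep in the second variable becomes one in the first,
  applied to the argument of \<open>sweeps l\<close>; this is why \<open>sweeps\<close> has two
  sweeps per disc.\<close>

lemma swept_kernel_add_sweeps:
  assumes l: "discs_within l R" and z: "norm z < R" and w: "norm w < R"
  shows "swept_kernel l z w + sweeps l (\<lambda>x. shifted_log (ln (3 * R)) x w) z = shifted_log (ln (3 * R)) z w"
  using assms
proof (induction l arbitrary: z w)
  case (Cons p l)
  define E where "E = shifted_log (ln (3 * R))"
  obtain c r where p: "p = (c, r)"
    by force
  have r: "r > 0" "norm c + r < R" and l: "discs_within l R"
    using Cons.prems by (auto simp: p)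
  have R: "exp (ln (3 * R)) = 3 * R"
    using r norm_ge_zero[of c] by (simp del: norm_ge_zero)
  have circ: "norm x < R" if "dist c x \<le> r" for x
    using norm_triangle_ineq4[of "c" "c - x"] r that by (simp add: dist_norm)
  have M: "3 * r \<le> exp (ln (3 * R))" "\<And>x. dist c x \<le> r \<Longrightarrow> norm (x - y) \<le> exp (ln (3 * R))" if "norm y < R" for y
  proof -
    show "3 * r \<le> exp (ln (3 * R))"
      unfolding R using r norm_ge_zero[of c] by linarith
    show "norm (x - y) \<le> exp (ln (3 * R))" if "dist c x \<le> r" for x
      unfolding R using circ[OF that] \<open>norm y < R\<close> norm_triangle_ineq4[of x y] norm_ge_zero[of y] by linarith
  qed
  have green: "disc_green c r x y + sweep c r (\<lambda>x. E x y) x = E x y" if "norm y < R" for x y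
    unfolding E_def by (rule disc_green_add_sweep[OF r(1) M[OF that]])
  have swap: "sweep c r (\<lambda>y. E x y) y = sweep c r (\<lambda>x. E x y) x" if "norm x < R" "norm y < R" for x y
    unfolding E_def by (rule sweep_shifted_log_commute[OF r(1) M(1)[OF that(2)] M(2)[OF that(2)] M(2)[OF that(1)]])
  have meas [measurable]: "(\<lambda>(x, y). E x y) \<in> borel_measurable (borel \<Otimes>\<^sub>M borel)"
    unfolding E_def by measurable
  note [measurable] = measurable_sweeps[OF meas]
  have IH: "swept_kernel l x y + sweeps l (\<lambda>x. E x y) x = E x y" if "norm x < R" "norm y < R" for x y
    unfolding E_def using Cons.IH l that by blast
  have inner: "sweep c r (\<lambda>y. swept_kernel l x y) w + sweeps l (sweep c r (\<lambda>x. E x w)) x = sweep c r (\<lambda>x. E x w) x"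
    if x: "norm x < R" for x
  proof -
    have "sweep c r (\<lambda>x. E x w) x = sweep c r (\<lambda>y. E x y) w"
      using swap x Cons.prems by simp
    also have "\<dots> = sweep c r (\<lambda>y. swept_kernel l x y + sweeps l (\<lambda>x. E x y) x) w"
      by (rule sweep_cong) (use IH x circ Cons.prems r in auto)
    also have "\<dots> = sweep c r (\<lambda>y. swept_kernel l x y) w + sweep c r (\<lambda>y. sweeps l (\<lambda>x. E x y) x) w"
      by (rule sweep_add) measurable
    also have "sweep c r (\<lambda>y. sweeps l (\<lambda>x. E x y) x) w = sweeps l (\<lambda>x. sweep c r (\<lambda>y. E x y) w) x"
      by (rule sweep_sweeps_commute) measurable
    also have "\<dots> = sweeps l (sweep c r (\<lambda>x. E x w)) x"
      by (rule sweeps_cong[OF l _ x]) (use swap Cons.prems in auto)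
    finally show ?thesis ..
  qed
  have "sweep c r (\<lambda>x. sweep c r (\<lambda>y. swept_kernel l x y) w) z + sweep c r (sweeps l (sweep c r (\<lambda>x. E x w))) z
      = sweep c r (\<lambda>x. sweep c r (\<lambda>y. swept_kernel l x y) w + sweeps l (sweep c r (\<lambda>x. E x w)) x) z"
  proof (rule sweep_add[symmetric])
    have "(\<lambda>(z, w). sweep c r (\<lambda>y. swept_kernel l w y) z) \<in> borel_measurable (borel \<Otimes>\<^sub>M borel)"
      by (rule measurable_sweep) measurable
    note [measurable] = this
    show "(\<lambda>x. sweep c r (\<lambda>y. swept_kernel l x y) w) \<in> borel_measurable borel"
      by measurable
    show "sweeps l (sweep c r (\<lambda>x. E x w)) \<in> borel_measurable borel"
      by (intro measurable_sweeps1 measurable_sweep1) measurable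
  qed
  also have "\<dots> = sweep c r (sweep c r (\<lambda>x. E x w)) z"
    by (rule sweep_cong) (use inner circ Cons.prems r in auto)
  \<comment> \<open>Idempotence leaves a single sweep, which together with \<open>disc_green\<close>
    of the new disc restores \<open>E z w\<close>.\<close>
  also have "\<dots> = sweep c r (\<lambda>x. E x w) z"
    using r by (intro sweep_idem) simp
  finally have "swept_kernel (p # l) z w + sweeps (p # l) (\<lambda>x. E x w) z = disc_green c r z w + sweep c r (\<lambda>x. E x w) z"
    by (simp add: p add.assoc)
  also have "\<dots> = E z w"
    using green Cons.prems by simp
  finally show ?case
    unfolding E_def .
qed simp

section \<open>Real-valued sweeps and truncated logarithms\<close>

lemma sweep_ennreal:
  assumes [measurable]: "u \<in> borel_measurable borel" and C: "\<And>x. dist c x = r \<Longrightarrow> \<bar>u x\<bar> \<le> C"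
    and r: "r > 0" and nn: "\<And>x. dist c x = r \<Longrightarrow> 0 \<le> u x" "dist c z \<ge> r \<Longrightarrow> 0 \<le> u z"
  shows "sweep c r (\<lambda>x. ennreal (u x)) z = ennreal (poisson_modification c r u z)"
    and "0 \<le> poisson_modification c r u z"
proof -
  let ?p = "\<lambda>\<xi>. poisson ((z - c) / of_real r) \<xi>"
  have "sweep c r (\<lambda>x. ennreal (u x)) z = ennreal (poisson_modification c r u z) \<and> 0 \<le> poisson_modification c r u z"
  proof (cases "dist c z < r")
    case True
    then have z: "norm ((z - c) / complex_of_real r) < 1"
      using r by (simp add: norm_scaled_less_1_iff)
    have nn': "0 \<le> u (c + of_real r * \<xi>)" if "norm \<xi> = 1" for \<xi>
      using that r by (intro nn) (simp add: dist_norm norm_mult)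
    have ae: "AE \<xi> in circle_measure. 0 \<le> ?p \<xi> * u (c + of_real r * \<xi>)"
      using AE_circle_measure by eventually_elim (use nn' poisson_nonneg z in auto)
    have "(\<integral>\<^sup>+\<xi>. ennreal (?p \<xi>) * ennreal (u (c + of_real r * \<xi>)) \<partial>circle_measure)
        = (\<integral>\<^sup>+\<xi>. ennreal (?p \<xi> * u (c + of_real r * \<xi>)) \<partial>circle_measure)"
      by (rule nn_integral_cong_AE, use AE_circle_measure in eventually_elim) (use nn' poisson_nonneg z in \<open>auto simp: ennreal_mult\<close>)
    also have "\<dots> = ennreal (LINT \<xi>|circle_measure. ?p \<xi> * u (c + of_real r * \<xi>))"
      by (rule nn_integral_eq_integral[OF integrable_poisson[where C=C] ae])
        (use C z r in \<open>auto simp: dist_norm norm_mult\<close>)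
    finally show ?thesis
      using True integral_nonneg_AE[OF ae] by (simp add: sweep_def poisson_modification_def)
  qed (use nn in \<open>auto simp: sweep_def poisson_modification_def\<close>)
  then show "sweep c r (\<lambda>x. ennreal (u x)) z = ennreal (poisson_modification c r u z)"
    "0 \<le> poisson_modification c r u z" by auto
qed

lemma sweep_ennreal_continuous:
  assumes u: "continuous_on UNIV u" and r: "r > 0" and nn: "\<And>x. dist c x = r \<Longrightarrow> 0 \<le> u x" "dist c z \<ge> r \<Longrightarrow> 0 \<le> u z"
  shows "sweep c r (\<lambda>x. ennreal (u x)) z = ennreal (poisson_modification c r u z)"
    and "0 \<le> poisson_modification c r u z"
proof -
  obtain C where C: "\<And>x. dist c x = r \<Longrightarrow> \<bar>u x\<bar> \<le> C"
    using continuous_bounded_on_circle[OF u] by blast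
  show "sweep c r (\<lambda>x. ennreal (u x)) z = ennreal (poisson_modification c r u z)"
    "0 \<le> poisson_modification c r u z"
    using sweep_ennreal[OF borel_measurable_continuous_onI[OF u] C r nn] by auto
qed

lemma sweeps_ennreal:
  assumes "discs_within l R" "continuous_on UNIV u" "\<And>x. norm x < R \<Longrightarrow> 0 \<le> u x" "norm z < R"
  shows "sweeps l (\<lambda>x. ennreal (u x)) z = ennreal (modifications l u z) \<and> 0 \<le> modifications l u z
    \<and> continuous_on UNIV (modifications l u)"
  using assms
proof (induction l arbitrary: u z)
  case (Cons p l)
  obtain c r where p: "p = (c, r)"
    by force
  have r: "r > 0" and l: "discs_within l R"
    using Cons.prems by (auto simp: p)
  have circ: "norm x < R" if "dist c x = r" for x
    using norm_triangle_ineq4[of "c" "c - x"] Cons.prems(1) that by (simp add: p dist_norm)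
  let ?v = "poisson_modification c r u"
  let ?w = "modifications l ?v"
  have v: "sweep c r (\<lambda>x. ennreal (u x)) x = ennreal (?v x)" "0 \<le> ?v x" if "norm x < R" for x
    using sweep_ennreal_continuous[OF Cons.prems(2) r, of c x] Cons.prems(3) circ that by auto
  have w: "sweeps l (\<lambda>x. ennreal (?v x)) x = ennreal (?w x)" "0 \<le> ?w x" "continuous_on UNIV ?w" if "norm x < R" for x
    using Cons.IH[OF l continuous_poisson_modification[OF Cons.prems(2) r] v(2) that] by auto
  have "sweeps l (sweep c r (\<lambda>x. ennreal (u x))) x = ennreal (?w x)" if "norm x < R" for x
    using sweeps_cong[OF l v(1) that] w(1)[OF that] by simp
  then have "sweeps (p # l) (\<lambda>x. ennreal (u x)) z = sweep c r (\<lambda>x. ennreal (?w x)) z"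
    unfolding p sweeps.simps by (intro sweep_cong) (use circ Cons.prems r in auto)
  with sweep_ennreal_continuous[OF w(3) r, of z c z] w(2) circ Cons.prems(4) show ?case
    by (auto simp: p intro!: continuous_poisson_modification r w(3))
qed simp

lemma modifications_superharmonic:
  assumes "\<And>c r. (c, r) \<in> set l \<Longrightarrow> 0 < r" "superharmonic u"
  shows "superharmonic (modifications l u)"
  using assms
proof (induction l arbitrary: u)
  case (Cons p l)
  obtain c r where p: "p = (c, r)"
    by force
  have r: "0 < r" and l: "\<And>c r. (c, r) \<in> set l \<Longrightarrow> 0 < r"
    using Cons.prems(1) by (auto simp: p)
  show ?case
    unfolding p modifications.simps by (intro poisson_modification_superharmonic Cons.IH l r Cons.prems)
qed simp

lemma modifications_mono:
  assumes "\<And>c r. (c, r) \<in> set l \<Longrightarrow> 0 < r" "superharmonic u" "superharmonic v" "\<And>z. u z \<le> v z"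
  shows "modifications l u z \<le> modifications l v z"
  using assms
proof (induction l arbitrary: u v z)
  case (Cons p l)
  obtain c r where p: "p = (c, r)"
    by force
  have r: "r > 0" and l: "\<And>c r. (c, r) \<in> set l \<Longrightarrow> 0 < r"
    using Cons.prems(1) by (auto simp: p)
  note sup = poisson_modification_superharmonic[OF _ r]
  show ?case
    unfolding p modifications.simps
    by (intro poisson_modification_mono superharmonic_continuous modifications_superharmonic Cons.IH sup Cons.prems l r) auto
qed simp

text \<open>Both modifications over the new disc lower superharmonic functions; the effect of the
  inner one is carried through by monotonicity.\<close>

lemma modifications_Cons_le:
  assumes "\<And>c r. (c, r) \<in> set l \<Longrightarrow> 0 < r" "0 < r" "superharmonic u"
  shows "modifications ((c, r) # l) u z \<le> modifications l u z"
proof -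
  let ?v = "poisson_modification c r u"
  have v: "superharmonic ?v"
    using assms by (intro poisson_modification_superharmonic)
  have "modifications ((c, r) # l) u z \<le> modifications l ?v z"
    by (simp, intro poisson_modification_le modifications_superharmonic assms v)
  also have "\<dots> \<le> modifications l u z"
    by (intro modifications_mono assms v poisson_modification_le)
  finally show ?thesis .
qed

lemma modifications_outside:
  assumes "\<And>c r. (c, r) \<in> set l \<Longrightarrow> r \<le> dist c z"
  shows "modifications l u z = u z"
  using assms
proof (induction l arbitrary: u)
  case (Cons p l)
  obtain c r where p: "p = (c, r)"
    by force
  have "\<not> dist c z < r"
    using Cons.prems[of c r] by (simp add: p)
  then show ?case
    using Cons by (simp add: p poisson_modification_def)
qed simp

definition truncated_log :: "real \<Rightarrow> complex \<Rightarrow> nat \<Rightarrow> complex \<Rightarrow> real" where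
  "truncated_log M w n z = M - ln (max (norm (z - w)) (1 / real (Suc n)))"

lemma superharmonic_truncated_log': "superharmonic (truncated_log M w n)"
  unfolding truncated_log_def[abs_def] by (rule superharmonic_truncated_log) simp

lemma truncated_log_mono: "m \<le> n \<Longrightarrow> truncated_log M w m z \<le> truncated_log M w n z"
  unfolding truncated_log_def
  by (intro diff_left_mono ln_mono max.mono) (auto simp: less_max_iff_disj frac_le)

lemma SUP_truncated_log: "(SUP n. ennreal (truncated_log M w n z)) = shifted_log M z w"
proof (cases "z = w")
  case True
  have "ennreal x \<le> (SUP n. ennreal (truncated_log M w n z))" for x
  proof -
    obtain k where k: "exp (x - M) < real k"
      using reals_Archimedean2 by blast
    have "ln (1 / real (Suc k)) \<le> M - x"
    proof (rule ln_le_of_le_exp)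
      have "1 / real (Suc k) \<le> 1 / exp (x - M)"
        using k by (intro divide_left_mono) auto
      then show "1 / real (Suc k) \<le> exp (M - x)"
        by (simp add: exp_diff)
    qed auto
    then have "x \<le> truncated_log M w k z"
      using True by (simp add: truncated_log_def max_def)
    then show ?thesis
      by (intro SUP_upper2[of k] ennreal_leI) auto
  qed
  then have "(SUP n. ennreal (truncated_log M w n z)) = \<infinity>"
    by (rule ennreal_eq_topI)
  then show ?thesis
    using True by (simp add: shifted_log_def)
next
  case False
  obtain k where k: "inverse (real (Suc k)) < norm (z - w)"
    using reals_Archimedean[of "norm (z - w)"] False by auto
  have "(SUP n. ennreal (truncated_log M w n z)) = ennreal (M - ln (norm (z - w)))"
  proof (rule antisym)
    show "(SUP n. ennreal (truncated_log M w n z)) \<le> ennreal (M - ln (norm (z - w)))"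
      using False by (intro SUP_least ennreal_leI) (auto simp: truncated_log_def intro!: ln_mono)
    have "truncated_log M w k z = M - ln (norm (z - w))"
      using k by (simp add: truncated_log_def max_def inverse_eq_divide)
    then show "ennreal (M - ln (norm (z - w))) \<le> (SUP n. ennreal (truncated_log M w n z))"
      by (intro SUP_upper2[of k]) auto
  qed
  with False show ?thesis
    by (simp add: shifted_log_def)
qed

lemma truncated_log_nonneg:
  assumes "norm w < R" "norm z < R" "1 \<le> 3 * R"
  shows "0 \<le> truncated_log (ln (3 * R)) w n z"
proof -
  have "norm (z - w) \<le> 3 * R"
    using norm_triangle_ineq4[of z w] assms by linarith
  moreover have "1 / real (Suc n) \<le> 3 * R"
    using assms by (simp add: field_simps) (smt (verit) mult_nonneg_nonneg of_nat_0_le_iff)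
  ultimately have "ln (max (norm (z - w)) (1 / real (Suc n))) \<le> ln (3 * R)"
    by (intro ln_mono) (auto simp: less_max_iff_disj)
  then show ?thesis
    by (simp add: truncated_log_def)
qed

text \<open>The logarithm is infinite at its pole and so outside the scope of
  \<open>superharmonic\<close>; as a supremum of truncations it still inherits the inequalities
  between modifications.\<close>

lemma sweeps_shifted_log:
  assumes l: "discs_within l R" and R: "1 \<le> R" and z: "norm z < R" and w: "norm w < R"
  shows "sweeps l (\<lambda>x. shifted_log (ln (3 * R)) x w) z = (SUP n. ennreal (modifications l (truncated_log (ln (3 * R)) w n) z))"
proof -
  let ?M = "ln (3 * R)"
  have pos: "0 < r" if "(c, r) \<in> set l" for c r
    using l that by (auto simp: discs_within_def)
  have cont: "continuous_on UNIV (truncated_log ?M w n)" for n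
    by (intro superharmonic_continuous superharmonic_truncated_log')
  have [measurable]: "truncated_log ?M w n \<in> borel_measurable borel" for n
    by (intro borel_measurable_continuous_onI cont)
  have "sweeps l (\<lambda>x. shifted_log ?M x w) z = sweeps l (\<lambda>x. SUP n. ennreal (truncated_log ?M w n x)) z"
    by (simp add: SUP_truncated_log)
  also have "\<dots> = (SUP n. sweeps l (\<lambda>x. ennreal (truncated_log ?M w n x)) z)"
    by (rule sweeps_SUP[OF pos]) (auto simp: incseq_def le_fun_def intro!: ennreal_leI truncated_log_mono)
  also have "\<dots> = (SUP n. ennreal (modifications l (truncated_log ?M w n) z))"
    using sweeps_ennreal[OF l cont _ z] truncated_log_nonneg[OF w] R by simp
  finally show ?thesis .
qed

text \<open>A further disc lowers the remainder, and kernel and remainder always add up to the same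
  logarithmic kernel, so the kernel grows. Cancelling the remainder needs finiteness, guaranteed off
  the diagonal; on it the new disc contributes infinity or leaves the point fixed.\<close>

lemma swept_kernel_le_Cons:
  assumes l: "\<And>c r. (c, r) \<in> set l \<Longrightarrow> 0 < r" and r: "0 < r"
  shows "swept_kernel l z w \<le> swept_kernel ((c, r) # l) z w"
proof (cases "z = w")
  case True
  show ?thesis
  proof (cases "dist c w < r")
    case True
    then show ?thesis
      using disc_green_diagonal[OF r True] \<open>z = w\<close> by simp
  next
    case False
    then show ?thesis
      using \<open>z = w\<close> by (simp add: sweep_def)
  qed
next
  case False
  obtain R where R: "R > max 1 (max (norm z) (norm w))" "discs_within ((c, r) # l) R"
    using discs_within_exists[of "(c, r) # l" "max 1 (max (norm z) (norm w))"] l r by auto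
  have l': "discs_within l R" and zw: "norm z < R" "norm w < R" "1 \<le> R"
    using R by auto
  let ?E = "\<lambda>x. shifted_log (ln (3 * R)) x w"
  have le: "sweeps ((c, r) # l) ?E z \<le> sweeps l ?E z"
    unfolding sweeps_shifted_log[OF R(2) zw(3,1,2)] sweeps_shifted_log[OF l' zw(3,1,2)]
    by (intro SUP_mono' ennreal_leI modifications_Cons_le superharmonic_truncated_log' l r)
  have eq: "swept_kernel l z w + sweeps l ?E z = swept_kernel ((c, r) # l) z w + sweeps ((c, r) # l) ?E z"
    using swept_kernel_add_sweeps[OF R(2) zw(1,2)] swept_kernel_add_sweeps[OF l' zw(1,2)] by simp
  have fin: "sweeps l ?E z < \<infinity>"
  proof -
    have "sweeps l ?E z \<le> shifted_log (ln (3 * R)) z w"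
      using swept_kernel_add_sweeps[OF l' zw(1,2)] by (metis add_increasing zero_le order_refl)
    also have "\<dots> < \<infinity>"
      using False by (simp add: shifted_log_def)
    finally show ?thesis .
  qed
  have "sweeps l ?E z + swept_kernel l z w \<le> sweeps l ?E z + swept_kernel ((c, r) # l) z w"
    using add_left_mono[OF le, of "swept_kernel ((c, r) # l) z w"] eq by (simp only: add.commute)
  then show ?thesis
    using fin unfolding ennreal_add_left_cancel_le by (metis less_irrefl)
qed

text \<open>Off the pole, \<open>swept_kernel l _ w\<close> is the logarithmic kernel minus a sweep of its (continuous)
  truncations, so the minimum principle compares it with \<open>(1 + e) * p\<close>.\<close>

lemma swept_kernel_le:
  assumes S: "open S" and l: "\<And>c r. (c, r) \<in> set l \<Longrightarrow> 0 < r \<and> cball c r \<subseteq> S"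
    and p: "\<And>x. x \<in> S - {w} \<Longrightarrow> \<exists>s>0. re_holomorphic_near p x s" and nn: "\<And>x. x \<in> S - {w} \<Longrightarrow> 0 \<le> p x"
    and pole: "d > 0" "\<And>x. x \<noteq> w \<Longrightarrow> dist x w < d \<Longrightarrow> - C \<le> p x + ln (norm (x - w))"
    and z: "z \<in> S - {w}"
  shows "swept_kernel l z w \<le> ennreal (p z)"
proof -
  have pos: "0 < r" if "(c, r) \<in> set l" for c r
    using l that by blast
  obtain R where R: "R > max 1 (max (norm z) (norm w))" "discs_within l R"
    using discs_within_exists[of l "max 1 (max (norm z) (norm w))"] pos by auto
  have zw: "norm z < R" "norm w < R" "1 \<le> R"
    using R by auto
  define M where "M = ln (3 * R)"
  have M0: "0 \<le> M"
    using zw by (simp add: M_def)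
  define V where "V = (\<Union>(c, r)\<in>set l. cball c r)"
  have V: "compact V" "V \<subseteq> S"
    using l unfolding V_def by (auto intro!: compact_UN)
  have openS: "open (S - {w})"
    using S by auto
  \<comment> \<open>\<open>p\<close> is controlled only on \<open>S - {w}\<close>; the cut-off
    version is Borel on the plane.\<close>
  define p0 where "p0 x = (if x \<in> S - {w} then p x else 0)" for x
  have contp: "continuous_on (S - {w}) p"
  proof (rule continuous_at_imp_continuous_on, rule ballI)
    fix x assume "x \<in> S - {w}"
    then show "isCont p x"
      using p re_holomorphic_near_isCont by blast
  qed
  have contp0: "continuous_on (S - {w}) p0"
    by (rule continuous_on_eq[OF contp]) (simp add: p0_def)
  have [measurable]: "p0 \<in> borel_measurable borel"
  proof -
    have "(\<lambda>x. indicator (S - {w}) x *\<^sub>R p0 x) \<in> borel_measurable borel"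
      using openS by (intro borel_measurable_continuous_on_indicator contp0) auto
    moreover have "(\<lambda>x. indicator (S - {w}) x *\<^sub>R p0 x) = p0"
      by (auto simp: p0_def fun_eq_iff indicator_def)
    ultimately show ?thesis by simp
  qed
  \<comment> \<open>The factor \<open>1 + e\<close> makes the pole of \<open>(1 + e) * p\<close>
    stronger than that of the logarithm: the surplus \<open>- e * ln (norm (x - w))\<close> absorbs
    the bounded error in the pole condition.\<close>
  have bound: "\<exists>n. M - ln (norm (z - w)) \<le> modifications l (truncated_log M w n) z + (1 + e) * p z" if e: "e > 0" for e
  proof -
    define C0 where "C0 = max C 0"
    \<comment> \<open>Within \<open>d\<close> the pole estimate holds, within
      \<open>R - norm w\<close> all points have norm below \<open>R\<close>, and the last radius
      makes \<open>- e * ln (norm (x - w)) \<ge> (1 + e) * C0 + M\<close>.\<close>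
    define d0 where "d0 = min (min d (R - norm w)) (exp (- (((1 + e) * C0 + M) / e)))"
    have d0: "0 < d0" "d0 \<le> d" "d0 \<le> R - norm w" "d0 \<le> exp (- (((1 + e) * C0 + M) / e))"
      using pole(1) zw by (auto simp: d0_def)
    have near: "(1 + e) * p x - (M - ln (norm (x - w))) \<ge> 0" "norm x < R" "p x \<ge> - C0 - ln (norm (x - w))"
      if x: "x \<noteq> w" "dist x w < d0" for x
    proof -
      have "- C \<le> p x + ln (norm (x - w))"
        using pole(2)[of x] x d0 by auto
      then show px: "p x \<ge> - C0 - ln (norm (x - w))"
        by (simp add: C0_def)
      have "norm (x - w) < exp (- (((1 + e) * C0 + M) / e))"
        using x d0(4) by (simp add: dist_norm)
      then have "ln (norm (x - w)) \<le> - (((1 + e) * C0 + M) / e)"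
        using x by (intro ln_le_of_le_exp) auto
      then have "e * ln (norm (x - w)) \<le> - ((1 + e) * C0 + M)"
        using e by (simp add: field_simps)
      moreover have "(1 + e) * (- C0 - ln (norm (x - w))) \<le> (1 + e) * p x"
        using px e by (intro mult_left_mono) auto
      ultimately show "(1 + e) * p x - (M - ln (norm (x - w))) \<ge> 0"
        by (simp add: algebra_simps)
      show "norm x < R"
        using x d0(3) norm_triangle_ineq2[of x w] by (simp add: dist_norm)
    qed
    \<comment> \<open>With truncation radius below \<open>d0\<close>, truncated and true logarithm
      agree outside the ball of radius \<open>d0\<close> around \<open>w\<close>.\<close>
    obtain n where n: "inverse (real (Suc n)) < d0"
      using reals_Archimedean[OF d0(1)] by blast
    define \<delta> where "\<delta> = 1 / real (Suc n)"
    have \<delta>: "0 < \<delta>" "\<delta> < d0" "\<delta> \<le> 1"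
      using n by (auto simp: \<delta>_def inverse_eq_divide)
    define T where "T = modifications l (truncated_log M w n)"
    have supT: "superharmonic T"
      unfolding T_def by (intro modifications_superharmonic pos superharmonic_truncated_log')
    have contT: "continuous_on UNIV T"
      by (rule superharmonic_continuous[OF supT])
    have [measurable]: "T \<in> borel_measurable borel"
      by (rule borel_measurable_continuous_onI[OF contT])
    have T0: "0 \<le> T x" if "norm x < R" for x
      unfolding T_def
      using sweeps_ennreal[OF R(2) superharmonic_continuous[OF superharmonic_truncated_log'] _ that]
        truncated_log_nonneg[OF zw(2)] zw(3) unfolding M_def by simp
    define q where "q x = (if x \<in> S - {w} then (1 + e) * p0 x - (M - ln (norm (x - w))) else 0)" for x
    have contq: "continuous_on (S - {w}) q"
    proof (rule continuous_on_eq)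
      show "continuous_on (S - {w}) (\<lambda>x. (1 + e) * p0 x - (M - ln (norm (x - w))))"
        by (intro continuous_intros contp0) auto
    qed (auto simp: q_def)
    have [measurable]: "q \<in> borel_measurable borel"
    proof -
      have [measurable]: "S - {w} \<in> sets borel"
        using openS by simp
      show ?thesis
        unfolding q_def[abs_def] by measurable
    qed
    \<comment> \<open>Near \<open>w\<close> both summands are nonnegative. Away from
      \<open>w\<close> and outside the union \<open>V\<close> of the discs nothing has been
      modified, so the logarithms cancel and \<open>W\<close> is \<open>(1 + e) * p\<close>. What is
      left is the compact set \<open>K\<close>.\<close>
    define W where "W x = T x + q x" for x
    define K where "K = V - ball w d0"
    have "0 \<le> W z"
    proof (rule minimum_principle[where S="S - {w}" and C=K])
      show "continuous_on (S - {w}) W"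
        unfolding W_def by (intro continuous_intros contq continuous_on_subset[OF contT]) auto
      show "W \<in> borel_measurable borel"
        unfolding W_def[abs_def] by measurable
      show "compact K"
        unfolding K_def by (intro compact_diff V) auto
      show "K \<subseteq> S - {w}"
        using V(2) d0(1) by (auto simp: K_def)
      show "0 \<le> W x" if x: "x \<in> S - {w} - K" for x
      proof (cases "dist x w < d0")
        case True
        with x have "x \<noteq> w" by auto
        from near[OF this True] T0 x show ?thesis
          by (auto simp: W_def q_def p0_def)
      next
        case False
        then have "x \<notin> V"
          using x by (auto simp: K_def dist_commute)
        then have "r \<le> dist c x" if "(c, r) \<in> set l" for c r
          using that by (force simp: V_def)
        then have "T x = truncated_log M w n x"
          unfolding T_def by (rule modifications_outside)
        also have "\<dots> = M - ln (norm (x - w))"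
        proof -
        have "max (norm (x - w)) (1 / real (Suc n)) = norm (x - w)"
          using False \<delta>(2) unfolding \<delta>_def[symmetric] by (simp add: dist_norm max_def)
        then show ?thesis
          by (simp add: truncated_log_def)
      qed
        finally show ?thesis
          using x nn[of x] e by (auto simp: W_def q_def p0_def)
      qed
      show "\<exists>r>0. cball x r \<subseteq> S - {w} \<and> (LINT \<xi>|circle_measure. W (x + of_real r * \<xi>)) \<le> W x" if "x \<in> K" for x
      proof -
        have x: "x \<in> S - {w}"
          using that V(2) d0(1) by (auto simp: K_def)
        obtain s1 where s1: "s1 > 0" "re_holomorphic_near p x s1"
          using p x by blast
        obtain s2 where s2: "s2 > 0" "ball x s2 \<subseteq> S - {w}"
          using openS x openE by blast
        obtain s3 where s3: "s3 > 0" "\<And>r. 0 < r \<Longrightarrow> r < s3 \<Longrightarrow> (LINT \<xi>|circle_measure. T (x + of_real r * \<xi>)) \<le> T x"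
          using superharmonicE[OF supT, of x] by blast
        define s where "s = min (min s1 (norm (x - w))) (min s2 s3)"
        have s: "s > 0" "s \<le> s1" "s \<le> norm (x - w)" "s \<le> s2" "s \<le> s3"
          using s1(1) s2(1) s3(1) x by (auto simp: s_def)
        have sub: "ball x s \<subseteq> S - {w}"
          using s2(2) s(4) by (auto simp: subset_iff)
        have "re_holomorphic_near (\<lambda>y. (1 + e) * p y - (M - ln (norm (y - w)))) x s"
          by (intro re_holomorphic_near_diff re_holomorphic_near_cmult re_holomorphic_near_const
              re_holomorphic_near_subset[OF s1(2)] re_holomorphic_near_subset[OF re_holomorphic_near_ln_norm[where z=x]])
            (use s in \<open>auto simp: ball_subset_ball_iff\<close>)
        also have "?this \<longleftrightarrow> re_holomorphic_near q x s"
          by (rule re_holomorphic_near_cong) (use sub in \<open>auto simp: q_def p0_def\<close>)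
        finally have q: "re_holomorphic_near q x s" .
        define r where "r = s / 2"
        have r: "0 < r" "r < s" "r < s3"
          using s by (auto simp: r_def)
        have sub': "cball x r \<subseteq> S - {w}"
          using r(2) by (intro order_trans[OF _ sub]) (auto simp: cball_subset_ball_iff)
        have "integrable circle_measure (\<lambda>\<xi>. q (x + of_real r * \<xi>))"
          by (rule integrable_circle_continuous[OF continuous_on_subset[OF contq] r(1)]) (use sub' in auto)
        then have "(LINT \<xi>|circle_measure. W (x + of_real r * \<xi>))
            = (LINT \<xi>|circle_measure. T (x + of_real r * \<xi>)) + (LINT \<xi>|circle_measure. q (x + of_real r * \<xi>))"
          unfolding W_def using integrable_circle_continuous_UNIV[OF contT r(1)] by simp
        also have "\<dots> \<le> W x"
          unfolding W_def using s3(2)[OF r(1,3)] circle_mean_re_holomorphic[OF q _ r(1,2)] by simp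
        finally show ?thesis
          using r(1) sub' by blast
      qed
    qed (rule z)
    then have "M - ln (norm (z - w)) \<le> T z + (1 + e) * p z"
      using z by (auto simp: W_def q_def p0_def split: if_splits)
    then show ?thesis
      unfolding T_def by blast
  qed
  have "swept_kernel l z w \<le> ennreal (p z) + ennreal k" if k: "k > 0" for k
  proof -
    \<comment> \<open>Then \<open>e * p z \<le> k\<close>; the \<open>+ 1\<close> covers
      \<open>p z = 0\<close>.\<close>
    define e where "e = k / (p z + 1)"
    have e: "e > 0" "e * p z \<le> k"
      using k nn[OF z] by (auto simp: e_def field_simps)
    obtain n where n: "M - ln (norm (z - w)) \<le> modifications l (truncated_log M w n) z + (1 + e) * p z"
      using bound[OF e(1)] by blast
    let ?Q = "sweeps l (\<lambda>x. shifted_log M x w) z"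
    have "swept_kernel l z w + ?Q = ennreal (M - ln (norm (z - w)))"
      using swept_kernel_add_sweeps[OF R(2) zw(1,2)] z unfolding M_def by (simp add: shifted_log_def)
    also have "\<dots> \<le> ennreal (modifications l (truncated_log M w n) z + (1 + e) * p z)"
      by (rule ennreal_leI[OF n])
    also have "\<dots> \<le> ennreal (modifications l (truncated_log M w n) z) + ennreal ((1 + e) * p z)"
      using nn[OF z] e by (auto simp: ennreal_plus_if intro!: ennreal_leI)
    also have "\<dots> \<le> ?Q + ennreal (p z + k)"
    proof (rule add_mono)
      show "ennreal (modifications l (truncated_log M w n) z) \<le> ?Q"
        unfolding M_def sweeps_shifted_log[OF R(2) zw(3,1,2)] by (rule SUP_upper) simp
      show "ennreal ((1 + e) * p z) \<le> ennreal (p z + k)"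
        using e by (intro ennreal_leI) (simp add: algebra_simps)
    qed
    finally have le: "?Q + swept_kernel l z w \<le> ?Q + ennreal (p z + k)"
      by (simp only: add.commute)
    have "?Q \<le> swept_kernel l z w + ?Q"
      by simp
    also have "\<dots> < \<infinity>"
      using swept_kernel_add_sweeps[OF R(2) zw(1,2)] z unfolding M_def by (simp add: shifted_log_def)
    finally have "?Q \<noteq> \<infinity>" by simp
    with le show ?thesis
      unfolding ennreal_add_left_cancel_le using nn[OF z] k by simp
  qed
  then show ?thesis
    by (rule ennreal_le_epsilon)
qed

section \<open>Exhaustion of the Green function\<close>

text \<open>Centres come from a countable dense set, radii are reciprocals of positive integers. The
  discs are closed because sweeping uses the bounding circle as well.\<close>

lemma disc_family:
  assumes S: "open (S :: complex set)"
  obtains \<B> :: "(complex \<times> real) set" where "countable \<B>" "\<And>c r. (c, r) \<in> \<B> \<Longrightarrow> 0 < r \<and> cball c r \<subseteq> S"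
    "\<And>U x. open U \<Longrightarrow> x \<in> U \<Longrightarrow> U \<subseteq> S \<Longrightarrow> \<exists>(c, r)\<in>\<B>. x \<in> ball c r \<and> cball c r \<subseteq> U"
proof -
  obtain Q :: "complex set" where Q: "countable Q" "\<And>X. open X \<Longrightarrow> X \<noteq> {} \<Longrightarrow> \<exists>q\<in>Q. q \<in> X"
    using countable_dense_exists by blast
  define \<B> where "\<B> = {(c, r). c \<in> Q \<and> r \<in> (\<lambda>n. 1 / real (Suc n)) ` UNIV \<and> cball c r \<subseteq> S}"
  show thesis
  proof (rule that)
    have "\<B> \<subseteq> Q \<times> (\<lambda>n. 1 / real (Suc n)) ` UNIV"
      by (auto simp: \<B>_def)
    then show "countable \<B>"
      by (rule countable_subset) (intro countable_SIGMA Q countable_image, auto)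
    show "0 < r \<and> cball c r \<subseteq> S" if "(c, r) \<in> \<B>" for c r
      using that by (auto simp: \<B>_def)
    fix U x assume U: "open U" "x \<in> U" "U \<subseteq> S"
    then obtain e where e: "e > 0" "ball x e \<subseteq> U"
      using openE by blast
    obtain n where n: "inverse (real (Suc n)) < e / 2"
      using reals_Archimedean[of "e / 2"] e by auto
    define r where "r = 1 / real (Suc n)"
    have r: "0 < r" "2 * r < e"
      using n by (auto simp: r_def inverse_eq_divide)
    obtain c where c: "c \<in> Q" "c \<in> ball x r"
      using Q(2)[of "ball x r"] r by auto
    have "cball c r \<subseteq> ball x e"
      using c(2) r by (auto simp: cball_subset_ball_iff dist_commute)
    then have sub: "cball c r \<subseteq> U"
      using e(2) by blast
    then have "(c, r) \<in> \<B>"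
      using c(1) U(3) by (auto simp: \<B>_def r_def)
    then show "\<exists>(c, r)\<in>\<B>. x \<in> ball c r \<and> cball c r \<subseteq> U"
      using c(2) sub by (intro bexI[of _ "(c, r)"]) (auto simp: dist_commute)
  qed
qed

lemma green_competitorD:
  assumes p: "green_competitor D (Some w) p"
  shows "\<And>x. x \<in> Some -` D - {w} \<Longrightarrow> \<exists>s>0. re_holomorphic_near (\<lambda>x. p (Some x)) x s"
    and "\<And>x. x \<in> Some -` D - {w} \<Longrightarrow> 0 \<le> p (Some x)"
    and "\<exists>d>0. \<exists>C. \<forall>x. x \<noteq> w \<and> dist x w < d \<longrightarrow> \<bar>p (Some x) + ln (norm (x - w))\<bar> \<le> C"
proof -
  have eq: "Some -` (D - {Some w}) = Some -` D - {w}"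
    by auto
  have harm: "harmonic_on (\<lambda>x. p (Some x)) (Some -` D - {w})"
    using p unfolding green_competitor_def sphere_harmonic_on_def eq o_def by blast
  then have "open (Some -` D - {w})"
    by (simp add: harmonic_on_def)
  then show "\<exists>s>0. re_holomorphic_near (\<lambda>x. p (Some x)) x s" if "x \<in> Some -` D - {w}" for x
    using that openE harmonic_on_imp_re_holomorphic[OF harm] by metis
  show "0 \<le> p (Some x)" if "x \<in> Some -` D - {w}" for x
    using p that by (auto simp: green_competitor_def)
  have "Bfun (\<lambda>x. p (Some x) + ln (norm (x - w))) (at w)"
    using p by (simp add: green_competitor_def log_pole_def)
  then obtain C where "eventually (\<lambda>x. norm (p (Some x) + ln (norm (x - w))) \<le> C) (at w)"
    by (auto simp: Bfun_def)
  then show "\<exists>d>0. \<exists>C. \<forall>x. x \<noteq> w \<and> dist x w < d \<longrightarrow> \<bar>p (Some x) + ln (norm (x - w))\<bar> \<le> C"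
    unfolding eventually_at by auto
qed

text \<open>A bounded harmonic function extends over infinity, so competitors may be built on the finite part
  of the domain.\<close>

lemma green_competitor_extension:
  assumes p: "green_competitor D (Some w) p"
    and q: "\<And>x. x \<in> Some -` D - {w} \<Longrightarrow> \<exists>s>0. re_holomorphic_near q x s"
    and q0: "\<And>x. x \<in> Some -` D - {w} \<Longrightarrow> 0 \<le> q x" and qp: "\<And>x. x \<in> Some -` D - {w} \<Longrightarrow> q x \<le> p (Some x)"
    and pole: "d > 0" "\<And>x. x \<noteq> w \<Longrightarrow> dist x w < d \<Longrightarrow> \<bar>q x + ln (norm (x - w))\<bar> \<le> C"
  obtains P where "green_competitor D (Some w) P" "\<And>x. P (Some x) = q x"
proof -
  have eq: "Some -` (D - {Some w}) = Some -` D - {w}"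
    by auto
  define V where "V = inv_chart -` (D - {Some w})"
  have harm1: "harmonic_on (p \<circ> Some) (Some -` D - {w})" and harm2: "harmonic_on (p \<circ> inv_chart) V"
    and op: "openin riemann_sphere (D - {Some w})"
    using p unfolding green_competitor_def sphere_harmonic_on_def eq V_def by auto
  have open1: "open (Some -` D - {w})" and open2: "open V"
    using harm1 harm2 by (auto simp: harmonic_on_def)
  define u where "u x = q (inverse x)" for x
  have V_inv: "inverse x \<in> Some -` D - {w}" if "x \<in> V" "x \<noteq> 0" for x
    using that by (auto simp: V_def inv_chart_def split: if_splits)
  have u_hol: "\<exists>s>0. re_holomorphic_near u x s" if x: "x \<in> V" "x \<noteq> 0" for x
  proof -
    obtain s where s: "s > 0" "re_holomorphic_near q (inverse x) s"
      using q[OF V_inv[OF x]] by blast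
    have "isCont inverse x"
      using x by (intro continuous_intros)
    then obtain t where t: "t > 0" "\<And>y. dist y x < t \<Longrightarrow> dist (inverse y) (inverse x) < s"
      using s(1) unfolding continuous_at_eps_delta by blast
    have "re_holomorphic_near (\<lambda>y. q (inverse y)) x (min t (norm x))"
    proof (rule re_holomorphic_near_compose[where g=inverse, OF s(2)])
      show "inverse holomorphic_on ball x (min t (norm x))"
        by (intro holomorphic_intros) auto
      show "inverse ` ball x (min t (norm x)) \<subseteq> ball (inverse x) s"
        using t by (auto simp: dist_commute)
    qed
    then show ?thesis
      using t x unfolding u_def by (intro exI[of _ "min t (norm x)"]) auto
  qed
  \<comment> \<open>Guarded by \<open>None \<in> D\<close>, so that one definition of
    \<open>P\<close> covers domains with and without the point at infinity.\<close>
  obtain v \<rho> where v: "None \<in> D \<Longrightarrow> \<rho> > 0 \<and> ball 0 \<rho> \<subseteq> V \<and> re_holomorphic_near v 0 \<rho> \<and> (\<forall>x\<in>ball 0 \<rho> - {0}. v x = u x)"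
  proof (cases "None \<in> D")
    case True
    then have 0: "0 \<in> V"
      by (simp add: V_def inv_chart_def)
    obtain e where e: "e > 0" "ball 0 e \<subseteq> V"
      using open2 0 openE by blast
    have "isCont (p \<circ> inv_chart) 0"
      by (rule re_holomorphic_near_isCont[OF harmonic_on_imp_re_holomorphic[OF harm2 e(2)] e(1)])
    then obtain t where t: "t > 0" "\<And>x. dist x 0 < t \<Longrightarrow> dist ((p \<circ> inv_chart) x) ((p \<circ> inv_chart) 0) < 1"
      unfolding continuous_at_eps_delta by (meson zero_less_one)
    define \<rho>0 where "\<rho>0 = min e t"
    have \<rho>0: "\<rho>0 > 0" "\<rho>0 \<le> e"
      using e t by (auto simp: \<rho>0_def)
    have sub: "x \<in> V" "x \<noteq> 0" if "x \<in> ball 0 \<rho>0 - {0}" for x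
      using that e \<rho>0 by auto
    \<comment> \<open>Near infinity \<open>q\<close> lies between 0 and \<open>p\<close>, and
      \<open>p\<close> is continuous at infinity in the chart \<open>inv_chart\<close>.\<close>
    have bd: "\<bar>u x\<bar> \<le> \<bar>p None\<bar> + 1" if x: "x \<in> ball 0 \<rho>0 - {0}" for x
    proof -
      have "0 \<le> u x" "u x \<le> p (Some (inverse x))"
        using q0[OF V_inv[OF sub[OF x]]] qp[OF V_inv[OF sub[OF x]]] by (auto simp: u_def)
      moreover have "dist (p (Some (inverse x))) (p None) < 1"
        using t(2)[of x] x by (simp add: \<rho>0_def inv_chart_def)
      ultimately show ?thesis
        by (simp add: dist_real_def)
    qed
    have hol: "\<exists>s>0. re_holomorphic_near u x s" if "x \<in> ball 0 \<rho>0 - {0}" for x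
      by (rule u_hol[OF sub[OF that]])
    obtain v r where vr: "r > 0" "re_holomorphic_near v 0 r" "\<And>x. x \<in> ball 0 r - {0} \<Longrightarrow> v x = u x"
      by (rule removable_singularity[OF \<rho>0(1) bd hol]) (assumption+, rule that)
    have "re_holomorphic_near v 0 (min r e)"
      by (rule re_holomorphic_near_subset[OF vr(2)]) auto
    then show thesis
      using e vr by (intro that[of "min r e" v]) auto
  qed (use that in blast)
  define P where "P x = (case x of Some y \<Rightarrow> q y | None \<Rightarrow> v 0)" for x
  have P_chart: "P (inv_chart x) = (if x = 0 then v 0 else u x)" for x
    by (simp add: P_def inv_chart_def u_def)
  have "green_competitor D (Some w) P"
    unfolding green_competitor_def sphere_harmonic_on_def eq
  proof (intro conjI op ballI)
    show "harmonic_on (P \<circ> Some) (Some -` D - {w})"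
      by (rule harmonic_onI[OF open1]) (use q in \<open>simp add: P_def o_def\<close>)
    show "harmonic_on (P \<circ> inv_chart) (inv_chart -` (D - {Some w}))"
      unfolding V_def[symmetric]
    proof (rule harmonic_onI[OF open2])
      fix x assume x: "x \<in> V"
      show "\<exists>s>0. re_holomorphic_near (P \<circ> inv_chart) x s"
      proof (cases "x = 0")
        case True
        then have "None \<in> D"
          using x by (simp add: V_def inv_chart_def)
        note v = v[OF this]
        have "re_holomorphic_near (P \<circ> inv_chart) 0 \<rho> \<longleftrightarrow> re_holomorphic_near v 0 \<rho>"
          by (rule re_holomorphic_near_cong) (use v in \<open>auto simp: P_chart\<close>)
        then show ?thesis
          using v True by blast
      next
        case False
        obtain s where s: "s > 0" "re_holomorphic_near u x s"
          using u_hol[OF x False] by blast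
        have "re_holomorphic_near u x (min s (norm x))"
          by (rule re_holomorphic_near_subset[OF s(2)]) auto
        also have "?this \<longleftrightarrow> re_holomorphic_near (P \<circ> inv_chart) x (min s (norm x))"
          by (rule re_holomorphic_near_cong) (auto simp: P_chart)
        finally show ?thesis
          using s False by (intro exI[of _ "min s (norm x)"]) auto
      qed
    qed
    fix x assume x: "x \<in> D - {Some w}"
    show "0 \<le> P x"
    proof (cases x)
      case None
      then have N: "None \<in> D"
        using x by auto
      note v = v[OF N]
      have cv: "isCont v 0"
        using v re_holomorphic_near_isCont by blast
      have "0 \<le> v 0"
      proof (rule tendsto_lowerbound[where F="at (0::complex)"])
        show "(v \<longlongrightarrow> v 0) (at 0)"
          using cv by (simp add: isCont_def)
        show "eventually (\<lambda>x. 0 \<le> v x) (at 0)"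
          unfolding eventually_at
        proof (intro exI[of _ \<rho>] conjI ballI impI)
          fix y :: complex assume y: "y \<noteq> 0 \<and> dist y 0 < \<rho>"
          then have "y \<in> V" "v y = u y"
            using v by auto
          then show "0 \<le> v y"
            using q0[OF V_inv[of y]] y by (simp add: u_def)
        qed (use v in auto)
      qed auto
      then show ?thesis
        using None by (simp add: P_def)
    next
      case (Some y)
      then show ?thesis
        using x q0[of y] by (auto simp: P_def)
    qed
  next
    \<comment> \<open>\<open>max C 1\<close>, since \<open>Bfun\<close> asks for a positive
      bound.\<close>
    have "\<exists>d>0. \<forall>x\<in>UNIV. x \<noteq> w \<and> dist x w < d \<longrightarrow> norm (q x + ln (norm (x - w))) \<le> max C 1"
      using pole by (intro exI[of _ d]) (auto simp: le_max_iff_disj)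
    then show "log_pole P (Some w)"
      unfolding log_pole_def Bfun_def option.case eventually_at P_def by (intro exI[of _ "max C 1"]) auto
  qed
  then show thesis
    by (rule that) (simp add: P_def)
qed

lemma openin_riemann_sphere_vimage:
  assumes "openin riemann_sphere D"
  shows "open (Some -` D)"
proof -
  have "continuous_map euclidean riemann_sphere (Some :: complex \<Rightarrow> complex option)"
    by (rule continuous_map_Some)
  from openin_continuous_map_preimage[OF this assms] show ?thesis
    by (simp add: vimage_def)
qed

lemma green_functionE:
  assumes "is_green_function D g" "Some w \<in> D"
  obtains p where "green_competitor D (Some w) p" "\<And>z. z \<in> Some -` D - {w} \<Longrightarrow> g (Some z) (Some w) = ereal (p (Some z))"
    "\<And>q z. green_competitor D (Some w) q \<Longrightarrow> z \<in> Some -` D - {w} \<Longrightarrow> p (Some z) \<le> q (Some z)"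
    "g (Some w) (Some w) = \<infinity>"
  using assms unfolding is_green_function_def by (smt (verit) DiffD1 DiffD2 DiffI insert_iff empty_iff option.inject vimageE vimageI)

text \<open>Holds for every list of discs in \<open>D\<close>, not just for those of a fixed
  exhaustion; \<open>kernel_energy_psd_disc\<close> relies on this freedom.\<close>

lemma swept_kernel_le_green:
  assumes D: "openin riemann_sphere D" and g: "is_green_function D g"
    and l: "\<And>c r. (c, r) \<in> set l \<Longrightarrow> 0 < r \<and> cball c r \<subseteq> Some -` D"
    and z: "Some z \<in> D" and w: "Some w \<in> D"
  shows "enn2ereal (swept_kernel l z w) \<le> g (Some z) (Some w)"
proof -
  obtain p where p: "green_competitor D (Some w) p" "\<And>z. z \<in> Some -` D - {w} \<Longrightarrow> g (Some z) (Some w) = ereal (p (Some z))"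
    "g (Some w) (Some w) = \<infinity>"
    using green_functionE[OF g w] by metis
  show ?thesis
  proof (cases "z = w")
    case False
    obtain d C where dC: "d > 0" "\<And>x. x \<noteq> w \<Longrightarrow> dist x w < d \<Longrightarrow> \<bar>p (Some x) + ln (norm (x - w))\<bar> \<le> C"
      using green_competitorD(3)[OF p(1)] by metis
    have "swept_kernel l z w \<le> ennreal (p (Some z))"
    proof (rule swept_kernel_le[OF openin_riemann_sphere_vimage[OF D] l])
      show "- C \<le> p (Some x) + ln (norm (x - w))" if "x \<noteq> w" "dist x w < d" for x
        using dC(2)[OF that] by linarith
    qed (use green_competitorD[OF p(1)] dC(1) False z in auto)
    moreover have "0 \<le> p (Some z)"
      using green_competitorD(2)[OF p(1)] False z by auto
    ultimately have "enn2ereal (swept_kernel l z w) \<le> ereal (p (Some z))"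
      by (metis enn2ereal_ennreal less_eq_ennreal.rep_eq)
    then show ?thesis
      using p(2)[of z] False z by auto
  qed (use p(3) in simp)
qed

text \<open>Sweeping through a countable family of discs, each used infinitely often, exhausts the Green function:
  the limit is harmonic off the pole, hence a competitor.\<close>

lemma green_function_eq_SUP:
  assumes D: "openin riemann_sphere D" and g: "is_green_function D g"
  obtains ls :: "nat \<Rightarrow> (complex \<times> real) list" where
    "\<And>n c r. (c, r) \<in> set (ls n) \<Longrightarrow> 0 < r \<and> cball c r \<subseteq> Some -` D"
    "\<And>z w. incseq (\<lambda>n. swept_kernel (ls n) z w)"
    "\<And>z w. Some z \<in> D \<Longrightarrow> Some w \<in> D \<Longrightarrow> g (Some z) (Some w) = enn2ereal (SUP n. swept_kernel (ls n) z w)"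
proof -
  define S where "S = Some -` D"
  have S: "open S"
    unfolding S_def by (rule openin_riemann_sphere_vimage[OF D])
  obtain \<B> :: "(complex \<times> real) set" where B: "countable \<B>" "\<And>c r. (c, r) \<in> \<B> \<Longrightarrow> 0 < r \<and> cball c r \<subseteq> S"
    "\<And>U x. open U \<Longrightarrow> x \<in> U \<Longrightarrow> U \<subseteq> S \<Longrightarrow> \<exists>(c, r)\<in>\<B>. x \<in> ball c r \<and> cball c r \<subseteq> U"
    using disc_family[OF S] by blast
  show thesis
  proof (cases "S = {}")
    case True
    then show thesis
      by (intro that[of "\<lambda>_. []"]) (auto simp: S_def incseq_def)
  next
    case False
    then have Bne: "\<B> \<noteq> {}"
      using B(3)[of S] S by auto
    \<comment> \<open>\<open>prod_decode\<close> runs through all pairs, so every disc of the family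
      recurs infinitely often.\<close>
    define b where "b n = from_nat_into \<B> (fst (prod_decode n))" for n
    have b: "b n \<in> \<B>" for n
      unfolding b_def by (rule from_nat_into[OF Bne])
    have b_freq: "\<exists>m\<ge>n. b m = p" if p: "p \<in> \<B>" for p n
    proof -
      obtain i where i: "from_nat_into \<B> i = p"
        using from_nat_into_surj[OF B(1) p] by blast
      show ?thesis
        by (rule exI[of _ "prod_encode (i, n)"]) (simp add: b_def i le_prod_encode_2)
    qed
    define ls where "ls = rec_nat [] (\<lambda>n l. b n # l)"
    have ls: "ls 0 = []" "ls (Suc n) = b n # ls n" for n
      by (simp_all add: ls_def)
    have ls_set: "set (ls n) \<subseteq> \<B>" for n
      by (induction n) (use b in \<open>auto simp: ls\<close>)
    then have discs: "0 < r \<and> cball c r \<subseteq> Some -` D" if "(c, r) \<in> set (ls n)" for n c r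
      using that B(2) unfolding S_def by blast
    have inc: "incseq (\<lambda>n. swept_kernel (ls n) z w)" for z w
    proof (rule incseq_SucI)
      fix n
      obtain c r where cr: "b n = (c, r)"
        by force
      show "swept_kernel (ls n) z w \<le> swept_kernel (ls (Suc n)) z w"
        unfolding ls cr by (rule swept_kernel_le_Cons) (use discs B(2)[of c r] b[of n] cr in auto)
    qed
    define s where "s z w = (SUP n. swept_kernel (ls n) z w)" for z w
    have meas [measurable]: "(\<lambda>z. swept_kernel (ls n) z w) \<in> borel_measurable borel" for n w
      by measurable
    have [measurable]: "(\<lambda>z. s z w) \<in> borel_measurable borel" for w
      unfolding s_def by measurable
    have upper: "swept_kernel (ls n) z w \<le> s z w" for n z w
      unfolding s_def by (rule SUP_upper) simp
    \<comment> \<open>For \<open>w\<close> outside the disc, a stage using \<open>(c, r)\<close> is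
      exactly the sweep of the preceding stage. Such stages occur arbitrarily late, so the supremum
      equals its own sweep.\<close>
    have fix_sweep: "s z w = sweep c r (\<lambda>x. s x w) z" if cr: "(c, r) \<in> \<B>" and w: "r \<le> dist c w" for z w c r
    proof -
      have r: "0 < r"
        using B(2)[OF cr] by simp
      have step: "swept_kernel (ls (Suc m)) z w = sweep c r (\<lambda>x. swept_kernel (ls m) x w) z" if "b m = (c, r)" for m
        using w disc_green_outside[OF r, of c z w] unfolding ls that swept_kernel.simps by (simp add: sweep_def)
      have sup: "sweep c r (\<lambda>x. s x w) z = (SUP n. sweep c r (\<lambda>x. swept_kernel (ls n) x w) z)"
        unfolding s_def using inc by (intro sweep_SUP meas) (auto simp: incseq_def le_fun_def)
      show ?thesis
      proof (rule antisym)
        show "s z w \<le> sweep c r (\<lambda>x. s x w) z"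
          unfolding s_def[of z]
        proof (rule SUP_least)
          fix n
          obtain m where m: "m \<ge> n" "b m = (c, r)"
            using b_freq[OF cr] by blast
          have "swept_kernel (ls n) z w \<le> swept_kernel (ls (Suc m)) z w"
            using incseqD[OF inc, of n "Suc m"] m(1) by simp
          also have "\<dots> \<le> sweep c r (\<lambda>x. s x w) z"
            unfolding step[OF m(2)] by (rule sweep_mono) (use upper r in auto)
          finally show "swept_kernel (ls n) z w \<le> sweep c r (\<lambda>x. s x w) z" .
        qed
        show "sweep c r (\<lambda>x. s x w) z \<le> s z w"
          unfolding sup
        proof (rule SUP_least)
          fix n
          obtain m where m: "m \<ge> n" "b m = (c, r)"
            using b_freq[OF cr] by blast
          have "sweep c r (\<lambda>x. swept_kernel (ls n) x w) z \<le> sweep c r (\<lambda>x. swept_kernel (ls m) x w) z"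
            by (rule sweep_mono) (use incseqD[OF inc m(1)] r in auto)
          also have "\<dots> \<le> s z w"
            unfolding step[OF m(2), symmetric] by (rule upper)
          finally show "sweep c r (\<lambda>x. swept_kernel (ls n) x w) z \<le> s z w" .
        qed
      qed
    qed
    \<comment> \<open>This lower bound is what gives the limit its logarithmic pole.\<close>
    have disc_le: "disc_green c r z w \<le> s z w" if cr: "(c, r) \<in> \<B>" for c r z w
    proof -
      obtain m where "b m = (c, r)"
        using b_freq[OF cr] by blast
      then have "disc_green c r z w \<le> swept_kernel (ls (Suc m)) z w"
        by (simp add: ls)
      then show ?thesis
        using upper order_trans by blast
    qed
    have "g (Some z) (Some w) = enn2ereal (s z w)" if zD: "Some z \<in> D" and wD: "Some w \<in> D" for z w
    proof -
      obtain p where p: "green_competitor D (Some w) p"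
        "\<And>z. z \<in> Some -` D - {w} \<Longrightarrow> g (Some z) (Some w) = ereal (p (Some z))"
        "\<And>q z. green_competitor D (Some w) q \<Longrightarrow> z \<in> Some -` D - {w} \<Longrightarrow> p (Some z) \<le> q (Some z)"
        "g (Some w) (Some w) = \<infinity>"
        using green_functionE[OF g wD] by metis
      have wS: "w \<in> S"
        using wD by (simp add: S_def)
      obtain c0 r0 where B0: "(c0, r0) \<in> \<B>" "w \<in> ball c0 r0" "cball c0 r0 \<subseteq> S"
        using B(3)[OF S wS order_refl] by auto
      have r0: "0 < r0"
        using B(2)[OF B0(1)] by simp
      show ?thesis
      proof (cases "z = w")
        case True
        have "disc_green c0 r0 w w = \<infinity>"
          by (rule disc_green_diagonal) (use B0 r0 in auto)
        then have "s w w = \<infinity>"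
          using disc_le[OF B0(1), of w w] by (simp add: top_unique)
        then show ?thesis
          using True p(4) by simp
      next
        case False
        have Ppos: "0 \<le> p (Some x)" if "x \<in> S - {w}" for x
          using green_competitorD(2)[OF p(1)] that unfolding S_def by blast
        have sle: "s x w \<le> ennreal (p (Some x))" if x: "x \<in> S - {w}" for x
          unfolding s_def
        proof (rule SUP_least)
          fix n
          have "enn2ereal (swept_kernel (ls n) x w) \<le> g (Some x) (Some w)"
            by (rule swept_kernel_le_green[OF D g discs _ wD]) (use x in \<open>auto simp: S_def\<close>)
          also have "\<dots> = ereal (p (Some x))"
            using p(2) x unfolding S_def by blast
          finally show "swept_kernel (ls n) x w \<le> ennreal (p (Some x))"
            using Ppos[OF x] by (metis enn2ereal_ennreal less_eq_ennreal.rep_eq)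
        qed
        define q where "q x = enn2real (s x w)" for x
        have [measurable]: "q \<in> borel_measurable borel"
          unfolding q_def[abs_def] by measurable
        have sq: "s x w = ennreal (q x)" if "x \<in> S - {w}" for x
          using sle[OF that] unfolding q_def by (metis ennreal_enn2real ennreal_less_top le_less_trans)
        have q0: "0 \<le> q x" for x
          by (simp add: q_def)
        have qp: "q x \<le> p (Some x)" if "x \<in> S - {w}" for x
          using sle[OF that] Ppos[OF that] unfolding sq[OF that] by (simp add: ennreal_le_iff)
        have open': "open (S - {w})"
          using S by auto
        have contp: "continuous_on (S - {w}) (\<lambda>x. p (Some x))"
        proof (rule continuous_at_imp_continuous_on, rule ballI)
          fix x assume "x \<in> S - {w}"
          then show "isCont (\<lambda>x. p (Some x)) x"
            using green_competitorD(1)[OF p(1)] re_holomorphic_near_isCont unfolding S_def by blast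
        qed
        have q_hol: "\<exists>e>0. re_holomorphic_near q x e" if x: "x \<in> S - {w}" for x
        proof -
          obtain c r where cr: "(c, r) \<in> \<B>" "x \<in> ball c r" "cball c r \<subseteq> S - {w}"
            using B(3)[OF open' x] by auto
          have r: "0 < r"
            using B(2)[OF cr(1)] by simp
          have cw: "r \<le> dist c w"
          proof (rule ccontr)
            assume "\<not> r \<le> dist c w"
            then have "w \<in> cball c r"
              by simp
            with cr(3) show False
              by blast
          qed
          have sph: "y \<in> S - {w}" if "dist c y \<le> r" for y
            using cr(3) that by auto
          have "bounded ((\<lambda>x. p (Some x)) ` cball c r)"
            by (intro compact_imp_bounded compact_continuous_image continuous_on_subset[OF contp] cr) auto
          then obtain K where K: "\<And>y. y \<in> cball c r \<Longrightarrow> \<bar>p (Some y)\<bar> \<le> K"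
            unfolding bounded_iff by (metis image_eqI real_norm_def)
          have bd: "\<bar>q y\<bar> \<le> K" if "dist c y = r" for y
            using K[of y] qp[OF sph[of y]] q0[of y] that by auto
          \<comment> \<open>The chosen disc avoids \<open>w\<close>, so the limit equals its own
            Poisson integral there; this is its harmonicity.\<close>
          have "q y = poisson_modification c r q y" if y: "dist c y < r" for y
          proof -
            have "ennreal (q y) = s y w"
              using sq[OF sph[of y]] y by simp
            also have "\<dots> = sweep c r (\<lambda>x. s x w) y"
              by (rule fix_sweep[OF cr(1) cw])
            also have "\<dots> = sweep c r (\<lambda>x. ennreal (q x)) y"
              by (rule sweep_cong) (use sq sph y r in auto)
            also have "\<dots> = ennreal (poisson_modification c r q y)"
              by (rule sweep_ennreal[OF _ bd r]) (use q0 in auto)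
            finally show ?thesis
              using q0 sweep_ennreal(2)[where z=y, OF _ bd r] by (simp add: ennreal_inj)
          qed
          then have "re_holomorphic_near q c r \<longleftrightarrow> re_holomorphic_near (poisson_modification c r q) c r"
            by (intro re_holomorphic_near_cong) auto
          then have "re_holomorphic_near q c r"
            using poisson_modification_re_holomorphic[OF _ bd r] by simp
          then have "re_holomorphic_near q x (r - dist c x)"
            by (rule re_holomorphic_near_subset) (simp add: ball_subset_ball_iff dist_commute)
          then show ?thesis
            using cr(2) by (intro exI[of _ "r - dist c x"]) auto
        qed
        obtain d C where dC: "d > 0" "\<And>x. x \<noteq> w \<Longrightarrow> dist x w < d \<Longrightarrow> \<bar>p (Some x) + ln (norm (x - w))\<bar> \<le> C"
          using green_competitorD(3)[OF p(1)] by metis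
        define bb where "bb = (w - c0) / complex_of_real r0"
        have nb: "norm bb < 1"
          using B0(2) r0 by (simp add: bb_def norm_scaled_less_1_iff)
        \<comment> \<open>Near \<open>w\<close>, \<open>disc_le\<close> gives \<open>q x \<ge> ln
          (norm (1 - aa * cnj bb)) - ln (norm (x - w) / r0)\<close>, and
          \<open>norm (1 - aa * cnj bb) \<ge> 1 - norm bb\<close>.\<close>
        define C1 where "C1 = \<bar>ln (1 - norm bb) + ln r0\<bar>"
        define d1 where "d1 = min d (r0 - dist c0 w)"
        have d1: "0 < d1"
          using dC(1) B0(2) by (simp add: d1_def)
        have qpole: "\<bar>q x + ln (norm (x - w))\<bar> \<le> max C C1" if x: "x \<noteq> w" "dist x w < d1" for x
        proof -
          have xb: "dist c0 x < r0"
            using x(2) dist_triangle[of c0 x w] by (simp add: d1_def dist_commute)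
          then have xS: "x \<in> S - {w}"
            using B0(3) x(1) by auto
          have "q x + ln (norm (x - w)) \<le> C"
            using qp[OF xS] dC(2)[of x] x by (auto simp: d1_def)
          moreover have "- C1 \<le> q x + ln (norm (x - w))"
          proof -
            define aa where "aa = (x - c0) / complex_of_real r0"
            have na: "norm aa < 1"
              using xb r0 by (simp add: aa_def norm_scaled_less_1_iff)
            have dif: "norm (aa - bb) = norm (x - w) / r0"
              using r0 by (simp add: aa_def bb_def diff_divide_distrib[symmetric] norm_divide)
            have "norm (aa * cnj bb) \<le> 1 * norm bb"
              unfolding norm_mult using na by (intro mult_mono) auto
            then have "1 - norm bb \<le> norm (1 - aa * cnj bb)"
              using norm_triangle_ineq2[of 1 "aa * cnj bb"] by simp
            then have ln1: "ln (1 - norm bb) \<le> ln (norm (1 - aa * cnj bb))"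
              using nb by (intro ln_mono) auto
            have "ennreal (ln (norm (1 - aa * cnj bb)) - ln (norm (aa - bb))) \<le> ennreal (q x)"
              using disc_le[OF B0(1), of x w] disc_green_eq[OF r0 xb _ x(1)] B0(2)
              unfolding sq[OF xS] aa_def bb_def by simp
            then have "ln (norm (1 - aa * cnj bb)) - ln (norm (aa - bb)) \<le> q x"
              using q0[of x] by (auto simp: ennreal_le_iff2)
            then show ?thesis
              using ln1 x(1) r0 unfolding dif C1_def by (simp add: ln_div)
          qed
          ultimately show ?thesis
            by (auto simp: abs_le_iff le_max_iff_disj)
        qed
        obtain P where P: "green_competitor D (Some w) P" "\<And>x. P (Some x) = q x"
          by (rule green_competitor_extension[OF p(1) q_hol[unfolded S_def] q0 qp[unfolded S_def] d1 qpole]) (assumption+, rule that)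
        have zS: "z \<in> S - {w}"
          using zD False by (simp add: S_def)
        \<comment> \<open>\<open>p \<le> q\<close> by minimality, as \<open>q\<close> extends to a
          competitor; \<open>q \<le> p\<close> because all swept kernels are below
          \<open>g\<close>.\<close>
        then have "p (Some z) = q z"
          using p(3)[OF P(1), of z] P(2) qp[OF zS] unfolding S_def by force
        then show ?thesis
          using p(2)[of z] zS sq[OF zS] q0 unfolding S_def by simp
      qed
    qed
    with discs inc show thesis
      unfolding s_def by (rule that)
  qed
qed

section \<open>Strict positivity of the Green energy\<close>

text \<open>For open \<open>V\<close>, \<open>f n z\<close> is the proportion of centres
  \<open>c\<close> near \<open>z\<close> whose disc of radius \<open>s n\<close> lies in
  \<open>V\<close>. By Tonelli its integral depends only on the masses of these discs, and
  \<open>f n\<close> tends to the indicator of \<open>V\<close>; so the measures agree on open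
  sets.\<close>

lemma measures_eqI_balls:
  fixes \<mu> \<nu> :: "complex measure"
  assumes fin: "finite_measure \<mu>" "finite_measure \<nu>" and sets: "sets \<mu> = sets borel" "sets \<nu> = sets borel"
    and s0: "s0 > 0" and eq: "\<And>c s. 0 < s \<Longrightarrow> s < s0 \<Longrightarrow> emeasure \<mu> (ball c s) = emeasure \<nu> (ball c s)"
  shows "\<mu> = \<nu>"
proof -
  note [measurable_cong] = sets
  have open_eq: "emeasure \<mu> V = emeasure \<nu> V" if V: "open V" for V
  proof -
    \<comment> \<open>\<open>n + 2\<close> keeps all radii strictly below \<open>s0\<close>.\<close>
    define s where "s n = s0 / real (n + 2)" for n
    have s: "0 < s n" "s n < s0" for n
      using s0 by (auto simp: s_def field_simps intro: add_pos_nonneg)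
    have s_lim: "s \<longlonglongrightarrow> 0"
    proof -
      have "(\<lambda>n. s0 / real n) \<longlonglongrightarrow> 0"
        by (rule lim_const_over_n)
      from LIMSEQ_ignore_initial_segment[OF this, of 2] show ?thesis
        by (simp add: s_def[abs_def])
    qed
    define Vs where "Vs n = {c. ball c (s n) \<subseteq> V}" for n
    have "closed (Vs n)" for n
    proof -
      have "- Vs n = (\<Union>z\<in>- V. ball z (s n))"
        by (auto simp: Vs_def subset_iff dist_commute)
      then show ?thesis
        by (simp add: closed_def open_UN)
    qed
    then have [measurable]: "Vs n \<in> sets borel" for n
      by simp
    define f where "f n z = emeasure lborel (ball z (s n) \<inter> Vs n) / emeasure lborel (ball (0::complex) (s n))" for n z
    have vol: "emeasure lborel (ball z (s n)) = emeasure lborel (ball (0::complex) (s n))" for n and z :: complex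
      using s[of n] by (simp add: emeasure_ball)
    have vol0: "emeasure lborel (ball (0::complex) (s n)) \<noteq> 0" "emeasure lborel (ball (0::complex) (s n)) \<noteq> \<infinity>" for n
      using s[of n] unit_ball_vol_pos[of 2] by (auto simp: emeasure_ball zero_less_mult_iff simp del: unit_ball_vol_pos)
    have f_eq: "f n z = (\<integral>\<^sup>+c. indicator {z. dist c z < s n} z * indicator (Vs n) c \<partial>lborel) / emeasure lborel (ball (0::complex) (s n))" for n z
    proof -
      have "emeasure lborel (ball z (s n) \<inter> Vs n) = (\<integral>\<^sup>+c. indicator (ball z (s n) \<inter> Vs n) c \<partial>lborel)"
        by (rule nn_integral_indicator[symmetric]) simp
      also have "\<dots> = (\<integral>\<^sup>+c. indicator {z. dist c z < s n} z * indicator (Vs n) c \<partial>lborel)"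
        by (rule nn_integral_cong) (auto simp: indicator_def dist_commute)
      finally show ?thesis
        by (simp add: f_def)
    qed
    have [measurable]: "f n \<in> borel_measurable borel" for n
      unfolding f_eq[abs_def] by measurable
    have int_f: "(\<integral>\<^sup>+z. f n z \<partial>M) = (\<integral>\<^sup>+c. emeasure M (ball c (s n)) * indicator (Vs n) c \<partial>lborel) / emeasure lborel (ball (0::complex) (s n))"
      if M: "finite_measure M" and [measurable_cong]: "sets M = sets borel" for M n
    proof -
      interpret M: finite_measure M by (rule M)
      interpret pair_sigma_finite lborel M ..
      have "(\<integral>\<^sup>+z. \<integral>\<^sup>+c. indicator {z. dist c z < s n} z * indicator (Vs n) c \<partial>lborel \<partial>M)
          = (\<integral>\<^sup>+c. \<integral>\<^sup>+z. indicator {z. dist c z < s n} z * indicator (Vs n) c \<partial>M \<partial>lborel)"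
        by (rule Fubini') measurable
      also have "\<dots> = (\<integral>\<^sup>+c. emeasure M (ball c (s n)) * indicator (Vs n) c \<partial>lborel)"
      proof (rule nn_integral_cong)
        fix c :: complex
        have "ball c (s n) = {z. dist c z < s n}"
          by auto
        then have "emeasure M (ball c (s n)) = (\<integral>\<^sup>+z. indicator {z. dist c z < s n} z \<partial>M)"
          by (simp add: nn_integral_indicator[symmetric] del: nn_integral_indicator)
        then show "(\<integral>\<^sup>+z. indicator {z. dist c z < s n} z * indicator (Vs n) c \<partial>M) = emeasure M (ball c (s n)) * indicator (Vs n) c"
          by (subst nn_integral_multc) auto
      qed
      finally show ?thesis
        unfolding f_eq by (subst nn_integral_divide) auto
    qed
    have f1: "f n z \<le> 1" for n z
    proof -
      have "emeasure lborel (ball z (s n) \<inter> Vs n) \<le> emeasure lborel (ball z (s n))"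
        by (intro emeasure_mono) auto
      then show ?thesis
        using divide_right_mono_ennreal[of "emeasure lborel (ball z (s n) \<inter> Vs n)" "emeasure lborel (ball z (s n))"
            "emeasure lborel (ball (0::complex) (s n))"]
          ennreal_divide_self[OF vol0(1)[of n]] vol0(2)[of n]
        unfolding f_def vol[where z=z and n=n] by (simp add: less_top)
    qed
    have f_lim: "(\<lambda>n. f n z) \<longlonglongrightarrow> indicator V z" for z
    proof (cases "z \<in> V")
      case True
      then obtain e where e: "e > 0" "ball z e \<subseteq> V"
        using V openE by blast
      have "eventually (\<lambda>n. s n < e / 2) sequentially"
        using order_tendstoD(2)[OF s_lim, of "e / 2"] e by simp
      then have "eventually (\<lambda>n. f n z = 1) sequentially"
      proof eventually_elim
        case (elim n)
        have "ball z (s n) \<subseteq> Vs n"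
        proof
          fix c assume c: "c \<in> ball z (s n)"
          then have "ball c (s n) \<subseteq> ball z e"
            using elim by (auto simp: ball_subset_ball_iff dist_commute)
          then show "c \<in> Vs n"
            using e(2) by (auto simp: Vs_def)
        qed
        then have "ball z (s n) \<inter> Vs n = ball z (s n)"
          by blast
        then show ?case
          unfolding f_def using vol0[of n] vol[where z=z and n=n] by (simp add: ennreal_divide_self less_top)
      qed
      then have "(\<lambda>n. f n z) \<longlonglongrightarrow> 1"
        by (rule tendsto_eventually)
      then show ?thesis
        using True by simp
    next
      case False
      have "ball z (s n) \<inter> Vs n = {}" for n
        using False by (auto simp: Vs_def subset_iff dist_commute)
      then show ?thesis
        using False by (simp add: f_def)
    qed
    have lim: "(\<lambda>n. \<integral>\<^sup>+z. f n z \<partial>M) \<longlonglongrightarrow> emeasure M V"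
      if M: "finite_measure M" and [measurable_cong]: "sets M = sets borel" for M
    proof -
      interpret M: finite_measure M by (rule M)
      have [measurable]: "V \<in> sets M"
        using V that(2) by simp
      have "(\<lambda>n. \<integral>\<^sup>+z. f n z \<partial>M) \<longlonglongrightarrow> (\<integral>\<^sup>+z. indicator V z \<partial>M)"
        by (rule nn_integral_dominated_convergence[where w="\<lambda>_. 1"])
          (use f1 f_lim V M.emeasure_finite in \<open>auto simp: less_top[symmetric]\<close>)
      then show ?thesis
        using V that(2) by (subst (asm) nn_integral_indicator) auto
    qed
    have "(\<integral>\<^sup>+z. f n z \<partial>\<mu>) = (\<integral>\<^sup>+z. f n z \<partial>\<nu>)" for n
      unfolding int_f[OF fin(1) sets(1)] int_f[OF fin(2) sets(2)] using eq[OF s] by simp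
    note int_eq = this
    show ?thesis
      using lim[OF fin(1) sets(1)] lim[OF fin(2) sets(2)] unfolding int_eq by (rule LIMSEQ_unique)
  qed
  show ?thesis
  proof (rule measure_eqI_generator_eq[where E="{V. open V}" and \<Omega>=UNIV and A="\<lambda>_. UNIV"])
    show "Int_stable {V :: complex set. open V}"
      by (auto simp: Int_stable_def)
    show "sets \<mu> = sigma_sets UNIV {V. open V}" "sets \<nu> = sigma_sets UNIV {V. open V}"
      unfolding sets borel_def by (rule sets_measure_of, simp)+
    show "emeasure \<mu> UNIV \<noteq> \<infinity>"
      using finite_measure.emeasure_finite[OF fin(1)] by auto
  qed (use open_eq in auto)
qed

section \<open>Sum of squares representation of the swept kernels\<close>

fun sweep_factor :: "(complex \<times> real) list \<Rightarrow> nat \<Rightarrow> complex \<Rightarrow> real \<times> complex \<Rightarrow> ennreal" where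
  "sweep_factor [] i z p = 0"
| "sweep_factor ((c, r) # l) 0 z p = disc_factor c r z p"
| "sweep_factor ((c, r) # l) (Suc i) z p = sweep c r (\<lambda>x. sweep_factor l i x p) z"

abbreviation disc_measure :: "(real \<times> complex) measure" where
  "disc_measure \<equiv> lborel \<Otimes>\<^sub>M circle_measure"

lemma measurable_sweep_factor [measurable]:
  "(\<lambda>(z, p). sweep_factor l i z p) \<in> borel_measurable (borel \<Otimes>\<^sub>M disc_measure)"
proof (induction l arbitrary: i)
  case Nil
  have "sweep_factor [] i = (\<lambda>_ _. 0)"
    by (intro ext) simp
  then show ?case
    by simp
next
  case (Cons a l)
  obtain c r where a: "a = (c, r)"
    by force
  show ?case
  proof (cases i)
    case (Suc j)
    show ?thesis
      unfolding a Suc sweep_factor.simps by (rule measurable_sweep[OF Cons])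
  next
    case 0
    have "sweep_factor (a # l) 0 = disc_factor c r"
      by (intro ext) (simp add: a)
    then show ?thesis
      by (simp add: 0)
  qed
qed

lemma measurable_sweep_factor1 [measurable]: "(\<lambda>z. sweep_factor l i z p) \<in> borel_measurable borel"
proof -
  have "p \<in> space disc_measure"
    by (simp add: space_pair_measure)
  from measurable_compose[OF measurable_Pair2'[OF this] measurable_sweep_factor[of l i]] show ?thesis
    by simp
qed

lemma sweep_nn_integral:
  assumes M: "sigma_finite_measure M" and [measurable]: "(\<lambda>(y, p). k y p) \<in> borel_measurable (borel \<Otimes>\<^sub>M M)"
  shows "sweep c r (\<lambda>y. \<integral>\<^sup>+p. k y p \<partial>M) w = (\<integral>\<^sup>+p. sweep c r (\<lambda>y. k y p) w \<partial>M)"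
proof (cases "dist c w < r")
  case True
  interpret M: sigma_finite_measure M by (rule M)
  interpret pair_sigma_finite circle_measure M ..
  let ?p = "\<lambda>\<xi>. ennreal (poisson ((w - c) / of_real r) \<xi>)"
  have "(\<integral>\<^sup>+\<xi>. ?p \<xi> * (\<integral>\<^sup>+p. k (c + of_real r * \<xi>) p \<partial>M) \<partial>circle_measure)
      = (\<integral>\<^sup>+\<xi>. \<integral>\<^sup>+p. ?p \<xi> * k (c + of_real r * \<xi>) p \<partial>M \<partial>circle_measure)"
    by (subst nn_integral_cmult) auto
  also have "\<dots> = (\<integral>\<^sup>+p. \<integral>\<^sup>+\<xi>. ?p \<xi> * k (c + of_real r * \<xi>) p \<partial>circle_measure \<partial>M)"
    by (rule Fubini'[symmetric]) measurable
  finally show ?thesis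
    using True by (simp add: sweep_def)
qed (simp add: sweep_def)

lemma sweep_cmult:
  assumes [measurable]: "u \<in> borel_measurable borel"
  shows "sweep c r (\<lambda>x. a * u x) z = a * sweep c r u z"
  unfolding sweep_def by (simp add: nn_integral_cmult[symmetric] ac_simps)

lemma sweep_sum:
  fixes u :: "nat \<Rightarrow> complex \<Rightarrow> ennreal"
  assumes [measurable]: "\<And>i. u i \<in> borel_measurable borel"
  shows "sweep c r (\<lambda>x. \<Sum>i<n. u i x) z = (\<Sum>i<n. sweep c r (u i) z)"
  by (induction n) (simp_all add: sweep_add, simp add: sweep_def)

text \<open>Sweeping a product of a function of \<open>z\<close> and one of \<open>w\<close> in both
  variables sweeps each factor separately. So every disc retains the form of a square, with its
  \<open>disc_factor\<close> swept by the discs in front of it in the list.\<close>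

lemma swept_kernel_eq_sum:
  "swept_kernel l z w = (\<Sum>i<length l. \<integral>\<^sup>+p. sweep_factor l i z p * sweep_factor l i w p \<partial>disc_measure)"
proof (induction l arbitrary: z w)
  case (Cons a l)
  interpret P: sigma_finite_measure disc_measure
    by (rule sigma_finite_disc_measure)
  obtain c r where a: "a = (c, r)"
    by force
  have [measurable]: "(\<lambda>(w, p). sweep c r (\<lambda>y. sweep_factor l i y p) w) \<in> borel_measurable (borel \<Otimes>\<^sub>M disc_measure)" for i
    by (rule measurable_sweep) measurable
  have 1: "sweep c r (\<lambda>y. swept_kernel l x y) w =
      (\<Sum>i<length l. \<integral>\<^sup>+p. sweep_factor l i x p * sweep c r (\<lambda>y. sweep_factor l i y p) w \<partial>disc_measure)" for x
  proof -
    have "sweep c r (\<lambda>y. swept_kernel l x y) w = (\<Sum>i<length l. sweep c r (\<lambda>y. \<integral>\<^sup>+p. sweep_factor l i x p * sweep_factor l i y p \<partial>disc_measure) w)"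
      unfolding Cons by (rule sweep_sum) measurable
    also have "\<dots> = (\<Sum>i<length l. \<integral>\<^sup>+p. sweep c r (\<lambda>y. sweep_factor l i x p * sweep_factor l i y p) w \<partial>disc_measure)"
      by (intro sum.cong sweep_nn_integral sigma_finite_disc_measure) measurable
    also have "\<dots> = (\<Sum>i<length l. \<integral>\<^sup>+p. sweep_factor l i x p * sweep c r (\<lambda>y. sweep_factor l i y p) w \<partial>disc_measure)"
      by (intro sum.cong nn_integral_cong sweep_cmult) measurable
    finally show ?thesis .
  qed
  have "sweep c r (\<lambda>x. sweep c r (\<lambda>y. swept_kernel l x y) w) z = (\<Sum>i<length l. sweep c r (\<lambda>x. \<integral>\<^sup>+p. sweep_factor l i x p * sweep c r (\<lambda>y. sweep_factor l i y p) w \<partial>disc_measure) z)"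
    unfolding 1 by (rule sweep_sum) measurable
  also have "\<dots> = (\<Sum>i<length l. \<integral>\<^sup>+p. sweep c r (\<lambda>x. sweep_factor l i x p * sweep c r (\<lambda>y. sweep_factor l i y p) w) z \<partial>disc_measure)"
    by (intro sum.cong sweep_nn_integral sigma_finite_disc_measure) measurable
  also have "\<dots> = (\<Sum>i<length l. \<integral>\<^sup>+p. sweep c r (\<lambda>x. sweep_factor l i x p) z * sweep c r (\<lambda>y. sweep_factor l i y p) w \<partial>disc_measure)"
  proof (intro sum.cong nn_integral_cong refl)
    fix i p
    have "sweep c r (\<lambda>x. sweep c r (\<lambda>y. sweep_factor l i y p) w * sweep_factor l i x p) z
        = sweep c r (\<lambda>y. sweep_factor l i y p) w * sweep c r (\<lambda>x. sweep_factor l i x p) z"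
      by (rule sweep_cmult) measurable
    then show "sweep c r (\<lambda>x. sweep_factor l i x p * sweep c r (\<lambda>y. sweep_factor l i y p) w) z
        = sweep c r (\<lambda>x. sweep_factor l i x p) z * sweep c r (\<lambda>y. sweep_factor l i y p) w"
      by (simp only: mult.commute)
  qed
  finally show ?case
    unfolding a swept_kernel.simps length_Cons sum.lessThan_Suc_shift sweep_factor.simps disc_green_def by (simp only:)
qed simp

definition kernel_energy :: "complex measure \<Rightarrow> (complex \<Rightarrow> complex \<Rightarrow> ennreal) \<Rightarrow> (complex \<Rightarrow> ennreal) \<Rightarrow> (complex \<Rightarrow> ennreal) \<Rightarrow> ennreal" where
  "kernel_energy M k u v = (\<integral>\<^sup>+x. \<integral>\<^sup>+y. k x y * u x * v y \<partial>M \<partial>M)"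

text \<open>Through these potentials the energy of each summand becomes an inner product on
  \<open>disc_measure\<close>.\<close>

definition factor_potential :: "complex measure \<Rightarrow> (complex \<Rightarrow> real \<times> complex \<Rightarrow> ennreal) \<Rightarrow> (complex \<Rightarrow> ennreal) \<Rightarrow> real \<times> complex \<Rightarrow> ennreal" where
  "factor_potential M a u p = (\<integral>\<^sup>+x. a x p * u x \<partial>M)"

lemma kernel_energy_swept_kernel:
  assumes M: "sigma_finite_measure M" and [measurable]: "(\<lambda>x. x) \<in> measurable M borel"
    and [measurable]: "u \<in> borel_measurable M" "v \<in> borel_measurable M"
  shows "kernel_energy M (swept_kernel l) u v =
    (\<Sum>i<length l. \<integral>\<^sup>+p. factor_potential M (sweep_factor l i) u p * factor_potential M (sweep_factor l i) v p \<partial>disc_measure)"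
proof -
  interpret M: sigma_finite_measure M by (rule M)
  interpret P: sigma_finite_measure disc_measure
    by (rule sigma_finite_disc_measure)
  interpret pair_sigma_finite M disc_measure ..
  have "kernel_energy M (swept_kernel l) u v =
      (\<Sum>i<length l. \<integral>\<^sup>+x. \<integral>\<^sup>+y. \<integral>\<^sup>+p. (sweep_factor l i x p * u x) * (sweep_factor l i y p * v y) \<partial>disc_measure \<partial>M \<partial>M)"
  proof -
    have "swept_kernel l x y * u x * v y = (\<Sum>i<length l. \<integral>\<^sup>+p. (sweep_factor l i x p * u x) * (sweep_factor l i y p * v y) \<partial>disc_measure)" for x y
    proof -
      have "(\<integral>\<^sup>+p. (sweep_factor l i x p * u x) * (sweep_factor l i y p * v y) \<partial>disc_measure)
          = (\<integral>\<^sup>+p. sweep_factor l i x p * sweep_factor l i y p \<partial>disc_measure) * u x * v y" for i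
      proof -
        have "(\<integral>\<^sup>+p. (sweep_factor l i x p * u x) * (sweep_factor l i y p * v y) \<partial>disc_measure)
            = (\<integral>\<^sup>+p. sweep_factor l i x p * sweep_factor l i y p * (u x * v y) \<partial>disc_measure)"
          by (intro nn_integral_cong) (simp only: ac_simps)
        also have "\<dots> = (\<integral>\<^sup>+p. sweep_factor l i x p * sweep_factor l i y p \<partial>disc_measure) * (u x * v y)"
          by (rule nn_integral_multc) measurable
        finally show ?thesis
          by (simp only: mult.assoc)
      qed
      then show ?thesis
        by (simp add: swept_kernel_eq_sum sum_distrib_right)
    qed
    then have "kernel_energy M (swept_kernel l) u v =
        (\<integral>\<^sup>+x. \<integral>\<^sup>+y. (\<Sum>i<length l. \<integral>\<^sup>+p. (sweep_factor l i x p * u x) * (sweep_factor l i y p * v y) \<partial>disc_measure) \<partial>M \<partial>M)"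
      unfolding kernel_energy_def by (simp only:)
    also have "\<dots> = (\<integral>\<^sup>+x. (\<Sum>i<length l. \<integral>\<^sup>+y. \<integral>\<^sup>+p. (sweep_factor l i x p * u x) * (sweep_factor l i y p * v y) \<partial>disc_measure \<partial>M) \<partial>M)"
      by (intro nn_integral_cong nn_integral_sum) measurable
    also have "\<dots> = (\<Sum>i<length l. \<integral>\<^sup>+x. \<integral>\<^sup>+y. \<integral>\<^sup>+p. (sweep_factor l i x p * u x) * (sweep_factor l i y p * v y) \<partial>disc_measure \<partial>M \<partial>M)"
      by (intro nn_integral_sum) measurable
    finally show ?thesis .
  qed
  also have "\<dots> = (\<Sum>i<length l. \<integral>\<^sup>+p. factor_potential M (sweep_factor l i) u p * factor_potential M (sweep_factor l i) v p \<partial>disc_measure)"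
  proof (rule sum.cong)
    fix i
    have "(\<integral>\<^sup>+x. \<integral>\<^sup>+y. \<integral>\<^sup>+p. (sweep_factor l i x p * u x) * (sweep_factor l i y p * v y) \<partial>disc_measure \<partial>M \<partial>M)
        = (\<integral>\<^sup>+x. \<integral>\<^sup>+p. \<integral>\<^sup>+y. (sweep_factor l i x p * u x) * (sweep_factor l i y p * v y) \<partial>M \<partial>disc_measure \<partial>M)"
      by (intro nn_integral_cong Fubini'[symmetric]) measurable
    also have "\<dots> = (\<integral>\<^sup>+x. \<integral>\<^sup>+p. (sweep_factor l i x p * u x) * factor_potential M (sweep_factor l i) v p \<partial>disc_measure \<partial>M)"
      unfolding factor_potential_def by (intro nn_integral_cong nn_integral_cmult) measurable
    also have "\<dots> = (\<integral>\<^sup>+p. \<integral>\<^sup>+x. (sweep_factor l i x p * u x) * factor_potential M (sweep_factor l i) v p \<partial>M \<partial>disc_measure)"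
      unfolding factor_potential_def by (intro Fubini'[symmetric]) measurable
    also have "\<dots> = (\<integral>\<^sup>+p. factor_potential M (sweep_factor l i) u p * factor_potential M (sweep_factor l i) v p \<partial>disc_measure)"
      unfolding factor_potential_def by (intro nn_integral_cong nn_integral_multc) measurable
    finally show "(\<integral>\<^sup>+x. \<integral>\<^sup>+y. \<integral>\<^sup>+p. (sweep_factor l i x p * u x) * (sweep_factor l i y p * v y) \<partial>disc_measure \<partial>M \<partial>M)
      = (\<integral>\<^sup>+p. factor_potential M (sweep_factor l i) u p * factor_potential M (sweep_factor l i) v p \<partial>disc_measure)" .
  qed simp
  finally show ?thesis .
qed

text \<open>Subtraction in \<open>ennreal\<close> stops at 0, so for finite arguments one difference
  vanishes and the other is the absolute difference; the claim is then an equality.\<close>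

lemma ennreal_two_mult_le:
  fixes a b :: ennreal
  shows "2 * (a * b) + ((a - b) * (a - b) + (b - a) * (b - a)) \<le> a * a + b * b"
proof (cases "a = \<infinity> \<or> b = \<infinity>")
  case True
  then show ?thesis
    by (auto simp: ennreal_mult_eq_top_iff)
next
  case False
  then obtain x y where xy: "a = ennreal x" "b = ennreal y" "0 \<le> x" "0 \<le> y"
    by (metis ennreal_cases infinity_ennreal_def)
  show ?thesis
  proof (cases "x \<le> y")
    case True
    have "2 * (a * b) + ((a - b) * (a - b) + (b - a) * (b - a)) = ennreal (2 * (x * y) + (y - x) * (y - x))"
      using xy True by (simp add: ennreal_minus ennreal_mult[symmetric] ennreal_plus[symmetric] ennreal_neg numeral_mult_ennreal del: ennreal_plus)
    also have "2 * (x * y) + (y - x) * (y - x) = x * x + y * y"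
      by (simp add: algebra_simps)
    finally show ?thesis
      using xy by (simp add: ennreal_mult)
  next
    case False
    have "2 * (a * b) + ((a - b) * (a - b) + (b - a) * (b - a)) = ennreal (2 * (x * y) + (x - y) * (x - y))"
      using xy False by (simp add: ennreal_minus ennreal_mult[symmetric] ennreal_plus[symmetric] ennreal_neg numeral_mult_ennreal del: ennreal_plus)
    also have "2 * (x * y) + (x - y) * (x - y) = x * x + y * y"
      by (simp add: algebra_simps)
    finally show ?thesis
      using xy by (simp add: ennreal_mult)
  qed
qed

text \<open>The disc \<open>(c, r)\<close> stands at the head of the list because there its factor
  is unswept, hence still tied to the concentric discs. Its defect is kept; the nonnegative defects
  of the other summands are dropped.\<close>

lemma kernel_energy_swept_kernel_psd:
  fixes c :: complex and r :: real
  assumes M: "sigma_finite_measure M" and [measurable]: "(\<lambda>x. x) \<in> measurable M borel"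
    and [measurable]: "u \<in> borel_measurable M" "v \<in> borel_measurable M"
  defines "A \<equiv> factor_potential M (disc_factor c r) u" and "B \<equiv> factor_potential M (disc_factor c r) v"
  shows "2 * kernel_energy M (swept_kernel ((c, r) # l)) u v + (\<integral>\<^sup>+p. (A p - B p) * (A p - B p) + (B p - A p) * (B p - A p) \<partial>disc_measure)
    \<le> kernel_energy M (swept_kernel ((c, r) # l)) u u + kernel_energy M (swept_kernel ((c, r) # l)) v v"
proof -
  interpret M: sigma_finite_measure M by (rule M)
  let ?l = "(c, r) # l"
  let ?F = "\<lambda>i. factor_potential M (sweep_factor ?l i)"
  have meas [measurable]: "?F i w \<in> borel_measurable disc_measure" if [measurable]: "w \<in> borel_measurable M" for i w
    unfolding factor_potential_def by measurable
  define X where "X i = (\<integral>\<^sup>+p. (?F i u p - ?F i v p) * (?F i u p - ?F i v p) + (?F i v p - ?F i u p) * (?F i v p - ?F i u p) \<partial>disc_measure)" for i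
  have 1: "2 * (\<integral>\<^sup>+p. ?F i u p * ?F i v p \<partial>disc_measure) + X i
      \<le> (\<integral>\<^sup>+p. ?F i u p * ?F i u p \<partial>disc_measure) + (\<integral>\<^sup>+p. ?F i v p * ?F i v p \<partial>disc_measure)" for i
  proof -
    have "2 * (\<integral>\<^sup>+p. ?F i u p * ?F i v p \<partial>disc_measure) + X i = (\<integral>\<^sup>+p. 2 * (?F i u p * ?F i v p)
      + ((?F i u p - ?F i v p) * (?F i u p - ?F i v p) + (?F i v p - ?F i u p) * (?F i v p - ?F i u p)) \<partial>disc_measure)"
      unfolding X_def by (subst nn_integral_cmult[symmetric], measurable, rule nn_integral_add[symmetric], measurable)
    also have "\<dots> \<le> (\<integral>\<^sup>+p. ?F i u p * ?F i u p + ?F i v p * ?F i v p \<partial>disc_measure)"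
      by (intro nn_integral_mono ennreal_two_mult_le)
    also have "\<dots> = (\<integral>\<^sup>+p. ?F i u p * ?F i u p \<partial>disc_measure) + (\<integral>\<^sup>+p. ?F i v p * ?F i v p \<partial>disc_measure)"
      by (intro nn_integral_add) measurable
    finally show ?thesis .
  qed
  have F0: "sweep_factor ?l 0 = disc_factor c r"
    by (intro ext) simp
  have X0: "(\<integral>\<^sup>+p. (A p - B p) * (A p - B p) + (B p - A p) * (B p - A p) \<partial>disc_measure) = X 0"
    unfolding X_def A_def B_def F0 ..
  have "X 0 \<le> (\<Sum>i<length ?l. X i)"
    by (rule member_le_sum) auto
  then have "2 * kernel_energy M (swept_kernel ?l) u v + X 0
      \<le> (\<Sum>i<length ?l. 2 * (\<integral>\<^sup>+p. ?F i u p * ?F i v p \<partial>disc_measure)) + (\<Sum>i<length ?l. X i)"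
    unfolding kernel_energy_swept_kernel[OF assms(1-4)] sum_distrib_left by (intro add_left_mono)
  also have "\<dots> \<le> kernel_energy M (swept_kernel ?l) u u + kernel_energy M (swept_kernel ?l) v v"
    unfolding kernel_energy_swept_kernel[OF assms(1-2) assms(3) assms(3)] kernel_energy_swept_kernel[OF assms(1-2) assms(4) assms(4)]
      sum.distrib[symmetric] by (intro sum_mono 1)
  finally show ?thesis
    unfolding X0 .
qed

text \<open>The Poisson kernel has mean 1, so integrating out the circle leaves only the indicator
  of the concentric disc.\<close>

lemma nn_integral_disc_factor:
  assumes r: "r > 0" and t: "t > 0"
  shows "(\<integral>\<^sup>+\<xi>. disc_factor c r x (t, \<xi>) \<partial>circle_measure) = indicator (ball c (r * exp (- t))) x"
proof (cases "dist c x < r * exp (- t)")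
  case True
  define a where "a = (x - c) / complex_of_real (r * exp (- t))"
  have a: "norm a < 1"
    using True r unfolding a_def by (subst norm_scaled_less_1_iff) auto
  have "(\<integral>\<^sup>+\<xi>. disc_factor c r x (t, \<xi>) \<partial>circle_measure) = (\<integral>\<^sup>+\<xi>. ennreal (poisson a \<xi>) * ennreal 1 \<partial>circle_measure)"
    using True t by (simp add: disc_factor_def a_def)
  also have "\<dots> = ennreal (Re 1)"
    by (rule nn_integral_poisson_mult[where S=UNIV]) (use a in auto)
  finally show ?thesis
    using True by simp
qed (simp add: disc_factor_def)

lemma kernel_energy_mono:
  assumes "\<And>x y. x \<in> space M \<Longrightarrow> y \<in> space M \<Longrightarrow> k x y \<le> k' x y"
  shows "kernel_energy M k u v \<le> kernel_energy M k' u v"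
  unfolding kernel_energy_def using assms by (intro nn_integral_mono mult_right_mono) auto

text \<open>Integrating the factor potential over the circle gives, for almost every \<open>\<tau>\<close>, the mass of the concentric
  disc of radius \<open>r * exp (- \<tau>)\<close>.\<close>

lemma factor_potential_eq_imp_ball_eq:
  assumes M: "sigma_finite_measure M" and [measurable]: "(\<lambda>x. x) \<in> measurable M borel"
    and [measurable]: "u \<in> borel_measurable M" "v \<in> borel_measurable M" and r: "r > 0"
    and eq: "AE p in disc_measure. factor_potential M (disc_factor c r) u p = factor_potential M (disc_factor c r) v p"
  shows "(\<integral>\<^sup>+x. indicator (ball c r) x * u x \<partial>M) = (\<integral>\<^sup>+x. indicator (ball c r) x * v x \<partial>M)"
proof -
  interpret M: sigma_finite_measure M by (rule M)
  interpret pair_sigma_finite M circle_measure ..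
  interpret circle_pair: pair_sigma_finite lborel "circle_measure :: complex measure" ..
  define m where "m w s = (\<integral>\<^sup>+x. indicator (ball c s) x * w x \<partial>M)" for w s
  have m_mono: "m w s \<le> m w s'" if "s \<le> s'" for w s s'
    unfolding m_def using that by (intro nn_integral_mono mult_right_mono) (auto simp: indicator_def)
  have mass: "(\<integral>\<^sup>+\<xi>. factor_potential M (disc_factor c r) w (t, \<xi>) \<partial>circle_measure) = m w (r * exp (- t))"
    if t: "t > 0" and [measurable]: "w \<in> borel_measurable M" for t w
  proof -
    have "(\<integral>\<^sup>+\<xi>. factor_potential M (disc_factor c r) w (t, \<xi>) \<partial>circle_measure)
        = (\<integral>\<^sup>+x. \<integral>\<^sup>+\<xi>. disc_factor c r x (t, \<xi>) * w x \<partial>circle_measure \<partial>M)"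
      unfolding factor_potential_def by (rule Fubini') measurable
    also have "\<dots> = m w (r * exp (- t))"
      unfolding m_def by (simp add: nn_integral_multc nn_integral_disc_factor[OF r t])
    finally show ?thesis .
  qed
  have "AE t in lborel. AE \<xi> in circle_measure. factor_potential M (disc_factor c r) u (t, \<xi>) = factor_potential M (disc_factor c r) v (t, \<xi>)"
    by (rule circle_pair.AE_pair[OF eq])
  then have ae: "AE t in lborel. 0 < t \<longrightarrow> m u (r * exp (- t)) = m v (r * exp (- t))"
  proof eventually_elim
    case (elim t)
    show ?case
      using nn_integral_cong_AE[OF elim] mass[of t u] mass[of t v] by simp
  qed
  \<comment> \<open>Equality for almost every \<open>t\<close> gives equality somewhere in each
    interval; as the masses are monotone in the radius, letting \<open>t\<close> tend to 0 recovers
    the full disc.\<close>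
  have dense: "\<exists>t. a < t \<and> t < b \<and> m u (r * exp (- t)) = m v (r * exp (- t))" if ab: "0 \<le> a" "a < b" for a b
  proof (rule ccontr)
    assume no: "\<not> ?thesis"
    have "AE t in lborel. t \<notin> {a<..<b}"
      using ae
      by eventually_elim (use no ab in auto)
    then have "emeasure lborel {a<..<b} = 0"
      by (subst (asm) AE_iff_measurable[where N="{a<..<b}"]) auto
    with ab show False
      by simp
  qed
  have le: "m u r \<le> m v r" if [measurable]: "u \<in> borel_measurable M" "v \<in> borel_measurable M"
    and dense: "\<And>a b. 0 \<le> a \<Longrightarrow> a < b \<Longrightarrow> \<exists>t. a < t \<and> t < b \<and> m u (r * exp (- t)) = m v (r * exp (- t))" for u v
  proof -
    define s where "s n = r * exp (- (1 / real (Suc n)))" for n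
    have s_inc: "incseq s"
      unfolding s_def using r by (intro incseq_SucI mult_left_mono) (auto simp: field_simps)
    have s_lim: "s \<longlonglongrightarrow> r"
    proof -
      have "(\<lambda>n. r * exp (- inverse (real (Suc n)))) \<longlonglongrightarrow> r * exp (- 0)"
        by (intro tendsto_intros LIMSEQ_inverse_real_of_nat)
      then show ?thesis
        by (simp add: s_def[abs_def] inverse_eq_divide)
    qed
    have s_lt: "s n < r" for n
      using r by (simp add: s_def)
    have sup: "(SUP n. indicator (ball c (s n)) x * u x) = indicator (ball c r) x * u x" for x
    proof (cases "dist c x < r")
      case True
      then obtain n where "dist c x < s n"
        using order_tendstoD(1)[OF s_lim True] by (auto simp: eventually_sequentially)
      then show ?thesis
        using True by (intro antisym SUP_least SUP_upper2[of n]) (auto simp: indicator_def)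
    next
      case False
      then have "\<not> dist c x < s n" for n
        using s_lt[of n] by linarith
      then show ?thesis
        using False by (simp add: indicator_def)
    qed
    have "m u r = (SUP n. m u (s n))"
      unfolding m_def sup[symmetric]
    proof (rule nn_integral_monotone_convergence_SUP)
      show "incseq (\<lambda>n x. indicator (ball c (s n)) x * u x)"
        using s_inc by (auto simp: incseq_def le_fun_def indicator_def intro: less_le_trans)
      have [measurable]: "u \<in> borel_measurable M"
        by fact
      have [measurable]: "(\<lambda>x. indicator (ball c (s n)) x :: ennreal) \<in> borel_measurable M" for n
        by (rule measurable_compose[OF assms(2) borel_measurable_indicator]) simp
      show "(\<lambda>x. indicator (ball c (s n)) x * u x) \<in> borel_measurable M" for n
        by measurable
    qed
    also have "\<dots> \<le> m v r"
    proof (rule SUP_least)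
      fix n
      obtain t where t: "0 < t" "t < 1 / real (Suc n)" "m u (r * exp (- t)) = m v (r * exp (- t))"
        using dense[of 0 "1 / real (Suc n)"] by auto
      have "m u (s n) \<le> m u (r * exp (- t))"
        using t r by (intro m_mono) (simp add: s_def)
      also have "\<dots> \<le> m v r"
        unfolding t(3) using t(1) r by (intro m_mono) simp
      finally show "m u (s n) \<le> m v r" .
    qed
    finally show ?thesis .
  qed
  have "m u r = m v r"
    using le[of u v] le[of v u] dense assms(3,4) by (metis antisym)
  then show ?thesis
    by (simp add: m_def)
qed

section \<open>Positive definiteness of the Green energy\<close>

locale green_setting =
  fixes D :: "complex option set" and g :: "complex option \<Rightarrow> complex option \<Rightarrow> ereal"
    and K :: "complex set" and M :: "complex measure" and k :: "complex \<Rightarrow> complex \<Rightarrow> ennreal"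
    and ls :: "nat \<Rightarrow> (complex \<times> real) list"
  assumes D: "openin riemann_sphere D" and green: "is_green_function D g"
    and K: "compact K" "Some ` K \<subseteq> D" "K \<noteq> {}"
    and M: "finite_measure M" and sets_M: "sets M = sets (restrict_space borel K)"
    and ls: "\<And>n c r. (c, r) \<in> set (ls n) \<Longrightarrow> 0 < r \<and> cball c r \<subseteq> Some -` D"
    and inc: "\<And>z w. incseq (\<lambda>n. swept_kernel (ls n) z w)"
    and g_eq: "\<And>z w. Some z \<in> D \<Longrightarrow> Some w \<in> D \<Longrightarrow> g (Some z) (Some w) = enn2ereal (k z w)"
    and k_def: "\<And>z w. k z w = (SUP n. swept_kernel (ls n) z w)"
begin

sublocale finite_measure M
  by (rule M)

lemma space_M: "space M = K"
  using sets_eq_imp_space_eq[OF sets_M] by (simp add: space_restrict_space)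

lemma id_measurable [measurable]: "(\<lambda>x. x) \<in> measurable M borel"
proof -
  have "(\<lambda>x. x) \<in> measurable (restrict_space borel K) borel"
    by (rule measurable_restrict_space1) simp
  then show ?thesis
    by (subst measurable_cong_sets[OF sets_M refl])
qed

lemma in_D: "x \<in> space M \<Longrightarrow> Some x \<in> D"
  using K space_M by auto

lemma measurable_kernel [measurable]: "(\<lambda>(x, y). k x y) \<in> borel_measurable (borel \<Otimes>\<^sub>M borel)"
  unfolding k_def by measurable

text \<open>The minimality that defines the Green function treats pole and argument differently;
  symmetry is inherited from the swept kernels.\<close>

lemma kernel_commute: "k x y = k y x"
  unfolding k_def by (subst swept_kernel_commute) (rule refl)

lemma kernel_energy_tendsto:
  assumes [measurable]: "u \<in> borel_measurable M" "v \<in> borel_measurable M"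
  shows "(\<lambda>n. kernel_energy M (swept_kernel (ls n)) u v) \<longlonglongrightarrow> kernel_energy M k u v"
proof -
  have inc1: "incseq (\<lambda>n y. swept_kernel (ls n) x y * u x * v y)" for x
    using inc by (auto simp: incseq_def le_fun_def intro!: mult_right_mono)
  have inc2: "incseq (\<lambda>n x. \<integral>\<^sup>+y. swept_kernel (ls n) x y * u x * v y \<partial>M)"
    using inc1 by (auto simp: incseq_def le_fun_def intro!: nn_integral_mono)
  have "kernel_energy M k u v = (\<integral>\<^sup>+x. \<integral>\<^sup>+y. (SUP n. swept_kernel (ls n) x y * u x * v y) \<partial>M \<partial>M)"
    unfolding kernel_energy_def k_def by (simp add: SUP_mult_right_ennreal)
  also have "\<dots> = (\<integral>\<^sup>+x. (SUP n. \<integral>\<^sup>+y. swept_kernel (ls n) x y * u x * v y \<partial>M) \<partial>M)"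
    by (intro nn_integral_cong nn_integral_monotone_convergence_SUP inc1) measurable
  also have "\<dots> = (SUP n. kernel_energy M (swept_kernel (ls n)) u v)"
    unfolding kernel_energy_def by (intro nn_integral_monotone_convergence_SUP inc2) measurable
  finally have eq: "kernel_energy M k u v = (SUP n. kernel_energy M (swept_kernel (ls n)) u v)" .
  have "incseq (\<lambda>n. kernel_energy M (swept_kernel (ls n)) u v)"
    by (intro incseq_SucI kernel_energy_mono incseq_SucD[OF inc])
  then show ?thesis
    unfolding eq by (rule LIMSEQ_SUP)
qed

text \<open>Any disc in \<open>D\<close> may be put in front of the \<open>n\<close>-th list: the
  kernel grows by \<open>swept_kernel_le_Cons\<close> and stays below \<open>k\<close> by
  \<open>swept_kernel_le_green\<close>. So the defect of that disc survives the limit, whether or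
  not the disc occurs in the exhaustion.\<close>

lemma kernel_energy_psd_disc:
  fixes c :: complex and r :: real
  assumes [measurable]: "u \<in> borel_measurable M" "v \<in> borel_measurable M" and r: "r > 0" "cball c r \<subseteq> Some -` D"
  defines "A \<equiv> factor_potential M (disc_factor c r) u" and "B \<equiv> factor_potential M (disc_factor c r) v"
  shows "2 * kernel_energy M k u v + (\<integral>\<^sup>+p. (A p - B p) * (A p - B p) + (B p - A p) * (B p - A p) \<partial>disc_measure)
    \<le> kernel_energy M k u u + kernel_energy M k v v" (is "2 * _ + ?X \<le> ?R")
proof (rule LIMSEQ_le_const2)
  show "(\<lambda>n. 2 * kernel_energy M (swept_kernel (ls n)) u v + ?X) \<longlonglongrightarrow> 2 * kernel_energy M k u v + ?X"
    by (intro tendsto_add tendsto_const ennreal_tendsto_cmult kernel_energy_tendsto assms(1,2)) auto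
  have pos: "0 < r'" if "(c', r') \<in> set (ls n)" for n c' r'
    using ls that by blast
  have le_k: "swept_kernel ((c, r) # ls n) x y \<le> k x y" if "x \<in> space M" "y \<in> space M" for n x y
  proof -
    have "enn2ereal (swept_kernel ((c, r) # ls n) x y) \<le> g (Some x) (Some y)"
    proof (rule swept_kernel_le_green[OF D green])
      show "0 < r' \<and> cball c' r' \<subseteq> Some -` D" if "(c', r') \<in> set ((c, r) # ls n)" for c' r'
        using ls[of c' r' n] r that by (metis prod.inject set_ConsD)
    qed (use in_D that in auto)
    then show ?thesis
      unfolding g_eq[OF in_D[OF that(1)] in_D[OF that(2)]] by (simp add: less_eq_ennreal.rep_eq)
  qed
  have "2 * kernel_energy M (swept_kernel (ls n)) u v + ?X \<le> ?R" for n
  proof -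
    have "2 * kernel_energy M (swept_kernel (ls n)) u v + ?X \<le> 2 * kernel_energy M (swept_kernel ((c, r) # ls n)) u v + ?X"
      by (intro add_right_mono mult_left_mono kernel_energy_mono swept_kernel_le_Cons pos r(1)) auto
    also have "\<dots> \<le> kernel_energy M (swept_kernel ((c, r) # ls n)) u u + kernel_energy M (swept_kernel ((c, r) # ls n)) v v"
      unfolding A_def B_def by (intro kernel_energy_swept_kernel_psd id_measurable assms(1,2) sigma_finite_measure_axioms)
    also have "\<dots> \<le> ?R"
      by (intro add_mono kernel_energy_mono le_k)
    finally show ?thesis .
  qed
  then show "\<exists>N. \<forall>n\<ge>N. 2 * kernel_energy M (swept_kernel (ls n)) u v + ?X \<le> ?R"
    by blast
qed

lemma small_discs:
  obtains e where "e > 0" "\<And>x. x \<in> K \<Longrightarrow> cball x e \<subseteq> Some -` D"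
proof -
  have "open (Some -` D)" "K \<subseteq> Some -` D"
    using openin_riemann_sphere_vimage[OF D] K by auto
  then obtain e where "e > 0" "(\<Union>x\<in>K. cball x e) \<subseteq> Some -` D"
    using compact_subset_open_imp_cball_epsilon_subset[OF K(1)] by metis
  then show thesis
    by (intro that) auto
qed

lemma kernel_energy_psd:
  assumes "u \<in> borel_measurable M" "v \<in> borel_measurable M"
  shows "2 * kernel_energy M k u v \<le> kernel_energy M k u u + kernel_energy M k v v"
proof -
  obtain e where e: "e > 0" "\<And>x. x \<in> K \<Longrightarrow> cball x e \<subseteq> Some -` D"
    using small_discs by blast
  obtain x where x: "x \<in> K"
    using K(3) by blast
  show ?thesis
    by (rule order_trans[OF _ kernel_energy_psd_disc[OF assms e(1) e(2)[OF x]]]) simp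
qed

text \<open>After cancelling the finite mixed energy, equality makes the defect of every disc
  vanish, so \<open>u\<close> and \<open>v\<close> give the same mass to all closed discs' interiors
  in \<open>D\<close>. A disc of radius below \<open>e / 2\<close> either lies in \<open>D\<close>
  or misses \<open>K\<close>, and small discs determine a finite measure.\<close>

lemma kernel_energy_strict:
  assumes [measurable]: "u \<in> borel_measurable M" "v \<in> borel_measurable M"
    and fin: "(\<integral>\<^sup>+x. u x \<partial>M) < \<infinity>" "(\<integral>\<^sup>+x. v x \<partial>M) < \<infinity>"
    and eq: "kernel_energy M k u u + kernel_energy M k v v \<le> 2 * kernel_energy M k u v" and energy: "kernel_energy M k u v < \<infinity>"
  shows "AE x in M. u x = v x"
proof -
  obtain e where e: "e > 0" "\<And>x. x \<in> K \<Longrightarrow> cball x e \<subseteq> Some -` D"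
    using small_discs by blast
  have disc: "(\<integral>\<^sup>+x. indicator (ball c r) x * u x \<partial>M) = (\<integral>\<^sup>+x. indicator (ball c r) x * v x \<partial>M)"
    if r: "r > 0" "cball c r \<subseteq> Some -` D" for c r
  proof -
    let ?A = "factor_potential M (disc_factor c r) u"
    let ?B = "factor_potential M (disc_factor c r) v"
    have meas [measurable]: "?A \<in> borel_measurable disc_measure" "?B \<in> borel_measurable disc_measure"
      unfolding factor_potential_def by measurable
    let ?X = "\<integral>\<^sup>+p. (?A p - ?B p) * (?A p - ?B p) + (?B p - ?A p) * (?B p - ?A p) \<partial>disc_measure"
    have "2 * kernel_energy M k u v + ?X \<le> 2 * kernel_energy M k u v + 0"
      using order_trans[OF kernel_energy_psd_disc[OF assms(1,2) r] eq] by simp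
    moreover have "2 * kernel_energy M k u v \<noteq> \<infinity>"
      using energy by (simp add: ennreal_mult_eq_top_iff)
    ultimately have "?X = 0"
      unfolding ennreal_add_left_cancel_le by auto
    then have "AE p in disc_measure. (?A p - ?B p) * (?A p - ?B p) + (?B p - ?A p) * (?B p - ?A p) = 0"
      by (subst (asm) nn_integral_0_iff_AE) auto
    then have "AE p in disc_measure. ?A p = ?B p"
    proof eventually_elim
      case (elim p)
      then have "?A p - ?B p = 0" "?B p - ?A p = 0"
        by auto
      then show ?case
        by (metis antisym ennreal_minus_eq_0)
    qed
    then show ?thesis
      by (rule factor_potential_eq_imp_ball_eq[OF sigma_finite_measure_axioms id_measurable assms(1,2) r(1)])
  qed
  \<comment> \<open>Transported to the plane, since discs around points of \<open>K\<close> need not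
    lie in \<open>K\<close>.\<close>
  define N where "N w = distr (density M w) borel (\<lambda>x. x)" for w
  have N: "emeasure (N w) V = (\<integral>\<^sup>+x. indicator V x * w x \<partial>M)" if [measurable]: "w \<in> borel_measurable M" and V: "V \<in> sets borel" for w V
  proof -
    have [measurable]: "(\<lambda>x. x) \<in> measurable (density M w) borel"
      using id_measurable by (simp add: measurable_density_eq1)
    have VM: "V \<inter> space M \<in> sets M"
      using measurable_sets[OF id_measurable V] by (simp add: vimage_def)
    have "emeasure (N w) V = emeasure (density M w) (V \<inter> space M)"
      unfolding N_def by (subst emeasure_distr) (use V in \<open>auto simp: vimage_def\<close>)
    also have "\<dots> = (\<integral>\<^sup>+x. w x * indicator (V \<inter> space M) x \<partial>M)"
      by (rule emeasure_density) (use VM in auto)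
    also have "\<dots> = (\<integral>\<^sup>+x. indicator V x * w x \<partial>M)"
      by (rule nn_integral_cong) (auto simp: indicator_def)
    finally show ?thesis .
  qed
  have finN: "finite_measure (N w)" if "w \<in> borel_measurable M" "(\<integral>\<^sup>+x. w x \<partial>M) < \<infinity>" for w
  proof
    have "space (N w) = UNIV"
      by (simp add: N_def)
    then show "emeasure (N w) (space (N w)) \<noteq> \<infinity>"
      using N[OF that(1), of UNIV] that(2) by auto
  qed
  have "N u = N v"
  proof (rule measures_eqI_balls[where ?s0.0="e / 2"])
    fix c s assume s: "0 < s" "s < e / 2"
    show "emeasure (N u) (ball c s) = emeasure (N v) (ball c s)"
    proof (cases "ball c s \<inter> K = {}")
      case True
      have "(\<integral>\<^sup>+x. indicator (ball c s) x * w x \<partial>M) = 0" for w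
      proof -
        have "(\<integral>\<^sup>+x. indicator (ball c s) x * w x \<partial>M) = (\<integral>\<^sup>+x. 0 \<partial>M)"
          by (rule nn_integral_cong) (use True space_M in \<open>auto simp: indicator_def\<close>)
        then show ?thesis by simp
      qed
      then show ?thesis
        by (simp add: N)
    next
      case False
      then obtain x where x: "x \<in> K" "dist c x < s"
        by auto
      have "cball c s \<subseteq> cball x e"
        using x s by (auto simp: cball_subset_cball_iff)
      then have "cball c s \<subseteq> Some -` D"
        using e(2)[OF x(1)] by blast
      from disc[OF s(1) this] show ?thesis
        by (simp add: N)
    qed
  qed (use finN fin e in \<open>auto simp: N_def\<close>)
  have "density M u = density M v"
  proof (rule measure_eqI)
    fix A assume "A \<in> sets (density M u)"
    then have A: "A \<in> sets M"
      by simp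
    then obtain V where V: "V \<in> sets borel" "A = V \<inter> K"
      unfolding sets_M by (auto simp: sets_restrict_space)
    have "emeasure (density M w) A = emeasure (N w) V" if [measurable]: "w \<in> borel_measurable M" for w
    proof -
      have "emeasure (density M w) A = (\<integral>\<^sup>+x. w x * indicator A x \<partial>M)"
        by (rule emeasure_density) (use A in auto)
      also have "\<dots> = (\<integral>\<^sup>+x. indicator V x * w x \<partial>M)"
        by (rule nn_integral_cong) (use V space_M in \<open>auto simp: indicator_def\<close>)
      finally show ?thesis
        using N[OF that V(1)] by simp
    qed
    then show "emeasure (density M u) A = emeasure (density M v) A"
      using \<open>N u = N v\<close> by simp
  qed simp
  then show ?thesis
    using density_unique_iff[of u v] by auto
qed

end

section \<open>Minimisation of convex functionals of densities\<close>

text \<open>Among almost-minimisers those of almost minimal \<open>L\<^sup>2\<close> norm form a Cauchy sequence, by the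
  parallelogram law and midpoint convexity.\<close>

lemma exists_minimizer:
  fixes j :: "('a \<Rightarrow> real) \<Rightarrow> real"
  assumes M: "finite_measure M" and U: "\<And>u. u \<in> U \<Longrightarrow> u \<in> borel_measurable M" "\<And>u x. u \<in> U \<Longrightarrow> 0 \<le> u x \<and> u x \<le> R"
    and U0: "u0 \<in> U" and R: "0 \<le> R"
    and mid: "\<And>u v. u \<in> U \<Longrightarrow> v \<in> U \<Longrightarrow> (\<lambda>x. (u x + v x) / 2) \<in> U \<and> j (\<lambda>x. (u x + v x) / 2) \<le> (j u + j v) / 2"
    and below: "\<And>u. u \<in> U \<Longrightarrow> B \<le> j u"
    and lsc: "\<And>w u L. (\<And>n. w n \<in> U) \<Longrightarrow> u \<in> borel_measurable M \<Longrightarrow> (\<And>x. 0 \<le> u x \<and> u x \<le> R) \<Longrightarrow>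
      (AE x in M. (\<lambda>n. w n x) \<longlonglongrightarrow> u x) \<Longrightarrow> (\<lambda>n. j (w n)) \<longlonglongrightarrow> L \<Longrightarrow> u \<in> U \<and> j u \<le> L"
  obtains u where "u \<in> U" "\<And>v. v \<in> U \<Longrightarrow> j u \<le> j v"
proof -
  interpret finite_measure M by (rule M)
  define v0 where "v0 = Inf (j ` U)"
  have bdd: "bdd_below (j ` U)"
    using below by (auto simp: bdd_below_def)
  have v0: "v0 \<le> j u" if "u \<in> U" for u
    unfolding v0_def using bdd that by (intro cInf_lower) auto
  define S where "S n = {u \<in> U. j u \<le> v0 + 1 / real (Suc n)}" for n
  have S_ne: "S n \<noteq> {}" for n
  proof -
    have "Inf (j ` U) < v0 + 1 / real (Suc n)"
      by (simp add: v0_def)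
    then obtain u where "u \<in> U" "j u < v0 + 1 / real (Suc n)"
      using cInf_lessD[of "j ` U"] U0 by blast
    then show ?thesis
      by (auto simp: S_def)
  qed
  have S_mono: "S m \<subseteq> S n" if "n \<le> m" for n m
  proof -
    have "1 / real (Suc m) \<le> 1 / real (Suc n)"
      using that by (intro divide_left_mono) auto
    then show ?thesis
      by (auto simp: S_def)
  qed
  have bounded: "integrable M h" if "h \<in> borel_measurable M" "\<And>x. \<bar>h x\<bar> \<le> C" for h :: "'a \<Rightarrow> real" and C
    by (rule integrable_const_bound[where B=C]) (use that in auto)
  have int_sq: "integrable M (\<lambda>x. (u x)\<^sup>2)" if "u \<in> U" for u
    using U[OF that] by (intro bounded[where C="R\<^sup>2"]) (auto intro!: power_mono)
  \<comment> \<open>Nondecreasing, as the sets \<open>S n\<close> shrink, and bounded; hence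
    Cauchy.\<close>
  define N where "N n = Inf ((\<lambda>u. LINT x|M. (u x)\<^sup>2) ` S n)" for n
  have bddN: "bdd_below ((\<lambda>u. LINT x|M. (u x)\<^sup>2) ` S n)" for n
    by (rule bdd_belowI2[where m=0]) simp
  have N_le: "N n \<le> (LINT x|M. (u x)\<^sup>2)" if "u \<in> S n" for u n
    unfolding N_def using bddN that by (intro cInf_lower) auto
  have N_mono: "N n \<le> N m" if "n \<le> m" for n m
    unfolding N_def using bddN S_mono[OF that] S_ne by (intro cInf_superset_mono image_mono) auto
  have N_bound: "N n \<le> R\<^sup>2 * measure M (space M)" for n
  proof -
    obtain u where u: "u \<in> S n"
      using S_ne by blast
    then have uU: "u \<in> U"
      by (simp add: S_def)
    have "(LINT x|M. (u x)\<^sup>2) \<le> (LINT x|M. R\<^sup>2)"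
      using U[OF uU] by (intro integral_mono int_sq uU bounded[where C="R\<^sup>2"]) (auto intro!: power_mono)
    then show ?thesis
      using N_le[OF u] by (simp add: mult.commute)
  qed
  have Cauchy_N: "Cauchy N"
  proof -
    have "incseq N"
      using N_mono by (auto simp: incseq_def)
    then obtain L where "N \<longlonglongrightarrow> L"
      using incseq_convergent[of N "R\<^sup>2 * measure M (space M)"] N_bound by blast
    then show ?thesis
      by (rule LIMSEQ_imp_Cauchy)
  qed
  have "\<exists>u. \<forall>n. u n \<in> S n \<and> (LINT x|M. (u n x)\<^sup>2) < N n + 1 / real (Suc n)"
  proof (intro choice allI)
    fix n
    have "N n < N n + 1 / real (Suc n)"
      by simp
    then obtain u where "u \<in> S n" "(LINT x|M. (u x)\<^sup>2) < N n + 1 / real (Suc n)"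
      using cInf_lessD[of "(\<lambda>u. LINT x|M. (u x)\<^sup>2) ` S n"] S_ne unfolding N_def by blast
    then show "\<exists>u. u \<in> S n \<and> (LINT x|M. (u x)\<^sup>2) < N n + 1 / real (Suc n)"
      by blast
  qed
  then obtain u where u: "\<And>n. u n \<in> S n" "\<And>n. (LINT x|M. (u n x)\<^sup>2) < N n + 1 / real (Suc n)"
    by blast
  have uU: "u n \<in> U" for n
    using u(1)[of n] by (simp add: S_def)
  note [measurable] = U(1)[OF uU]
  \<comment> \<open>Midpoints of elements of \<open>S n\<close> stay in \<open>S n\<close>, so their
    squared norm is at least \<open>N n\<close>; the parallelogram law turns this into a bound on
    the difference.\<close>
  have dist: "(LINT x|M. (u n x - u m x)\<^sup>2) \<le> 2 * (N m - N n) + 2 / real (Suc n) + 2 / real (Suc m)" if nm: "n \<le> m" for n m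
  proof -
    let ?h = "\<lambda>x. (u n x + u m x) / 2"
    have um: "u m \<in> S n"
      using u(1) S_mono[OF nm] by blast
    have "?h \<in> U \<and> j ?h \<le> (j (u n) + j (u m)) / 2"
      by (rule mid[OF uU uU])
    then have h: "?h \<in> S n"
      using u(1)[of n] um by (auto simp: S_def)
    have "(LINT x|M. (u n x - u m x)\<^sup>2) = (LINT x|M. 2 * (u n x)\<^sup>2 + 2 * (u m x)\<^sup>2 - 4 * (?h x)\<^sup>2)"
      by (intro Bochner_Integration.integral_cong refl) (simp add: power2_eq_square field_simps)
    also have "\<dots> = 2 * (LINT x|M. (u n x)\<^sup>2) + 2 * (LINT x|M. (u m x)\<^sup>2) - 4 * (LINT x|M. (?h x)\<^sup>2)"
      using int_sq[OF uU[of n]] int_sq[OF uU[of m]] int_sq[of ?h] h by (simp add: S_def)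
    also have "\<dots> \<le> 2 * (N m - N n) + 2 / real (Suc n) + 2 / real (Suc m)"
    proof -
      have key: "2 * A + 2 * B - 4 * H \<le> 2 * (b - a) + 2 * s + 2 * t" if "A < a + s" "B < b + t" "a \<le> H" for A B H a b s t :: real
      proof -
        have "2 * A \<le> 2 * a + 2 * s" "2 * B \<le> 2 * b + 2 * t" "4 * a \<le> 4 * H"
          using that by simp_all
        then show ?thesis
          by (simp add: right_diff_distrib)
      qed
      show ?thesis
        using key[OF u(2)[of n] u(2)[of m] N_le[OF h]] by (simp only: times_divide_eq_right mult_1_right)
    qed
    finally show ?thesis .
  qed
  have int_u: "integrable M (u n)" for n
    using U(2)[OF uU] by (intro bounded[where C=R]) auto
  have cauchy: "\<exists>n0. \<forall>i\<ge>n0. \<forall>j\<ge>n0. (LINT x|M. norm (u i x - u j x)) < e" if e: "e > 0" for e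
  proof -
    define m0 where "m0 = measure M (space M)"
    have m0: "m0 \<ge> 0"
      by (simp add: m0_def)
    define d where "d = e / (2 * (m0 + 1))"
    have d: "d > 0"
      using e m0 by (simp add: d_def)
    \<comment> \<open>Three contributions of \<open>2 * \<epsilon>\<close> bound the squared
      distance, and \<open>6 * \<epsilon> / d = 3 * e / 10\<close>; the remaining
      \<open>d * m0\<close> is at most \<open>e / 2\<close>.\<close>
    define \<epsilon> where "\<epsilon> = d * e / 20"
    have \<epsilon>: "\<epsilon> > 0"
      using d e by (simp add: \<epsilon>_def)
    obtain n1 where n1: "\<And>i j. i \<ge> n1 \<Longrightarrow> j \<ge> n1 \<Longrightarrow> \<bar>N i - N j\<bar> < \<epsilon>"
      using CauchyD[OF Cauchy_N \<epsilon>] by auto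
    obtain n2 where n2: "inverse (real (Suc n2)) < \<epsilon>"
      using reals_Archimedean[OF \<epsilon>] by blast
    have inv: "1 / real (Suc i) < \<epsilon>" if "i \<ge> n2" for i
    proof -
      have "1 / real (Suc i) \<le> 1 / real (Suc n2)"
        using that by (intro divide_left_mono) auto
      with n2 show ?thesis
        by (simp add: inverse_eq_divide)
    qed
    have sq: "(LINT x|M. (u i x - u k x)\<^sup>2) \<le> 6 * \<epsilon>" if "i \<ge> max n1 n2" "k \<ge> i" for i k
    proof -
      have "2 / real (Suc i) \<le> 2 * \<epsilon>" "2 / real (Suc k) \<le> 2 * \<epsilon>"
        using inv[of i] inv[of k] that by (auto simp: field_simps)
      then show ?thesis
        using dist[OF that(2)] n1[of i k] that by auto
    qed
    have sq': "(LINT x|M. (u i x - u k x)\<^sup>2) \<le> 6 * \<epsilon>" if "i \<ge> max n1 n2" "k \<ge> max n1 n2" for i k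
      using sq[of i k] sq[of k i] that by (cases "i \<le> k") (auto simp: power2_commute)
    have "(LINT x|M. norm (u i x - u k x)) < e" if "i \<ge> max n1 n2" "k \<ge> max n1 n2" for i k
    proof -
      have int2: "integrable M (\<lambda>x. (u i x - u k x)\<^sup>2)"
      proof (rule bounded[where C="R\<^sup>2"])
        fix x
        have "\<bar>u i x - u k x\<bar> \<le> R"
          using U(2)[OF uU, of i x] U(2)[OF uU, of k x] by auto
        then show "\<bar>(u i x - u k x)\<^sup>2\<bar> \<le> R\<^sup>2"
          by (metis abs_ge_zero abs_power2 power2_abs power_mono)
      qed measurable
      \<comment> \<open>Bounds the integral of the absolute value by that of the square, as the
        measure is finite.\<close>
      have pt: "\<bar>t\<bar> \<le> d + t\<^sup>2 / d" for t :: real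
      proof (cases "\<bar>t\<bar> \<le> d")
        case False
        then have "\<bar>t\<bar> * d \<le> \<bar>t\<bar> * \<bar>t\<bar>"
          by (intro mult_left_mono) auto
        then have "\<bar>t\<bar> \<le> t\<^sup>2 / d"
          using d by (simp add: field_simps power2_eq_square)
        then show ?thesis
          using d by simp
      qed (use d in \<open>simp add: add_increasing2\<close>)
      have "(LINT x|M. norm (u i x - u k x)) \<le> (LINT x|M. d + (u i x - u k x)\<^sup>2 / d)"
        using int_u int2 pt by (intro integral_mono) auto
      also have "\<dots> = d * m0 + (LINT x|M. (u i x - u k x)\<^sup>2) / d"
        using int2 by (simp add: m0_def)
      also have "\<dots> \<le> d * m0 + 6 * \<epsilon> / d"
        using sq'[OF that] d by (intro add_left_mono divide_right_mono) auto
      also have "\<dots> < e"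
      proof -
        have "d * m0 \<le> e / 2"
          using m0 e by (simp add: d_def field_simps)
        moreover have "6 * \<epsilon> / d = 3 * e / 10"
          using d by (simp add: \<epsilon>_def)
        ultimately show ?thesis
          using e by linarith
      qed
      finally show ?thesis .
    qed
    then show ?thesis
      by blast
  qed
  obtain r where r: "strict_mono r" "AE x in M. Cauchy (\<lambda>i. u (r i) x)"
    using cauchy_L1_AE_cauchy_subseq[OF int_u cauchy] by blast
  \<comment> \<open>The default 0 keeps the pointwise bounds \<open>0 \<le> ul x \<le> R\<close> off
    the set of convergence.\<close>
  define ul where "ul x = (if Cauchy (\<lambda>i. u (r i) x) then lim (\<lambda>i. u (r i) x) else 0)" for x
  have meas: "ul \<in> borel_measurable M"
    unfolding ul_def[abs_def] by measurable
  have lim: "(\<lambda>i. u (r i) x) \<longlonglongrightarrow> ul x" if "Cauchy (\<lambda>i. u (r i) x)" for x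
    using that by (simp add: ul_def Cauchy_convergent_iff convergent_LIMSEQ_iff)
  have ul_bd: "0 \<le> ul x \<and> ul x \<le> R" for x
  proof (cases "Cauchy (\<lambda>i. u (r i) x)")
    case True
    then show ?thesis
      using U(2)[OF uU] by (intro conjI LIMSEQ_le_const[OF lim] LIMSEQ_le_const2[OF lim]) auto
  qed (simp add: ul_def R)
  have j_lim: "(\<lambda>i. j (u (r i))) \<longlonglongrightarrow> v0"
  proof (rule tendsto_sandwich[where f="\<lambda>_. v0" and h="\<lambda>i. v0 + 1 / real (Suc i)"])
    show "eventually (\<lambda>i. v0 \<le> j (u (r i))) sequentially"
      using v0[OF uU] by simp
    show "eventually (\<lambda>i. j (u (r i)) \<le> v0 + 1 / real (Suc i)) sequentially"
    proof (intro always_eventually allI)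
      fix i
      have "u (r i) \<in> S i"
        using u(1) S_mono[OF seq_suble[OF r(1), of i]] by blast
      then show "j (u (r i)) \<le> v0 + 1 / real (Suc i)"
        by (simp add: S_def)
    qed
    have "(\<lambda>i. v0 + inverse (real (Suc i))) \<longlonglongrightarrow> v0 + 0"
      by (intro tendsto_intros LIMSEQ_inverse_real_of_nat)
    then show "(\<lambda>i. v0 + 1 / real (Suc i)) \<longlonglongrightarrow> v0"
      by (simp add: inverse_eq_divide)
  qed simp
  have "ul \<in> U \<and> j ul \<le> v0"
    by (rule lsc[OF uU meas ul_bd _ j_lim]) (use r(2) lim in \<open>auto elim: eventually_mono\<close>)
  then show thesis
    using v0 order_trans by (intro that[of ul]) blast+
qed

section \<open>Extended integrals, and dominated measures as densities\<close>

lemma ereal_integral_enn2ereal: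
  assumes "\<And>x. x \<in> space M \<Longrightarrow> h x = enn2ereal (k x)"
  shows "ereal_integral M h = enn2ereal (\<integral>\<^sup>+x. k x \<partial>M)"
proof -
  have 1: "(\<integral>\<^sup>+x. e2ennreal (h x) \<partial>M) = (\<integral>\<^sup>+x. k x \<partial>M)"
    by (rule nn_integral_cong) (simp add: assms)
  have "(\<integral>\<^sup>+x. e2ennreal (- h x) \<partial>M) = (\<integral>\<^sup>+x. 0 \<partial>M)"
    by (rule nn_integral_cong) (simp add: assms e2ennreal_neg)
  then have 2: "(\<integral>\<^sup>+x. e2ennreal (- h x) \<partial>M) = 0"
    by simp
  show ?thesis
    unfolding ereal_integral_def 1 2 by (simp add: zero_ennreal.rep_eq)
qed

text \<open>Pointwise, \<open>f + c\<close> plus the negative part of \<open>f\<close> equals the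
  positive part plus \<open>c\<close>. This is integrated without subtraction; the negative part is
  at most \<open>c\<close>, so its integral is finite and may be moved across afterwards.\<close>

lemma ereal_integral_shift:
  assumes M: "finite_measure M" and [measurable]: "f \<in> borel_measurable M" and c: "0 \<le> c" "\<And>x. x \<in> space M \<Longrightarrow> ereal (- c) \<le> f x"
  shows "ereal_integral M f = enn2ereal (\<integral>\<^sup>+x. e2ennreal (f x + ereal c) \<partial>M) - ereal (c * measure M (space M))"
proof -
  interpret finite_measure M by (rule M)
  let ?P = "\<integral>\<^sup>+x. e2ennreal (f x) \<partial>M" and ?N = "\<integral>\<^sup>+x. e2ennreal (- f x) \<partial>M" and ?\<Phi> = "\<integral>\<^sup>+x. e2ennreal (f x + ereal c) \<partial>M"
  have "?\<Phi> + ?N = (\<integral>\<^sup>+x. e2ennreal (f x + ereal c) + e2ennreal (- f x) \<partial>M)"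
    by (rule nn_integral_add[symmetric]) measurable
  also have "\<dots> = (\<integral>\<^sup>+x. e2ennreal (f x) + ennreal c \<partial>M)"
  proof (rule nn_integral_cong)
    fix x assume "x \<in> space M"
    then have "ereal (- c) \<le> f x"
      by (rule c)
    then show "e2ennreal (f x + ereal c) + e2ennreal (- f x) = e2ennreal (f x) + ennreal c"
    proof (cases "f x")
      case (real y)
      then have "- c \<le> y"
        using \<open>ereal (- c) \<le> f x\<close> by simp
      then show ?thesis
        using real c(1) by (cases "0 \<le> y") (simp_all add: ennreal.abs_eq[symmetric] e2ennreal_ereal ennreal_neg ennreal_plus[symmetric] del: ennreal_plus)
    qed (use c in \<open>auto simp: e2ennreal_neg\<close>)
  qed
  also have "\<dots> = ?P + (\<integral>\<^sup>+x. ennreal c \<partial>M)"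
    by (rule nn_integral_add) measurable
  also have "(\<integral>\<^sup>+x. ennreal c \<partial>M) = ennreal (c * measure M (space M))"
    using c(1) by (simp add: emeasure_eq_measure ennreal_mult)
  finally have eq: "?\<Phi> + ?N = ?P + ennreal (c * measure M (space M))" .
  have "?N \<le> (\<integral>\<^sup>+x. ennreal c \<partial>M)"
  proof (rule nn_integral_mono)
    fix x assume "x \<in> space M"
    then have "- f x \<le> ereal c"
      using c(2) by (metis ereal_minus_le_minus ereal_uminus_uminus uminus_ereal.simps(1))
    then show "e2ennreal (- f x) \<le> ennreal c"
      using e2ennreal_mono by (metis e2ennreal_ereal)
  qed
  also have "\<dots> < \<infinity>"
    by (simp add: emeasure_eq_measure ennreal_mult_less_top)
  finally have "?N < \<infinity>" .
  then obtain n where n: "?N = ennreal n" "0 \<le> n"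
    by (cases ?N rule: ennreal_cases) auto
  have cm: "0 \<le> c * measure M (space M)"
    using c(1) by simp
  have "enn2ereal ?\<Phi> + ereal n = enn2ereal ?P + ereal (c * measure M (space M))"
    using arg_cong[OF eq, of enn2ereal] n cm by (simp add: plus_ennreal.rep_eq)
  then have "enn2ereal ?P - ereal n = enn2ereal ?\<Phi> - ereal (c * measure M (space M))"
    by (cases "enn2ereal ?P"; cases "enn2ereal ?\<Phi>") auto
  then show ?thesis
    unfolding ereal_integral_def using n by simp
qed

text \<open>Where a Radon-Nikodym density exceeds \<open>R\<close>, the excess integrates to 0.
  Cutting the density at \<open>R\<close> everywhere gives pointwise bounds, as the minimisation
  runs over functions rather than classes.\<close>

lemma (in finite_measure) density_of_dominated:
  assumes sets: "sets N = sets M" and le: "N \<le> scale_measure (ennreal R) M" and R: "0 \<le> R"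
  obtains u :: "'a \<Rightarrow> real" where "u \<in> borel_measurable M" "\<And>x. 0 \<le> u x \<and> u x \<le> R" "N = density M (\<lambda>x. ennreal (u x))"
proof -
  have le': "emeasure N A \<le> ennreal R * emeasure M A" for A
    using le_measureD3[OF le, of A] sets by simp
  have "absolutely_continuous M N"
    unfolding absolutely_continuous_def
  proof
    fix A assume "A \<in> null_sets M"
    then show "A \<in> null_sets N"
      using le'[of A] sets by (auto simp: null_sets_def)
  qed
  moreover have "finite_measure N"
  proof
    have "emeasure N (space N) \<le> ennreal R * emeasure M (space N)"
      by (rule le')
    also have "\<dots> < \<infinity>"
      using emeasure_finite[of "space N"] by (auto simp: ennreal_mult_eq_top_iff less_top[symmetric])
    finally show "emeasure N (space N) \<noteq> \<infinity>"
      by simp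
  qed
  ultimately obtain h where h: "h \<in> borel_measurable M" "density M h = N"
    using Radon_Nikodym_finite_measure[of N] sets by blast
  note [measurable] = h(1)
  define A where "A = {x \<in> space M. ennreal R < h x}"
  have A [measurable]: "A \<in> sets M"
    unfolding A_def by measurable
  have "(\<integral>\<^sup>+x. (h x - ennreal R) * indicator A x \<partial>M) + ennreal R * emeasure M A = (\<integral>\<^sup>+x. (h x - ennreal R) * indicator A x + ennreal R * indicator A x \<partial>M)"
    by (subst nn_integral_add) (auto simp: nn_integral_cmult)
  also have "\<dots> = (\<integral>\<^sup>+x. h x * indicator A x \<partial>M)"
    by (rule nn_integral_cong) (auto simp: A_def indicator_def intro!: diff_add_cancel_ennreal)
  also have "\<dots> = emeasure N A"
    unfolding h(2)[symmetric] by (rule emeasure_density[symmetric]) measurable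
  also have "\<dots> \<le> 0 + ennreal R * emeasure M A"
    using le' by simp
  finally have "(\<integral>\<^sup>+x. (h x - ennreal R) * indicator A x \<partial>M) \<le> 0"
    using emeasure_finite[of A] by (subst (asm) (1 2) add.commute) (simp add: ennreal_add_left_cancel_le ennreal_mult_eq_top_iff)
  then have "AE x in M. (h x - ennreal R) * indicator A x = 0"
    by (subst nn_integral_0_iff_AE[symmetric]) auto
  then have ae: "AE x in M. h x \<le> ennreal R"
    using AE_space
  proof eventually_elim
    case (elim x)
    show ?case
    proof (rule ccontr)
      assume "\<not> h x \<le> ennreal R"
      then have "x \<in> A"
        using elim by (simp add: A_def)
      with elim(1) have "h x - ennreal R = 0"
        by simp
      with \<open>\<not> h x \<le> ennreal R\<close> show False
        by (simp add: ennreal_minus_eq_0)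
    qed
  qed
  define u where "u x = enn2real (min (h x) (ennreal R))" for x
  have u: "ennreal (u x) = min (h x) (ennreal R)" for x
    unfolding u_def by (rule ennreal_enn2real) (simp add: min_less_iff_disj)
  show thesis
  proof (rule that)
    show "u \<in> borel_measurable M"
      unfolding u_def[abs_def] by measurable
    show "0 \<le> u x \<and> u x \<le> R" for x
    proof -
      have "ennreal (u x) \<le> ennreal R"
        by (simp add: u)
      then show ?thesis
        using R by (simp add: u_def ennreal_le_iff)
    qed
    show "N = density M (\<lambda>x. ennreal (u x))"
      unfolding h(2)[symmetric] u using ae by (intro density_cong) (auto elim: eventually_mono simp: min_def)
  qed
qed

lemma density_dominated:
  assumes [measurable]: "u \<in> borel_measurable M" and u: "\<And>x. u x \<le> R"
  shows "density M (\<lambda>x. ennreal (u x)) \<le> scale_measure (ennreal R) M"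
proof -
  have "emeasure (density M (\<lambda>x. ennreal (u x))) A \<le> emeasure (scale_measure (ennreal R) M) A" if A: "A \<in> sets M" for A
  proof -
    have "emeasure (density M (\<lambda>x. ennreal (u x))) A = (\<integral>\<^sup>+x. ennreal (u x) * indicator A x \<partial>M)"
      by (rule emeasure_density) (use A in auto)
    also have "\<dots> \<le> (\<integral>\<^sup>+x. ennreal R * indicator A x \<partial>M)"
      by (intro nn_integral_mono mult_right_mono ennreal_leI u) auto
    finally show ?thesis
      using A by (simp add: nn_integral_cmult)
  qed
  then show ?thesis
    by (subst le_measure) auto
qed

text \<open>The algebra of \<open>functional_lin\<close> with both coefficients
  \<open>1 / 2\<close>: the midpoint lies below the mean by a quarter of the energy of the
  difference.\<close>

lemma midpoint_identity:
  fixes a b d s t c p q :: real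
  shows "(1 / 2)\<^sup>2 * a + 2 * (1 / 2) * (1 / 2) * b + (1 / 2)\<^sup>2 * d - 2 * c * (1 / 2 * s + 1 / 2 * t) + 2 * (1 / 2 * p + 1 / 2 * q)
    = ((a - 2 * c * s + 2 * p) + (d - 2 * c * t + 2 * q)) / 2 - (a + d - 2 * b) / 4"
  by (simp add: power2_eq_square field_simps)

lemma diff_quarter_le: "0 \<le> y \<Longrightarrow> x - y / 4 \<le> (x::real)"
  by simp

section \<open>The constrained weighted energy problem\<close>

locale green_minimization = green_setting +
  fixes f :: "complex \<Rightarrow> ereal" and R c :: real
  assumes energy: "kernel_energy M k (\<lambda>_. 1) (\<lambda>_. 1) < \<infinity>" and R: "0 < R"
    and f_measurable [measurable]: "f \<in> borel_measurable M"
    and c: "0 \<le> c" and f_ge: "\<And>x. x \<in> space M \<Longrightarrow> ereal (- c) \<le> f x"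
begin

sublocale MM: pair_sigma_finite M M ..

lemma measurable_pair_components [measurable]:
  "fst \<in> measurable (M \<Otimes>\<^sub>M M) borel" "snd \<in> measurable (M \<Otimes>\<^sub>M M) borel"
  using measurable_compose[OF measurable_fst id_measurable] measurable_compose[OF measurable_snd id_measurable] by auto

text \<open>Finite energy makes \<open>k\<close> finite almost everywhere on the product, so on
  bounded functions the energy becomes a real bilinear form.\<close>

definition kernel :: "complex \<times> complex \<Rightarrow> real" where
  "kernel p = enn2real (k (fst p) (snd p))"

lemma measurable_real_kernel [measurable]: "kernel \<in> borel_measurable (M \<Otimes>\<^sub>M M)"
  unfolding kernel_def[abs_def] by measurable

lemma kernel_nonneg: "0 \<le> kernel p"
  by (simp add: kernel_def)

lemma nn_integral_kernel: "(\<integral>\<^sup>+p. k (fst p) (snd p) \<partial>(M \<Otimes>\<^sub>M M)) < \<infinity>"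
proof -
  have "(\<integral>\<^sup>+p. k (fst p) (snd p) \<partial>(M \<Otimes>\<^sub>M M)) = (\<integral>\<^sup>+x. \<integral>\<^sup>+y. k x y \<partial>M \<partial>M)"
    by (subst nn_integral_fst[symmetric]) auto
  then show ?thesis
    using energy by (simp add: kernel_energy_def)
qed

lemma AE_kernel_finite: "AE p in (M \<Otimes>\<^sub>M M). k (fst p) (snd p) = ennreal (kernel p)"
proof -
  have "AE p in (M \<Otimes>\<^sub>M M). k (fst p) (snd p) \<noteq> \<infinity>"
    by (rule nn_integral_PInf_AE) (use nn_integral_kernel in auto)
  then show ?thesis
    by eventually_elim (simp add: kernel_def less_top)
qed

definition bounded_fun :: "(complex \<Rightarrow> real) \<Rightarrow> bool" where
  "bounded_fun u \<longleftrightarrow> u \<in> borel_measurable M \<and> (\<exists>C. \<forall>x. \<bar>u x\<bar> \<le> C)"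

lemma bounded_fun_measurable: "bounded_fun u \<Longrightarrow> u \<in> borel_measurable M"
  by (simp add: bounded_fun_def)

lemma bounded_fun_lin:
  assumes "bounded_fun u" "bounded_fun v"
  shows "bounded_fun (\<lambda>x. a * u x + b * v x)"
proof -
  obtain C D where C: "\<And>x. \<bar>u x\<bar> \<le> C" "\<And>x. \<bar>v x\<bar> \<le> D"
    using assms by (auto simp: bounded_fun_def)
  have "\<bar>a * u x + b * v x\<bar> \<le> \<bar>a\<bar> * C + \<bar>b\<bar> * D" for x
    using C[of x] by (intro order_trans[OF abs_triangle_ineq] add_mono) (auto simp: abs_mult intro!: mult_left_mono)
  then show ?thesis
    using assms unfolding bounded_fun_def by auto
qed

lemma bounded_fun_integrable:
  assumes "bounded_fun u"
  shows "integrable M u"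
proof -
  obtain C where "\<And>x. \<bar>u x\<bar> \<le> C"
    using assms by (auto simp: bounded_fun_def)
  then show ?thesis
    by (intro integrable_const_bound[where B=C] bounded_fun_measurable assms) auto
qed

definition energy_form :: "(complex \<Rightarrow> real) \<Rightarrow> (complex \<Rightarrow> real) \<Rightarrow> real" where
  "energy_form u v = (LINT p|(M \<Otimes>\<^sub>M M). kernel p * (u (fst p) * v (snd p)))"

lemma integrable_kernel: "integrable (M \<Otimes>\<^sub>M M) kernel"
proof (rule integrableI_nonneg)
  have "(\<integral>\<^sup>+p. ennreal (kernel p) \<partial>(M \<Otimes>\<^sub>M M)) = (\<integral>\<^sup>+p. k (fst p) (snd p) \<partial>(M \<Otimes>\<^sub>M M))"
    by (rule nn_integral_cong_AE) (use AE_kernel_finite in \<open>auto elim: eventually_mono\<close>)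
  then show "(\<integral>\<^sup>+p. ennreal (kernel p) \<partial>(M \<Otimes>\<^sub>M M)) < \<infinity>"
    using nn_integral_kernel by simp
qed (auto simp: kernel_nonneg)

lemma integrable_energy_form:
  assumes "bounded_fun u" "bounded_fun v"
  shows "integrable (M \<Otimes>\<^sub>M M) (\<lambda>p. kernel p * (u (fst p) * v (snd p)))"
proof -
  note [measurable] = assms[THEN bounded_fun_measurable]
  obtain C D where C: "\<And>x. \<bar>u x\<bar> \<le> C" "\<And>x. \<bar>v x\<bar> \<le> D"
    using assms by (auto simp: bounded_fun_def)
  have nn: "0 \<le> C" "0 \<le> D"
    using C[of 0] by auto
  show ?thesis
  proof (rule Bochner_Integration.integrable_bound[where f="\<lambda>p. kernel p * (C * D)"])
    show "integrable (M \<Otimes>\<^sub>M M) (\<lambda>p. kernel p * (C * D))"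
      using integrable_kernel by simp
    show "AE p in (M \<Otimes>\<^sub>M M). norm (kernel p * (u (fst p) * v (snd p))) \<le> norm (kernel p * (C * D))"
      using C nn kernel_nonneg by (auto simp: abs_mult intro!: mult_left_mono mult_mono)
  qed measurable
qed

lemma energy_form_lin_left:
  assumes "bounded_fun u" "bounded_fun v" "bounded_fun w"
  shows "energy_form (\<lambda>x. a * u x + b * v x) w = a * energy_form u w + b * energy_form v w"
proof -
  have "energy_form (\<lambda>x. a * u x + b * v x) w = (LINT p|(M \<Otimes>\<^sub>M M). a * (kernel p * (u (fst p) * w (snd p))) + b * (kernel p * (v (fst p) * w (snd p))))"
    unfolding energy_form_def by (intro Bochner_Integration.integral_cong refl) (simp add: algebra_simps)
  then show ?thesis
    using integrable_energy_form[OF assms(1,3)] integrable_energy_form[OF assms(2,3)] by (simp add: energy_form_def)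
qed

lemma energy_form_commute:
  assumes "bounded_fun u" "bounded_fun v"
  shows "energy_form u v = energy_form v u"
proof -
  note [measurable] = assms[THEN bounded_fun_measurable]
  have "energy_form u v = (LINT p|(M \<Otimes>\<^sub>M M). (case p of (x, y) \<Rightarrow> (\<lambda>p. kernel p * (u (fst p) * v (snd p))) (y, x)))"
    unfolding energy_form_def by (rule MM.integral_product_swap[symmetric]) measurable
  also have "\<dots> = energy_form v u"
    unfolding energy_form_def kernel_def
    by (intro Bochner_Integration.integral_cong refl) (auto simp: kernel_commute mult.commute split: prod.splits)
  finally show ?thesis .
qed

lemma energy_form_quadratic:
  assumes u: "bounded_fun u" and v: "bounded_fun v"
  shows "energy_form (\<lambda>x. a * u x + b * v x) (\<lambda>x. a * u x + b * v x)
    = a\<^sup>2 * energy_form u u + 2 * a * b * energy_form u v + b\<^sup>2 * energy_form v v"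
proof -
  let ?w = "\<lambda>x. a * u x + b * v x"
  have w: "bounded_fun ?w"
    by (rule bounded_fun_lin[OF u v])
  have "energy_form u ?w = a * energy_form u u + b * energy_form u v"
    using energy_form_lin_left[OF u v u] energy_form_commute[OF u w] energy_form_commute[OF u v] by simp
  moreover have "energy_form v ?w = a * energy_form u v + b * energy_form v v"
    using energy_form_lin_left[OF u v v] energy_form_commute[OF v w] by simp
  ultimately show ?thesis
    unfolding energy_form_lin_left[OF u v w] by (simp add: algebra_simps power2_eq_square)
qed

lemma energy_form_eq_kernel_energy:
  assumes u: "bounded_fun u" "\<And>x. 0 \<le> u x" and v: "bounded_fun v" "\<And>x. 0 \<le> v x"
  shows "kernel_energy M k (\<lambda>x. ennreal (u x)) (\<lambda>x. ennreal (v x)) = ennreal (energy_form u v)" "0 \<le> energy_form u v"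
proof -
  note [measurable] = u(1)[THEN bounded_fun_measurable] v(1)[THEN bounded_fun_measurable]
  show "0 \<le> energy_form u v"
    unfolding energy_form_def using u v kernel_nonneg by (intro integral_nonneg_AE) auto
  have "kernel_energy M k (\<lambda>x. ennreal (u x)) (\<lambda>x. ennreal (v x)) = (\<integral>\<^sup>+p. k (fst p) (snd p) * ennreal (u (fst p)) * ennreal (v (snd p)) \<partial>(M \<Otimes>\<^sub>M M))"
    unfolding kernel_energy_def by (subst nn_integral_fst[symmetric]) auto
  also have "\<dots> = (\<integral>\<^sup>+p. ennreal (kernel p * (u (fst p) * v (snd p))) \<partial>(M \<Otimes>\<^sub>M M))"
    by (rule nn_integral_cong_AE, use AE_kernel_finite in eventually_elim)
      (use u v kernel_nonneg in \<open>simp add: ennreal_mult mult.assoc\<close>)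
  also have "\<dots> = ennreal (energy_form u v)"
    unfolding energy_form_def
    by (rule nn_integral_eq_integral[OF integrable_energy_form[OF u(1) v(1)]]) (use u v kernel_nonneg in auto)
  finally show "kernel_energy M k (\<lambda>x. ennreal (u x)) (\<lambda>x. ennreal (v x)) = ennreal (energy_form u v)" .
qed

lemma energy_form_psd:
  assumes u: "bounded_fun u" "\<And>x. 0 \<le> u x" and v: "bounded_fun v" "\<And>x. 0 \<le> v x"
  shows "2 * energy_form u v \<le> energy_form u u + energy_form v v"
proof -
  note [measurable] = u(1)[THEN bounded_fun_measurable] v(1)[THEN bounded_fun_measurable]
  have "2 * kernel_energy M k (\<lambda>x. ennreal (u x)) (\<lambda>x. ennreal (v x))
      \<le> kernel_energy M k (\<lambda>x. ennreal (u x)) (\<lambda>x. ennreal (u x)) + kernel_energy M k (\<lambda>x. ennreal (v x)) (\<lambda>x. ennreal (v x))"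
    by (rule kernel_energy_psd) measurable
  then have "ennreal (2 * energy_form u v) \<le> ennreal (energy_form u u + energy_form v v)"
    using energy_form_eq_kernel_energy[OF u v] energy_form_eq_kernel_energy[OF u u] energy_form_eq_kernel_energy[OF v v]
    by (simp add: ennreal_mult ennreal_plus)
  then show ?thesis
    using energy_form_eq_kernel_energy(2)[OF u u] energy_form_eq_kernel_energy(2)[OF v v]
    by (simp add: ennreal_le_iff del: ennreal_plus)
qed

lemma energy_form_strict:
  assumes u: "bounded_fun u" "\<And>x. 0 \<le> u x" and v: "bounded_fun v" "\<And>x. 0 \<le> v x"
    and le: "energy_form u u + energy_form v v \<le> 2 * energy_form u v"
  shows "AE x in M. u x = v x"
proof -
  note [measurable] = u(1)[THEN bounded_fun_measurable] v(1)[THEN bounded_fun_measurable]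
  have fin: "(\<integral>\<^sup>+x. ennreal (w x) \<partial>M) < \<infinity>" if "bounded_fun w" "\<And>x. 0 \<le> w x" for w
    using nn_integral_eq_integral[OF bounded_fun_integrable[OF that(1)]] that(2) by simp
  have "AE x in M. ennreal (u x) = ennreal (v x)"
  proof (rule kernel_energy_strict)
    have "ennreal (energy_form u u + energy_form v v) \<le> ennreal (2 * energy_form u v)"
      by (rule ennreal_leI[OF le])
    then show "kernel_energy M k (\<lambda>x. ennreal (u x)) (\<lambda>x. ennreal (u x)) + kernel_energy M k (\<lambda>x. ennreal (v x)) (\<lambda>x. ennreal (v x))
        \<le> 2 * kernel_energy M k (\<lambda>x. ennreal (u x)) (\<lambda>x. ennreal (v x))"
      using energy_form_eq_kernel_energy[OF u v] energy_form_eq_kernel_energy[OF u u] energy_form_eq_kernel_energy[OF v v]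
      by (simp add: ennreal_mult ennreal_plus)
    show "kernel_energy M k (\<lambda>x. ennreal (u x)) (\<lambda>x. ennreal (v x)) < \<infinity>"
      using energy_form_eq_kernel_energy[OF u v] by simp
  qed (use fin u v in auto)
  then show ?thesis
    by eventually_elim (use u v in \<open>simp add: ennreal_inj\<close>)
qed

definition field_integral :: "(complex \<Rightarrow> real) \<Rightarrow> ennreal" where
  "field_integral u = (\<integral>\<^sup>+x. e2ennreal (f x + ereal c) * ennreal (u x) \<partial>M)"

lemma field_integral_lin:
  assumes [measurable]: "u \<in> borel_measurable M" "v \<in> borel_measurable M" and "\<And>x. 0 \<le> u x" "\<And>x. 0 \<le> v x" "0 \<le> a" "0 \<le> b"
  shows "field_integral (\<lambda>x. a * u x + b * v x) = ennreal a * field_integral u + ennreal b * field_integral v"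
proof -
  have "field_integral (\<lambda>x. a * u x + b * v x) = (\<integral>\<^sup>+x. ennreal a * (e2ennreal (f x + ereal c) * ennreal (u x)) + ennreal b * (e2ennreal (f x + ereal c) * ennreal (v x)) \<partial>M)"
    unfolding field_integral_def
    by (intro nn_integral_cong) (use assms in \<open>simp add: ennreal_plus ennreal_mult distrib_left ac_simps\<close>)
  also have "\<dots> = ennreal a * field_integral u + ennreal b * field_integral v"
    unfolding field_integral_def by (simp add: nn_integral_add nn_integral_cmult)
  finally show ?thesis .
qed

definition admissible :: "(complex \<Rightarrow> real) set" where
  "admissible = {u. u \<in> borel_measurable M \<and> (\<forall>x. 0 \<le> u x \<and> u x \<le> R) \<and> field_integral u < \<infinity>}"

text \<open>The middle term undoes the shift of \<open>f\<close> inside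
  \<open>field_integral\<close>, so that on \<open>admissible\<close> this is the weighted energy;
  see \<open>weighted_energy_functional\<close>.\<close>

definition functional :: "(complex \<Rightarrow> real) \<Rightarrow> real" where
  "functional u = energy_form u u - 2 * c * (LINT x|M. u x) + 2 * enn2real (field_integral u)"

lemma bounded_funI: "u \<in> borel_measurable M \<Longrightarrow> (\<And>x. 0 \<le> u x \<and> u x \<le> R) \<Longrightarrow> bounded_fun u"
  unfolding bounded_fun_def by (auto intro!: exI[of _ R])

lemma admissibleD:
  assumes "u \<in> admissible"
  shows "bounded_fun u" "\<And>x. 0 \<le> u x" "\<And>x. u x \<le> R" "u \<in> borel_measurable M" "field_integral u < \<infinity>"
  using assms bounded_funI by (auto simp: admissible_def)

lemma functional_lin:
  assumes u: "u \<in> admissible" and v: "v \<in> admissible" and ab: "0 \<le> a" "0 \<le> b"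
  shows "functional (\<lambda>x. a * u x + b * v x) = a\<^sup>2 * energy_form u u + 2 * a * b * energy_form u v + b\<^sup>2 * energy_form v v
     - 2 * c * (a * (LINT x|M. u x) + b * (LINT x|M. v x)) + 2 * (a * enn2real (field_integral u) + b * enn2real (field_integral v))"
proof -
  have "enn2real (field_integral (\<lambda>x. a * u x + b * v x)) = a * enn2real (field_integral u) + b * enn2real (field_integral v)"
    using field_integral_lin[OF admissibleD(4)[OF u] admissibleD(4)[OF v] admissibleD(2)[OF u] admissibleD(2)[OF v] ab]
      admissibleD(5)[OF u] admissibleD(5)[OF v] ab
    by (simp add: enn2real_plus enn2real_mult ennreal_mult_less_top)
  then show ?thesis
    using bounded_fun_integrable[OF admissibleD(1)[OF u]] bounded_fun_integrable[OF admissibleD(1)[OF v]]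
    by (simp add: functional_def energy_form_quadratic[OF admissibleD(1)[OF u] admissibleD(1)[OF v]])
qed

lemma admissible_midpoint:
  assumes u: "u \<in> admissible" and v: "v \<in> admissible"
  shows "(\<lambda>x. (u x + v x) / 2) \<in> admissible"
    "functional (\<lambda>x. (u x + v x) / 2) = (functional u + functional v) / 2 - (energy_form u u + energy_form v v - 2 * energy_form u v) / 4"
proof -
  have eq: "(\<lambda>x. (u x + v x) / 2) = (\<lambda>x. 1 / 2 * u x + 1 / 2 * v x)"
    by (auto simp: fun_eq_iff)
  note D = admissibleD[OF u] admissibleD[OF v]
  note [measurable] = D(4) D(9)
  have "field_integral (\<lambda>x. (u x + v x) / 2) < \<infinity>"
  proof -
    have half: "ennreal (1 / 2) * field_integral w < \<infinity>" if "field_integral w < \<infinity>" for w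
      using that ennreal_less_top[of "1 / 2"] unfolding infinity_ennreal_def ennreal_mult_less_top by blast
    have "field_integral (\<lambda>x. 1 / 2 * u x + 1 / 2 * v x) = ennreal (1 / 2) * field_integral u + ennreal (1 / 2) * field_integral v"
      by (rule field_integral_lin) (use D in auto)
    then show ?thesis
      unfolding eq using half[OF D(5)] half[OF D(10)]
      by (metis ennreal_add_eq_top infinity_ennreal_def less_top)
  qed
  moreover have "0 \<le> (u x + v x) / 2 \<and> (u x + v x) / 2 \<le> R" for x
    using D(2,3)[of x] D(7,8)[of x] by auto
  ultimately show "(\<lambda>x. (u x + v x) / 2) \<in> admissible"
    unfolding admissible_def by auto
  show "functional (\<lambda>x. (u x + v x) / 2) = (functional u + functional v) / 2 - (energy_form u u + energy_form v v - 2 * energy_form u v) / 4"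
  proof -
    have half: "(0::real) \<le> 1 / 2"
      by simp
    show ?thesis
      unfolding eq functional_lin[OF u v half half] functional_def by (rule midpoint_identity)
  qed
qed

lemma zero_admissible: "(\<lambda>_. 0) \<in> admissible" "functional (\<lambda>_. 0) = 0"
  using R by (auto simp: admissible_def functional_def field_integral_def energy_form_def)

text \<open>Energy and mass converge by domination, with \<open>kernel p * (R * R)\<close> as
  integrable bound; only the field term can drop in the limit, and Fatou controls it.\<close>

lemma functional_lsc:
  assumes w: "\<And>n. w n \<in> admissible" and u: "u \<in> borel_measurable M" "\<And>x. 0 \<le> u x \<and> u x \<le> R"
    and ae: "AE x in M. (\<lambda>n. w n x) \<longlonglongrightarrow> u x" and L: "(\<lambda>n. functional (w n)) \<longlonglongrightarrow> L"
  shows "u \<in> admissible \<and> functional u \<le> L"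
proof -
  note [measurable] = u(1) admissibleD(4)[OF w]
  have ub: "bounded_fun u"
    by (rule bounded_funI[OF u])
  note D = admissibleD[OF w]
  have R0: "0 \<le> R"
    using R by simp
  have aep: "AE p in (M \<Otimes>\<^sub>M M). (\<lambda>n. w n (fst p)) \<longlonglongrightarrow> u (fst p) \<and> (\<lambda>n. w n (snd p)) \<longlonglongrightarrow> u (snd p)"
  proof (rule MM.AE_pair_measure)
    have "AE x in M. AE y in M. (\<lambda>n. w n x) \<longlonglongrightarrow> u x \<and> (\<lambda>n. w n y) \<longlonglongrightarrow> u y"
      using ae
    proof eventually_elim
      case (elim x)
      then show ?case
        using ae by (auto elim: eventually_mono)
    qed
    then show "AE x in M. AE y in M. (\<lambda>n. w n (fst (x, y))) \<longlonglongrightarrow> u (fst (x, y)) \<and> (\<lambda>n. w n (snd (x, y))) \<longlonglongrightarrow> u (snd (x, y))"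
      by simp
  qed measurable
  have I_lim: "(\<lambda>n. energy_form (w n) (w n)) \<longlonglongrightarrow> energy_form u u"
    unfolding energy_form_def
  proof (rule integral_dominated_convergence[where w="\<lambda>p. kernel p * (R * R)"])
    show "integrable (M \<Otimes>\<^sub>M M) (\<lambda>p. kernel p * (R * R))"
      using integrable_kernel by simp
    show "AE p in (M \<Otimes>\<^sub>M M). (\<lambda>n. kernel p * (w n (fst p) * w n (snd p))) \<longlonglongrightarrow> kernel p * (u (fst p) * u (snd p))"
      using aep by eventually_elim (auto intro!: tendsto_intros)
    show "AE p in (M \<Otimes>\<^sub>M M). norm (kernel p * (w n (fst p) * w n (snd p))) \<le> kernel p * (R * R)" for n
      using D(2,3) kernel_nonneg R0 by (auto simp: abs_mult intro!: mult_left_mono mult_mono)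
  qed measurable
  have int_lim: "(\<lambda>n. LINT x|M. w n x) \<longlonglongrightarrow> (LINT x|M. u x)"
    by (rule integral_dominated_convergence[where w="\<lambda>_. R"]) (use ae D(2,3) in auto)
  define l where "l = (L - energy_form u u + 2 * c * (LINT x|M. u x)) / 2"
  have F_eq: "enn2real (field_integral (w n)) = (functional (w n) - energy_form (w n) (w n) + 2 * c * (LINT x|M. w n x)) / 2" for n
    by (simp add: functional_def)
  have F_lim: "(\<lambda>n. enn2real (field_integral (w n))) \<longlonglongrightarrow> l"
    unfolding F_eq l_def by (intro tendsto_intros L I_lim int_lim) simp
  have l0: "0 \<le> l"
    by (rule LIMSEQ_le_const[OF F_lim]) auto
  have F_enn: "field_integral (w n) = ennreal (enn2real (field_integral (w n)))" for n
    using D(5)[of n] by (simp add: less_top)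
  have "field_integral u \<le> (\<integral>\<^sup>+x. liminf (\<lambda>n. e2ennreal (f x + ereal c) * ennreal (w n x)) \<partial>M)"
    unfolding field_integral_def
  proof (rule nn_integral_mono_AE)
    show "AE x in M. e2ennreal (f x + ereal c) * ennreal (u x) \<le> liminf (\<lambda>n. e2ennreal (f x + ereal c) * ennreal (w n x))"
      using ae
    proof eventually_elim
      case (elim x)
      show ?case
      \<comment> \<open>Where \<open>f\<close> is infinite, the product with the density is
        discontinuous at density 0; but there the left side is 0.\<close>
      proof (cases "u x = 0")
        case False
        then have "ennreal (u x) \<noteq> 0"
          using u(2)[of x] by (simp add: ennreal_eq_0_iff)
        then have "(\<lambda>n. e2ennreal (f x + ereal c) * ennreal (w n x)) \<longlonglongrightarrow> e2ennreal (f x + ereal c) * ennreal (u x)"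
          using elim by (intro tendsto_mult_ennreal tendsto_const tendsto_ennrealI) auto
        then show ?thesis
          by (simp add: lim_imp_Liminf)
      qed simp
    qed
  qed
  also have "\<dots> \<le> liminf (\<lambda>n. field_integral (w n))"
    unfolding field_integral_def by (rule nn_integral_liminf) measurable
  also have "liminf (\<lambda>n. field_integral (w n)) = ennreal l"
  proof -
    have "(\<lambda>n. field_integral (w n)) \<longlonglongrightarrow> ennreal l"
      by (subst F_enn) (intro tendsto_ennrealI F_lim)
    then show ?thesis
      by (simp add: lim_imp_Liminf)
  qed
  finally have Fu: "field_integral u \<le> ennreal l" .
  then have "field_integral u < \<infinity>"
    by (rule le_less_trans) simp
  then have "u \<in> admissible"
    using u by (auto simp: admissible_def)
  moreover have "enn2real (field_integral u) \<le> l"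
    using Fu l0 by (metis enn2real_ennreal enn2real_mono ennreal_less_top)
  ultimately show ?thesis
    by (simp add: functional_def l_def)
qed

lemma exists_functional_minimizer:
  obtains u where "u \<in> admissible" "\<And>v. v \<in> admissible \<Longrightarrow> functional u \<le> functional v"
proof (rule exists_minimizer[where U=admissible and R=R and j=functional and ?u0.0="\<lambda>_. 0" and B="- (2 * c * (R * measure M (space M)))"])
  show "finite_measure M"
    by (rule M)
  show "(\<lambda>x. (u x + v x) / 2) \<in> admissible \<and> functional (\<lambda>x. (u x + v x) / 2) \<le> (functional u + functional v) / 2"
    if u: "u \<in> admissible" and v: "v \<in> admissible" for u v
  proof
    show "(\<lambda>x. (u x + v x) / 2) \<in> admissible"
      by (rule admissible_midpoint[OF u v])
    show "functional (\<lambda>x. (u x + v x) / 2) \<le> (functional u + functional v) / 2"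
      unfolding admissible_midpoint(2)[OF u v]
      using energy_form_psd[OF admissibleD(1,2)[OF u] admissibleD(1,2)[OF v]] by (intro diff_quarter_le) simp
  qed
  show "- (2 * c * (R * measure M (space M))) \<le> functional u" if u: "u \<in> admissible" for u
  proof -
    have "(LINT x|M. u x) \<le> (LINT x|M. R)"
      using bounded_fun_integrable[OF admissibleD(1)[OF u]] admissibleD(3)[OF u] by (intro integral_mono) auto
    then have "2 * c * (LINT x|M. u x) \<le> 2 * c * (R * measure M (space M))"
      using c by (intro mult_left_mono) (auto simp: mult.commute)
    moreover have "0 \<le> energy_form u u"
      by (intro energy_form_eq_kernel_energy admissibleD u)
    ultimately show ?thesis
      unfolding functional_def using enn2real_nonneg[of "field_integral u"] by linarith
  qed
  show "u \<in> borel_measurable M" if "u \<in> admissible" for u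
    by (rule admissibleD[OF that])
  show "0 \<le> u x \<and> u x \<le> R" if "u \<in> admissible" for u x
    using admissibleD(2,3)[OF that] by simp
  show "(\<lambda>_. 0) \<in> admissible"
    by (rule zero_admissible)
  show "0 \<le> R"
    using R by simp
  show "u \<in> admissible \<and> functional u \<le> L"
    if "\<And>n. w n \<in> admissible" "u \<in> borel_measurable M" "\<And>x. 0 \<le> u x \<and> u x \<le> R"
      "AE x in M. (\<lambda>n. w n x) \<longlonglongrightarrow> u x" "(\<lambda>n. functional (w n)) \<longlonglongrightarrow> L" for w u L
    by (rule functional_lsc[OF that])
qed (rule that; blast)

text \<open>The midpoint of two minimisers lies a quarter of the energy of their difference below
  the minimum, so that energy cannot be positive.\<close>

lemma functional_minimizer_unique:
  assumes u: "u \<in> admissible" "\<And>w. w \<in> admissible \<Longrightarrow> functional u \<le> functional w"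
    and v: "v \<in> admissible" "\<And>w. w \<in> admissible \<Longrightarrow> functional v \<le> functional w"
  shows "AE x in M. u x = v x"
proof (rule energy_form_strict)
  have "functional u = functional v"
    using u v by (intro antisym) auto
  moreover have "functional u \<le> (functional u + functional v) / 2 - (energy_form u u + energy_form v v - 2 * energy_form u v) / 4"
    using u(2)[OF admissible_midpoint(1)[OF u(1) v(1)]] unfolding admissible_midpoint(2)[OF u(1) v(1)] .
  ultimately show "energy_form u u + energy_form v v \<le> 2 * energy_form u v"
    by simp
qed (use admissibleD(1,2)[OF u(1)] admissibleD(1,2)[OF v(1)] in simp_all)

end

section \<open>Potentials and energies of densities\<close>

context green_setting
begin

abbreviation with_density :: "(complex \<Rightarrow> real) \<Rightarrow> complex measure" where
  "with_density u \<equiv> density M (\<lambda>x. ennreal (u x))"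

lemma green_potential_density:
  assumes [measurable]: "u \<in> borel_measurable M" and z: "z \<in> K"
  shows "green_potential g (with_density u) z = enn2ereal (\<integral>\<^sup>+y. k z y * ennreal (u y) \<partial>M)"
proof -
  have "green_potential g (with_density u) z = enn2ereal (\<integral>\<^sup>+y. k z y \<partial>with_density u)"
    unfolding green_potential_def by (rule ereal_integral_enn2ereal) (use z in_D space_M in \<open>auto intro: g_eq\<close>)
  also have "(\<integral>\<^sup>+y. k z y \<partial>with_density u) = (\<integral>\<^sup>+y. ennreal (u y) * k z y \<partial>M)"
    by (rule nn_integral_density) measurable
  finally show ?thesis
    by (simp add: mult.commute)
qed

lemma green_energy_density:
  assumes [measurable]: "u \<in> borel_measurable M"
  shows "green_energy g (with_density u) = enn2ereal (kernel_energy M k (\<lambda>x. ennreal (u x)) (\<lambda>x. ennreal (u x)))"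
proof -
  have "green_energy g (with_density u) = enn2ereal (\<integral>\<^sup>+x. (\<integral>\<^sup>+y. k x y * ennreal (u y) \<partial>M) \<partial>with_density u)"
    unfolding green_energy_def by (rule ereal_integral_enn2ereal) (simp add: green_potential_density space_M)
  also have "(\<integral>\<^sup>+x. (\<integral>\<^sup>+y. k x y * ennreal (u y) \<partial>M) \<partial>with_density u) = (\<integral>\<^sup>+x. ennreal (u x) * (\<integral>\<^sup>+y. k x y * ennreal (u y) \<partial>M) \<partial>M)"
    by (rule nn_integral_density) measurable
  also have "\<dots> = kernel_energy M k (\<lambda>x. ennreal (u x)) (\<lambda>x. ennreal (u x))"
    unfolding kernel_energy_def by (intro nn_integral_cong) (simp add: nn_integral_cmult[symmetric] ac_simps)
  finally show ?thesis .
qed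

end

section \<open>The constrained minimum in terms of densities\<close>

context green_minimization
begin

lemma weighted_energy_density:
  assumes u: "u \<in> borel_measurable M" "\<And>x. 0 \<le> u x \<and> u x \<le> R"
  shows "weighted_energy g f (with_density u) =
    ereal (energy_form u u - 2 * c * (LINT x|M. u x)) + 2 * enn2ereal (field_integral u)"
proof -
  note [measurable] = u(1)
  have ub: "bounded_fun u" "\<And>x. 0 \<le> u x"
    using bounded_funI u by auto
  have mass: "emeasure (with_density u) (space M) = ennreal (LINT x|M. u x)"
    using nn_integral_eq_integral[OF bounded_fun_integrable[OF ub(1)]] ub(2)
    by (simp add: emeasure_density nn_integral_cong[of M "\<lambda>x. ennreal (u x) * indicator (space M) x" "\<lambda>x. ennreal (u x)"])
  have int0: "0 \<le> (LINT x|M. u x)"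
    using ub(2) by (intro integral_nonneg_AE) auto
  have "ereal_integral (with_density u) f = enn2ereal (\<integral>\<^sup>+x. e2ennreal (f x + ereal c) \<partial>with_density u) - ereal (c * measure (with_density u) (space (with_density u)))"
  proof (rule ereal_integral_shift)
    show "finite_measure (with_density u)"
      by standard (simp add: mass)
  qed (use c f_ge in auto)
  also have "measure (with_density u) (space (with_density u)) = (LINT x|M. u x)"
    using mass int0 by (simp add: measure_def)
  also have "(\<integral>\<^sup>+x. e2ennreal (f x + ereal c) \<partial>with_density u) = field_integral u"
    unfolding field_integral_def by (subst nn_integral_density) (auto simp: mult.commute)
  finally have F: "ereal_integral (with_density u) f = enn2ereal (field_integral u) - ereal (c * (LINT x|M. u x))" .
  have E: "green_energy g (with_density u) = ereal (energy_form u u)"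
    using energy_form_eq_kernel_energy[OF ub ub] by (simp add: green_energy_density[OF u(1)])
  show ?thesis
    unfolding weighted_energy_def E F
    by (cases "enn2ereal (field_integral u)") (auto simp: algebra_simps)
qed

lemma weighted_energy_functional:
  assumes u: "u \<in> admissible"
  shows "weighted_energy g f (with_density u) = ereal (functional u)"
proof -
  have "enn2ereal (field_integral u) = ereal (enn2real (field_integral u))"
    using admissibleD(5)[OF u] by (metis enn2ereal_ennreal enn2real_nonneg ennreal_enn2real infinity_ennreal_def)
  then show ?thesis
    using weighted_energy_density[OF admissibleD(4)[OF u]] admissibleD(2,3)[OF u] by (simp add: functional_def)
qed

lemma weighted_energy_infinite:
  assumes u: "u \<in> borel_measurable M" "\<And>x. 0 \<le> u x \<and> u x \<le> R" "u \<notin> admissible"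
  shows "weighted_energy g f (with_density u) = \<infinity>"
proof -
  have "\<not> field_integral u < \<infinity>"
    using u by (auto simp: admissible_def)
  then have "field_integral u = \<top>"
    unfolding infinity_ennreal_def by (metis less_top)
  then show ?thesis
    unfolding weighted_energy_density[OF u(1,2)] by simp
qed

lemma constrained_measures_eq:
  "constrained_measures K R M = with_density ` {u. u \<in> borel_measurable M \<and> (\<forall>x. 0 \<le> u x \<and> u x \<le> R)}"
proof (rule set_eqI, rule iffI)
  fix \<mu> assume "\<mu> \<in> constrained_measures K R M"
  then have "sets \<mu> = sets M" "\<mu> \<le> scale_measure (ennreal R) M"
    by (auto simp: constrained_measures_def borel_measure_on_def sets_M)
  from density_of_dominated[OF this] R obtain u where "u \<in> borel_measurable M" "\<And>x. 0 \<le> u x \<and> u x \<le> R" "\<mu> = with_density u"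
    by (metis less_imp_le)
  then show "\<mu> \<in> with_density ` {u. u \<in> borel_measurable M \<and> (\<forall>x. 0 \<le> u x \<and> u x \<le> R)}"
    by auto
next
  fix \<mu> assume "\<mu> \<in> with_density ` {u. u \<in> borel_measurable M \<and> (\<forall>x. 0 \<le> u x \<and> u x \<le> R)}"
  then show "\<mu> \<in> constrained_measures K R M"
    using density_dominated[of _ M R] by (auto simp: constrained_measures_def borel_measure_on_def sets_M)
qed

lemma weighted_energy_ge:
  assumes u: "\<And>v. v \<in> admissible \<Longrightarrow> functional u \<le> functional v" and \<mu>: "\<mu> \<in> constrained_measures K R M"
  shows "ereal (functional u) \<le> weighted_energy g f \<mu>"
proof -
  obtain v where v: "v \<in> borel_measurable M" "\<And>x. 0 \<le> v x \<and> v x \<le> R" "\<mu> = with_density v"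
    using \<mu> unfolding constrained_measures_eq by auto
  show ?thesis
  proof (cases "v \<in> admissible")
    case True
    then show ?thesis
      using u weighted_energy_functional by (simp add: v(3))
  next
    case False
    then show ?thesis
      using weighted_energy_infinite[OF v(1,2)] by (simp add: v(3))
  qed
qed

lemma admissible_constrained: "u \<in> admissible \<Longrightarrow> with_density u \<in> constrained_measures K R M"
  unfolding constrained_measures_eq using admissibleD by auto

lemma constrained_value_eq:
  assumes "u \<in> admissible" "\<And>v. v \<in> admissible \<Longrightarrow> functional u \<le> functional v"
  shows "constrained_value g f K R M = ereal (functional u)"
  unfolding constrained_value_def
proof (rule antisym)
  show "(INF \<mu>\<in>constrained_measures K R M. weighted_energy g f \<mu>) \<le> ereal (functional u)"
    by (rule INF_lower2[OF admissible_constrained[OF assms(1)]]) (simp add: weighted_energy_functional[OF assms(1)])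
  show "ereal (functional u) \<le> (INF \<mu>\<in>constrained_measures K R M. weighted_energy g f \<mu>)"
    by (intro INF_greatest weighted_energy_ge assms(2))
qed

text \<open>The minimal value is real, being the functional of an admissible density, so a density
  with infinite field term cannot attain it.\<close>

lemma minimizer_density:
  assumes \<mu>: "\<mu> \<in> constrained_measures K R M" "weighted_energy g f \<mu> = constrained_value g f K R M"
  obtains u where "u \<in> admissible" "\<And>v. v \<in> admissible \<Longrightarrow> functional u \<le> functional v" "\<mu> = with_density u"
proof -
  obtain w where w: "w \<in> admissible" "\<And>v. v \<in> admissible \<Longrightarrow> functional w \<le> functional v"
    using exists_functional_minimizer by blast
  obtain u where u: "u \<in> borel_measurable M" "\<And>x. 0 \<le> u x \<and> u x \<le> R" "\<mu> = with_density u"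
    using \<mu>(1) unfolding constrained_measures_eq by auto
  have val: "weighted_energy g f \<mu> = ereal (functional w)"
    using \<mu>(2) constrained_value_eq[OF w] by simp
  then have ua: "u \<in> admissible"
    using weighted_energy_infinite[OF u(1,2)] u(3) by force
  then have "functional u = functional w"
    using val weighted_energy_functional[OF ua] u(3) by simp
  then show thesis
    using that[OF ua _ u(3)] w(2) by simp
qed

lemma minimizer_ex1:
  "\<exists>!\<mu>. \<mu> \<in> constrained_measures K R M \<and> weighted_energy g f \<mu> = constrained_value g f K R M"
proof -
  obtain w where w: "w \<in> admissible" "\<And>v. v \<in> admissible \<Longrightarrow> functional w \<le> functional v"
    using exists_functional_minimizer by blast
  show ?thesis
  proof (rule ex1I[of _ "with_density w"])
    show "with_density w \<in> constrained_measures K R M \<and> weighted_energy g f (with_density w) = constrained_value g f K R M"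
      using admissible_constrained[OF w(1)] weighted_energy_functional[OF w(1)] constrained_value_eq[OF w] by simp
    fix \<mu> assume "\<mu> \<in> constrained_measures K R M \<and> weighted_energy g f \<mu> = constrained_value g f K R M"
    then obtain u where u: "u \<in> admissible" "\<And>v. v \<in> admissible \<Longrightarrow> functional u \<le> functional v" "\<mu> = with_density u"
      using minimizer_density by metis
    have "AE x in M. u x = w x"
      by (rule functional_minimizer_unique[OF u(1,2) w])
    then show "\<mu> = with_density w"
      unfolding u(3) using admissibleD(4)[OF u(1)] admissibleD(4)[OF w(1)] by (intro density_cong) (auto elim: eventually_mono)
  qed
qed

text \<open>The zero measure has value 0. Were the minimum not negative, it would be attained there
  too, and uniqueness would make \<open>\<mu>\<close> zero.\<close>

lemma minimizer_value_neg:
  assumes \<mu>: "\<mu> \<in> constrained_measures K R M" "weighted_energy g f \<mu> = constrained_value g f K R M" and pos: "0 < emeasure \<mu> K"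
  shows "constrained_value g f K R M < 0"
proof (rule ccontr)
  assume neg: "\<not> ?thesis"
  obtain u where u: "u \<in> admissible" "\<And>v. v \<in> admissible \<Longrightarrow> functional u \<le> functional v" "\<mu> = with_density u"
    using minimizer_density[OF \<mu>] by metis
  have "functional u = 0"
    using neg constrained_value_eq[OF u(1,2)] u(2)[OF zero_admissible(1)] zero_admissible(2) by simp
  then have "AE x in M. u x = 0"
    using functional_minimizer_unique[OF u(1,2) zero_admissible(1)] u(2) zero_admissible(2) by simp
  then have "with_density u = density M (\<lambda>_. 0)"
    using admissibleD(4)[OF u(1)] by (intro density_cong) (auto elim: eventually_mono)
  then have "emeasure \<mu> K = 0"
    using u(3) sets.top[of M] by (simp add: emeasure_density space_M)
  with pos show False
    by simp
qed

section \<open>First variation along a transfer of mass\<close>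

lemma field_integral_indicator_finite:
  assumes u: "u \<in> admissible" and A [measurable]: "A \<in> sets M" and d: "d > 0" and uA: "\<And>x. x \<in> A \<Longrightarrow> d \<le> u x"
  shows "field_integral (indicator A) < \<infinity>"
proof -
  have "ennreal d * field_integral (indicator A) \<le> field_integral u"
  proof -
    have "ennreal d * field_integral (indicator A) = (\<integral>\<^sup>+x. ennreal d * (e2ennreal (f x + ereal c) * ennreal (indicator A x)) \<partial>M)"
      unfolding field_integral_def by (rule nn_integral_cmult[symmetric]) measurable
    also have "\<dots> \<le> field_integral u"
      unfolding field_integral_def
    proof (rule nn_integral_mono)
      fix x
      show "ennreal d * (e2ennreal (f x + ereal c) * ennreal (indicator A x)) \<le> e2ennreal (f x + ereal c) * ennreal (u x)"
      proof (cases "x \<in> A")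
        case True
        then show ?thesis
          using uA[OF True] by (simp add: mult.commute[of "ennreal d"] mult_left_mono ennreal_leI)
      qed simp
    qed
    finally show ?thesis .
  qed
  also have "\<dots> < \<infinity>"
    by (rule admissibleD[OF u])
  finally show ?thesis
    using d by (auto simp: ennreal_mult_less_top)
qed

text \<open>The competitor is \<open>u + t * (measure M A * indicator B - measure M B * indicator A)\<close> for small \<open>t\<close>.\<close>

lemma first_variation:
  assumes u: "u \<in> admissible" "\<And>v. v \<in> admissible \<Longrightarrow> functional u \<le> functional v"
    and A: "A \<in> sets M" and B: "B \<in> sets M" and d: "d > 0"
    and uA: "\<And>x. x \<in> A \<Longrightarrow> d \<le> u x" and uB: "\<And>x. x \<in> B \<Longrightarrow> u x \<le> R - d" and disj: "A \<inter> B = {}"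
    and BF: "field_integral (indicator B) < \<infinity>"
  shows "measure M B * (energy_form u (indicator A) - c * measure M A + enn2real (field_integral (indicator A)))
    \<le> measure M A * (energy_form u (indicator B) - c * measure M B + enn2real (field_integral (indicator B)))"
proof -
  define a where "a = measure M A"
  define b where "b = measure M B"
  have ab: "0 \<le> a" "0 \<le> b"
    by (simp_all add: a_def b_def)
  have R0: "0 \<le> R"
    using R by simp
  have bA: "bounded_fun (indicator A)" and bB: "bounded_fun (indicator B)"
    unfolding bounded_fun_def using A B by (auto intro!: exI[of _ 1])
  have ub: "bounded_fun u"
    by (rule admissibleD[OF u(1)])
  note [measurable] = A B bounded_fun_measurable[OF ub]
  have FA: "field_integral (indicator A) < \<infinity>"
    by (rule field_integral_indicator_finite[OF u(1) A d uA])
  \<comment> \<open>The crossed weights give \<open>h\<close> total mass 0, so the mass term with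
    \<open>c\<close> does not change.\<close>
  define h where "h x = a * indicator B x + (- b) * indicator A x" for x
  have bh: "bounded_fun h"
    unfolding h_def[abs_def] by (rule bounded_fun_lin[OF bB bA])
  \<comment> \<open>Half the derivative of the functional at \<open>t = 0\<close> in direction
    \<open>h\<close>; the two terms with \<open>c\<close> cancel.\<close>
  define P where "P = a * (energy_form u (indicator B) - c * b + enn2real (field_integral (indicator B)))
     - b * (energy_form u (indicator A) - c * a + enn2real (field_integral (indicator A)))"
  have adm: "(\<lambda>x. u x + t * h x) \<in> admissible \<and> functional (\<lambda>x. u x + t * h x) = functional u + 2 * t * P + t\<^sup>2 * energy_form h h"
    if t: "0 \<le> t" "t * (a + b) \<le> d" for t
  proof -
    have ta: "0 \<le> t * a" "0 \<le> t * b"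
      using t(1) ab by simp_all
    moreover have "t * a + t * b \<le> d"
      using t(2) by (simp add: distrib_left)
    ultimately have ta': "t * a \<le> d" "t * b \<le> d"
      by simp_all
    have bd: "0 \<le> u x + t * h x \<and> u x + t * h x \<le> R" for x
    proof -
      consider "x \<in> A" "x \<notin> B" | "x \<in> B" "x \<notin> A" | "x \<notin> A" "x \<notin> B"
        using disj by blast
      then show ?thesis
      proof cases
        case 1
        then show ?thesis
          using uA[OF 1(1)] admissibleD(2,3)[OF u(1), of x] ta ta' by (simp add: h_def)
      next
        case 2
        then show ?thesis
          using uB[OF 2(1)] admissibleD(2,3)[OF u(1), of x] ta ta' by (simp add: h_def)
      next
        case 3
        then show ?thesis
          using admissibleD(2,3)[OF u(1), of x] by (simp add: h_def)
      qed
    qed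
    have um [measurable]: "(\<lambda>x. u x + t * h x) \<in> borel_measurable M"
      using bounded_fun_measurable[OF bounded_fun_lin[OF ub bh, of 1 t]] by simp
    \<comment> \<open>Written without subtraction, because \<open>h\<close> takes both signs and
      \<open>field_integral\<close> is \<open>ennreal\<close>-valued.\<close>
    have split: "field_integral (\<lambda>x. u x + t * h x) + ennreal (t * b) * field_integral (indicator A)
        = field_integral u + ennreal (t * a) * field_integral (indicator B)"
    proof -
      have 1: "field_integral (\<lambda>x. 1 * (u x + t * h x) + (t * b) * indicator A x) = ennreal 1 * field_integral (\<lambda>x. u x + t * h x) + ennreal (t * b) * field_integral (indicator A)"
        using ta bd um by (intro field_integral_lin) auto
      have 2: "field_integral (\<lambda>x. 1 * u x + (t * a) * indicator B x) = ennreal 1 * field_integral u + ennreal (t * a) * field_integral (indicator B)"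
        using ta admissibleD[OF u(1)] by (intro field_integral_lin) auto
      have "(\<lambda>x. 1 * (u x + t * h x) + (t * b) * indicator A x) = (\<lambda>x. 1 * u x + (t * a) * indicator B x)"
        by (auto simp: fun_eq_iff h_def algebra_simps)
      with 1 2 show ?thesis
        by (metis ennreal_1 mult_1)
    qed
    have finA: "ennreal (t * b) * field_integral (indicator A) < \<infinity>" and finB: "ennreal (t * a) * field_integral (indicator B) < \<infinity>"
      using FA BF ennreal_less_top by (auto simp: ennreal_mult_less_top)
    have fin: "field_integral (\<lambda>x. u x + t * h x) < \<infinity>"
    proof -
      have "field_integral (\<lambda>x. u x + t * h x) \<le> field_integral u + ennreal (t * a) * field_integral (indicator B)"
        unfolding split[symmetric] by simp
      also have "\<dots> < \<infinity>"
        using admissibleD(5)[OF u(1)] finB by simp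
      finally show ?thesis .
    qed
    have F: "enn2real (field_integral (\<lambda>x. u x + t * h x)) = enn2real (field_integral u)
        + t * a * enn2real (field_integral (indicator B)) - t * b * enn2real (field_integral (indicator A))"
      using arg_cong[OF split, of enn2real] fin finA finB admissibleD(5)[OF u(1)] ta
      by (simp add: enn2real_plus enn2real_mult)
    have I: "energy_form (\<lambda>x. u x + t * h x) (\<lambda>x. u x + t * h x) = energy_form u u + 2 * t * energy_form u h + t\<^sup>2 * energy_form h h"
      using energy_form_quadratic[OF ub bh, of 1 t] by simp
    have Ih: "energy_form u h = a * energy_form u (indicator B) - b * energy_form u (indicator A)"
    proof -
      have "energy_form h u = a * energy_form (indicator B) u + (- b) * energy_form (indicator A) u"
        unfolding h_def[abs_def] by (rule energy_form_lin_left[OF bB bA ub])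
      then show ?thesis
        using energy_form_commute[OF ub bh] energy_form_commute[OF ub bA] energy_form_commute[OF ub bB] by simp
    qed
    have int_ind: "(LINT x|M. indicator V x) = measure M V" if "V \<in> sets M" for V
      using that by simp
    have Lh: "(LINT x|M. u x + t * h x) = (LINT x|M. u x)"
    proof -
      have "(LINT x|M. h x) = a * b - b * a"
        using bounded_fun_integrable[OF bA] bounded_fun_integrable[OF bB] int_ind[OF A] int_ind[OF B]
        by (simp add: h_def a_def b_def)
      then show ?thesis
        using bounded_fun_integrable[OF ub] bounded_fun_integrable[OF bh] by simp
    qed
    have "(\<lambda>x. u x + t * h x) \<in> admissible"
      using bd fin um by (auto simp: admissible_def)
    moreover have "functional (\<lambda>x. u x + t * h x) = functional u + 2 * t * P + t\<^sup>2 * energy_form h h"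
      unfolding functional_def I Ih Lh F P_def by (simp add: algebra_simps)
    ultimately show ?thesis ..
  qed
  have "0 \<le> P"
  proof (rule ccontr)
    assume "\<not> 0 \<le> P"
    then have P: "P < 0"
      by simp
    define E where "E = \<bar>energy_form h h\<bar> + 1"
    have E: "E > 0" "energy_form h h \<le> E"
      by (auto simp: E_def)
    \<comment> \<open>The first bound keeps the competitor between 0 and \<open>R\<close>; the
      second gives \<open>t * energy_form h h \<le> - P\<close>, so the linear term wins.\<close>
    define t where "t = min (d / (a + b + 1)) (- P / E)"
    have t: "0 < t" "t \<le> d / (a + b + 1)" "t \<le> - P / E"
      using d P E ab by (auto simp: t_def divide_neg_pos intro: min.cobounded1 min.cobounded2)
    have "t * (a + b) \<le> d / (a + b + 1) * (a + b)"
      using t ab by (intro mult_right_mono) auto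
    also have "\<dots> \<le> d"
      using d ab by (simp add: field_simps)
    finally have adm': "(\<lambda>x. u x + t * h x) \<in> admissible \<and> functional (\<lambda>x. u x + t * h x) = functional u + 2 * t * P + t\<^sup>2 * energy_form h h"
      using t by (intro adm) auto
    have "t * energy_form h h \<le> t * E"
      using E t by (intro mult_left_mono) auto
    also have "\<dots> \<le> - P"
      using t E by (simp add: field_simps)
    finally have "2 * P + t * energy_form h h < 0"
      using P by simp
    then have "t * (2 * P + t * energy_form h h) < 0"
      using t by (simp add: mult_pos_neg)
    then have "functional (\<lambda>x. u x + t * h x) < functional u"
      using adm' by (simp add: algebra_simps power2_eq_square)
    with u(2)[of "\<lambda>x. u x + t * h x"] adm' show False
      by simp
  qed
  then show ?thesis
    by (simp add: P_def a_def b_def algebra_simps)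
qed

end

section \<open>Lower semicontinuity of the Green potential\<close>

context green_setting
begin

text \<open>Off the pole the kernel is continuous, being harmonic; at the pole the logarithmic lower
  bound makes it tend to infinity.\<close>

lemma kernel_lsc:
  assumes z: "z \<in> K" and y: "y \<in> K" and t: "t < k z y"
  shows "eventually (\<lambda>x. t < k x y) (nhds z)"
proof -
  have S: "open (Some -` D)" "z \<in> Some -` D" "Some y \<in> D"
    using openin_riemann_sphere_vimage[OF D] K z y by auto
  have evS: "eventually (\<lambda>x. x \<in> Some -` D) (nhds z)"
    using S by (auto simp: eventually_nhds)
  obtain p where p: "green_competitor D (Some y) p" "\<And>z. z \<in> Some -` D - {y} \<Longrightarrow> g (Some z) (Some y) = ereal (p (Some z))"
    "g (Some y) (Some y) = \<infinity>"
    using green_functionE[OF green S(3)] by metis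
  have kp: "k x y = ennreal (p (Some x))" if "x \<in> Some -` D - {y}" for x
  proof -
    have "enn2ereal (k x y) = ereal (p (Some x))"
      using g_eq[of x y] p(2)[OF that] that S(3) by simp
    also have "\<dots> = enn2ereal (ennreal (p (Some x)))"
      using green_competitorD(2)[OF p(1) that] by simp
    finally show ?thesis
      by (simp only: enn2ereal_inject)
  qed
  show ?thesis
  proof (cases "z = y")
    case False
    then have zS: "z \<in> Some -` D - {y}"
      using S by auto
    obtain s where "s > 0" "re_holomorphic_near (\<lambda>x. p (Some x)) z s"
      using green_competitorD(1)[OF p(1) zS] by auto
    then have "((\<lambda>x. p (Some x)) \<longlongrightarrow> p (Some z)) (nhds z)"
      using re_holomorphic_near_isCont[of "\<lambda>x. p (Some x)" z s] by (simp add: isCont_def tendsto_nhds_iff)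
    then have "((\<lambda>x. ennreal (p (Some x))) \<longlongrightarrow> ennreal (p (Some z))) (nhds z)"
      by (rule tendsto_ennrealI)
    then have "eventually (\<lambda>x. t < ennreal (p (Some x))) (nhds z)"
      by (rule order_tendstoD(1)) (use t kp[OF zS] in simp)
    moreover have "eventually (\<lambda>x. x \<noteq> y) (nhds z)"
      using False t1_space_nhds by blast
    ultimately show ?thesis
      using evS by eventually_elim (use kp in auto)
  next
    case True
    obtain r where r: "r \<ge> 0" "t = ennreal r"
      using t by (cases t) auto
    obtain d C where dC: "d > 0" "\<And>x. x \<noteq> y \<Longrightarrow> dist x y < d \<Longrightarrow> \<bar>p (Some x) + ln (norm (x - y))\<bar> \<le> C"
      using green_competitorD(3)[OF p(1)] by metis
    \<comment> \<open>From \<open>p (Some x) + ln (norm (x - y)) \<ge> - C\<close>: closer than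
      \<open>exp (- C - r)\<close> to the pole the kernel exceeds \<open>r\<close>.\<close>
    have "eventually (\<lambda>x. dist x z < min d (exp (- C - r))) (nhds z)"
      using dC(1) by (auto simp: eventually_nhds_metric intro!: exI[of _ "min d (exp (- C - r))"])
    with evS show ?thesis
    proof eventually_elim
      case (elim x)
      show ?case
      proof (cases "x = y")
        case True
        then show ?thesis
          using t \<open>z = y\<close> by simp
      next
        case False
        have "ln (norm (x - y)) < ln (exp (- C - r))"
          using elim False \<open>z = y\<close> by (subst ln_less_cancel_iff) (auto simp: dist_norm)
        then have "r < p (Some x)"
          using dC(2)[OF False] elim \<open>z = y\<close> by (simp add: abs_le_iff)
        then show ?thesis
          using kp[of x] elim False r by (simp add: ennreal_lessI)
      qed
    qed
  qed
qed

text \<open>Fatou along sequences, which suffices because points of the plane have countable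
  neighbourhood bases.\<close>

lemma potential_lsc:
  assumes sets: "sets \<mu> = sets M" and z: "z \<in> K" and t: "t < (\<integral>\<^sup>+y. k z y \<partial>\<mu>)"
  shows "eventually (\<lambda>x. t < (\<integral>\<^sup>+y. k x y \<partial>\<mu>)) (nhds z)"
proof -
  have [measurable_cong]: "sets \<mu> = sets M"
    by (rule sets)
  have space: "space \<mu> = K"
    using sets_eq_imp_space_eq[OF sets] space_M by simp
  have "eventually (\<lambda>n. t < (\<integral>\<^sup>+y. k (X n) y \<partial>\<mu>)) sequentially" if X: "X \<longlonglongrightarrow> z" for X
  proof -
    have "(\<integral>\<^sup>+y. k z y \<partial>\<mu>) \<le> (\<integral>\<^sup>+y. liminf (\<lambda>n. k (X n) y) \<partial>\<mu>)"
    proof (rule nn_integral_mono)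
      fix y assume "y \<in> space \<mu>"
      then have y: "y \<in> K"
        by (simp add: space)
      show "k z y \<le> liminf (\<lambda>n. k (X n) y)"
        unfolding le_Liminf_iff
      proof (intro allI impI)
        fix s assume "s < k z y"
        from eventually_compose_filterlim[OF kernel_lsc[OF z y this] X] show "eventually (\<lambda>n. s < k (X n) y) sequentially" .
      qed
    qed
    also have "\<dots> \<le> liminf (\<lambda>n. \<integral>\<^sup>+y. k (X n) y \<partial>\<mu>)"
      by (rule nn_integral_liminf) measurable
    finally have "t < liminf (\<lambda>n. \<integral>\<^sup>+y. k (X n) y \<partial>\<mu>)"
      using t by simp
    then show ?thesis
      by (rule less_LiminfD)
  qed
  then show ?thesis
    using sequentially_imp_eventually_nhds_within[of UNIV z "\<lambda>x. t < (\<integral>\<^sup>+y. k x y \<partial>\<mu>)"] by simp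
qed

end

section \<open>The inequality between support and remaining measure\<close>

context green_minimization
begin

lemma energy_field_indicator:
  assumes u: "bounded_fun u" "\<And>x. 0 \<le> u x" and A: "A \<in> sets M" and fin: "field_integral (indicator A) < \<infinity>"
  shows "(\<integral>\<^sup>+x. indicator A x * ((\<integral>\<^sup>+y. k x y * ennreal (u y) \<partial>M) + e2ennreal (f x + ereal c)) \<partial>M)
    = ennreal (energy_form u (indicator A) + enn2real (field_integral (indicator A)))"
proof -
  note [measurable] = A bounded_fun_measurable[OF u(1)]
  have bA: "bounded_fun (indicator A)"
    unfolding bounded_fun_def by (auto intro!: exI[of _ 1])
  have E: "kernel_energy M k (\<lambda>x. ennreal (indicator A x)) (\<lambda>x. ennreal (u x)) = ennreal (energy_form u (indicator A))" "0 \<le> energy_form u (indicator A)"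
    using energy_form_eq_kernel_energy[OF bA _ u] energy_form_eq_kernel_energy[OF u bA] energy_form_commute[OF u(1) bA] by auto
  have "kernel_energy M k (\<lambda>x. ennreal (indicator A x)) (\<lambda>x. ennreal (u x)) = (\<integral>\<^sup>+x. indicator A x * (\<integral>\<^sup>+y. k x y * ennreal (u y) \<partial>M) \<partial>M)"
    unfolding kernel_energy_def by (intro nn_integral_cong) (simp add: nn_integral_cmult[symmetric] ennreal_indicator ac_simps)
  moreover have "field_integral (indicator A) = (\<integral>\<^sup>+x. indicator A x * e2ennreal (f x + ereal c) \<partial>M)"
    unfolding field_integral_def by (intro nn_integral_cong) (simp add: ennreal_indicator mult.commute)
  ultimately have "(\<integral>\<^sup>+x. indicator A x * ((\<integral>\<^sup>+y. k x y * ennreal (u y) \<partial>M) + e2ennreal (f x + ereal c)) \<partial>M)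
      = ennreal (energy_form u (indicator A)) + field_integral (indicator A)"
    by (simp add: distrib_left nn_integral_add E(1))
  also have "\<dots> = ennreal (energy_form u (indicator A) + enn2real (field_integral (indicator A)))"
    using fin E(2) by (simp add: ennreal_plus ennreal_enn2real_if less_top)
  finally show ?thesis .
qed

text \<open>The set where \<open>u\<close> is positive is the countable union of the sets where it
  is at least \<open>inverse (real (Suc n))\<close>; these cannot all be null.\<close>

lemma measure_pos_superlevel:
  assumes [measurable]: "u \<in> borel_measurable M" "N \<in> sets M" and pos: "\<not> (AE x in M. x \<in> N \<longrightarrow> u x \<le> (0::real))"
  obtains d where "d > 0" "measure M {x\<in>N. d \<le> u x} > 0"
proof (rule ccontr)
  assume no: "\<not> thesis"
  have N: "N \<subseteq> space M"
    using assms(2) by (rule sets.sets_into_space)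
  have null: "{x\<in>N. inverse (real (Suc n)) \<le> u x} \<in> null_sets M" for n
  proof -
    have "{x\<in>N. inverse (real (Suc n)) \<le> u x} = {x\<in>space M. x \<in> N \<and> inverse (real (Suc n)) \<le> u x}"
      using N by auto
    then have "{x\<in>N. inverse (real (Suc n)) \<le> u x} \<in> sets M"
      by simp
    moreover have "measure M {x\<in>N. inverse (real (Suc n)) \<le> u x} = 0"
      using no that[of "inverse (real (Suc n))"] by (force simp: less_le)
    ultimately show ?thesis
      by (simp add: null_sets_def emeasure_eq_measure)
  qed
  have "AE x in M. \<forall>n. x \<notin> {x\<in>N. inverse (real (Suc n)) \<le> u x}"
    unfolding AE_all_countable by (intro allI AE_not_in null)
  then have "AE x in M. x \<in> N \<longrightarrow> u x \<le> 0"
  proof eventually_elim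
    case (elim x)
    show ?case
    proof (rule ccontr)
      assume x: "\<not> ?case"
      then obtain n where "inverse (real (Suc n)) < u x"
        using reals_Archimedean[of "u x"] by auto
      with x elim[rule_format, of n] show False
        by auto
    qed
  qed
  with pos show False
    by simp
qed

text \<open>The set from which mass is taken: the weighted potential stays above \<open>r\<close>
  near \<open>z\<close> by semicontinuity, and the neighbourhood carries mass because
  \<open>z\<close> is in the support.\<close>

lemma support_superlevel:
  assumes u: "u \<in> admissible" and lsc: "lower_semicontinuous_on K f"
    and z: "z \<in> measure_support (with_density u)" and r: "ereal r < enn2ereal (\<integral>\<^sup>+y. k z y * ennreal (u y) \<partial>M) + f z"
  obtains A d where "A \<in> sets M" "measure M A > 0" "d > 0" "\<And>x. x \<in> A \<Longrightarrow> d \<le> u x"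
    "\<And>x. x \<in> A \<Longrightarrow> ereal r < enn2ereal (\<integral>\<^sup>+y. k x y * ennreal (u y) \<partial>M) + f x"
proof -
  define U where "U x = (\<integral>\<^sup>+y. k x y * ennreal (u y) \<partial>M)" for x
  note [measurable] = admissibleD(4)[OF u]
  have zK: "z \<in> K"
    using z by (simp add: measure_support_def space_M)
  have U_eq: "(\<integral>\<^sup>+y. k x y \<partial>with_density u) = U x" for x
    unfolding U_def by (subst nn_integral_density) (auto simp: mult.commute)
  have f_open: "\<exists>T. open T \<and> z \<in> T \<and> (\<forall>x\<in>T \<inter> K. s < f x)" if "s < f z" for s
    using lsc that zK unfolding lower_semicontinuous_on_def openin_open
    by (metis (mono_tags, lifting) Int_commute IntD2 mem_Collect_eq)
  obtain T where T: "open T" "z \<in> T" "\<And>x. x \<in> T \<Longrightarrow> x \<in> K \<Longrightarrow> ereal r < enn2ereal (U x) + f x"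
  \<comment> \<open>\<open>f z\<close> may be infinite. If it alone exceeds \<open>r\<close>, the
    nonnegative potential can be ignored; otherwise \<open>f z\<close> is finite and
    \<open>r\<close> is split as \<open>s + (r - s)\<close> between potential and field.\<close>
  proof (cases "ereal r < f z")
    case True
    from f_open[OF this] obtain T where T: "open T" "z \<in> T" "\<forall>x\<in>T \<inter> K. ereal r < f x"
      by blast
    have "ereal r < enn2ereal (U x) + f x" if "x \<in> T" "x \<in> K" for x
    proof -
      have "f x \<le> enn2ereal (U x) + f x"
        by (rule ereal_le_add_self2) simp
      then show ?thesis
        using T(3) that by (meson IntI less_le_trans)
    qed
    with T that show thesis
      by blast
  next
    case False
    moreover have "ereal (- c) \<le> f z"
      using f_ge zK space_M by simp
    ultimately obtain q where q: "f z = ereal q" "q \<le> r"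
      by (cases "f z") auto
    have "ereal (r - q) < enn2ereal (U z)"
      using r unfolding q(1) U_def[symmetric] by (cases "enn2ereal (U z)") (auto simp: algebra_simps)
    then obtain s where s: "r - q < s" "ereal s < enn2ereal (U z)"
      using ereal_dense2 by (metis ereal_less(1) less_ereal.simps(1))
    have s0: "0 \<le> s"
      using s(1) q(2) by simp
    have "ennreal s < U z"
      using s(2) s0 by (simp add: less_ennreal.rep_eq)
    then have "eventually (\<lambda>x. ennreal s < U x) (nhds z)"
      using potential_lsc[of "with_density u" z "ennreal s"] zK unfolding U_eq by simp
    then obtain T1 where T1: "open T1" "z \<in> T1" "\<And>x. x \<in> T1 \<Longrightarrow> ennreal s < U x"
      unfolding eventually_nhds by blast
    have "ereal (r - s) < f z"
      using s(1) q(1) by simp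
    from f_open[OF this] obtain T2 where T2: "open T2" "z \<in> T2" "\<forall>x\<in>T2 \<inter> K. ereal (r - s) < f x"
      by blast
    have "ereal r < enn2ereal (U x) + f x" if "x \<in> T1 \<inter> T2" "x \<in> K" for x
    proof -
      have "ereal s < enn2ereal (U x)"
        using T1(3)[of x] that s0 by (simp add: less_ennreal.rep_eq)
      moreover have "ereal (r - s) < f x"
        using T2(3) that by auto
      ultimately have "ereal s + ereal (r - s) < enn2ereal (U x) + f x"
        by (rule ereal_add_strict_mono2)
      then show ?thesis
        by simp
    qed
    with T1 T2 that[of "T1 \<inter> T2"] show thesis
      by auto
  qed
  have N [measurable]: "T \<inter> K \<in> sets M"
    unfolding sets_M using T(1) by (auto simp: sets_restrict_space)
  have "0 < emeasure (with_density u) (T \<inter> K)"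
    using z T(1,2) by (auto simp: measure_support_def space_M)
  then have "\<not> (AE x in M. x \<in> T \<inter> K \<longrightarrow> u x \<le> 0)"
  proof (rule contrapos_pn)
    assume "AE x in M. x \<in> T \<inter> K \<longrightarrow> u x \<le> 0"
    then have "AE x in M. ennreal (u x) * indicator (T \<inter> K) x = 0"
      by eventually_elim (auto simp: indicator_def ennreal_neg)
    then show "\<not> 0 < emeasure (with_density u) (T \<inter> K)"
      by (simp add: emeasure_density nn_integral_0_iff_AE)
  qed
  then obtain d where d: "d > 0" "measure M {x\<in>T \<inter> K. d \<le> u x} > 0"
    using measure_pos_superlevel[OF admissibleD(4)[OF u] N] by blast
  have "{x\<in>T \<inter> K. d \<le> u x} = {x\<in>space M. d \<le> u x} \<inter> (T \<inter> K)"
    using space_M by auto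
  also have "\<dots> \<in> sets M"
    by (intro sets.Int N) measurable
  finally have "{x\<in>T \<inter> K. d \<le> u x} \<in> sets M" .
  then show thesis
    by (rule that[of _ d]) (use d T in \<open>auto simp: U_def\<close>)
qed

text \<open>The set to which mass is moved: if \<open>R - u\<close> vanished almost everywhere on
  the sublevel set \<open>N\<close>, then \<open>N\<close> would be null for the remaining measure
  and \<open>r\<close> would not exceed the essential infimum.\<close>

lemma ess_inf_sublevel:
  assumes u: "u \<in> admissible" and h: "h \<in> borel_measurable M"
    and r: "ess_inf (diff_measure (scale_measure (ennreal R) M) (with_density u)) h < ereal r"
  obtains B d where "B \<in> sets M" "measure M B > 0" "d > 0" "\<And>x. x \<in> B \<Longrightarrow> u x \<le> R - d" "\<And>x. x \<in> B \<Longrightarrow> h x < ereal r"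
proof -
  note [measurable] = admissibleD(4)[OF u] h
  define \<rho> where "\<rho> = diff_measure (scale_measure (ennreal R) M) (with_density u)"
  define N where "N = {x\<in>space M. h x < ereal r}"
  have N [measurable]: "N \<in> sets M"
    unfolding N_def by simp
  have sets_\<rho>: "sets \<rho> = sets M" "space \<rho> = space M"
    unfolding \<rho>_def by (simp_all add: space_scale_measure)
  have R_int: "emeasure (scale_measure (ennreal R) M) A = (\<integral>\<^sup>+x. ennreal R * indicator A x \<partial>M)" if "A \<in> sets M" for A
    using that by (simp add: nn_integral_cmult)
  have "\<not> (AE x in M. x \<in> N \<longrightarrow> R - u x \<le> 0)"
  proof
    assume ae: "AE x in M. x \<in> N \<longrightarrow> R - u x \<le> 0"
    have "emeasure \<rho> N = emeasure (scale_measure (ennreal R) M) N - emeasure (with_density u) N"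
      unfolding \<rho>_def
    proof (rule emeasure_diff_measure)
      show "finite_measure (scale_measure (ennreal R) M)" 
        by standard (simp add: space_scale_measure ennreal_mult_eq_top_iff)
      show "finite_measure (with_density u)"
      proof
        have "emeasure (with_density u) (space M) = ennreal (LINT x|M. u x)"
          using nn_integral_eq_integral[OF bounded_fun_integrable[OF admissibleD(1)[OF u]]] admissibleD(2)[OF u]
          by (simp add: emeasure_density nn_integral_cong[of M "\<lambda>x. ennreal (u x) * indicator (space M) x" "\<lambda>x. ennreal (u x)"])
        then show "emeasure (with_density u) (space (with_density u)) \<noteq> \<infinity>"
          by simp
      qed
      show "emeasure (with_density u) A \<le> emeasure (scale_measure (ennreal R) M) A" if "A \<in> sets (scale_measure (ennreal R) M)" for A
        using that admissibleD(3)[OF u] by (simp only: sets_scale_measure R_int emeasure_density) (auto intro!: nn_integral_mono mult_right_mono ennreal_leI simp: emeasure_density)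
    qed (use N in auto)
    also have "emeasure (with_density u) N = emeasure (scale_measure (ennreal R) M) N"
      unfolding R_int[OF N]
    proof (subst emeasure_density)
      show "(\<integral>\<^sup>+x. ennreal (u x) * indicator N x \<partial>M) = (\<integral>\<^sup>+x. ennreal R * indicator N x \<partial>M)"
      proof (rule nn_integral_cong_AE, use ae in eventually_elim)
        fix x assume "x \<in> N \<longrightarrow> R - u x \<le> 0"
        then have "x \<in> N \<Longrightarrow> u x = R"
          using admissibleD(3)[OF u, of x] by simp
        then show "ennreal (u x) * indicator N x = ennreal R * indicator N x"
          by (auto simp: indicator_def)
      qed
    qed auto
    finally have "emeasure \<rho> N = 0"
      by (simp add: ennreal_diff_self ennreal_mult_eq_top_iff)
    then have "AE x in \<rho>. ereal r \<le> h x"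
      by (intro AE_I[of _ _ N]) (auto simp: sets_\<rho> N_def not_le)
    then have "ereal r \<le> ess_inf \<rho> h"
      unfolding ess_inf_def by (intro Sup_upper) auto
    with r show False
      by (simp add: \<rho>_def)
  qed
  then obtain d where d: "d > 0" "measure M {x\<in>N. d \<le> R - u x} > 0"
    using measure_pos_superlevel[of "\<lambda>x. R - u x" N] by auto
  have "{x\<in>N. d \<le> R - u x} = {x\<in>space M. x \<in> N \<and> d \<le> R - u x}"
    by (auto simp: N_def)
  then have "{x\<in>N. d \<le> R - u x} \<in> sets M"
    by simp
  then show thesis
    by (rule that[of _ d]) (use d in \<open>auto simp: N_def\<close>)
qed

text \<open>A failure leaves room for two real levels \<open>r1 < r2\<close>. The weighted potential
  is above \<open>r2\<close> on \<open>A\<close> and below \<open>r1\<close> on \<open>B\<close>, so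
  its means over these sets differ strictly, whereas \<open>first_variation\<close> yields
  \<open>r2 + c \<le> r1 + c\<close>.\<close>

lemma minimizer_inequality:
  assumes u: "u \<in> admissible" "\<And>v. v \<in> admissible \<Longrightarrow> functional u \<le> functional v"
    and lsc: "lower_semicontinuous_on K f"
  shows "(SUP z\<in>measure_support (with_density u). green_potential g (with_density u) z + f z)
    \<le> ess_inf (diff_measure (scale_measure (ennreal R) M) (with_density u)) (\<lambda>z. green_potential g (with_density u) z + f z)"
proof (rule SUP_least, rule ccontr)
  note [measurable] = admissibleD(4)[OF u(1)]
  define U where "U x = (\<integral>\<^sup>+y. k x y * ennreal (u y) \<partial>M)" for x
  have [measurable]: "U \<in> borel_measurable M"
    unfolding U_def by measurable
  let ?h = "\<lambda>z. green_potential g (with_density u) z + f z"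
  have h: "?h x = enn2ereal (U x) + f x" if "x \<in> space M" for x
    using green_potential_density[OF admissibleD(4)[OF u(1)]] that by (simp add: U_def space_M)
  have "(\<lambda>x. enn2ereal (U x) + f x) \<in> borel_measurable M"
    by measurable
  then have hm: "?h \<in> borel_measurable M"
    by (subst measurable_cong[OF h])
  fix z assume z: "z \<in> measure_support (with_density u)"
  then have zM: "z \<in> space M"
    by (simp add: measure_support_def)
  assume "\<not> ?h z \<le> ess_inf (diff_measure (scale_measure (ennreal R) M) (with_density u)) ?h"
  then have "ess_inf (diff_measure (scale_measure (ennreal R) M) (with_density u)) ?h < ?h z"
    by (rule not_le_imp_less)
  from ereal_dense2[OF this] obtain r1 where r1: "ess_inf (diff_measure (scale_measure (ennreal R) M) (with_density u)) ?h < ereal r1" "ereal r1 < ?h z"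
    by (elim exE conjE)
  from ereal_dense2[OF r1(2)] obtain r2 where r2: "ereal r1 < ereal r2" "ereal r2 < ?h z"
    by (elim exE conjE)
  have r: "ess_inf (diff_measure (scale_measure (ennreal R) M) (with_density u)) ?h < ereal r1" "r1 < r2" "ereal r2 < ?h z"
    using r1(1) r2 by (simp_all only: less_ereal.simps)
  have "ereal r2 < enn2ereal (\<integral>\<^sup>+y. k z y * ennreal (u y) \<partial>M) + f z"
    using r(3) h[OF zM] by (simp add: U_def)
  from support_superlevel[OF u(1) lsc z this] obtain A d1 where A: "A \<in> sets M" "measure M A > 0" "d1 > 0" "\<And>x. x \<in> A \<Longrightarrow> d1 \<le> u x"
    and hA: "\<And>x. x \<in> A \<Longrightarrow> ereal r2 < enn2ereal (U x) + f x"
    unfolding U_def by blast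
  from ess_inf_sublevel[OF u(1) hm r(1)] obtain B d2 where B: "B \<in> sets M" "measure M B > 0" "d2 > 0" "\<And>x. x \<in> B \<Longrightarrow> u x \<le> R - d2"
    and hB: "\<And>x. x \<in> B \<Longrightarrow> ?h x < ereal r1"
    by blast
  have hB: "enn2ereal (U x) + f x < ereal r1" if "x \<in> B" for x
    using hB[OF that] h[of x] sets.sets_into_space[OF B(1)] that by auto
  note [measurable] = A(1) B(1)
  define EF where "EF X = energy_form u (indicator X) + enn2real (field_integral (indicator X))" for X
  \<comment> \<open>Below the real level \<open>r1\<close> both summands are finite, so the shifted
    sum can be computed in the reals.\<close>
  have ptB: "U x + e2ennreal (f x + ereal c) \<le> ennreal (r1 + c)" "0 \<le> r1 + c" if "x \<in> B" for x
  proof -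
    have x: "ereal (- c) \<le> f x"
      using f_ge sets.sets_into_space[OF B(1)] that by auto
    have "f x < ereal r1"
      using hB[OF that] by (rule le_less_trans[rotated]) (simp add: ereal_le_add_self2)
    then obtain q where q: "f x = ereal q" "- c \<le> q"
      using x by (cases "f x") auto
    have "U x \<noteq> \<top>"
      using hB[OF that] q by auto
    then obtain v where v: "U x = ennreal v" "0 \<le> v"
      by (cases "U x") auto
    have "v + q < r1"
      using hB[OF that] v q by simp
    then show "U x + e2ennreal (f x + ereal c) \<le> ennreal (r1 + c)" "0 \<le> r1 + c"
      using v q by (simp_all add: ennreal_plus[symmetric] e2ennreal_ereal ennreal_leI del: ennreal_plus)
  qed
  have ptA: "ennreal (r2 + c) \<le> U x + e2ennreal (f x + ereal c)" if "x \<in> A" for x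
  proof -
    have x: "ereal (- c) \<le> f x"
      using f_ge sets.sets_into_space[OF A(1)] that by auto
    show ?thesis
    proof (cases "U x = \<top> \<or> f x = \<infinity>")
      case True
      then show ?thesis
        by (auto simp: e2ennreal_infty)
    next
      case False
      then obtain q v where q: "f x = ereal q" "- c \<le> q" "U x = ennreal v" "0 \<le> v"
        using x by (cases "f x"; cases "U x") auto
      then have "r2 < v + q"
        using hA[OF that] by simp
      then show ?thesis
        using q by (simp add: ennreal_plus[symmetric] e2ennreal_ereal ennreal_leI del: ennreal_plus)
    qed
  qed
  have FA: "field_integral (indicator A) < \<infinity>"
    by (rule field_integral_indicator_finite[OF u(1) A(1,3,4)])
  have constB: "(\<integral>\<^sup>+x. indicator B x * ennreal (r1 + c) \<partial>M) = ennreal ((r1 + c) * measure M B)"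
  proof -
    have "B \<noteq> {}"
      using B(2) by auto
    then show ?thesis
      using ptB(2) by (auto simp: nn_integral_multc emeasure_eq_measure ennreal_mult mult.commute)
  qed
  have FB: "field_integral (indicator B) < \<infinity>"
  proof -
    have "field_integral (indicator B) \<le> (\<integral>\<^sup>+x. indicator B x * ennreal (r1 + c) \<partial>M)"
      unfolding field_integral_def
    proof (rule nn_integral_mono)
      fix x
      show "e2ennreal (f x + ereal c) * ennreal (indicator B x) \<le> indicator B x * ennreal (r1 + c)"
        using ptB(1)[of x] by (auto simp: indicator_def intro: order_trans[rotated])
    qed
    also have "\<dots> < \<infinity>"
      unfolding constB by simp
    finally show ?thesis .
  qed
  have "A \<inter> B = {}"
  proof (rule ccontr)
    assume "A \<inter> B \<noteq> {}"
    then obtain x where "x \<in> A" "x \<in> B"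
      by blast
    then have "ereal r2 < ereal r1"
      using hA[of x] hB[of x] by (meson less_trans)
    with r(2) show False
      by simp
  qed
  have "measure M B * (energy_form u (indicator A) - c * measure M A + enn2real (field_integral (indicator A)))
    \<le> measure M A * (energy_form u (indicator B) - c * measure M B + enn2real (field_integral (indicator B)))"
    by (rule first_variation[OF u A(1) B(1), of "min d1 d2"]) (use A(3) B(3) \<open>A \<inter> B = {}\<close> FB in \<open>auto dest!: A(4) B(4)\<close>)
  then have le: "measure M B * EF A \<le> measure M A * EF B"
    by (simp add: EF_def algebra_simps)
  have EF: "ennreal (EF X) = (\<integral>\<^sup>+x. indicator X x * (U x + e2ennreal (f x + ereal c)) \<partial>M)" "0 \<le> EF X"
    if "X \<in> sets M" "field_integral (indicator X) < \<infinity>" for X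
  proof -
    have bX: "bounded_fun (indicator X)"
      unfolding bounded_fun_def using that(1) by (auto intro!: exI[of _ 1])
    show "ennreal (EF X) = (\<integral>\<^sup>+x. indicator X x * (U x + e2ennreal (f x + ereal c)) \<partial>M)"
      unfolding EF_def U_def using energy_field_indicator[OF admissibleD(1,2)[OF u(1)] that] by simp
    show "0 \<le> EF X"
      unfolding EF_def using energy_form_eq_kernel_energy(2)[OF admissibleD(1,2)[OF u(1)] bX] by simp
  qed
  have "ennreal (EF B) \<le> ennreal ((r1 + c) * measure M B)"
    unfolding EF(1)[OF B(1) FB] constB[symmetric] using ptB(1) by (intro nn_integral_mono) (simp add: indicator_def)
  moreover have "0 \<le> (r1 + c) * measure M B"
  proof -
    have "B \<noteq> {}"
      using B(2) by auto
    then show ?thesis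
      using ptB(2) by auto
  qed
  ultimately have EFB: "EF B \<le> (r1 + c) * measure M B"
    by (simp add: ennreal_le_iff)
  have EFA: "(r2 + c) * measure M A \<le> EF A"
  \<comment> \<open>\<open>ennreal\<close> would turn a negative \<open>r2 + c\<close> into 0; in
    that case \<open>0 \<le> EF A\<close> is enough.\<close>
  proof (cases "0 \<le> r2 + c")
    case True
    have "ennreal ((r2 + c) * measure M A) = (\<integral>\<^sup>+x. indicator A x * ennreal (r2 + c) \<partial>M)"
      using True by (simp add: nn_integral_multc emeasure_eq_measure ennreal_mult mult.commute)
    also have "\<dots> \<le> ennreal (EF A)"
      unfolding EF(1)[OF A(1) FA] using ptA by (intro nn_integral_mono) (simp add: indicator_def)
    finally show ?thesis
      using EF(2)[OF A(1) FA] by (simp add: ennreal_le_iff)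
  next
    case False
    then have "(r2 + c) * measure M A \<le> 0"
      by (simp add: mult_nonpos_nonneg)
    then show ?thesis
      using EF(2)[OF A(1) FA] by simp
  qed
  have "measure M B * ((r2 + c) * measure M A) \<le> measure M A * ((r1 + c) * measure M B)"
    using le mult_left_mono[OF EFA, of "measure M B"] mult_left_mono[OF EFB, of "measure M A"] by simp
  then have "(measure M A * measure M B) * (r2 + c) \<le> (measure M A * measure M B) * (r1 + c)"
    by (simp add: ac_simps)
  then have "r2 + c \<le> r1 + c"
    using A(2) B(2) by (simp add: mult_le_cancel_left_pos)
  with r(2) show False
    by simp
qed

end

section \<open>Lower semicontinuous fields on a compact set, and the theorem\<close>

lemma lower_semicontinuous_on_measurable:
  assumes "lower_semicontinuous_on K f"
  shows "f \<in> borel_measurable (restrict_space borel K)"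
proof (rule borel_measurableI_greater)
  fix s
  obtain T where "open T" "{x\<in>K. s < f x} = K \<inter> T"
    using assms unfolding lower_semicontinuous_on_def openin_open by blast
  then have "{x\<in>space (restrict_space borel K). s < f x} = T \<inter> K"
    by (auto simp: space_restrict_space)
  then show "{x\<in>space (restrict_space borel K). s < f x} \<in> sets (restrict_space borel K)"
    using \<open>open T\<close> unfolding sets_restrict_space by (intro image_eqI[of _ _ T] Int_commute) auto
qed

text \<open>The sets where \<open>f\<close> exceeds \<open>- real n\<close> are relatively open and
  cover \<open>K\<close>; a finite subcover gives the bound.\<close>

lemma lower_semicontinuous_on_bounded_below:
  assumes lsc: "lower_semicontinuous_on K f" and K: "compact K" and f: "\<And>z. z \<in> K \<Longrightarrow> f z \<noteq> -\<infinity>"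
  obtains c where "0 \<le> c" "\<And>z. z \<in> K \<Longrightarrow> ereal (- c) \<le> f z"
proof -
  have "\<exists>T. open T \<and> {x\<in>K. ereal (- real n) < f x} = K \<inter> T" for n :: nat
    using lsc unfolding lower_semicontinuous_on_def openin_open by blast
  then obtain T where T: "\<And>n. open (T n)" "\<And>n. {x\<in>K. ereal (- real n) < f x} = K \<inter> T n"
    by metis
  have "K \<subseteq> \<Union>(range T)"
  proof
    fix z assume z: "z \<in> K"
    have "\<exists>n. ereal (- real n) < f z"
    proof (cases "f z")
      case (real q)
      obtain n where "- q < real n"
        using reals_Archimedean2 by blast
      then show ?thesis
        using real by (intro exI[of _ n]) simp
    qed (use f[OF z] in auto)
    then show "z \<in> \<Union>(range T)"
      using T(2) z by blast
  qed
  then obtain I where I: "finite I" "K \<subseteq> \<Union>(T ` I)"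
    using compactE_image[OF K, of UNIV T] T(1) by auto
  \<comment> \<open>\<open>insert 0\<close> makes the maximum defined also for an empty
    subcover.\<close>
  show thesis
  proof (rule that[of "real (Max (insert 0 I))"])
    fix z assume z: "z \<in> K"
    then obtain n where n: "n \<in> I" "z \<in> T n"
      using I by blast
    then have "ereal (- real n) < f z"
      using T(2) z by blast
    moreover have "n \<le> Max (insert 0 I)"
      using n I by simp
    ultimately show "ereal (- real (Max (insert 0 I))) \<le> f z"
      by (meson ereal_less_eq(3) less_imp_le neg_le_iff_le of_nat_le_iff order_trans)
  qed simp
qed

theorem theorem4p1:
  fixes D :: "complex option set"
    and g :: "complex option \<Rightarrow> complex option \<Rightarrow> ereal"
    and K :: "complex set"
    and R :: real
    and f :: "complex \<Rightarrow> ereal"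
    and lam :: "complex measure"
  assumes "sphere_domain D"
    and "is_green_function D g"
    and "compact K" and "Some ` K \<subseteq> D"
    and "R > 0"
    and "\<forall>z\<in>K. f z \<noteq> -\<infinity>"
    and "lower_semicontinuous_on K f"
    and "log_capacity {z\<in>K. f z < \<infinity>} > 0"
    and "borel_measure_on K lam" and "prob_space lam"
    and "green_energy g lam < \<infinity>"
  shows "(\<exists>!\<mu>. \<mu> \<in> constrained_measures K R lam \<and>
              weighted_energy g f \<mu> = constrained_value g f K R lam) \<and>
         (\<forall>\<mu>. \<mu> \<in> constrained_measures K R lam \<and>
              weighted_energy g f \<mu> = constrained_value g f K R lam \<and>
              emeasure \<mu> K > 0 \<longrightarrow>
                constrained_value g f K R lam < 0 \<and>
                (SUP z\<in>measure_support \<mu>. green_potential g \<mu> z + f z)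
                  \<le> ess_inf (diff_measure (scale_measure (ennreal R) lam) \<mu>)
                      (\<lambda>z. green_potential g \<mu> z + f z))"
proof -
  have D: "openin riemann_sphere D"
    using assms(1) by (simp add: sphere_domain_def)
  interpret lam: prob_space lam
    by fact
  have sets_lam: "sets lam = sets (restrict_space borel K)"
    using assms(9) by (simp add: borel_measure_on_def)
  then have space_lam: "space lam = K"
    using sets_eq_imp_space_eq[OF sets_lam] by (simp add: space_restrict_space)
  obtain ls where ls: "\<And>n c r. (c, r) \<in> set (ls n) \<Longrightarrow> 0 < r \<and> cball c r \<subseteq> Some -` D"
    "\<And>z w. incseq (\<lambda>n. swept_kernel (ls n) z w)"
    "\<And>z w. Some z \<in> D \<Longrightarrow> Some w \<in> D \<Longrightarrow> g (Some z) (Some w) = enn2ereal (SUP n. swept_kernel (ls n) z w)"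
    using green_function_eq_SUP[OF D assms(2)] by blast
  define k where "k z w = (SUP n. swept_kernel (ls n) z w)" for z w
  interpret green_setting D g K lam k ls
  proof
    show "K \<noteq> {}"
      using lam.not_empty space_lam by simp
    show "0 < r \<and> cball c r \<subseteq> Some -` D" if "(c, r) \<in> set (ls n)" for n c r
      by (rule ls(1)[OF that])
    show "g (Some z) (Some w) = enn2ereal (k z w)" if "Some z \<in> D" "Some w \<in> D" for z w
      unfolding k_def by (rule ls(3)[OF that])
  qed (fact D assms ls(2) sets_lam k_def lam.emeasure_finite)+
  \<comment> \<open>\<open>lam\<close> has density 1 with respect to itself, so this is the assumed
    finiteness of its Green energy.\<close>
  have energy: "kernel_energy lam k (\<lambda>_. 1) (\<lambda>_. 1) < \<infinity>"
  proof -
    have "enn2ereal (kernel_energy lam k (\<lambda>_. 1) (\<lambda>_. 1)) < \<infinity>"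
      using green_energy_density[of "\<lambda>_. 1"] assms(11) by (simp add: density_1)
    then show ?thesis
      by (simp add: less_ennreal.rep_eq)
  qed
  obtain c where c: "0 \<le> c" "\<And>z. z \<in> K \<Longrightarrow> ereal (- c) \<le> f z"
    using lower_semicontinuous_on_bounded_below[OF assms(7,3)] assms(6) by blast
  interpret green_minimization D g K lam k ls f R c
  proof
    show "f \<in> borel_measurable lam"
      using lower_semicontinuous_on_measurable[OF assms(7)] by (subst measurable_cong_sets[OF sets_lam refl])
    show "ereal (- c) \<le> f z" if "z \<in> space lam" for z
      using c(2) that space_lam by simp
  qed (fact energy c assms)+
  show ?thesis
  proof (intro conjI allI impI; (elim conjE)?)
    show "\<exists>!\<mu>. \<mu> \<in> constrained_measures K R lam \<and> weighted_energy g f \<mu> = constrained_value g f K R lam"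
      by (rule minimizer_ex1)
    fix \<mu>
    assume \<mu>: "\<mu> \<in> constrained_measures K R lam" "weighted_energy g f \<mu> = constrained_value g f K R lam" "0 < emeasure \<mu> K"
    show "constrained_value g f K R lam < 0"
      by (rule minimizer_value_neg[OF \<mu>])
    obtain u where "u \<in> admissible" "\<And>v. v \<in> admissible \<Longrightarrow> functional u \<le> functional v" "\<mu> = with_density u"
      using minimizer_density[OF \<mu>(1,2)] by metis
    then show "(SUP z\<in>measure_support \<mu>. green_potential g \<mu> z + f z)
        \<le> ess_inf (diff_measure (scale_measure (ennreal R) lam) \<mu>) (\<lambda>z. green_potential g \<mu> z + f z)"
      using minimizer_inequality[OF _ _ assms(7)] by blast
  qed
qed

end
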